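(* Let $K$ be a field of characteristic $p>0$, let $G$ be a finite $p$-group, and let $V$ be a finite-dimensional representation of $G$ over $K$. If there exists a graded geometric separating algebra in $K[V]^G$ which is Cohen-Macaulay, then $G$ is generated by elements acting as bireflections on $V$.
   Context: $K[V]:=S(V^* )$ is the symmetric algebra on the dual of $V$ with its standard grading; $G$ acts on it by graded algebra automorphisms extending $(\sigma\cdot f)(v)=f(\sigma^{-1}v)$ for $f\in V^*$. The ring of invariants is $K[V]^G$. An element $\sigma\in G$ acts as a bireflection on $V$ if its fixed space $V^\sigma$ has codimension at most $2$ in $V$ (in particular, elements acting trivially count as bireflections; $V$ is not assumed faithful). Let $\overline K$ be an algebraic closure of $K$ and $\overline V=\overline K\otimes_K V$, with the extended $G$-action. Elements of $K[V]\subseteq \overline K[\overline V]$ are viewed as functions $\overline V\to\overline K$. A graded geometric separating algebra in $K[V]^G$ is a graded $K$-subalgebra $A\subseteq K[V]^G$ such that any two points of $\overline V$ lying in distinct $G$-orbits take different values under some $f\in A$ (equivalently, $A$ separates the same points of $\overline V$ as $K[V]^G$). Such an algebra is finitely generated. For a finitely generated graded subalgebra $A\subseteq K[V]$ with maximal homogeneous ideal $A_+$, $\operatorname{depth}(A)$ is the maximal length of an $A$-regular sequence of homogeneous elements in $A_+$, and $A$ is Cohen-Macaulay iff $\dim A=\operatorname{depth}(A)$. *)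

theory Defs
  imports
    "HOL-Algebra.Algebra"
    "HOL-Algebra.Algebraic_Closure_Type"
    "HOL-Library.Poly_Mapping"
    "HOL-Library.Extended_Nat"
begin

section \<open>Krull dimension and regular sequences\<close>

text \<open>Supremum of the lengths \<open>l\<close> of strict chains \<open>P 0 \<subset> \<dots> \<subset> P l\<close> of prime ideals.\<close>

definition krull_dim :: "('a, 'm) ring_scheme \<Rightarrow> enat" where
  "krull_dim R = Sup {enat l | l. \<exists>P. (\<forall>i\<le>l. primeideal (P i) R) \<and> (\<forall>i<l. P i \<subset> P (Suc i))}"

text \<open>
  The \<open>i\<close>-th element is a nonzerodivisor modulo the ideal generated by the preceding ones, and
  the ideal generated by the whole sequence is proper.
\<close>

definition regular_sequence :: "('a, 'm) ring_scheme \<Rightarrow> 'a list \<Rightarrow> bool" where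
  "regular_sequence R fs \<longleftrightarrow>
     set fs \<subseteq> carrier R \<and>
     (\<forall>i<length fs. \<forall>a\<in>carrier R.
        a \<otimes>\<^bsub>R\<^esub> (fs ! i) \<in> genideal R (set (take i fs)) \<longrightarrow> a \<in> genideal R (set (take i fs))) \<and>
     genideal R (set fs) \<noteq> carrier R"


section \<open>Polynomials\<close>

text \<open>
  Polynomials in the variables \<open>x\<^sub>0, x\<^sub>1, \<dots>\<close>: a monomial is an exponent vector \<open>nat \<Rightarrow>\<^sub>0 nat\<close>.
\<close>

type_synonym 'a mpoly = "(nat \<Rightarrow>\<^sub>0 nat) \<Rightarrow>\<^sub>0 'a"

definition const :: "'a::zero \<Rightarrow> 'a mpoly" where
  "const c = Poly_Mapping.single 0 c"

definition var :: "nat \<Rightarrow> 'a::zero_neq_one mpoly" where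
  "var i = Poly_Mapping.single (Poly_Mapping.single i 1) 1"

text \<open>The polynomial ring in the \<open>n\<close> variables \<open>x\<^sub>0, \<dots>, x\<^sub>n\<^sub>-\<^sub>1\<close>.\<close>

definition polys :: "nat \<Rightarrow> 'a::zero mpoly set" where
  "polys n = {f. \<forall>m\<in>Poly_Mapping.keys f. Poly_Mapping.keys m \<subseteq> {..<n}}"

text \<open>
  The homomorphism sending the variable \<open>x\<^sub>i\<close> to \<open>a i\<close> and acting on coefficients by \<open>\<iota>\<close>.
\<close>

definition subst_poly :: "('a::zero \<Rightarrow> 'r::comm_ring_1) \<Rightarrow> (nat \<Rightarrow> 'r) \<Rightarrow> 'a mpoly \<Rightarrow> 'r" where
  "subst_poly \<iota> a f =
     (\<Sum>m\<in>Poly_Mapping.keys f. \<iota> (Poly_Mapping.lookup f m) *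
        (\<Prod>i\<in>Poly_Mapping.keys m. a i ^ Poly_Mapping.lookup m i))"

definition monom_deg :: "(nat \<Rightarrow>\<^sub>0 nat) \<Rightarrow> nat" where
  "monom_deg m = (\<Sum>i\<in>Poly_Mapping.keys m. Poly_Mapping.lookup m i)"

definition homogeneous :: "nat \<Rightarrow> 'a::zero mpoly \<Rightarrow> bool" where
  "homogeneous d f \<longleftrightarrow> (\<forall>m\<in>Poly_Mapping.keys f. monom_deg m = d)"

definition hom_component :: "nat \<Rightarrow> 'a::comm_monoid_add mpoly \<Rightarrow> 'a mpoly" where
  "hom_component d f =
     (\<Sum>m\<in>{m \<in> Poly_Mapping.keys f. monom_deg m = d}.
        Poly_Mapping.single m (Poly_Mapping.lookup f m))"


section \<open>Graded subalgebras\<close>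

definition alg_ring :: "'a::comm_ring_1 mpoly set \<Rightarrow> 'a mpoly ring" where
  "alg_ring A = ring_of_type_algebra\<lparr>carrier := A\<rparr>"

definition graded_subalgebra :: "'a::comm_ring_1 mpoly set \<Rightarrow> bool" where
  "graded_subalgebra A \<longleftrightarrow>
     subring A ring_of_type_algebra \<and> range const \<subseteq> A \<and> (\<forall>f\<in>A. \<forall>d. hom_component d f \<in> A)"

definition max_hom_ideal :: "'a::zero mpoly set \<Rightarrow> 'a mpoly set" where
  "max_hom_ideal A = {f \<in> A. Poly_Mapping.lookup f 0 = 0}"

definition hom_depth :: "'a::comm_ring_1 mpoly set \<Rightarrow> enat" where
  "hom_depth A = Sup {enat (length fs) | fs.
     set fs \<subseteq> max_hom_ideal A \<and> (\<forall>f\<in>set fs. \<exists>d. homogeneous d f) \<and>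
     regular_sequence (alg_ring A) fs}"

definition graded_Cohen_Macaulay :: "'a::comm_ring_1 mpoly set \<Rightarrow> bool" where
  "graded_Cohen_Macaulay A \<longleftrightarrow> krull_dim (alg_ring A) = hom_depth A"


section \<open>Representations\<close>

text \<open>
  A linear action \<open>\<rho>\<close> of \<open>G\<close> on the \<open>K\<close>-vector space carried by the type \<open>'v\<close>, with scalar
  multiplication \<open>scale\<close>, together with an ordered basis \<open>e 0, \<dots>, e (n - 1)\<close>. The case
  \<open>n = 0\<close> is included.
\<close>

locale finite_dim_rep =
  group_action G "UNIV :: 'v set" \<rho> + finite_dimensional_vector_space scale "e ` {..<n}"
  for G :: "('g, 'm) monoid_scheme" (structure)
    and \<rho> :: "'g \<Rightarrow> 'v::ab_group_add \<Rightarrow> 'v"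
    and scale :: "'k::field \<Rightarrow> 'v \<Rightarrow> 'v"
    and e :: "nat \<Rightarrow> 'v"
    and n :: nat +
  assumes inj_basis: "inj_on e {..<n}"
    and linear_action: "g \<in> carrier G \<Longrightarrow> Vector_Spaces.linear scale scale (\<rho> g)"

definition fixed_space :: "('g \<Rightarrow> 'v \<Rightarrow> 'v) \<Rightarrow> 'g \<Rightarrow> 'v set" where
  "fixed_space \<rho> \<sigma> = {v. \<rho> \<sigma> v = v}"

definition bireflection ::
    "('k::field \<Rightarrow> 'v::ab_group_add \<Rightarrow> 'v) \<Rightarrow> ('g \<Rightarrow> 'v \<Rightarrow> 'v) \<Rightarrow> 'g \<Rightarrow> bool" where
  "bireflection scale \<rho> \<sigma> \<longleftrightarrow>
     vector_space.dim scale UNIV \<le> vector_space.dim scale (fixed_space \<rho> \<sigma>) + 2"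

text \<open>The dual basis \<open>x\<^sub>0, \<dots>, x\<^sub>n\<^sub>-\<^sub>1\<close> of \<open>e 0, \<dots>, e (n - 1)\<close>.\<close>

definition coord ::
    "('k::field \<Rightarrow> 'v::ab_group_add \<Rightarrow> 'v) \<Rightarrow> (nat \<Rightarrow> 'v) \<Rightarrow> nat \<Rightarrow> nat \<Rightarrow> 'v \<Rightarrow> 'k" where
  "coord scale e n i v = module.representation scale (e ` {..<n}) v (e i)"


section \<open>The action on the symmetric algebra of the dual space\<close>

text \<open>
  The symmetric algebra of the dual space is \<^term>\<open>polys n\<close>, the polynomial ring on the dual
  basis; \<open>dual_form\<close> is the identification of the dual space with its degree-one part.
\<close>

definition dual_form :: "(nat \<Rightarrow> 'v) \<Rightarrow> nat \<Rightarrow> ('v \<Rightarrow> 'k::comm_ring_1) \<Rightarrow> 'k mpoly" where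
  "dual_form e n \<phi> = (\<Sum>j<n. const (\<phi> (e j)) * var j)"

text \<open>
  The algebra homomorphism sending the variable \<open>x\<^sub>i\<close> to the linear form
  \<open>v \<mapsto> x\<^sub>i (\<sigma>\<inverse> v)\<close>.
\<close>

definition poly_action ::
    "('g, 'm) monoid_scheme \<Rightarrow> ('g \<Rightarrow> 'v \<Rightarrow> 'v) \<Rightarrow> ('k::field \<Rightarrow> 'v::ab_group_add \<Rightarrow> 'v) \<Rightarrow>
     (nat \<Rightarrow> 'v) \<Rightarrow> nat \<Rightarrow> 'g \<Rightarrow> 'k mpoly \<Rightarrow> 'k mpoly" where
  "poly_action G \<rho> scale e n \<sigma> f =
     subst_poly const (\<lambda>i. dual_form e n (\<lambda>v. coord scale e n i (\<rho> (inv\<^bsub>G\<^esub> \<sigma>) v))) f"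

definition invariant_ring ::
    "('g, 'm) monoid_scheme \<Rightarrow> ('g \<Rightarrow> 'v \<Rightarrow> 'v) \<Rightarrow> ('k::field \<Rightarrow> 'v::ab_group_add \<Rightarrow> 'v) \<Rightarrow>
     (nat \<Rightarrow> 'v) \<Rightarrow> nat \<Rightarrow> 'k mpoly set" where
  "invariant_ring G \<rho> scale e n =
     {f \<in> polys n. \<forall>\<sigma>\<in>carrier G. poly_action G \<rho> scale e n \<sigma> f = f}"


section \<open>Geometric separation\<close>

text \<open>
  The base change of \<open>V\<close> to the algebraic closure, in coordinates with respect to the basis
  \<open>1 \<otimes> e i\<close>; a point is a coordinate vector, extended by \<open>0\<close> outside \<open>{..<n}\<close>.
\<close>

definition ext_space :: "nat \<Rightarrow> (nat \<Rightarrow> 'k::field alg_closure) set" where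
  "ext_space n = {w. \<forall>i\<ge>n. w i = 0}"

definition ext_action ::
    "('g \<Rightarrow> 'v \<Rightarrow> 'v) \<Rightarrow> ('k::field \<Rightarrow> 'v::ab_group_add \<Rightarrow> 'v) \<Rightarrow> (nat \<Rightarrow> 'v) \<Rightarrow> nat \<Rightarrow>
     'g \<Rightarrow> (nat \<Rightarrow> 'k alg_closure) \<Rightarrow> (nat \<Rightarrow> 'k alg_closure)" where
  "ext_action \<rho> scale e n \<sigma> w =
     (\<lambda>i. if i < n then \<Sum>j<n. to_ac (coord scale e n i (\<rho> \<sigma> (e j))) * w j else 0)"

definition geom_separating ::
    "('g, 'm) monoid_scheme \<Rightarrow> ('g \<Rightarrow> 'v \<Rightarrow> 'v) \<Rightarrow> ('k::field \<Rightarrow> 'v::ab_group_add \<Rightarrow> 'v) \<Rightarrow>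
     (nat \<Rightarrow> 'v) \<Rightarrow> nat \<Rightarrow> 'k mpoly set \<Rightarrow> bool" where
  "geom_separating G \<rho> scale e n A \<longleftrightarrow>
     (\<forall>u\<in>ext_space n. \<forall>w\<in>ext_space n.
        orbit G (ext_action \<rho> scale e n) u \<noteq> orbit G (ext_action \<rho> scale e n) w \<longrightarrow>
        (\<exists>f\<in>A. subst_poly to_ac u f \<noteq> subst_poly to_ac w f))"

end

theory Submission
  imports Defs "Jordan_Normal_Form.Determinant" "HOL-Computational_Algebra.Primes" "HOL-Number_Theory.Cong"
begin

text \<open>
  Write \<open>S = K[V]\<close>. If the bireflections generate a proper subgroup, a \<open>p\<close>-group has a nontrivial
  character \<open>\<chi>\<close> with values in \<open>\<int>/p\<close> vanishing on them. An invariant \<open>a\<close> that vanishes on the fixed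
  spaces of all \<open>\<sigma>\<close> with \<open>\<chi> \<sigma> \<noteq> 0\<close> has a power annihilating the class of \<open>\<chi>\<close> in \<open>H\<^sup>1(G, S)\<close>, that is,
  \<open>\<sigma> b - b = a\<^sup>m \<chi> \<sigma>\<close> for some \<open>b \<in> S\<close>. As these fixed spaces have codimension at least \<open>3\<close>, there are three
  such \<open>a\<^sub>i\<close> which are independent enough to be treated like a regular sequence, and the
  \<open>u\<^sub>i\<^sub>j = a\<^sub>i b\<^sub>j - a\<^sub>j b\<^sub>i\<close> are invariants satisfying the Koszul relation
  \<open>a\<^sub>1 u\<^sub>2\<^sub>3 - a\<^sub>2 u\<^sub>1\<^sub>3 + a\<^sub>3 u\<^sub>1\<^sub>2 = 0\<close>.

  By the Nullstellensatz a separating algebra \<open>A\<close> contains a \<open>p\<^sup>k\<close>-th power of every invariant, and \<open>S\<close> is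
  finite over \<open>A\<close>; so the relation may be raised to a power and read in \<open>A\<close>. A regular sequence of length
  \<open>dim V\<close> in \<open>A\<close> makes \<open>A\<close> free over the subalgebra it generates, and the relation yields
  \<open>c u\<^sub>1\<^sub>2 \<in> a\<^sub>1 A + a\<^sub>2 A\<close> with \<open>c\<close> not vanishing on the fixed space of some \<open>\<sigma>\<close> with \<open>\<chi> \<sigma> \<noteq> 0\<close>. Correcting the
  \<open>b\<^sub>i\<close> by the coefficients and applying an Artin-Schreier polynomial gives
  \<open>h \<in> S\<close> with \<open>\<sigma> h - h = c' \<chi> \<sigma>\<close>, and \<open>c'\<close> would vanish on that fixed space after all.
\<close>

section \<open>Subrings, submodules and pseudo-division\<close>

text \<open>Heights and systems of parameters are avoided. The \<open>a\<^sub>i\<close> are built as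
  polynomials in one homogeneous regular sequence \<open>f\<close> of \<open>A\<close>. Let
  \<open>T\<close> be a largest set of indices for which the \<open>f i\<close> stay algebraically
  independent modulo the ideal of the fixed space of some \<open>\<sigma>\<close> with
  \<open>\<chi> \<sigma> \<noteq> 0\<close>. Codimension at least 3 bounds the size of
  \<open>T\<close> by \<open>dim V - 3\<close>, so three indices \<open>j\<close> remain, and
  maximality gives for each of them a nonzero polynomial in \<open>f j\<close> over
  \<open>K[f\<^sub>T]\<close> lying in all these ideals. Since \<open>A\<close> is free over
  \<open>K[f]\<close>, the three act as a regular sequence up to pseudo-division. Its price is a
  product of leading coefficients in \<open>K[f\<^sub>T]\<close>, which by the choice of
  \<open>T\<close> stays outside the ideal of one fixed space: this is the origin of
  \<open>c\<close>. Frobenius powers respect the equations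
  \<open>\<sigma> b - b = a \<chi> \<sigma>\<close> because \<open>\<chi>\<close> has values in the
  prime field. The final division by \<open>a\<^sub>1\<close> is carried out in \<open>S\<close>,
  which is integrally closed: the Artin-Schreier polynomial supplies a monic equation for the
  quotient.\<close>

definition sring :: "'a::comm_ring_1 set \<Rightarrow> bool" where
  "sring A \<longleftrightarrow> 1 \<in> A \<and> (\<forall>x\<in>A. \<forall>y\<in>A. x - y \<in> A \<and> x * y \<in> A)"

definition smod :: "'a::comm_ring_1 set \<Rightarrow> 'a set \<Rightarrow> bool" where
  "smod A M \<longleftrightarrow> 0 \<in> M \<and> (\<forall>x\<in>M. \<forall>y\<in>M. x + y \<in> M) \<and> (\<forall>a\<in>A. \<forall>x\<in>M. a * x \<in> M)"

definition idl :: "'a::comm_ring_1 set \<Rightarrow> 'a set \<Rightarrow> bool" where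
  "idl A J \<longleftrightarrow> J \<subseteq> A \<and> smod A J"

definition pidl :: "'a::comm_ring_1 set \<Rightarrow> 'a set \<Rightarrow> bool" where
  "pidl A P \<longleftrightarrow> idl A P \<and> 1 \<notin> P \<and> (\<forall>x\<in>A. \<forall>y\<in>A. x * y \<in> P \<longrightarrow> x \<in> P \<or> y \<in> P)"

definition cpoly :: "'a::zero set \<Rightarrow> 'a poly set" where
  "cpoly M = {p. \<forall>i. coeff p i \<in> M}"

lemma sring_1: "sring A \<Longrightarrow> 1 \<in> A" by (simp add: sring_def)
lemma sring_diff: "sring A \<Longrightarrow> x \<in> A \<Longrightarrow> y \<in> A \<Longrightarrow> x - y \<in> A" by (simp add: sring_def)
lemma sring_mult: "sring A \<Longrightarrow> x \<in> A \<Longrightarrow> y \<in> A \<Longrightarrow> x * y \<in> A" by (simp add: sring_def)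
lemma sring_0: "sring A \<Longrightarrow> 0 \<in> A" using sring_diff[of A 1 1] by (simp add: sring_1)
lemma sring_uminus: "sring A \<Longrightarrow> x \<in> A \<Longrightarrow> - x \<in> A" using sring_diff[of A 0 x] by (simp add: sring_0)
lemma sring_add: "sring A \<Longrightarrow> x \<in> A \<Longrightarrow> y \<in> A \<Longrightarrow> x + y \<in> A"
  using sring_diff[of A x "- y"] by (simp add: sring_uminus)
lemma sring_power: "sring A \<Longrightarrow> x \<in> A \<Longrightarrow> x ^ k \<in> A"
  by (induction k) (auto simp: sring_1 sring_mult)
lemma sring_sum: "sring A \<Longrightarrow> (\<And>i. i \<in> I \<Longrightarrow> f i \<in> A) \<Longrightarrow> sum f I \<in> A"
  by (induction I rule: infinite_finite_induct) (auto simp: sring_0 sring_add)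
lemma sring_prod: "sring A \<Longrightarrow> (\<And>i. i \<in> I \<Longrightarrow> f i \<in> A) \<Longrightarrow> prod f I \<in> A"
  by (induction I rule: infinite_finite_induct) (auto simp: sring_1 sring_mult)
lemma sring_of_nat: "sring A \<Longrightarrow> of_nat k \<in> A"
  by (induction k) (auto simp: sring_0 sring_1 sring_add)

lemmas sring_closed = sring_1 sring_0 sring_diff sring_mult sring_uminus sring_add sring_power sring_of_nat

lemma smod_0: "smod A M \<Longrightarrow> 0 \<in> M" by (simp add: smod_def)
lemma smod_add: "smod A M \<Longrightarrow> x \<in> M \<Longrightarrow> y \<in> M \<Longrightarrow> x + y \<in> M" by (simp add: smod_def)
lemma smod_scale: "smod A M \<Longrightarrow> a \<in> A \<Longrightarrow> x \<in> M \<Longrightarrow> a * x \<in> M" by (simp add: smod_def)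
lemma smod_uminus: "smod A M \<Longrightarrow> sring A \<Longrightarrow> x \<in> M \<Longrightarrow> - x \<in> M"
  using smod_scale[of A M "-1" x] by (simp add: sring_uminus sring_1)
lemma smod_diff: "smod A M \<Longrightarrow> sring A \<Longrightarrow> x \<in> M \<Longrightarrow> y \<in> M \<Longrightarrow> x - y \<in> M"
  using smod_add[of A M x "- y"] by (simp add: smod_uminus)
lemma smod_sum: "smod A M \<Longrightarrow> (\<And>i. i \<in> I \<Longrightarrow> f i \<in> M) \<Longrightarrow> sum f I \<in> M"
  by (induction I rule: infinite_finite_induct) (auto simp: smod_0 smod_add)

lemma sring_smod: "sring A \<Longrightarrow> smod A A"
  by (simp add: smod_def sring_closed)

lemma idl_subset: "idl A J \<Longrightarrow> J \<subseteq> A" by (simp add: idl_def)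
lemma idl_smod: "idl A J \<Longrightarrow> smod A J" by (simp add: idl_def)
lemma pidl_idl: "pidl A P \<Longrightarrow> idl A P" by (simp add: pidl_def)
lemma pidl_smod: "pidl A P \<Longrightarrow> smod A P" by (simp add: pidl_def idl_def)
lemma pidl_1: "pidl A P \<Longrightarrow> 1 \<notin> P" by (simp add: pidl_def)
lemma pidl_mult: "pidl A P \<Longrightarrow> x \<in> A \<Longrightarrow> y \<in> A \<Longrightarrow> x \<notin> P \<Longrightarrow> y \<notin> P \<Longrightarrow> x * y \<notin> P"
  by (auto simp: pidl_def)
lemma pidl_power: "pidl A P \<Longrightarrow> sring A \<Longrightarrow> x \<in> A \<Longrightarrow> x \<notin> P \<Longrightarrow> x ^ k \<notin> P"
  by (induction k) (auto simp: pidl_1 pidl_mult sring_power)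
lemma pidl_prod:
  assumes "pidl A P" "sring A" "finite I" "\<And>i. i \<in> I \<Longrightarrow> f i \<in> A - P"
  shows "prod f I \<in> A - P"
  using assms(3,4) by (induction I rule: finite_induct)
    (use assms(1,2) in \<open>auto simp: sring_1 pidl_1 sring_mult pidl_mult\<close>)

lemma cpolyI: "(\<And>i. coeff p i \<in> M) \<Longrightarrow> p \<in> cpoly M" by (simp add: cpoly_def)
lemma cpolyD: "p \<in> cpoly M \<Longrightarrow> coeff p i \<in> M" by (simp add: cpoly_def)

lemma sring_cpoly: assumes "sring A" shows "sring (cpoly A)"
  using assms by (auto simp: sring_def cpoly_def coeff_mult coeff_1 sring_0 intro!: sring_sum)

lemma smod_cpoly: assumes "sring D" "smod D M" shows "smod (cpoly D) (cpoly M)"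
  using assms by (auto simp: smod_def cpoly_def coeff_mult intro!: smod_sum[of D] smod_scale)

lemma poly_cpoly_in:
  assumes "sring D" "smod D M" "p \<in> cpoly M" "x \<in> D"
  shows "poly p x \<in> M"
  unfolding poly_altdef
  using assms by (intro smod_sum[of D]) (auto simp: mult.commute[of "coeff p _"] cpoly_def intro!: smod_scale sring_power)

text \<open>The dividend has coefficients only in a \<open>D\<close>-module \<open>M\<close>, since
  the division is used over a ring as well as for expansions with coefficients in a module.
  Vanishing of coefficients replaces a degree bound on \<open>r\<close>, so that a constant
  \<open>g\<close> forces \<open>r = 0\<close>; the bound on \<open>Q\<close> is stated separately
  because zero divisors rule out degree arithmetic.\<close>

lemma pseudo_division:
  assumes D: "sring D" and M: "smod D M" and g: "g \<in> cpoly D" and U: "U \<in> cpoly M"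
  shows "\<exists>k. \<exists>Q\<in>cpoly M. \<exists>r\<in>cpoly M. smult (lead_coeff g ^ k) U = g * Q + r \<and>
    (\<forall>i\<ge>degree g. coeff r i = 0) \<and> (\<forall>i. degree U < i + degree g \<longrightarrow> coeff Q i = 0)"
proof -
  let ?c = "lead_coeff g" and ?d = "degree g"
  have cD: "?c \<in> D" using g by (simp add: cpoly_def)
  have MM: "smod (cpoly D) (cpoly M)" using smod_cpoly D M by blast
  define R where "R N U \<longleftrightarrow> (\<exists>k. \<exists>Q\<in>cpoly M. \<exists>r\<in>cpoly M.
    smult (?c ^ k) U = g * Q + r \<and> (\<forall>i\<ge>?d. coeff r i = 0) \<and> (\<forall>i. N \<le> i + ?d \<longrightarrow> coeff Q i = 0))" for N U
  have RI: "R N U" if "Q \<in> cpoly M" "r \<in> cpoly M" "smult (?c ^ k) U = g * Q + r"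
    "\<forall>i\<ge>?d. coeff r i = 0" "\<forall>i. N \<le> i + ?d \<longrightarrow> coeff Q i = 0" for N U k Q r unfolding R_def using that by (intro exI[of _ k] bexI[OF _ that(1)] bexI[OF _ that(2)]) simp
  have "\<forall>U\<in>cpoly M. (\<forall>i\<ge>N. coeff U i = 0) \<longrightarrow> R N U" for N
  proof (induction N)
    case 0
    show ?case using RI[OF smod_0[OF MM] smod_0[OF MM], of 0] by (auto simp: poly_eq_iff)
  next
    case (Suc N)
    show ?case
    proof (intro ballI impI)
      fix U assume U: "U \<in> cpoly M" and van: "\<forall>i\<ge>Suc N. coeff U i = 0"
      show "R (Suc N) U"
      proof (cases "N < ?d")
        case True
        then show ?thesis using RI[OF smod_0[OF MM] U, of 0] van by auto
      next
        case False
        let ?u = "coeff U N"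
        \<comment> \<open>\<open>g * T\<close> and \<open>lead_coeff g * U\<close> have the same
          coefficient at \<open>N\<close>, so the difference is shorter.\<close>
        define T where "T = monom ?u (N - ?d)"
        define U1 where "U1 = smult ?c U - g * T"
        have T: "T \<in> cpoly M"
          using U by (auto simp: T_def cpoly_def smod_0[OF M])
        have gT: "g * T \<in> cpoly M" using smod_scale[OF MM] g T by blast
        have "[:?c:] \<in> cpoly D" using cD D by (auto simp: cpoly_def coeff_pCons sring_0 split: nat.split)
        then have "smult ?c U \<in> cpoly M" using smod_scale[OF MM, of "[:?c:]" U] U by simp
        then have U1: "U1 \<in> cpoly M" unfolding U1_def
          using gT smod_diff[OF MM] sring_cpoly[OF D] by blast
        have gT': "g * T = monom ?u (N - ?d) * g" by (simp add: T_def mult.commute)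
        have U1N: "coeff U1 i = 0" if "i \<ge> N" for i
        proof (cases "i = N")
          case True
          have "coeff (g * T) N = ?u * ?c"
            using False unfolding gT' coeff_monom_mult by simp
          then show ?thesis using True by (simp add: U1_def)
        next
          case i: False
          have "coeff (g * T) i = ?u * coeff g (i - (N - ?d))"
            using False that unfolding gT' coeff_monom_mult by simp
          also have "coeff g (i - (N - ?d)) = 0"
          proof (rule coeff_eq_0)
            show "?d < i - (N - ?d)" using i that False by linarith
          qed
          finally have "coeff (g * T) i = 0" by simp
          moreover have "coeff U i = 0" using van i that by simp
          ultimately show ?thesis by (simp add: U1_def)
        qed
        have "R N U1" using Suc U1 U1N by blast
        then obtain k Q r where *: "Q \<in> cpoly M" "r \<in> cpoly M" "smult (?c ^ k) U1 = g * Q + r"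
          "\<forall>i\<ge>?d. coeff r i = 0" "\<forall>i. N \<le> i + ?d \<longrightarrow> coeff Q i = 0" unfolding R_def by (elim exE bexE conjE)
        have cT: "smult (?c ^ k) T \<in> cpoly M"
          by (rule cpolyI, unfold coeff_smult, rule smod_scale[OF M sring_power[OF D cD] cpolyD[OF T]])
        have "smult (?c ^ Suc k) U = smult (?c ^ k) U1 + g * smult (?c ^ k) T"
          by (simp add: U1_def smult_diff_right power_Suc2 del: power_Suc)
        also have "\<dots> = g * (Q + smult (?c ^ k) T) + r" by (simp only: *(3) distrib_left add_ac)
        finally have "smult (?c ^ Suc k) U = g * (Q + smult (?c ^ k) T) + r" .
        moreover have "Q + smult (?c ^ k) T \<in> cpoly M" by (rule smod_add[OF MM *(1) cT])
        moreover have "coeff (Q + smult (?c ^ k) T) i = 0" if "Suc N \<le> i + ?d" for i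
          using *(5) that False by (auto simp: T_def)
        ultimately show ?thesis using RI *(2,4) by metis
      qed
    qed
  qed
  moreover have "\<forall>i\<ge>Suc (degree U). coeff U i = 0" by (simp add: coeff_eq_0)
  ultimately have "R (Suc (degree U)) U" using U by blast
  then show ?thesis by (simp only: R_def Suc_le_eq)
qed

section \<open>Zorn's lemma for submodules and prime ideals\<close>

lemma smod_Union_chain:
  assumes "\<C> \<noteq> {}" and M: "\<And>M. M \<in> \<C> \<Longrightarrow> smod A M"
    and ch: "\<And>M N. M \<in> \<C> \<Longrightarrow> N \<in> \<C> \<Longrightarrow> M \<subseteq> N \<or> N \<subseteq> M"
  shows "smod A (\<Union>\<C>)"
proof -
  have "x + y \<in> \<Union>\<C>" if "x \<in> M" "M \<in> \<C>" "y \<in> N" "N \<in> \<C>" for x y M N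
  proof (cases "M \<subseteq> N")
    case True
    then have "x + y \<in> N" using that smod_add[OF M] by blast
    then show ?thesis using that by blast
  next
    case False
    then have "y \<in> M" using that ch by blast
    then have "x + y \<in> M" using that smod_add[OF M] by blast
    then show ?thesis using that by blast
  qed
  moreover have "a * x \<in> \<Union>\<C>" if "x \<in> M" "M \<in> \<C>" "a \<in> A" for x M a
    using that smod_scale[OF M] by blast
  moreover have "0 \<in> \<Union>\<C>" using assms(1) smod_0[OF M] by blast
  ultimately show ?thesis unfolding smod_def by blast
qed

text \<open>One maximality principle for prime ideals, for the submodule behind a functional and for
  complements of subspaces: each \<open>Q\<close> used is a condition on single elements, so it
  passes to unions.\<close>

lemma smod_Zorn:
  assumes "smod A J" and "Q J"
    and Q: "\<And>\<C>. \<C> \<noteq> {} \<Longrightarrow> (\<And>M. M \<in> \<C> \<Longrightarrow> Q M) \<Longrightarrow> Q (\<Union>\<C>)"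
  obtains M where "smod A M" "J \<subseteq> M" "Q M" "\<And>N. smod A N \<Longrightarrow> M \<subseteq> N \<Longrightarrow> Q N \<Longrightarrow> N = M"
proof -
  define F where "F = {M. smod A M \<and> J \<subseteq> M \<and> Q M}"
  have F: "M \<in> F \<longleftrightarrow> smod A M \<and> J \<subseteq> M \<and> Q M" for M by (simp add: F_def)
  have "\<exists>M\<in>F. \<forall>N\<in>F. M \<subseteq> N \<longrightarrow> N = M"
  proof (rule subset_Zorn_nonempty)
    show "F \<noteq> {}" using assms(1,2) F by blast
    fix \<C> assume ne: "\<C> \<noteq> {}" and chain: "subset.chain F \<C>"
    have sub: "M \<in> F" if "M \<in> \<C>" for M using chain that unfolding subset_chain_def by blast
    have ch: "M \<subseteq> N \<or> N \<subseteq> M" if "M \<in> \<C>" "N \<in> \<C>" for M N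
      using chain that unfolding subset_chain_def by blast
    have "smod A (\<Union>\<C>)" using smod_Union_chain[OF ne _ ch] sub F by blast
    moreover have "J \<subseteq> \<Union>\<C>" using ne sub F by blast
    moreover have "Q (\<Union>\<C>)" using Q[OF ne] sub F by blast
    ultimately show "\<Union>\<C> \<in> F" using F by blast
  qed
  then obtain M where M: "M \<in> F" and max: "\<And>N. N \<in> F \<Longrightarrow> M \<subseteq> N \<Longrightarrow> N = M" by blast
  show thesis
  proof
    show "smod A M" "J \<subseteq> M" "Q M" using M F by auto
    fix N assume N: "smod A N" "M \<subseteq> N" "Q N"
    then have "N \<in> F" using M F by auto
    then show "N = M" using max N(2) by blast
  qed
qed

lemma smod_insert:
  fixes x :: "'a::comm_ring_1"
  assumes A: "sring A" and M: "smod A M"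
  defines "N \<equiv> {b * x + q | b q. b \<in> A \<and> q \<in> M}"
  shows "smod A N" "M \<subseteq> N" "x \<in> N"
proof -
  have I: "b * x + q \<in> N" if "b \<in> A" "q \<in> M" for b q using that by (auto simp: N_def)
  show "M \<subseteq> N" using I[OF sring_0[OF A]] by auto
  show "x \<in> N" using I[OF sring_1[OF A] smod_0[OF M]] by simp
  have "y + z \<in> N" if yz: "y \<in> N" "z \<in> N" for y z
  proof -
    obtain b q b' q' where *: "y = b * x + q" "z = b' * x + q'" "b \<in> A" "b' \<in> A" "q \<in> M" "q' \<in> M"
      using yz by (auto simp: N_def)
    have "y + z = (b + b') * x + (q + q')" using * by (simp add: algebra_simps)
    then show ?thesis using I[OF sring_add[OF A *(3,4)] smod_add[OF M *(5,6)]] by simp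
  qed
  moreover have "c * y \<in> N" if yz: "y \<in> N" "c \<in> A" for y c
  proof -
    obtain b q where *: "y = b * x + q" "b \<in> A" "q \<in> M" using yz by (auto simp: N_def)
    have "c * y = (c * b) * x + c * q" using * by (simp add: algebra_simps)
    then show ?thesis using I[OF sring_mult[OF A yz(2) *(2)] smod_scale[OF M yz(2) *(3)]] by simp
  qed
  moreover have "0 \<in> N" using \<open>M \<subseteq> N\<close> smod_0[OF M] by blast
  ultimately show "smod A N" unfolding smod_def by blast
qed

text \<open>Krull's argument: an ideal maximal among those over \<open>J\<close> containing no power
  of \<open>a\<close> is prime. It serves in place of radicals: an element of all primes over
  \<open>J\<close> has a power in \<open>J\<close>.\<close>

lemma prime_ideal_avoiding:
  assumes A: "sring A" and J: "idl A J" and a: "a \<in> A" and avoid: "\<And>k. a ^ k \<notin> J"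
  obtains P where "pidl A P" "J \<subseteq> P" "a \<notin> P"
proof -
  define Q where "Q I \<longleftrightarrow> I \<subseteq> A \<and> (\<forall>k. a ^ k \<notin> I)" for I
  have QU: "Q (\<Union>\<C>)" if "\<And>M. M \<in> \<C> \<Longrightarrow> Q M" for \<C>
    using that unfolding Q_def by blast
  have QJ: "Q J" using J avoid by (auto simp: Q_def idl_def)
  obtain P where sm: "smod A P" and JP: "J \<subseteq> P" and QP: "Q P"
    and max: "\<And>N. smod A N \<Longrightarrow> P \<subseteq> N \<Longrightarrow> Q N \<Longrightarrow> N = P"
    using smod_Zorn[of A J Q] idl_smod[OF J] QJ QU by metis
  have PA: "P \<subseteq> A" and aP: "\<And>k. a ^ k \<notin> P" using QP by (auto simp: Q_def)
  \<comment> \<open>By maximality the ideal generated by \<open>P\<close> and \<open>x\<close>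
    contains a power of \<open>a\<close>.\<close>
  have key: "\<exists>k b q. b \<in> A \<and> q \<in> P \<and> a ^ k = b * x + q" if x: "x \<in> A" "x \<notin> P" for x
  proof (rule ccontr)
    assume no: "\<not> ?thesis"
    define N where "N = {b * x + q | b q. b \<in> A \<and> q \<in> P}"
    note ins = smod_insert[OF A sm, of x, folded N_def]
    have "N \<subseteq> A" using x PA by (auto simp: N_def intro!: sring_add[OF A] sring_mult[OF A])
    moreover have "a ^ k \<notin> N" for k using no unfolding N_def by blast
    ultimately have "N = P" using max[OF ins(1,2)] by (simp add: Q_def)
    then show False using ins(3) x(2) by simp
  qed
  have "x * y \<notin> P" if x: "x \<in> A" "x \<notin> P" and y: "y \<in> A" "y \<notin> P" for x y
  proof
    assume xy: "x * y \<in> P"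
    obtain k b q where 1: "b \<in> A" "q \<in> P" "a ^ k = b * x + q" using key x by blast
    obtain l c r where 2: "c \<in> A" "r \<in> P" "a ^ l = c * y + r" using key y by blast
    have "a ^ (k + l) = (b * c) * (x * y) + (c * y + r) * q + (b * x) * r"
      unfolding power_add 1(3) 2(3) by (simp add: algebra_simps)
    moreover have "(b * c) * (x * y) + (c * y + r) * q + (b * x) * r \<in> P"
      proof (intro smod_add[OF sm])
      show "(b * c) * (x * y) \<in> P" by (rule smod_scale[OF sm sring_mult[OF A 1(1) 2(1)] xy])
      show "(c * y + r) * q \<in> P"
        by (rule smod_scale[OF sm _ 1(2)]) (use 2 y PA in \<open>auto intro!: sring_add[OF A] sring_mult[OF A]\<close>)
      show "(b * x) * r \<in> P" by (rule smod_scale[OF sm sring_mult[OF A 1(1) x(1)] 2(2)])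
    qed
    ultimately show False using aP by metis
  qed
  then have "pidl A P" using sm PA aP[of 0] by (auto simp: pidl_def idl_def)
  then show ?thesis using that JP aP[of 1] by simp
qed

section \<open>The Nullstellensatz for towers\<close>

text \<open>Homomorphisms of subrings are total functions whose values outside \<open>A\<close> are
  arbitrary.\<close>

definition rhom :: "'a::comm_ring_1 set \<Rightarrow> ('a \<Rightarrow> 'b::comm_ring_1) \<Rightarrow> bool" where
  "rhom A \<phi> \<longleftrightarrow> \<phi> 1 = 1 \<and> (\<forall>x\<in>A. \<forall>y\<in>A. \<phi> (x + y) = \<phi> x + \<phi> y \<and> \<phi> (x * y) = \<phi> x * \<phi> y)"

lemma rhom_1: "rhom A \<phi> \<Longrightarrow> \<phi> 1 = 1" by (simp add: rhom_def)
lemma rhom_add: "rhom A \<phi> \<Longrightarrow> x \<in> A \<Longrightarrow> y \<in> A \<Longrightarrow> \<phi> (x + y) = \<phi> x + \<phi> y" by (simp add: rhom_def)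
lemma rhom_mult: "rhom A \<phi> \<Longrightarrow> x \<in> A \<Longrightarrow> y \<in> A \<Longrightarrow> \<phi> (x * y) = \<phi> x * \<phi> y" by (simp add: rhom_def)
lemma rhom_0: "rhom A \<phi> \<Longrightarrow> sring A \<Longrightarrow> \<phi> 0 = 0"
  using rhom_add[of A \<phi> 0 0] by (simp add: sring_0)
lemma rhom_diff: "rhom A \<phi> \<Longrightarrow> sring A \<Longrightarrow> x \<in> A \<Longrightarrow> y \<in> A \<Longrightarrow> \<phi> (x - y) = \<phi> x - \<phi> y"
  using rhom_add[of A \<phi> "x - y" y] by (simp add: sring_diff algebra_simps)
lemma rhom_uminus: "rhom A \<phi> \<Longrightarrow> sring A \<Longrightarrow> x \<in> A \<Longrightarrow> \<phi> (- x) = - \<phi> x"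
  using rhom_diff[of A \<phi> 0 x] by (simp add: sring_0 rhom_0)
lemma rhom_power: "rhom A \<phi> \<Longrightarrow> sring A \<Longrightarrow> x \<in> A \<Longrightarrow> \<phi> (x ^ k) = \<phi> x ^ k"
  by (induction k) (auto simp: rhom_1 rhom_mult sring_power)
lemma rhom_sum:
  "rhom A \<phi> \<Longrightarrow> sring A \<Longrightarrow> (\<And>i. i \<in> I \<Longrightarrow> f i \<in> A) \<Longrightarrow> \<phi> (sum f I) = (\<Sum>i\<in>I. \<phi> (f i))"
  by (induction I rule: infinite_finite_induct) (auto simp: rhom_0 rhom_add sring_sum)
lemma rhom_prod:
  "rhom A \<phi> \<Longrightarrow> sring A \<Longrightarrow> (\<And>i. i \<in> I \<Longrightarrow> f i \<in> A) \<Longrightarrow> \<phi> (prod f I) = (\<Prod>i\<in>I. \<phi> (f i))"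
  by (induction I rule: infinite_finite_induct) (auto simp: rhom_1 rhom_mult sring_prod)

lemma map_poly_rhom_add:
  assumes "rhom A \<phi>" "sring A" "p \<in> cpoly A" "q \<in> cpoly A"
  shows "map_poly \<phi> (p + q) = map_poly \<phi> p + map_poly \<phi> q"
  using assms by (simp add: poly_eq_iff coeff_map_poly rhom_0 rhom_add cpolyD)

lemma map_poly_rhom_diff:
  assumes "rhom A \<phi>" "sring A" "p \<in> cpoly A" "q \<in> cpoly A"
  shows "map_poly \<phi> (p - q) = map_poly \<phi> p - map_poly \<phi> q"
  using assms by (simp add: poly_eq_iff coeff_map_poly rhom_0 rhom_diff cpolyD)

lemma map_poly_rhom_mult:
  assumes "rhom A \<phi>" "sring A" "p \<in> cpoly A" "q \<in> cpoly A"
  shows "map_poly \<phi> (p * q) = map_poly \<phi> p * map_poly \<phi> q"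
proof (rule poly_eqI)
  fix k
  have "\<phi> (\<Sum>i\<le>k. coeff p i * coeff q (k - i)) = (\<Sum>i\<le>k. \<phi> (coeff p i * coeff q (k - i)))"
    by (rule rhom_sum[OF assms(1,2)]) (use assms in \<open>auto intro!: sring_mult cpolyD\<close>)
  also have "\<dots> = (\<Sum>i\<le>k. \<phi> (coeff p i) * \<phi> (coeff q (k - i)))"
    by (rule sum.cong) (use assms in \<open>auto intro!: rhom_mult[of A] cpolyD\<close>)
  finally show "coeff (map_poly \<phi> (p * q)) k = coeff (map_poly \<phi> p * map_poly \<phi> q) k"
    using assms by (simp add: coeff_map_poly rhom_0 coeff_mult)
qed

section \<open>Extending homomorphisms into algebraically closed fields\<close>

definition adj :: "'a::comm_ring_1 set \<Rightarrow> 'a \<Rightarrow> 'a set" where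
  "adj A x = (\<lambda>p. poly p x) ` cpoly A"

lemma const_cpoly: "sring A \<Longrightarrow> c \<in> A \<Longrightarrow> [:c:] \<in> cpoly A"
  by (auto simp: cpoly_def coeff_pCons sring_0 split: nat.split)

lemma adj_superset: assumes "sring A" shows "A \<subseteq> adj A x"
proof
  fix c assume "c \<in> A"
  then have "[:c:] \<in> cpoly A" "c = poly [:c:] x" using const_cpoly assms by auto
  then show "c \<in> adj A x" unfolding adj_def by blast
qed

lemma adj_self: assumes "sring A" shows "x \<in> adj A x"
proof -
  have "[:0, 1:] \<in> cpoly A" using assms by (auto simp: cpoly_def coeff_pCons sring_0 sring_1 split: nat.split)
  moreover have "x = poly [:0, 1:] x" by simp
  ultimately show ?thesis unfolding adj_def by blast
qed

lemma sring_adj: assumes "sring A" shows "sring (adj A x)"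
proof -
  note C = sring_cpoly[OF assms]
  have "1 \<in> adj A x" using adj_superset[OF assms] sring_1[OF assms] by auto
  moreover have "poly p x - poly q x \<in> adj A x" "poly p x * poly q x \<in> adj A x"
    if "p \<in> cpoly A" "q \<in> cpoly A" for p q
    using sring_diff[OF C that] sring_mult[OF C that] unfolding adj_def by (metis imageI poly_diff, metis imageI poly_mult)
  ultimately show ?thesis by (auto simp: sring_def adj_def)
qed

lemma adj_minimal: assumes "sring B" "A \<subseteq> B" "x \<in> B" shows "adj A x \<subseteq> B"
  using assms unfolding adj_def by (auto simp: poly_altdef cpoly_def intro!: sring_sum sring_mult sring_power)

text \<open>The extension sends \<open>p(x)\<close> to the value at \<open>\<alpha>\<close> of the
  image of \<open>p\<close>. Two representations of an element differ by a polynomial with value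
  \<open>0 \<in> P\<close>, so \<open>W\<close> makes it well defined; having \<open>W\<close> for
  all of \<open>P\<close> later makes the extension kill \<open>P\<close>.\<close>

lemma extend_hom_adj:
  fixes \<phi> :: "'a::comm_ring_1 \<Rightarrow> 'b::comm_ring_1"
  assumes A: "sring A" and \<phi>: "rhom A \<phi>"
    and W: "\<And>p. p \<in> cpoly A \<Longrightarrow> poly p x \<in> P \<Longrightarrow> poly (map_poly \<phi> p) \<alpha> = 0" and P0: "0 \<in> P"
  shows "\<exists>\<phi>'. rhom (adj A x) \<phi>' \<and> (\<forall>p\<in>cpoly A. \<phi>' (poly p x) = poly (map_poly \<phi> p) \<alpha>)"
proof -
  define \<phi>' where "\<phi>' z = poly (map_poly \<phi> (SOME p. p \<in> cpoly A \<and> poly p x = z)) \<alpha>" for z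
  note C = sring_cpoly[OF A]
  have eq: "\<phi>' (poly p x) = poly (map_poly \<phi> p) \<alpha>" if p: "p \<in> cpoly A" for p
  proof -
    define q where "q = (SOME q. q \<in> cpoly A \<and> poly q x = poly p x)"
    have q: "q \<in> cpoly A" "poly q x = poly p x"
      using someI[of "\<lambda>q. q \<in> cpoly A \<and> poly q x = poly p x" p] p unfolding q_def by auto
    have "poly (map_poly \<phi> (q - p)) \<alpha> = 0"
      using W[OF sring_diff[OF C q(1) p]] q(2) P0 by simp
    then show ?thesis
      using map_poly_rhom_diff[OF \<phi> A q(1) p] by (simp add: \<phi>'_def q_def)
  qed
  have "rhom (adj A x) \<phi>'"
  proof -
    have "\<phi>' 1 = 1" using eq[OF const_cpoly[OF A sring_1[OF A]]] rhom_1[OF \<phi>] rhom_0[OF \<phi> A]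
      by (simp add: map_poly_pCons)
    moreover have "\<phi>' (poly p x + poly q x) = \<phi>' (poly p x) + \<phi>' (poly q x)"
      "\<phi>' (poly p x * poly q x) = \<phi>' (poly p x) * \<phi>' (poly q x)" if pq: "p \<in> cpoly A" "q \<in> cpoly A" for p q
      using eq[OF sring_add[OF C pq]] eq[OF sring_mult[OF C pq]] eq[OF pq(1)] eq[OF pq(2)]
        map_poly_rhom_add[OF \<phi> A pq] map_poly_rhom_mult[OF \<phi> A pq] by simp_all
    ultimately show ?thesis by (auto simp: rhom_def adj_def)
  qed
  then show ?thesis using eq by blast
qed

text \<open>A root \<open>x\<close> of \<open>1 + X p\<close> satisfies
  \<open>x p(x) = -1\<close>.\<close>

lemma alg_closed_nonroot:
  fixes p :: "'b::alg_closed_field poly"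
  assumes "p \<noteq> 0" shows "\<exists>x. poly p x \<noteq> 0"
proof -
  have d: "degree (pCons 1 p) > 0" using assms by simp
  obtain x where "poly (pCons 1 p) x = 0" using alg_closed_imp_poly_has_root[OF d] by blast
  then have "poly p x \<noteq> 0" by auto
  then show ?thesis ..
qed

text \<open>A leading coefficient in \<open>P\<close> could be dropped, as this changes the value at
  \<open>x\<close> only by an element of \<open>P \<subseteq> J\<close>. So minimality among the
  polynomials with value in \<open>J\<close> and not all coefficients in \<open>P\<close> forces a
  leading coefficient outside \<open>P\<close>.\<close>

lemma min_degree_lead_coeff:
  fixes x :: "'a::comm_ring_1"
  assumes A: "sring A" and P: "pidl (adj A x) P" and J: "smod (adj A x) J" "P \<subseteq> J"
    and w0: "w0 \<in> cpoly A" "poly w0 x \<in> J" "w0 \<notin> cpoly P"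
  obtains w where "w \<in> cpoly A" "poly w x \<in> J" "lead_coeff w \<notin> P" "degree w \<le> degree w0"
    "\<And>p. p \<in> cpoly A \<Longrightarrow> poly p x \<in> J \<Longrightarrow> degree p < degree w \<Longrightarrow> p \<in> cpoly P"
proof -
  let ?Q = "\<lambda>w. w \<in> cpoly A \<and> poly w x \<in> J \<and> w \<notin> cpoly P"
  obtain w where w: "?Q w" and min: "\<And>p. ?Q p \<Longrightarrow> degree w \<le> degree p"
    using ex_has_least_nat[of ?Q w0 degree] w0 by blast
  note smP = pidl_smod[OF P]
  have "lead_coeff w \<notin> P"
  proof
    assume lc: "lead_coeff w \<in> P"
    define w' where "w' = w - monom (lead_coeff w) (degree w)"
    have "w \<noteq> 0" using w smod_0[OF smP] by (auto simp: cpoly_def)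
    have c: "coeff w' i = (if i = degree w then 0 else coeff w i)" for i by (simp add: w'_def)
    have "w' \<in> cpoly A" using w sring_0[OF A] by (auto simp: cpoly_def c)
    moreover have "w' \<notin> cpoly P"
    proof
      assume "w' \<in> cpoly P"
      then have "coeff w i \<in> P" for i using c[of i] cpolyD[of w' P i] lc by (cases "i = degree w") auto
      then show False using w by (auto simp: cpoly_def)
    qed
    moreover have "poly w' x \<in> J"
    proof -
      have "x ^ degree w * lead_coeff w \<in> P"
        by (rule smod_scale[OF smP _ lc]) (simp add: sring_power sring_adj[OF A] adj_self[OF A])
      then have "poly w x - lead_coeff w * x ^ degree w \<in> J"
        using w J by (intro smod_diff[OF J(1) sring_adj[OF A]]) (auto simp: mult.commute)
      then show ?thesis by (simp add: w'_def poly_monom)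
    qed
    ultimately have "degree w \<le> degree w'" and "w' \<noteq> 0"
      using min smod_0[OF smP] by (auto simp: cpoly_def)
    moreover have "lead_coeff w' \<noteq> 0" using \<open>w' \<noteq> 0\<close> by simp
    moreover have "coeff w' (degree w') = 0"
    proof (cases "degree w' = degree w")
      case True then show ?thesis using c[of "degree w"] by simp
    next
      case False then have "degree w < degree w'" using \<open>degree w \<le> degree w'\<close> by simp
      then show ?thesis using c[of "degree w'"] by (simp add: coeff_eq_0)
    qed
    ultimately show False by simp
  qed
  then show thesis using that w min w0 by (metis leD)
qed

text \<open>The extension theorem behind the Nullstellensatz, for one generator and modulo a prime
  \<open>P\<close>. The point is a single \<open>u\<close> below that serves all
  \<open>\<phi>\<close>: its nonvanishing has to provide a root for the minimal relation of
  \<open>x\<close> and to keep the image of \<open>v\<close> nonzero.\<close>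

lemma nullstellensatz_step:
  fixes x v :: "'a::comm_ring_1"
  assumes A: "sring A" and P: "pidl (adj A x) P" and v: "v \<in> adj A x" "v \<notin> P"
  shows "\<exists>u\<in>A - P. \<forall>\<phi>::'a \<Rightarrow> 'b::alg_closed_field. rhom A \<phi> \<and> (\<forall>z\<in>A \<inter> P. \<phi> z = 0) \<and> \<phi> u \<noteq> 0 \<longrightarrow>
    (\<exists>\<phi>'. rhom (adj A x) \<phi>' \<and> (\<forall>z\<in>A. \<phi>' z = \<phi> z) \<and> (\<forall>z\<in>P. \<phi>' z = 0) \<and> \<phi>' v \<noteq> 0)"
proof -
  let ?B = "adj A x"
  note B = sring_adj[OF A, of x] and smP = pidl_smod[OF P] and C = sring_cpoly[OF A]
  have AB: "A \<subseteq> ?B" by (rule adj_superset[OF A])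
  have PB: "P \<subseteq> ?B" using P by (auto simp: pidl_def idl_def)
  obtain q where q: "q \<in> cpoly A" "v = poly q x" using v by (auto simp: adj_def)
  have qP: "q \<notin> cpoly P"
  proof
    assume "q \<in> cpoly P"
    then show False using poly_cpoly_in[OF B smP _ adj_self[OF A]] v(2) q(2) by simp
  qed
  have finish: "\<exists>\<phi>'. rhom ?B \<phi>' \<and> (\<forall>z\<in>A. \<phi>' z = \<phi> z) \<and> (\<forall>z\<in>P. \<phi>' z = 0) \<and> \<phi>' v \<noteq> 0"
    if \<phi>: "rhom A \<phi>" and W: "\<And>p. p \<in> cpoly A \<Longrightarrow> poly p x \<in> P \<Longrightarrow> poly (map_poly \<phi> p) \<alpha> = 0"
      and nz: "poly (map_poly \<phi> q) \<alpha> \<noteq> 0" for \<phi> :: "'a \<Rightarrow> 'b" and \<alpha>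
  proof -
    obtain \<phi>' where h: "rhom ?B \<phi>'" and e: "\<And>p. p \<in> cpoly A \<Longrightarrow> \<phi>' (poly p x) = poly (map_poly \<phi> p) \<alpha>"
      using extend_hom_adj[OF A \<phi> W smod_0[OF smP]] by blast
    have "\<phi>' z = \<phi> z" if "z \<in> A" for z
      using e[OF const_cpoly[OF A that]] rhom_0[OF \<phi> A] by (simp add: map_poly_pCons)
    moreover have "\<phi>' z = 0" if zP: "z \<in> P" for z
    proof -
      obtain p where p: "p \<in> cpoly A" "z = poly p x" using subsetD[OF PB zP] by (auto simp: adj_def)
      then show ?thesis using e[OF p(1)] W[OF p(1)] zP by simp
    qed
    ultimately show ?thesis using h e[OF q(1)] nz q(2) by metis
  qed
  have kill: "map_poly \<phi> r = 0" if "\<And>z. z \<in> A \<inter> P \<Longrightarrow> \<phi> z = 0" "r \<in> cpoly A" "r \<in> cpoly P" "rhom A \<phi>"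
    for \<phi> :: "'a \<Rightarrow> 'b" and r
    using that by (simp add: poly_eq_iff coeff_map_poly rhom_0[OF _ A] cpolyD)
  have cp0: "r \<in> cpoly P" if "\<forall>i\<ge>(0::nat). coeff r i = 0" for r
    using that smod_0[OF smP] by (auto simp: cpoly_def)
  show ?thesis
  proof (cases "\<forall>p\<in>cpoly A. poly p x \<in> P \<longrightarrow> p \<in> cpoly P")
    \<comment> \<open>Here \<open>x\<close> is transcendental modulo \<open>P\<close>: any value
      that is not a root of the image of \<open>q\<close> will do, and one surviving coefficient
      makes that image nonzero.\<close>
    case True
    obtain i where i: "coeff q i \<notin> P" using qP by (auto simp: cpoly_def)
    have "\<exists>\<phi>'. rhom ?B \<phi>' \<and> (\<forall>z\<in>A. \<phi>' z = \<phi> z) \<and> (\<forall>z\<in>P. \<phi>' z = 0) \<and> \<phi>' v \<noteq> 0"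
      if \<phi>: "rhom A \<phi>" "\<forall>z\<in>A \<inter> P. \<phi> z = 0" "\<phi> (coeff q i) \<noteq> 0" for \<phi> :: "'a \<Rightarrow> 'b"
    proof -
      have "coeff (map_poly \<phi> q) i \<noteq> 0" using \<phi>(3) rhom_0[OF \<phi>(1) A] by (simp add: coeff_map_poly)
      then have "map_poly \<phi> q \<noteq> 0" by auto
      then obtain \<alpha> where "poly (map_poly \<phi> q) \<alpha> \<noteq> 0" using alg_closed_nonroot by blast
      then show ?thesis using finish[OF \<phi>(1)] kill \<phi> True by (metis poly_0)
    qed
    then show ?thesis using i cpolyD[OF q(1)] by blast
  next
    case False
    then obtain w0 where w0: "w0 \<in> cpoly A" "poly w0 x \<in> P" "w0 \<notin> cpoly P" by blast
    obtain w where w: "w \<in> cpoly A" "poly w x \<in> P" "lead_coeff w \<notin> P"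
      and minw: "\<And>p. p \<in> cpoly A \<Longrightarrow> poly p x \<in> P \<Longrightarrow> degree p < degree w \<Longrightarrow> p \<in> cpoly P"
      using min_degree_lead_coeff[OF A P smP subset_refl w0] by metis
    have wP: "w \<notin> cpoly P" using w(3) by (auto simp: cpoly_def)
    have dw: "degree w > 0"
    proof (rule ccontr)
      assume "\<not> degree w > 0"
      then obtain c where "w = [:c:]" using degree_eq_zeroE by blast
      then show False using w by simp
    qed
    \<comment> \<open>The ideal generated by \<open>v\<close> and \<open>P\<close>. A polynomial of
      least degree with value in it turns out to be a constant \<open>c = b v + \<pi>\<close>, which
      ties the image of \<open>v\<close> to that of \<open>c\<close>.\<close>
    define J where "J = {b * v + \<pi> | b \<pi>. b \<in> ?B \<and> \<pi> \<in> P}"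
    note J = smod_insert[OF B smP, of v, folded J_def]
    have wJ: "poly w x \<in> J" using w J by blast
    obtain z where z: "z \<in> cpoly A" "poly z x \<in> J" "lead_coeff z \<notin> P" "degree z \<le> degree w"
      and minz: "\<And>p. p \<in> cpoly A \<Longrightarrow> poly p x \<in> J \<Longrightarrow> degree p < degree z \<Longrightarrow> p \<in> cpoly P"
      using min_degree_lead_coeff[OF A P J(1,2) w(1) wJ wP] by metis
    have xpoly: "poly p x \<in> ?B" if "p \<in> cpoly A" for p using that by (auto simp: adj_def)
    have small: "r \<in> cpoly P" if r: "r \<in> cpoly A" "poly r x \<in> J" "\<forall>i\<ge>degree z. coeff r i = 0" for r
    proof (cases "r = 0")
      case True then show ?thesis using smod_0[OF smP] by (auto simp: cpoly_def)
    next
      case False then have "degree r < degree z" using r(3) by (metis leading_coeff_0_iff not_le)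
      then show ?thesis using minz r by blast
    qed
    have cz: "lead_coeff z \<in> A" using z(1) by (rule cpolyD)
    have cw: "lead_coeff w \<in> A" using w(1) by (rule cpolyD)
    \<comment> \<open>Dividing the minimal relation \<open>w\<close> by \<open>z\<close> leaves a
      remainder in \<open>cpoly P\<close>, so \<open>z(x) t(x) \<in> P\<close>. If
      \<open>z(x) \<in> P\<close>, dividing \<open>q\<close> by \<open>z\<close> puts
      \<open>v\<close> into \<open>P\<close>. If \<open>t(x) \<in> P\<close>, then \<open>t\<close>
      has lower degree than \<open>w\<close>, so its coefficients, and with them the leading
      coefficient of \<open>w\<close>, lie in \<open>P\<close>. Both hold up to factors outside
      \<open>P\<close>.\<close>
    have dz: "degree z = 0"
    proof (rule ccontr)
      assume dz: "degree z \<noteq> 0"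
      obtain k t r where t: "t \<in> cpoly A" "r \<in> cpoly A" "smult (lead_coeff z ^ k) w = z * t + r"
        "\<forall>i\<ge>degree z. coeff r i = 0" "\<forall>i. degree w < i + degree z \<longrightarrow> coeff t i = 0"
        using pseudo_division[OF A sring_smod[OF A] z(1) w(1)] by blast
      have "poly r x = lead_coeff z ^ k * poly w x - poly t x * poly z x"
        using arg_cong[OF t(3), of "\<lambda>p. poly p x"] by (simp add: algebra_simps)
      also have "\<dots> \<in> J"
        by (rule smod_diff[OF J(1) B]) (use cz AB in \<open>auto intro!: smod_scale[OF J(1)] sring_power[OF B] xpoly t wJ z\<close>)
      finally have rP: "r \<in> cpoly P" using small t(2,4) by blast
      then have "poly r x \<in> P" using poly_cpoly_in[OF B smP _ adj_self[OF A]] by blast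
      moreover have "poly z x * poly t x = lead_coeff z ^ k * poly w x - poly r x"
        using arg_cong[OF t(3), of "\<lambda>p. poly p x"] by (simp add: algebra_simps)
      moreover have "lead_coeff z ^ k * poly w x \<in> P"
        using cz AB by (intro smod_scale[OF smP _ w(2)] sring_power[OF B]) auto
      ultimately have "poly z x * poly t x \<in> P" using smod_diff[OF smP B] by simp
      then consider "poly z x \<in> P" | "poly t x \<in> P" using P xpoly z(1) t(1) unfolding pidl_def by blast
      then show False
      proof cases
        case 1
        obtain k t r where t: "t \<in> cpoly A" "r \<in> cpoly A" "smult (lead_coeff z ^ k) q = z * t + r"
          "\<forall>i\<ge>degree z. coeff r i = 0"
          using pseudo_division[OF A sring_smod[OF A] z(1) q(1)] by blast
        have eq: "lead_coeff z ^ k * v = poly t x * poly z x + poly r x"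
          using arg_cong[OF t(3), of "\<lambda>p. poly p x"] q(2) by (simp add: algebra_simps)
        then have "poly r x = lead_coeff z ^ k * v - poly t x * poly z x" by simp
        also have "\<dots> \<in> J"
          by (rule smod_diff[OF J(1) B]) (use cz AB in \<open>auto intro!: smod_scale[OF J(1)] sring_power[OF B] xpoly t J(3) z\<close>)
        finally have "r \<in> cpoly P" using small t(2,4) by blast
        then have "poly r x \<in> P" using poly_cpoly_in[OF B smP _ adj_self[OF A]] by blast
        then have "lead_coeff z ^ k * v \<in> P" unfolding eq
          by (intro smod_add[OF smP] smod_scale[OF smP _ 1] xpoly t)
        then show False using pidl_mult[OF P _ v(1) pidl_power[OF P B _ z(3)] v(2)] cz AB
          by (metis subsetD sring_power[OF B])
      next
        case 2
        have "degree t < degree w"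
        proof (rule ccontr)
          assume "\<not> degree t < degree w"
          then have "coeff t (degree t) = 0" using t(5) dz by simp
          then show False using \<open>\<not> degree t < degree w\<close> dw by simp
        qed
        then have tP: "t \<in> cpoly P" using minw t(1) 2 by blast
        have "coeff (smult (lead_coeff z ^ k) w) (degree w) = coeff (z * t) (degree w)"
          using t(3,4) z(4) by simp
        also have "\<dots> \<in> P"
          unfolding coeff_mult by (rule smod_sum[OF smP], rule smod_scale[OF smP])
            (use z(1) AB tP in \<open>auto simp: cpoly_def\<close>)
        finally have "lead_coeff z ^ k * lead_coeff w \<in> P" by simp
        then show False using pidl_mult[OF P _ _ pidl_power[OF P B _ z(3)] w(3)] cz cw AB
          by (metis subsetD sring_power[OF B])
      qed
    qed
    define c where "c = lead_coeff z"
    have zc: "z = [:c:]" using dz unfolding c_def by (metis degree_eq_zeroE coeff_pCons_0 degree_pCons_0)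
    have cA: "c \<in> A" "c \<notin> P" using cz z(3) by (auto simp: c_def)
    obtain b \<pi> where b: "b \<in> ?B" "\<pi> \<in> P" "c = b * v + \<pi>" using z(2) zc by (auto simp: J_def)
    obtain s where s: "s \<in> cpoly A" "b = poly s x" using b(1) by (auto simp: adj_def)
    \<comment> \<open>The first factor yields a root \<open>\<alpha>\<close> of the image of
      \<open>w\<close>; the second keeps \<open>\<phi>' v\<close> nonzero because
      \<open>\<phi> c = \<phi>' b * \<phi>' v\<close>.\<close>
    define u where "u = lead_coeff w * c"
    have uA: "u \<in> A - P" unfolding u_def
      using sring_mult[OF A cw cA(1)] pidl_mult[OF P _ _ w(3) cA(2)] cw cA AB by blast
    have "\<exists>\<phi>'. rhom ?B \<phi>' \<and> (\<forall>z\<in>A. \<phi>' z = \<phi> z) \<and> (\<forall>z\<in>P. \<phi>' z = 0) \<and> \<phi>' v \<noteq> 0"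
      if \<phi>: "rhom A \<phi>" "\<forall>z\<in>A \<inter> P. \<phi> z = 0" "\<phi> u \<noteq> 0" for \<phi> :: "'a \<Rightarrow> 'b"
    proof -
      have nz: "\<phi> (lead_coeff w) \<noteq> 0" "\<phi> c \<noteq> 0"
        using \<phi>(3) rhom_mult[OF \<phi>(1) cw cA(1)] by (auto simp: u_def)
      have "coeff (map_poly \<phi> w) (degree w) \<noteq> 0" using nz rhom_0[OF \<phi>(1) A] by (simp add: coeff_map_poly)
      then have "degree (map_poly \<phi> w) > 0" using dw le_degree by (metis not_gr_zero not_le)
      then obtain \<alpha> where \<alpha>: "poly (map_poly \<phi> w) \<alpha> = 0" using alg_closed_imp_poly_has_root by blast
      \<comment> \<open>Division by \<open>w\<close> leaves a remainder whose coefficients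
        \<open>\<phi>\<close> kills, so every relation modulo \<open>P\<close> holds at
        \<open>\<alpha>\<close> because that of \<open>w\<close> does.\<close>
      have W: "poly (map_poly \<phi> p) \<alpha> = 0" if p: "p \<in> cpoly A" "poly p x \<in> P" for p
      proof -
        obtain k t r where t: "t \<in> cpoly A" "r \<in> cpoly A" "smult (lead_coeff w ^ k) p = w * t + r"
          "\<forall>i\<ge>degree w. coeff r i = 0"
          using pseudo_division[OF A sring_smod[OF A] w(1) p(1)] by blast
        have "poly r x = lead_coeff w ^ k * poly p x - poly t x * poly w x"
          using arg_cong[OF t(3), of "\<lambda>p. poly p x"] by (simp add: algebra_simps)
        also have "\<dots> \<in> P"
          by (rule smod_diff[OF smP B]) (use cw AB p in \<open>auto intro!: smod_scale[OF smP] sring_power[OF B] xpoly t w\<close>)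
        finally have "poly r x \<in> P" .
        moreover have "degree r < degree w"
          using t(4) dw by (metis leading_coeff_0_iff not_le degree_0)
        ultimately have "map_poly \<phi> r = 0" using kill \<phi> t(2) minw by blast
        moreover have "map_poly \<phi> ([:lead_coeff w ^ k:] * p) = map_poly \<phi> (w * t + r)" using t(3) by simp
        ultimately have "map_poly \<phi> [:lead_coeff w ^ k:] * map_poly \<phi> p = map_poly \<phi> w * map_poly \<phi> t"
          using map_poly_rhom_mult[OF \<phi>(1) A const_cpoly[OF A sring_power[OF A cw]] p(1)]
            map_poly_rhom_add[OF \<phi>(1) A sring_mult[OF C w(1) t(1)] t(2)]
            map_poly_rhom_mult[OF \<phi>(1) A w(1) t(1)] by simp
        then have "poly (map_poly \<phi> [:lead_coeff w ^ k:]) \<alpha> * poly (map_poly \<phi> p) \<alpha> =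
          poly (map_poly \<phi> w) \<alpha> * poly (map_poly \<phi> t) \<alpha>"
          by (metis poly_mult)
        moreover have "poly (map_poly \<phi> [:lead_coeff w ^ k:]) \<alpha> = \<phi> (lead_coeff w ^ k)"
          by (simp add: map_poly_pCons rhom_0[OF \<phi>(1) A])
        ultimately have "\<phi> (lead_coeff w ^ k) * poly (map_poly \<phi> p) \<alpha> = 0" using \<alpha> by simp
        then show ?thesis using nz rhom_power[OF \<phi>(1) A cw] by simp
      qed
      have "poly ([:c:] - s * q) x \<in> P" using b s q by simp
      then have "poly (map_poly \<phi> ([:c:] - s * q)) \<alpha> = 0"
        by (intro W) (use cA s q in \<open>auto intro!: sring_diff[OF C] sring_mult[OF C] const_cpoly A\<close>)
      then have "\<phi> c = poly (map_poly \<phi> s) \<alpha> * poly (map_poly \<phi> q) \<alpha>"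
        using map_poly_rhom_diff[OF \<phi>(1) A const_cpoly[OF A cA(1)] sring_mult[OF C s(1) q(1)]]
          map_poly_rhom_mult[OF \<phi>(1) A s(1) q(1)] rhom_0[OF \<phi>(1) A] by (simp add: map_poly_pCons)
      then have "poly (map_poly \<phi> q) \<alpha> \<noteq> 0" using nz by auto
      then show ?thesis using finish[OF \<phi>(1) W] by blast
    qed
    then show ?thesis using uA by blast
  qed
qed

fun adjs :: "'a::comm_ring_1 set \<Rightarrow> 'a list \<Rightarrow> 'a set" where
  "adjs A [] = A"
| "adjs A (x # xs) = adjs (adj A x) xs"

lemma sring_adjs: "sring A \<Longrightarrow> sring (adjs A xs)"
  by (induction xs arbitrary: A) (auto simp: sring_adj)

lemma adjs_superset: "sring A \<Longrightarrow> A \<subseteq> adjs A xs"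
  by (induction xs arbitrary: A) (auto dest: adj_superset sring_adj)

lemma adjs_elem: "sring A \<Longrightarrow> x \<in> set xs \<Longrightarrow> x \<in> adjs A xs"
proof (induction xs arbitrary: A)
  case (Cons y xs)
  then show ?case using adjs_superset[OF sring_adj[OF Cons(2)], of y xs] adj_self[OF Cons(2), of y]
    by (auto simp: sring_adj)
qed simp

lemma adjs_minimal: "sring B \<Longrightarrow> A \<subseteq> B \<Longrightarrow> set xs \<subseteq> B \<Longrightarrow> adjs A xs \<subseteq> B"
  by (induction xs arbitrary: A) (auto simp: adj_minimal)

lemma pidl_Int:
  assumes "pidl B P" "A \<subseteq> B" "sring A"
  shows "pidl A (A \<inter> P)"
  using assms unfolding pidl_def idl_def smod_def by (auto simp: sring_0 sring_add sring_mult) (metis subsetD)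

text \<open>The condition \<open>v \<notin> P\<close> is pushed down one generator at a time. Over a
  field of constants the final \<open>u\<close> is a nonzero constant, and no condition on
  \<open>\<phi>\<close> remains.\<close>

lemma nullstellensatz_tower:
  fixes v :: "'a::comm_ring_1"
  assumes "sring A" "pidl (adjs A xs) P" "v \<in> adjs A xs" "v \<notin> P"
  shows "\<exists>u\<in>A - P. \<forall>\<phi>::'a \<Rightarrow> 'b::alg_closed_field. rhom A \<phi> \<and> (\<forall>z\<in>A \<inter> P. \<phi> z = 0) \<and> \<phi> u \<noteq> 0 \<longrightarrow>
    (\<exists>\<phi>'. rhom (adjs A xs) \<phi>' \<and> (\<forall>z\<in>A. \<phi>' z = \<phi> z) \<and> (\<forall>z\<in>P. \<phi>' z = 0) \<and> \<phi>' v \<noteq> 0)"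
  using assms
proof (induction xs arbitrary: A)
  case Nil
  have "P \<subseteq> A" using Nil by (auto simp: pidl_def idl_def)
  then show ?case using Nil by (intro bexI[of _ v]) auto
next
  case (Cons x xs)
  let ?B = "adj A x"
  note B = sring_adj[OF Cons(2), of x]
  have BC: "?B \<subseteq> adjs ?B xs" by (rule adjs_superset[OF B])
  have AB: "A \<subseteq> ?B" by (rule adj_superset[OF Cons(2)])
  obtain u1 where u1: "u1 \<in> ?B - P" and ext1: "\<And>\<phi>::'a \<Rightarrow> 'b. rhom ?B \<phi> \<Longrightarrow> (\<forall>z\<in>?B \<inter> P. \<phi> z = 0) \<Longrightarrow> \<phi> u1 \<noteq> 0 \<Longrightarrow>
    (\<exists>\<phi>'. rhom (adjs ?B xs) \<phi>' \<and> (\<forall>z\<in>?B. \<phi>' z = \<phi> z) \<and> (\<forall>z\<in>P. \<phi>' z = 0) \<and> \<phi>' v \<noteq> 0)"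
    using Cons.IH[OF B] Cons.prems by auto
  have "pidl ?B (?B \<inter> P)" using pidl_Int[OF _ BC B] Cons.prems by simp
  from nullstellensatz_step[OF Cons(2) this, of u1, where 'b = 'b] u1
  obtain u where u: "u \<in> A - ?B \<inter> P" and ext: "\<And>\<phi>::'a \<Rightarrow> 'b. rhom A \<phi> \<Longrightarrow> (\<forall>z\<in>A \<inter> (?B \<inter> P). \<phi> z = 0) \<Longrightarrow> \<phi> u \<noteq> 0 \<Longrightarrow>
    (\<exists>\<phi>'. rhom ?B \<phi>' \<and> (\<forall>z\<in>A. \<phi>' z = \<phi> z) \<and> (\<forall>z\<in>?B \<inter> P. \<phi>' z = 0) \<and> \<phi>' u1 \<noteq> 0)"
    by auto
  have "\<exists>\<phi>'. rhom (adjs A (x # xs)) \<phi>' \<and> (\<forall>z\<in>A. \<phi>' z = \<phi> z) \<and> (\<forall>z\<in>P. \<phi>' z = 0) \<and> \<phi>' v \<noteq> 0"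
    if \<phi>: "rhom A \<phi>" "\<forall>z\<in>A \<inter> P. \<phi> z = 0" "\<phi> u \<noteq> 0" for \<phi> :: "'a \<Rightarrow> 'b"
  proof -
    obtain \<phi>1 where 1: "rhom ?B \<phi>1" "\<forall>z\<in>A. \<phi>1 z = \<phi> z" "\<forall>z\<in>?B \<inter> P. \<phi>1 z = 0" "\<phi>1 u1 \<noteq> 0"
      using ext[OF \<phi>(1) _ \<phi>(3)] \<phi>(2) by auto
    obtain \<phi>2 where 2: "rhom (adjs ?B xs) \<phi>2" "\<forall>z\<in>?B. \<phi>2 z = \<phi>1 z" "\<forall>z\<in>P. \<phi>2 z = 0" "\<phi>2 v \<noteq> 0"
      using ext1[OF 1(1,3,4)] by auto
    then show ?thesis using 1(2) AB by (intro exI[of _ \<phi>2]) auto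
  qed
  then show ?case using u AB by blast
qed

section \<open>Integrality and purely inseparable extensions\<close>

text \<open>With \<open>I = A\<close> this is a finitely generated \<open>A\<close>-module; with an
  ideal \<open>I\<close> of \<open>A\<close> it is the extended ideal \<open>I S\<close> when the
  \<open>g j\<close> generate \<open>S\<close>.\<close>

definition gs :: "nat \<Rightarrow> (nat \<Rightarrow> 'a::comm_ring_1) \<Rightarrow> 'a set \<Rightarrow> 'a set" where
  "gs M g I = {\<Sum>j<M. c j * g j | c. \<forall>j. c j \<in> I}"

lemma gsI: "(\<And>j. c j \<in> I) \<Longrightarrow> (\<Sum>j<M. c j * g j) \<in> gs M g I" by (auto simp: gs_def)

lemma gsE: assumes "z \<in> gs M g I" obtains c where "\<And>j. c j \<in> I" "z = (\<Sum>j<M. c j * g j)"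
  using assms unfolding gs_def by blast

lemma smod_gs: assumes "smod A I" shows "smod A (gs M g I)"
proof -
  have "0 \<in> gs M g I" using gsI[of "\<lambda>_. 0" I g M, OF smod_0[OF assms]] by simp
  moreover have "x + y \<in> gs M g I" if xy: "x \<in> gs M g I" "y \<in> gs M g I" for x y
  proof -
    obtain c where c: "\<And>j. c j \<in> I" "x = (\<Sum>j<M. c j * g j)" using xy(1) by (rule gsE) blast
    obtain d where d: "\<And>j. d j \<in> I" "y = (\<Sum>j<M. d j * g j)" using xy(2) by (rule gsE) blast
    have "x + y = (\<Sum>j<M. (c j + d j) * g j)" unfolding c d by (simp add: sum.distrib distrib_right)
    then show ?thesis using gsI[of "\<lambda>j. c j + d j" I g M, OF smod_add[OF assms c(1) d(1)]] by simp
  qed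
  moreover have "a * x \<in> gs M g I" if xy: "x \<in> gs M g I" "a \<in> A" for x a
  proof -
    obtain c where c: "\<And>j. c j \<in> I" "x = (\<Sum>j<M. c j * g j)" using xy(1) by (rule gsE) blast
    then have "a * x = (\<Sum>j<M. (a * c j) * g j)" by (simp add: sum_distrib_left mult.assoc)
    then show ?thesis using gsI[of "\<lambda>j. a * c j" I g M, OF smod_scale[OF assms xy(2) c(1)]] by simp
  qed
  ultimately show ?thesis unfolding smod_def by blast
qed

lemma gs_gen: assumes "sring A" "j < M" shows "g j \<in> gs M g A"
proof -
  have "(\<Sum>i<M. (if i = j then 1 else 0) * g i) = (\<Sum>i<M. if i = j then g i else 0)"
    by (intro sum.cong) auto
  then have "g j = (\<Sum>i<M. (if i = j then 1 else 0) * g i)" using assms(2) by simp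
  also have "\<dots> \<in> gs M g A" by (rule gsI) (use assms(1) in \<open>auto simp: sring_0 sring_1\<close>)
  finally show ?thesis .
qed

lemma gs_ideal_mult:
  assumes A: "sring A" and I: "smod A I" and S: "S = gs M g A" "sring S" and "x \<in> I" "s \<in> S"
  shows "x * s \<in> gs M g I"
proof -
  obtain c where c: "\<And>j. c j \<in> A" "s = (\<Sum>j<M. c j * g j)" using assms(6) unfolding S(1) by (rule gsE) blast
  have "x * s = (\<Sum>j<M. (c j * x) * g j)" using c(2) by (simp add: sum_distrib_left algebra_simps)
  then show ?thesis using gsI[of "\<lambda>j. c j * x" I g M, OF smod_scale[OF I c(1) assms(5)]] by simp
qed

lemma gs_mult:
  assumes A: "sring A" and I: "smod A I" and S: "S = gs M g A" "sring S" and "s \<in> S" "z \<in> gs M g I"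
  shows "s * z \<in> gs M g I"
proof -
  obtain c where c: "\<And>j. c j \<in> I" "z = (\<Sum>j<M. c j * g j)" using assms(6) by (rule gsE) blast
  have "s * z = (\<Sum>j<M. c j * (s * g j))" using c(2) by (simp add: sum_distrib_left algebra_simps)
  also have "\<dots> \<in> gs M g I"
    by (rule smod_sum[OF smod_gs[OF I]], rule gs_ideal_mult[OF A I S])
      (use c assms gs_gen[OF A] in \<open>auto intro!: sring_mult\<close>)
  finally show ?thesis .
qed

text \<open>Cayley-Hamilton through the adjugate: the determinant of \<open>y - b\<close> kills
  every \<open>g j\<close> and hence \<open>1\<close>. Every term of its expansion other than
  \<open>y ^ M\<close> contains an entry of \<open>b\<close> and so has its coefficient in
  \<open>I\<close>.\<close>

lemma determinant_trick:
  fixes y :: "'a::comm_ring_1" and g :: "nat \<Rightarrow> 'a"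
  assumes A: "sring A" and I: "idl A I" and b: "\<And>i j. b i j \<in> I"
    and eq: "\<And>i. i < M \<Longrightarrow> y * g i = (\<Sum>j<M. b i j * g j)"
    and one: "1 = (\<Sum>j<M. a j * g j)"
  shows "\<exists>c. (\<forall>k. c k \<in> I) \<and> y ^ M + (\<Sum>k<M. c k * y ^ k) = 0"
proof -
  note smI = idl_smod[OF I] and IA = idl_subset[OF I]
  define low where "low L = {\<Sum>k<L. c k * y ^ k | c. \<forall>k. c k \<in> I}" for L
  have low_gs: "low L = gs L (\<lambda>k. y ^ k) I" for L by (simp add: low_def gs_def)
  have sm: "smod A (low L)" for L unfolding low_gs by (rule smod_gs[OF smI])
  have low_Suc: "z \<in> low (Suc L)" if z: "z \<in> low L" for z L
  proof -
    obtain c where c: "\<And>k. c k \<in> I" "z = (\<Sum>k<L. c k * y ^ k)" using z[unfolded low_gs] by (rule gsE) blast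
    have "z = (\<Sum>k<Suc L. (if k < L then c k else 0) * y ^ k)" using c(2) by simp
    then show ?thesis unfolding low_def using c(1) smod_0[OF smI] by (intro CollectI exI[of _ "\<lambda>k. if k < L then c k else 0"]) auto
  qed
  have low_top: "x * y ^ L \<in> low (Suc L)" if "x \<in> I" for x L
  proof -
    have "(\<Sum>k<L. (if k = L then x else 0) * y ^ k) = 0" by (intro sum.neutral) auto
    then have "x * y ^ L = (\<Sum>k<Suc L. (if k = L then x else 0) * y ^ k)" by simp
    then show ?thesis unfolding low_def using that smod_0[OF smI]
      by (intro CollectI exI[of _ "\<lambda>k. if k = L then x else 0"]) auto
  qed
  have low_y: "y * z \<in> low (Suc L)" if z: "z \<in> low L" for z L
  proof -
    obtain c where c: "\<And>k. c k \<in> I" "z = (\<Sum>k<L. c k * y ^ k)" using z[unfolded low_gs] by (rule gsE) blast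
    have "y * z = (\<Sum>k<L. c k * y ^ Suc k)" unfolding c(2) sum_distrib_left by (simp add: algebra_simps)
    also have "\<dots> = (\<Sum>k<Suc L. (case k of 0 \<Rightarrow> 0 | Suc k' \<Rightarrow> c k') * y ^ k)"
      by (simp add: sum.lessThan_Suc_shift del: sum.lessThan_Suc)
    finally show ?thesis unfolding low_def using c(1) smod_0[OF smI]
      by (intro CollectI exI[of _ "\<lambda>k. case k of 0 \<Rightarrow> 0 | Suc k' \<Rightarrow> c k'"]) (auto split: nat.split)
  qed
  have low_I: "x * z \<in> low L" if "z \<in> low L" "x \<in> I" for x z L
    using smod_scale[OF sm] that IA by blast
  define e where "e \<pi> i = (if i = \<pi> i then y else 0) - b i (\<pi> i)" for \<pi> :: "nat \<Rightarrow> nat" and i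
  \<comment> \<open>Partial products along a permutation: diagonal entries alone give
    \<open>y ^ L\<close> plus lower terms, while one off-diagonal entry loses a power of
    \<open>y\<close> for good.\<close>
  have prod: "if \<forall>i<L. \<pi> i = i then (\<Prod>i<L. e \<pi> i) - y ^ L \<in> low L else (\<Prod>i<L. e \<pi> i) \<in> low L" for \<pi> L
  proof (induction L)
    case 0
    then show ?case using smod_0[OF sm] by simp
  next
    case (Suc L)
    let ?p = "\<Prod>i<L. e \<pi> i" and ?b = "b L (\<pi> L)"
    consider "\<forall>i<L. \<pi> i = i" "\<pi> L = L" | "\<forall>i<L. \<pi> i = i" "\<pi> L \<noteq> L"
      | "\<not> (\<forall>i<L. \<pi> i = i)" "\<pi> L = L" | "\<not> (\<forall>i<L. \<pi> i = i)" "\<pi> L \<noteq> L" by blast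
    then show ?case
    proof cases
      case 1
      define d where "d = ?p - y ^ L"
      have *: "d \<in> low L" using Suc 1 by (simp add: d_def)
      have "(\<Prod>i<Suc L. e \<pi> i) - y ^ Suc L = y * d - ?b * d - ?b * y ^ L"
        using 1 by (simp add: e_def d_def algebra_simps)
      also have "\<dots> \<in> low (Suc L)"
        using * b by (intro smod_diff[OF sm A] low_y low_top low_Suc[OF low_I])
      finally show ?thesis using 1 by (auto simp: less_Suc_eq)
    next
      case 2
      define d where "d = ?p - y ^ L"
      have *: "d \<in> low L" using Suc 2 by (simp add: d_def)
      have "(\<Prod>i<Suc L. e \<pi> i) = - (?b * d + ?b * y ^ L)"
        using 2 by (simp add: e_def d_def algebra_simps)
      also have "\<dots> \<in> low (Suc L)"
        using * b by (intro smod_uminus[OF sm A] smod_add[OF sm] low_top low_Suc[OF low_I])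
      finally show ?thesis using 2 by auto
    next
      case 3
      have *: "?p \<in> low L" using Suc 3 by simp
      have "(\<Prod>i<Suc L. e \<pi> i) = y * ?p - ?b * ?p"
        using 3 by (simp add: e_def algebra_simps)
      also have "\<dots> \<in> low (Suc L)"
        using * b by (intro smod_diff[OF sm A] low_y low_Suc[OF low_I])
      finally show ?thesis using 3 by auto
    next
      case 4
      have *: "?p \<in> low L" using Suc 4 by simp
      have "(\<Prod>i<Suc L. e \<pi> i) = - (?b * ?p)"
        using 4 by (simp add: e_def algebra_simps)
      also have "\<dots> \<in> low (Suc L)"
        using * b by (intro smod_uminus[OF sm A] low_Suc[OF low_I])
      finally show ?thesis using 4 by auto
    qed
  qed
  define B where "B = mat M M (\<lambda>(i, j). (if i = j then y else 0) - b i j)"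
  define v where "v = vec M g"
  have B: "B \<in> carrier_mat M M" by (simp add: B_def)
  have v: "v \<in> carrier_vec M" by (simp add: v_def)
  have "B *\<^sub>v v = 0\<^sub>v M"
  proof (rule eq_vecI)
    fix i assume i: "i < dim_vec (0\<^sub>v M :: 'a vec)"
    have "(B *\<^sub>v v) $ i = (\<Sum>j<M. ((if i = j then y else 0) - b i j) * g j)"
      using i by (simp add: B_def v_def scalar_prod_def lessThan_atLeast0)
    also have "\<dots> = (\<Sum>j<M. (if i = j then y * g j else 0)) - (\<Sum>j<M. b i j * g j)"
      unfolding sum_subtractf[symmetric] by (intro sum.cong) (auto simp: algebra_simps)
    also have "\<dots> = 0" using i eq[of i] by simp
    finally show "(B *\<^sub>v v) $ i = 0\<^sub>v M $ i" using i by simp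
  qed (simp add: B_def)
  then have "(adj_mat B * B) *\<^sub>v v = adj_mat B *\<^sub>v 0\<^sub>v M"
    using assoc_mult_mat_vec[OF adj_mat(1)[OF B] B v] by simp
  then have 0: "(det B \<cdot>\<^sub>m 1\<^sub>m M) *\<^sub>v v = 0\<^sub>v M"
    using adj_mat[OF B] by (simp add: mult_mat_vec_def) (intro eq_vecI, auto)
  have "det B * g i = 0" if i: "i < M" for i
  proof -
    have "((det B \<cdot>\<^sub>m 1\<^sub>m M) *\<^sub>v v) $ i = (\<Sum>j<M. (det B * (if i = j then 1 else 0)) * g j)"
      using i by (simp add: v_def scalar_prod_def lessThan_atLeast0 eq_commute[of i])
    also have "\<dots> = (\<Sum>j<M. if i = j then det B * g j else 0)" by (intro sum.cong) auto
    also have "\<dots> = det B * g i" using i by simp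
    finally show ?thesis using 0 i by simp
  qed
  then have "(\<Sum>j<M. a j * (det B * g j)) = 0" by simp
  moreover have "det B * 1 = (\<Sum>j<M. a j * (det B * g j))"
    unfolding one sum_distrib_left by (simp add: algebra_simps)
  ultimately have detB: "det B = 0" by simp
  have "det B = (\<Sum>\<pi> | \<pi> permutes {0..<M}. signof \<pi> * (\<Prod>i<M. e \<pi> i))"
    unfolding det_def using B
    by (auto intro!: sum.cong prod.cong simp: B_def e_def lessThan_atLeast0 permutes_in_image)
  also have "\<dots> = signof id * (\<Prod>i<M. e id i) + (\<Sum>\<pi> | \<pi> permutes {0..<M} \<and> \<pi> \<noteq> id. signof \<pi> * (\<Prod>i<M. e \<pi> i))"
  proof -
    have "{\<pi>. \<pi> permutes {0..<M}} = insert id {\<pi>. \<pi> permutes {0..<M} \<and> \<pi> \<noteq> id}" by (auto simp: permutes_id)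
    moreover have "finite {\<pi>. \<pi> permutes {0..<M} \<and> \<pi> \<noteq> id}"
      by (rule finite_subset[OF _ finite_permutations[of "{0..<M}"]]) auto
    ultimately show ?thesis by simp
  qed
  finally have d: "det B = (\<Prod>i<M. e id i) + (\<Sum>\<pi> | \<pi> permutes {0..<M} \<and> \<pi> \<noteq> id. signof \<pi> * (\<Prod>i<M. e \<pi> i))"
    by simp
  have "signof \<pi> * (\<Prod>i<M. e \<pi> i) \<in> low M" if \<pi>: "\<pi> permutes {0..<M}" "\<pi> \<noteq> id" for \<pi>
  proof -
    have "\<not> (\<forall>i<M. \<pi> i = i)"
    proof
      assume "\<forall>i<M. \<pi> i = i"
      then have "\<pi> i = i" for i using \<pi>(1) permutes_not_in[of \<pi> "{0..<M}" i] by (cases "i < M") auto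
      then show False using \<pi>(2) by auto
    qed
    then have "(\<Prod>i<M. e \<pi> i) \<in> low M" using prod[of M \<pi>] by simp
    then show ?thesis using smod_uminus[OF sm A] by (auto simp: sign_def)
  qed
  then have "(\<Sum>\<pi> | \<pi> permutes {0..<M} \<and> \<pi> \<noteq> id. signof \<pi> * (\<Prod>i<M. e \<pi> i)) \<in> low M"
    by (intro smod_sum[OF sm]) auto
  moreover have "(\<Prod>i<M. e id i) - y ^ M \<in> low M" using prod[of M id] by simp
  ultimately have "(\<Sum>\<pi> | \<pi> permutes {0..<M} \<and> \<pi> \<noteq> id. signof \<pi> * (\<Prod>i<M. e \<pi> i)) +
    ((\<Prod>i<M. e id i) - y ^ M) \<in> low M" by (rule smod_add[OF sm])
  moreover have sub: "(u + w) - z = w + (u - z)" for u w z :: 'a by simp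
  ultimately have "det B - y ^ M \<in> low M" by (simp only: d sub)
  then have "- (y ^ M) \<in> low M" using detB by simp
  then obtain c where c: "\<And>k. c k \<in> I" "- (y ^ M) = (\<Sum>k<M. c k * y ^ k)" unfolding low_gs by (rule gsE) blast
  then show ?thesis using c(2)[symmetric] by (intro exI[of _ c]) simp
qed

lemma integral_relation:
  assumes A: "sring A" and I: "idl A I" and S: "S = gs M g A" "sring S" and y: "y \<in> gs M g I"
  shows "\<exists>c. (\<forall>k. c k \<in> I) \<and> y ^ M + (\<Sum>k<M. c k * y ^ k) = 0"
proof -
  have "\<exists>b. (\<forall>j. b j \<in> I) \<and> (i < M \<longrightarrow> y * g i = (\<Sum>j<M. b j * g j))" for i
  proof (cases "i < M")
    case True
    have "g i * y \<in> gs M g I" using gs_mult[OF A idl_smod[OF I] S _ y] gs_gen[OF A True] S by blast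
    then obtain b where "\<And>j. b j \<in> I" "g i * y = (\<Sum>j<M. b j * g j)" by (rule gsE) blast
    then show ?thesis by (intro exI[of _ b]) (simp add: mult.commute)
  next
    case False
    then show ?thesis using smod_0[OF idl_smod[OF I]] by (intro exI[of _ "\<lambda>_. 0"]) auto
  qed
  then obtain b where b: "\<And>i j. b i j \<in> I" "\<And>i. i < M \<Longrightarrow> y * g i = (\<Sum>j<M. b i j * g j)" by metis
  obtain a where a: "1 = (\<Sum>j<M. a j * g j)" using sring_1[OF S(2)] unfolding S(1) by (rule gsE) blast
  show ?thesis by (rule determinant_trick[OF A I b a])
qed

text \<open>Lying over in elementary form: \<open>I S \<inter> A\<close> is contained in the radical
  of \<open>I\<close>, since all terms but \<open>y ^ M\<close> of the equation of \<open>y\<close>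
  lie in \<open>I\<close>.\<close>

lemma integral_ideal_power:
  assumes A: "sring A" and I: "idl A I" and S: "S = gs M g A" "sring S" and y: "y \<in> gs M g I" "y \<in> A"
  shows "y ^ M \<in> I"
proof -
  note smI = idl_smod[OF I]
  obtain c where c: "\<And>k. c k \<in> I" "y ^ M + (\<Sum>k<M. c k * y ^ k) = 0"
    using integral_relation[OF A I S y(1)] by blast
  have "(\<Sum>k<M. c k * y ^ k) \<in> I"
    by (rule smod_sum[OF smI]) (use c(1) y(2) smod_scale[OF smI sring_power[OF A]] in \<open>simp add: mult.commute\<close>)
  moreover have "y ^ M = - (\<Sum>k<M. c k * y ^ k)" using c(2) by (simp add: eq_neg_iff_add_eq_0)
  ultimately show ?thesis using smod_uminus[OF smI A] by simp
qed

section \<open>Frobenius powers and purely inseparable extensions\<close>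

lemma frobenius_add:
  fixes x y :: "'a::comm_ring_1" assumes "normalization_semidom_class.prime CHAR('a)"
  shows "(x + y) ^ (CHAR('a) ^ k) = x ^ (CHAR('a) ^ k) + y ^ (CHAR('a) ^ k)"
  by (rule freshmans_dream'[OF assms refl])

lemma frobenius_diff:
  fixes x y :: "'a::comm_ring_1" assumes "normalization_semidom_class.prime CHAR('a)"
  shows "(x - y) ^ (CHAR('a) ^ k) = x ^ (CHAR('a) ^ k) - y ^ (CHAR('a) ^ k)"
  using frobenius_add[OF assms, of "x - y" y k] by (simp add: algebra_simps)

lemma frobenius_sum:
  fixes f :: "'i \<Rightarrow> 'a::comm_ring_1" assumes "normalization_semidom_class.prime CHAR('a)"
  shows "(\<Sum>i\<in>I. f i) ^ (CHAR('a) ^ k) = (\<Sum>i\<in>I. f i ^ (CHAR('a) ^ k))"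
  by (rule freshmans_dream_sum'[OF assms refl])

lemma exists_power_ge: assumes "1 < (p::nat)" shows "\<exists>k. M \<le> p ^ k"
proof -
  have "M \<le> 2 ^ M" using less_exp[of M] by simp
  also have "2 ^ M \<le> p ^ M" using assms by (intro power_mono) auto
  finally show ?thesis ..
qed

text \<open>
  The complement of a maximal multiplicative set disjoint from \<open>C\<close> is a minimal prime over \<open>C\<close>;
  the last property says that \<open>C\<close> contains a power of its maximal ideal after localisation.
\<close>

lemma minimal_prime:
  fixes A :: "'a::comm_ring_1 set"
  assumes ch: "normalization_semidom_class.prime CHAR('a)" and A: "sring A" and C: "idl A C" and "1 \<notin> C"
  obtains P where "pidl A P" "C \<subseteq> P" "\<And>x. x \<in> P \<Longrightarrow> \<exists>s\<in>A - P. \<exists>N. s * x ^ N \<in> C"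
proof -
  note smC = idl_smod[OF C] and CA = idl_subset[OF C]
  define F where "F = {T. 1 \<in> T \<and> T \<subseteq> A \<and> T \<inter> C = {} \<and> (\<forall>x\<in>T. \<forall>y\<in>T. x * y \<in> T)}"
  have F: "T \<in> F \<longleftrightarrow> 1 \<in> T \<and> T \<subseteq> A \<and> T \<inter> C = {} \<and> (\<forall>x\<in>T. \<forall>y\<in>T. x * y \<in> T)" for T by (simp add: F_def)
  have "\<exists>M\<in>F. \<forall>N\<in>F. M \<subseteq> N \<longrightarrow> N = M"
  proof (rule subset_Zorn_nonempty)
    have "{1} \<in> F" using F sring_1[OF A] assms(4) by auto
    then show "F \<noteq> {}" by blast
    fix \<C> assume ne: "\<C> \<noteq> {}" and chain: "subset.chain F \<C>"
    have sub: "M \<in> F" if "M \<in> \<C>" for M using chain that unfolding subset_chain_def by blast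
    have ch: "M \<subseteq> N \<or> N \<subseteq> M" if "M \<in> \<C>" "N \<in> \<C>" for M N
      using chain that unfolding subset_chain_def by blast
    have mult: "x * y \<in> M" if "M \<in> \<C>" "x \<in> M" "y \<in> M" for x y M
      using sub[OF that(1)] that(2,3) by (simp add: F)
    have "x * y \<in> \<Union>\<C>" if xy: "x \<in> M" "M \<in> \<C>" "y \<in> N" "N \<in> \<C>" for x y M N
    proof (cases "M \<subseteq> N")
      case True
      then show ?thesis using mult[OF xy(4) _ xy(3)] xy by blast
    next
      case False
      then have "y \<in> M" using xy ch by blast
      then show ?thesis using mult[OF xy(2) xy(1)] xy by blast
    qed
    moreover have "1 \<in> M" "M \<subseteq> A" "M \<inter> C = {}" if "M \<in> \<C>" for M
      using sub[OF that] by (simp_all add: F)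
    then have "1 \<in> \<Union>\<C>" "\<Union>\<C> \<subseteq> A" "\<Union>\<C> \<inter> C = {}" using ne by blast+
    ultimately show "\<Union>\<C> \<in> F" by (auto simp: F)
  qed
  then obtain T where T: "T \<in> F" and max: "\<And>N. N \<in> F \<Longrightarrow> T \<subseteq> N \<Longrightarrow> N = T" by blast
  have T1: "1 \<in> T" and TA: "T \<subseteq> A" and TC: "T \<inter> C = {}" and Tm: "\<And>x y. x \<in> T \<Longrightarrow> y \<in> T \<Longrightarrow> x * y \<in> T"
    using T F by auto
  have Tp: "x ^ k \<in> T" if "x \<in> T" for x k using that by (induction k) (auto simp: T1 Tm)
  \<comment> \<open>Otherwise \<open>T\<close> together with the powers of \<open>x\<close> would
    generate a larger multiplicative set disjoint from \<open>C\<close>.\<close>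
  have key: "\<exists>s\<in>T. \<exists>N. s * x ^ N \<in> C" if x: "x \<in> A" "x \<notin> T" for x
  proof (rule ccontr)
    assume no: "\<not> ?thesis"
    define N where "N = {s * x ^ k | s k. s \<in> T}"
    have NI: "s * x ^ k \<in> N" if "s \<in> T" for s k using that by (auto simp: N_def)
    have "T \<subseteq> N" using NI[of _ 0] by auto
    moreover have "N \<subseteq> A" using x TA by (auto simp: N_def intro!: sring_mult[OF A] sring_power[OF A])
    moreover have "N \<inter> C = {}" using no by (auto simp: N_def)
    moreover have "y * z \<in> N" if "y \<in> N" "z \<in> N" for y z
    proof -
      obtain s k t l where *: "y = s * x ^ k" "z = t * x ^ l" "s \<in> T" "t \<in> T" using \<open>y \<in> N\<close> \<open>z \<in> N\<close> by (auto simp: N_def)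
      have "y * z = (s * t) * x ^ (k + l)" using * by (simp add: power_add algebra_simps)
      then show ?thesis using NI[OF Tm[OF *(3,4)]] by simp
    qed
    ultimately have "N \<in> F" unfolding F using T1 by blast
    then have "N = T" using max \<open>T \<subseteq> N\<close> by blast
    moreover have "x \<in> N" using NI[OF T1, of 1] by simp
    ultimately show False using x by blast
  qed
  define P where "P = A - T"
  have add: "x + y \<in> P" if x: "x \<in> P" and y: "y \<in> P" for x y
  proof -
    obtain s M where s: "s \<in> T" "s * x ^ M \<in> C" using key[of x] x unfolding P_def by blast
    obtain t N where t: "t \<in> T" "t * y ^ N \<in> C" using key[of y] y unfolding P_def by blast
    \<comment> \<open>In characteristic \<open>p\<close> the \<open>q\<close>-th power of a sum has
      only two terms, and their exponents are large enough to contain \<open>x ^ M\<close> and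
      \<open>y ^ N\<close>.\<close>
    obtain k where k: "M + N \<le> CHAR('a) ^ k" using exists_power_ge prime_gt_1_nat[OF ch] by blast
    define q where "q = CHAR('a) ^ k"
    have xA: "x \<in> A" "y \<in> A" using x y by (auto simp: P_def)
    have "s * t * (x + y) ^ q = (t * x ^ (q - M)) * (s * x ^ M) + (s * y ^ (q - N)) * (t * y ^ N)"
      using k frobenius_add[OF ch, of x y k] power_add[of x "q - M" M] power_add[of y "q - N" N]
      by (simp add: q_def algebra_simps)
    moreover have "\<dots> \<in> C"
      using s t xA TA by (intro smod_add[OF smC] smod_scale[OF smC _ s(2)] smod_scale[OF smC _ t(2)])
        (auto intro!: sring_mult[OF A] sring_power[OF A])
    ultimately have "s * t * (x + y) ^ q \<notin> T" using TC by auto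
    then have "x + y \<notin> T" using Tm[OF Tm[OF s(1) t(1)] Tp] by blast
    then show ?thesis using sring_add[OF A xA] by (simp add: P_def)
  qed
  have scale: "a * x \<in> P" if a: "a \<in> A" and x: "x \<in> P" for a x
  proof -
    obtain s M where s: "s \<in> T" "s * x ^ M \<in> C" using key[of x] x unfolding P_def by blast
    have xA: "x \<in> A" using x by (auto simp: P_def)
    have "s * (a * x) ^ M = a ^ M * (s * x ^ M)" by (simp add: power_mult_distrib algebra_simps)
    also have "\<dots> \<in> C" using smod_scale[OF smC sring_power[OF A a] s(2)] .
    finally have "s * (a * x) ^ M \<notin> T" using TC by auto
    then have "a * x \<notin> T" using Tm[OF s(1) Tp] by blast
    then show ?thesis using sring_mult[OF A a xA] by (simp add: P_def)
  qed
  have CP: "C \<subseteq> P" using CA TC by (auto simp: P_def)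
  have "pidl A P" unfolding pidl_def idl_def smod_def
    using add scale smod_0[OF smC] CP Tm T1 by (auto simp: P_def)
  moreover have "\<exists>s\<in>A - P. \<exists>N. s * x ^ N \<in> C" if "x \<in> P" for x
    using key[of x] that TA by (auto simp: P_def)
  ultimately show thesis using that CP by blast
qed

text \<open>
  A functional on a finite module modulo a prime, obtained from a rank-one quotient: \<open>N\<close> is a maximal
  submodule not meeting \<open>A - P\<close>, and \<open>d z \<equiv> \<ell> z\<close> modulo \<open>N\<close>.
\<close>

lemma functional_mod_prime:
  fixes A :: "'a::comm_ring_1 set"
  assumes A: "sring A" and S: "S = gs M g A" "sring S" and P: "pidl A P" and AS: "A \<subseteq> S"
  obtains l where "\<And>z. l z \<in> A" "l 1 \<notin> P"
    "\<And>z w. z \<in> S \<Longrightarrow> w \<in> S \<Longrightarrow> l (z + w) - (l z + l w) \<in> P"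
    "\<And>a z. a \<in> A \<Longrightarrow> z \<in> S \<Longrightarrow> l (a * z) - a * l z \<in> P"
proof -
  note smP = pidl_smod[OF P] and idP = pidl_idl[OF P]
  have PA: "P \<subseteq> A" using idl_subset[OF idP] .
  have smS: "smod A S" unfolding S(1) using smod_gs[OF sring_smod[OF A]] .
  let ?J = "gs M g P"
  define Q where "Q N \<longleftrightarrow> N \<subseteq> S \<and> N \<inter> A \<subseteq> P" for N
  have JS: "?J \<subseteq> S" unfolding S(1) gs_def using PA by blast
  \<comment> \<open>Lying over: \<open>P S\<close> meets \<open>A\<close> only in \<open>P\<close>,
    so the search for a maximal submodule can start at \<open>P S\<close>.\<close>
  have "y \<in> P" if "y \<in> ?J" "y \<in> A" for y
    using integral_ideal_power[OF A idP S that] pidl_power[OF P A that(2), of M] by blast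
  then have QJ: "Q ?J" using JS by (auto simp: Q_def)
  have QU: "Q (\<Union>\<C>)" if "\<And>M. M \<in> \<C> \<Longrightarrow> Q M" for \<C>
    using that unfolding Q_def by blast
  obtain N where smN: "smod A N" and JN: "?J \<subseteq> N" and QN: "Q N"
    and max: "\<And>N'. smod A N' \<Longrightarrow> N \<subseteq> N' \<Longrightarrow> Q N' \<Longrightarrow> N' = N"
    using smod_Zorn[OF smod_gs[OF smP, of M g], of Q] QJ QU by metis
  have NP: "y \<in> P" if "y \<in> N" "y \<in> A" for y using QN that by (auto simp: Q_def)
  \<comment> \<open>By maximality, adjoining \<open>z\<close> to \<open>N\<close> produces an
    element of \<open>A - P\<close>. The coefficient of \<open>z\<close> in it is outside
    \<open>P\<close>, since otherwise the element would already lie in \<open>N\<close>.\<close>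
  have ex1: "\<exists>a\<in>A - P. \<exists>t\<in>A. a * z - t \<in> N" if z: "z \<in> S" for z
  proof (cases "z \<in> N")
    case True
    then show ?thesis using sring_1[OF A] sring_0[OF A] pidl_1[OF P] by (intro bexI[of _ 1] bexI[of _ 0]) auto
  next
    case False
    define N' where "N' = {b * z + q | b q. b \<in> A \<and> q \<in> N}"
    note ins = smod_insert[OF A smN, of z, folded N'_def]
    have "\<not> Q N'" using max[OF ins(1,2)] ins(3) False by blast
    moreover have "N' \<subseteq> S" using z QN unfolding N'_def Q_def
      by (auto intro!: smod_add[OF smS] smod_scale[OF smS])
    ultimately obtain t where t: "t \<in> N'" "t \<in> A" "t \<notin> P" unfolding Q_def by blast
    obtain b q where b: "t = b * z + q" "b \<in> A" "q \<in> N" using t(1) by (auto simp: N'_def)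
    have "b \<notin> P"
    proof
      assume "b \<in> P"
      then have "b * z \<in> N" using gs_ideal_mult[OF A smP S _ z] JN by blast
      then have "t \<in> N" using b smod_add[OF smN] by blast
      then show False using NP t by blast
    qed
    moreover have "b * z - t \<in> N" using b smod_uminus[OF smN A b(3)] by simp
    ultimately show ?thesis using b t by blast
  qed
  have "\<exists>a. a \<in> A - P \<and> (j < M \<longrightarrow> (\<exists>t\<in>A. a * g j - t \<in> N))" for j
    using ex1[of "g j"] gs_gen[OF A, of j M g] S(1) sring_1[OF A] pidl_1[OF P] by (cases "j < M") blast+
  then obtain a where a: "\<And>j. a j \<in> A - P" "\<And>j. j < M \<Longrightarrow> \<exists>t\<in>A. a j * g j - t \<in> N" by metis
  \<comment> \<open>A common denominator for the generators, hence for all of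
    \<open>S\<close>.\<close>
  define d where "d = (\<Prod>j<M. a j)"
  have d: "d \<in> A - P" unfolding d_def by (rule pidl_prod[OF P A]) (use a in auto)
  have ex: "\<exists>t\<in>A. d * z - t \<in> N" if z: "z \<in> S" for z
  proof -
    have gen: "\<exists>t\<in>A. d * g j - t \<in> N" if j: "j < M" for j
    proof -
      obtain t where t: "t \<in> A" "a j * g j - t \<in> N" using a(2)[OF j] by blast
      define r where "r = (\<Prod>i\<in>{..<M} - {j}. a i)"
      have r: "r \<in> A" unfolding r_def by (rule sring_prod[OF A]) (use a in auto)
      have "d = a j * r" unfolding d_def r_def using j by (intro prod.remove) auto
      then have "d * g j - r * t = r * (a j * g j - t)" by (simp add: algebra_simps)
      then show ?thesis using smod_scale[OF smN r t(2)] sring_mult[OF A r t(1)] by metis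
    qed
    then obtain t where t: "\<And>j. j < M \<Longrightarrow> t j \<in> A \<and> d * g j - t j \<in> N" by metis
    obtain c where c: "\<And>j. c j \<in> A" "z = (\<Sum>j<M. c j * g j)" using z[unfolded S(1)] by (rule gsE) blast
    have "d * z - (\<Sum>j<M. c j * t j) = (\<Sum>j<M. c j * (d * g j - t j))"
      unfolding c(2) by (simp add: sum_distrib_left sum_subtractf algebra_simps)
    also have "\<dots> \<in> N" by (rule smod_sum[OF smN]) (use c t smod_scale[OF smN] in auto)
    finally have "d * z - (\<Sum>j<M. c j * t j) \<in> N" .
    moreover have "(\<Sum>j<M. c j * t j) \<in> A" by (rule sring_sum[OF A]) (use c t sring_mult[OF A] in auto)
    ultimately show ?thesis by blast
  qed
  \<comment> \<open>An arbitrary choice, additive and \<open>A\<close>-linear only modulo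
    \<open>N\<close>; the congruences follow from \<open>N \<inter> A \<subseteq> P\<close>. The
    value \<open>0\<close> outside \<open>S\<close> keeps \<open>l\<close> in \<open>A\<close>
    everywhere.\<close>
  define l where "l z = (if z \<in> S then SOME t. t \<in> A \<and> d * z - t \<in> N else 0)" for z
  have l: "l z \<in> A" "d * z - l z \<in> N" if "z \<in> S" for z
    using someI_ex[of "\<lambda>t. t \<in> A \<and> d * z - t \<in> N"] ex[OF that] that unfolding l_def by auto
  have lA: "l z \<in> A" for z using l(1)[of z] sring_0[OF A] by (cases "z \<in> S") (auto simp: l_def)
  have 1: "1 \<in> S" using sring_1[OF S(2)] .
  show thesis
  proof
    show "l z \<in> A" for z by (rule lA)
    show "l 1 \<notin> P"
    proof
      assume "l 1 \<in> P"
      moreover have "d - l 1 \<in> P" using NP[of "d - l 1"] l(2)[OF 1] sring_diff[OF A _ lA] d by simp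
      ultimately have "d \<in> P" using smod_add[OF smP, of "d - l 1" "l 1"] by simp
      then show False using d by blast
    qed
    show "l (z + w) - (l z + l w) \<in> P" if zw: "z \<in> S" "w \<in> S" for z w
    proof (rule NP)
      have "l (z + w) - (l z + l w) = (d * z - l z) + (d * w - l w) - (d * (z + w) - l (z + w))"
        by (simp add: algebra_simps)
      also have "\<dots> \<in> N"
        by (rule smod_diff[OF smN A smod_add[OF smN l(2)[OF zw(1)] l(2)[OF zw(2)]] l(2)[OF smod_add[OF smS zw]]])
      finally show "l (z + w) - (l z + l w) \<in> N" .
      show "l (z + w) - (l z + l w) \<in> A" by (intro sring_diff[OF A] sring_add[OF A] lA)
    qed
    show "l (b * z) - b * l z \<in> P" if bz: "b \<in> A" "z \<in> S" for b z
    proof (rule NP)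
      have "l (b * z) - b * l z = b * (d * z - l z) - (d * (b * z) - l (b * z))"
        by (simp add: algebra_simps)
      also have "\<dots> \<in> N"
        by (rule smod_diff[OF smN A smod_scale[OF smN bz(1) l(2)[OF bz(2)]] l(2)[OF smod_scale[OF smS bz]]])
      finally show "l (b * z) - b * l z \<in> N" .
      show "l (b * z) - b * l z \<in> A" by (intro sring_diff[OF A] sring_mult[OF A] lA bz)
    qed
  qed
qed

lemma power_le_dvd_smod:
  assumes "smod B J" "sring B" "y \<in> B" "y ^ M \<in> J" "M \<le> N"
  shows "y ^ N \<in> J"
  using smod_scale[OF assms(1) sring_power[OF assms(2,3), of "N - M"] assms(4)] assms(5)
  by (simp flip: power_add)

text \<open>
  \<open>C\<close> is the union of the conductors of \<open>A\<close> in the rings \<open>A[F\<^bsup>p^k\<^esup>]\<close>; if it were proper, then at a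
  minimal prime over it the hypothesis yields a new conductor element.
\<close>

lemma purely_inseparable:
  fixes A :: "'a::comm_ring_1 set"
  assumes ch: "normalization_semidom_class.prime CHAR('a)" and A: "sring A" and S: "S = gs M g A" "sring S" and AS: "A \<subseteq> S"
    and F: "F \<in> S"
    and Z: "\<And>P l. pidl A P \<Longrightarrow> (\<And>z. l z \<in> A) \<Longrightarrow>
      (\<And>z w. z \<in> S \<Longrightarrow> w \<in> S \<Longrightarrow> l (z + w) - (l z + l w) \<in> P) \<Longrightarrow>
      (\<And>a z. a \<in> A \<Longrightarrow> z \<in> S \<Longrightarrow> l (a * z) - a * l z \<in> P) \<Longrightarrow> l 1 * F - l F \<in> gs M g P"
  shows "\<exists>k. F ^ (CHAR('a) ^ k) \<in> A"
proof (rule ccontr)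
  assume no: "\<not> ?thesis"
  define p where "p = CHAR('a)"
  have p1: "1 < p" using prime_gt_1_nat[OF ch] by (simp add: p_def)
  note fadd = frobenius_add[OF ch, folded p_def] and fsum = frobenius_sum[OF ch, folded p_def]
  define C where "C k = {c \<in> A. \<forall>i. c * F ^ (i * p ^ k) \<in> A}" for k
  have smC: "smod A (C k)" for k
    by (auto simp: smod_def C_def sring_0[OF A] distrib_right mult.assoc sring_add[OF A] sring_mult[OF A])
  have C_mono: "C k \<subseteq> C (k + j)" for k j
  proof
    fix c assume c: "c \<in> C k"
    then have "c * F ^ ((i * p ^ j) * p ^ k) \<in> A" for i unfolding C_def by blast
    moreover have "(i * p ^ j) * p ^ k = i * p ^ (k + j)" for i by (simp add: power_add)
    ultimately show "c \<in> C (k + j)" using c by (simp add: C_def)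
  qed
  have Cle: "C k \<subseteq> C l" if "k \<le> l" for k l using C_mono[of k "l - k"] that by simp
  define CC where "CC = (\<Union>k. C k)"
  have smCC: "smod A CC" unfolding CC_def
  proof (rule smod_Union_chain)
    show "M \<subseteq> N \<or> N \<subseteq> M" if MN: "M \<in> range C" "N \<in> range C" for M N
    proof -
      obtain k l where "M = C k" "N = C l" using MN by blast
      then show ?thesis using Cle[of k l] Cle[of l k] nat_le_linear[of k l] by blast
    qed
  qed (use smC in auto)
  have "idl A CC" using smCC by (auto simp: idl_def CC_def C_def)
  moreover have "1 \<notin> CC"
  proof
    assume "1 \<in> CC"
    then obtain k where "1 \<in> C k" by (auto simp: CC_def)
    then have "1 * F ^ (1 * p ^ k) \<in> A" unfolding C_def by blast
    then show False using no by (simp add: p_def)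
  qed
  ultimately obtain P where P: "pidl A P" and CP: "CC \<subseteq> P"
    and Pmin: "\<And>x. x \<in> P \<Longrightarrow> \<exists>s\<in>A - P. \<exists>N. s * x ^ N \<in> CC"
    using minimal_prime[OF ch A] by metis
  note smP = pidl_smod[OF P]
  obtain l where lA: "\<And>z. l z \<in> A" and l1: "l 1 \<notin> P"
    and ladd: "\<And>z w. z \<in> S \<Longrightarrow> w \<in> S \<Longrightarrow> l (z + w) - (l z + l w) \<in> P"
    and lscale: "\<And>a z. a \<in> A \<Longrightarrow> z \<in> S \<Longrightarrow> l (a * z) - a * l z \<in> P"
    using functional_mod_prime[OF A S P AS] by metis
  define c a where "c = l 1" and "a = l F"
  have ca: "c \<in> A" "c \<notin> P" "a \<in> A" using lA l1 by (auto simp: c_def a_def)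
  define y where "y = c * F - a"
  have yP: "y \<in> gs M g P" unfolding y_def c_def a_def by (rule Z[OF P lA ladd lscale])
  let ?B = "adj A F"
  have B: "sring ?B" by (rule sring_adj[OF A])
  have AB: "A \<subseteq> ?B" by (rule adj_superset[OF A])
  define PB where "PB = (\<lambda>r. poly r F) ` cpoly P"
  note smcP = smod_cpoly[OF A smP]
  have smPB: "smod ?B PB"
  proof -
    have "0 \<in> PB" unfolding PB_def using smod_0[OF smcP] by (intro image_eqI[of _ _ 0]) auto
    moreover have "poly r F + poly s F \<in> PB" if "r \<in> cpoly P" "s \<in> cpoly P" for r s
      unfolding PB_def using smod_add[OF smcP that] by (intro image_eqI[of _ _ "r + s"]) auto
    moreover have "poly r F * poly s F \<in> PB" if "r \<in> cpoly A" "s \<in> cpoly P" for r s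
      unfolding PB_def using smod_scale[OF smcP that] by (intro image_eqI[of _ _ "r * s"]) auto
    ultimately show ?thesis by (auto simp: smod_def PB_def adj_def)
  qed
  have yB: "y \<in> ?B" unfolding y_def
    using ca AB by (intro sring_diff[OF B] sring_mult[OF B] adj_self[OF A]) auto
  \<comment> \<open>As \<open>y \<in> P S\<close>, its integral equation has coefficients in
    \<open>P\<close>. So a power of \<open>y\<close> already lies in \<open>P A[F]\<close>, where
    only powers of \<open>F\<close> occur.\<close>
  have yM: "y ^ M \<in> PB"
  proof -
    obtain b where b: "\<And>k. b k \<in> P" "y ^ M + (\<Sum>k<M. b k * y ^ k) = 0"
      using integral_relation[OF A pidl_idl[OF P] S yP] by blast
    have bPB: "b k \<in> PB" for k
      unfolding PB_def using b(1) smod_0[OF smP]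
      by (intro image_eqI[of _ _ "[:b k:]"]) (auto simp: cpoly_def coeff_pCons split: nat.split)
    have "(\<Sum>k<M. b k * y ^ k) \<in> PB"
      by (rule smod_sum[OF smPB]) (use smod_scale[OF smPB sring_power[OF B yB] bPB] in \<open>simp add: mult.commute\<close>)
    moreover have "y ^ M = - (\<Sum>k<M. b k * y ^ k)" using b(2) by (simp add: eq_neg_iff_add_eq_0)
    ultimately show ?thesis using smod_uminus[OF smPB B] by simp
  qed
  obtain e1 where e1: "M \<le> p ^ e1" using exists_power_ge[OF p1] by blast
  have "y ^ (p ^ e1) \<in> PB" by (rule power_le_dvd_smod[OF smPB B yB yM e1])
  then obtain r where r: "r \<in> cpoly P" "y ^ (p ^ e1) = poly r F" by (auto simp: PB_def)
  let ?D = "{..degree r}"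
  \<comment> \<open>Minimality of \<open>P\<close>: up to factors outside \<open>P\<close>, powers
    of the finitely many coefficients of \<open>r\<close> lie in conductors.\<close>
  have "\<exists>s N. s \<in> A - P \<and> s * coeff r i ^ N \<in> CC" for i using Pmin[OF cpolyD[OF r(1)]] by blast
  then obtain s N where sN: "\<And>i. s i \<in> A - P" "\<And>i. s i * coeff r i ^ N i \<in> CC" by metis
  define t where "t = (\<Prod>i\<in>?D. s i)"
  have t: "t \<in> A - P" unfolding t_def by (rule pidl_prod[OF P A]) (use sN in auto)
  obtain e2 where e2: "(\<Sum>i\<in>?D. N i) \<le> p ^ e2" using exists_power_ge[OF p1] by blast
  have rA: "coeff r i \<in> A" for i using cpolyD[OF r(1)] P by (auto simp: pidl_def idl_def)
  have tC: "t * coeff r i ^ (p ^ e2) \<in> CC" if i: "i \<in> ?D" for i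
  proof -
    define w where "w = (\<Prod>j\<in>?D - {i}. s j)"
    have w: "w \<in> A" unfolding w_def by (rule sring_prod[OF A]) (use sN in auto)
    have "t = s i * w" unfolding t_def w_def using i by (intro prod.remove) auto
    moreover have "N i \<le> p ^ e2" using e2 member_le_sum[of i ?D N] i by fastforce
    then have "coeff r i ^ (p ^ e2) = coeff r i ^ (p ^ e2 - N i) * coeff r i ^ N i" by (simp flip: power_add)
    ultimately have "t * coeff r i ^ (p ^ e2) = (w * coeff r i ^ (p ^ e2 - N i)) * (s i * coeff r i ^ N i)"
      by (simp add: algebra_simps)
    then show ?thesis using smod_scale[OF smCC sring_mult[OF A w sring_power[OF A rA]] sN(2)] by simp
  qed
  have "\<forall>i\<in>?D. \<exists>k. t * coeff r i ^ (p ^ e2) \<in> C k" using tC by (auto simp: CC_def)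
  then obtain \<kappa> where \<kappa>: "\<And>i. i \<in> ?D \<Longrightarrow> t * coeff r i ^ (p ^ e2) \<in> C (\<kappa> i)" by metis
  define k where "k = (\<Sum>i\<in>?D. \<kappa> i)"
  have tk: "t * coeff r i ^ (p ^ e2) \<in> C k" if i: "i \<in> ?D" for i
    using \<kappa>[OF i] Cle[of "\<kappa> i" k] member_le_sum[of i ?D \<kappa>] i by (auto simp: k_def)
  \<comment> \<open>Three Frobenius powers: \<open>e1\<close> brings \<open>y\<close> into
    \<open>P A[F]\<close>, \<open>e2\<close> brings the coefficients into a conductor, and
    \<open>k\<close> turns the powers of \<open>F\<close> into powers of \<open>F ^ (p ^ k)\<close>,
    which elements of \<open>C k\<close> multiply into \<open>A\<close>.\<close>
  define E where "E = e1 + e2 + k"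
  have yE: "y ^ (p ^ (e1 + e2)) = (\<Sum>i\<in>?D. coeff r i ^ (p ^ e2) * F ^ (i * p ^ e2))"
  proof -
    have "y ^ (p ^ (e1 + e2)) = (poly r F) ^ (p ^ e2)" by (simp add: power_add power_mult r(2))
    also have "\<dots> = (\<Sum>i\<in>?D. (coeff r i * F ^ i) ^ (p ^ e2))" unfolding poly_altdef fsum ..
    finally show ?thesis by (simp add: power_mult_distrib power_mult)
  qed
  have "t ^ (p ^ k) * y ^ (p ^ E) = (t * y ^ (p ^ (e1 + e2))) ^ (p ^ k)"
    by (simp add: E_def power_add power_mult power_mult_distrib)
  also have "\<dots> = (\<Sum>i\<in>?D. (t * coeff r i ^ (p ^ e2)) * F ^ (i * p ^ e2)) ^ (p ^ k)"
    unfolding yE sum_distrib_left by (simp add: mult.assoc)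
  also have "\<dots> = (\<Sum>i\<in>?D. (t * coeff r i ^ (p ^ e2)) ^ (p ^ k) * F ^ ((i * p ^ e2) * p ^ k))"
    unfolding fsum power_mult_distrib power_mult ..
  also have "\<dots> \<in> A"
  proof (rule sring_sum[OF A])
    fix i assume i: "i \<in> ?D"
    let ?x = "t * coeff r i ^ (p ^ e2)"
    have x: "?x \<in> C k" using tk[OF i] .
    have "?x ^ (p ^ k) \<in> C k"
      using power_le_dvd_smod[OF smC A, of ?x 1 k "p ^ k"] x p1 by (simp add: C_def)
    then show "?x ^ (p ^ k) * F ^ ((i * p ^ e2) * p ^ k) \<in> A" unfolding C_def by blast
  qed
  finally have tyA: "t ^ (p ^ k) * y ^ (p ^ E) \<in> A" .
  define \<epsilon> where "\<epsilon> = t ^ (p ^ k) * c ^ (p ^ E)"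
  have \<epsilon>: "\<epsilon> \<in> A" "\<epsilon> \<notin> P" unfolding \<epsilon>_def
    using t ca pidl_mult[OF P _ _ pidl_power[OF P A] pidl_power[OF P A]] sring_mult[OF A] sring_power[OF A] by auto
  define H where "H = F ^ (p ^ E)"
  have HS: "H \<in> S" unfolding H_def by (rule sring_power[OF S(2) F])
  have "(c * F) ^ (p ^ E) = y ^ (p ^ E) + a ^ (p ^ E)" using fadd[of y a E] by (simp add: y_def)
  then have "t ^ (p ^ k) * (c * F) ^ (p ^ E) = t ^ (p ^ k) * (y ^ (p ^ E) + a ^ (p ^ E))" by simp
  then have "\<epsilon> * H = t ^ (p ^ k) * y ^ (p ^ E) + t ^ (p ^ k) * a ^ (p ^ E)"
    by (simp add: \<epsilon>_def H_def power_mult_distrib distrib_left mult.assoc)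
  then have \<epsilon>H: "\<epsilon> * H \<in> A"
    using sring_add[OF A tyA sring_mult[OF A sring_power[OF A] sring_power[OF A]]] t ca by simp
  obtain b where b: "\<And>j. b j \<in> A" "H ^ M + (\<Sum>j<M. b j * H ^ j) = 0"
    using integral_relation[OF A _ S, of A H] HS sring_smod[OF A] unfolding S(1) by (auto simp: idl_def)
  \<comment> \<open>\<open>H\<close> satisfies a monic equation of degree \<open>M\<close>, so
    higher powers reduce to lower ones and one power of \<open>\<epsilon>\<close> serves for all
    \<open>i\<close>. It is a conductor element outside \<open>P\<close>.\<close>
  have "\<epsilon> ^ M * H ^ i \<in> A" for i
  proof (induction i rule: less_induct)
    case (less i)
    show ?case
    proof (cases "i \<le> M")
      case True
      then have "\<epsilon> ^ M * H ^ i = \<epsilon> ^ (M - i) * (\<epsilon> * H) ^ i"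
        by (simp add: power_mult_distrib flip: power_add mult.assoc)
      then show ?thesis using sring_mult[OF A sring_power[OF A \<epsilon>(1)] sring_power[OF A \<epsilon>H]] by simp
    next
      case False
      have "H ^ M = - (\<Sum>j<M. b j * H ^ j)" using b(2) by (simp add: eq_neg_iff_add_eq_0)
      then have "\<epsilon> ^ M * H ^ i = \<epsilon> ^ M * (H ^ (i - M) * - (\<Sum>j<M. b j * H ^ j))"
        using False by (metis le_add_diff_inverse2 nat_le_linear power_add)
      also have "\<dots> = - (\<Sum>j<M. b j * (\<epsilon> ^ M * H ^ (i - M + j)))"
        by (simp add: sum_distrib_left power_add algebra_simps)
      also have "\<dots> \<in> A"
        by (intro sring_uminus[OF A] sring_sum[OF A] sring_mult[OF A b(1)] less.IH) (use False in auto)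
      finally show ?thesis .
    qed
  qed
  then have "\<epsilon> ^ M \<in> C E" using sring_power[OF A \<epsilon>(1)]
    by (auto simp: C_def H_def mult.commute simp flip: power_mult)
  then have "\<epsilon> ^ M \<in> P" using CP by (auto simp: CC_def)
  then show False using pidl_power[OF P A \<epsilon>] by blast
qed

section \<open>Polynomials in finitely many variables\<close>

text \<open>Index sets other than initial segments are needed to remove single variables.\<close>

definition mpv :: "nat set \<Rightarrow> 'a::zero mpoly set" where
  "mpv V = {f. \<forall>m\<in>Poly_Mapping.keys f. Poly_Mapping.keys m \<subseteq> V}"

lemma polys_eq_mpv: "polys n = mpv {..<n}"
  by (simp add: polys_def mpv_def)

lemma mpv_mono: "V \<subseteq> W \<Longrightarrow> mpv V \<subseteq> mpv W"
  by (auto simp: mpv_def)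

lemma keys_add_nat: "Poly_Mapping.keys (m + m') = Poly_Mapping.keys m \<union> Poly_Mapping.keys m'"
  for m m' :: "nat \<Rightarrow>\<^sub>0 nat"
  by (auto simp: in_keys_iff lookup_add)

lemma sring_mpv: "sring (mpv V :: 'a::comm_ring_1 mpoly set)"
proof -
  have "f - g \<in> mpv V" if "f \<in> mpv V" "g \<in> mpv V" for f g :: "'a mpoly"
    using that keys_diff[of f g] by (auto simp: mpv_def in_keys_iff lookup_minus)
  moreover have "f * g \<in> mpv V" if "f \<in> mpv V" "g \<in> mpv V" for f g :: "'a mpoly"
    using that keys_mult[of f g] by (fastforce simp: mpv_def keys_add_nat)
  moreover have "1 \<in> (mpv V :: 'a mpoly set)" by (simp add: mpv_def)
  ultimately show ?thesis by (simp add: sring_def)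
qed

lemma const_in_mpv: "const c \<in> mpv V" by (simp add: mpv_def const_def)

lemma var_in_mpv: "i \<in> V \<Longrightarrow> var i \<in> mpv V" by (simp add: mpv_def var_def)

lemma const_add: "const (a + b) = const a + const b" by (simp add: const_def single_add)
lemma const_mult: "const (a * b) = const a * const (b :: 'a::comm_ring_1)" by (simp add: const_def mult_single)
lemma const_0: "const 0 = 0" by (simp add: const_def)
lemma const_1: "const 1 = (1 :: 'a::comm_ring_1 mpoly)" by (simp add: const_def)

lemma rhom_const: "rhom A (const :: 'a::comm_ring_1 \<Rightarrow> 'a mpoly)"
  by (simp add: rhom_def const_add const_mult const_1)

lemma sring_UNIV: "sring UNIV" by (simp add: sring_def)

lemma poly_mapping_sum_single: "f = (\<Sum>m\<in>Poly_Mapping.keys f. Poly_Mapping.single m (Poly_Mapping.lookup f m))"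
  by (rule poly_mapping_eqI)
    (auto simp: lookup_sum lookup_single when_def in_keys_iff)

lemma var_power: "var i ^ k = Poly_Mapping.single (Poly_Mapping.single i k) (1 :: 'a::comm_ring_1)"
  by (induction k) (auto simp: var_def mult_single simp flip: single_add)

lemma single_eq_monomial:
  "Poly_Mapping.single m (c :: 'a::comm_ring_1) =
    const c * (\<Prod>i\<in>Poly_Mapping.keys m. var i ^ Poly_Mapping.lookup m i)"
proof -
  have "(\<Prod>i\<in>I. var i ^ Poly_Mapping.lookup m i) = 
    Poly_Mapping.single (\<Sum>i\<in>I. Poly_Mapping.single i (Poly_Mapping.lookup m i)) (1 :: 'a)" for I
    by (induction I rule: infinite_finite_induct) (auto simp: var_power mult_single)
  then have "(\<Prod>i\<in>Poly_Mapping.keys m. var i ^ Poly_Mapping.lookup m i) = Poly_Mapping.single m (1 :: 'a)"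
    using poly_mapping_sum_single[of m] by simp
  then show ?thesis by (simp add: const_def mult_single)
qed

lemma mpv_induct:
  fixes B :: "'a::comm_ring_1 mpoly set"
  assumes B: "sring B" and "\<And>c. const c \<in> B" and "\<And>i. i \<in> V \<Longrightarrow> var i \<in> B"
  shows "mpv V \<subseteq> B"
proof
  fix f :: "'a mpoly" assume f: "f \<in> mpv V"
  have "(\<Sum>m\<in>Poly_Mapping.keys f. Poly_Mapping.single m (Poly_Mapping.lookup f m)) \<in> B"
    unfolding single_eq_monomial
    by (intro sring_sum[OF B] sring_mult[OF B] sring_prod[OF B] sring_power[OF B] assms(2,3))
      (use f in \<open>auto simp: mpv_def\<close>)
  then show "f \<in> B" using poly_mapping_sum_single[of f] by simp
qed

lemma mpv_UNIV: "f \<in> mpv UNIV" by (simp add: mpv_def)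

lemma rhom_eq_on_mpv:
  fixes \<phi> \<psi> :: "'a::comm_ring_1 mpoly \<Rightarrow> 'b::comm_ring_1"
  assumes \<phi>: "rhom A \<phi>" and \<psi>: "rhom A \<psi>" and A: "sring A" "mpv V \<subseteq> A"
    and "\<And>c. \<phi> (const c) = \<psi> (const c)" "\<And>i. i \<in> V \<Longrightarrow> \<phi> (var i) = \<psi> (var i)" and f: "f \<in> mpv V"
  shows "\<phi> f = \<psi> f"
proof -
  have "sring {f \<in> A. \<phi> f = \<psi> f}"
    using A(1) rhom_1[OF \<phi>] rhom_1[OF \<psi>]
    by (auto simp: sring_def rhom_diff[OF \<phi>] rhom_diff[OF \<psi>] rhom_mult[OF \<phi>] rhom_mult[OF \<psi>])
  moreover have "const c \<in> A" "i \<in> V \<Longrightarrow> var i \<in> A" for c i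
    using A(2) const_in_mpv[of c V] var_in_mpv[of i V] by blast+
  ultimately have "mpv V \<subseteq> {f \<in> A. \<phi> f = \<psi> f}"
    using assms(5,6) by (intro mpv_induct) auto
  then show ?thesis using f by blast
qed

section \<open>Substitution homomorphisms\<close>

definition meval :: "(nat \<Rightarrow> 'r::comm_ring_1) \<Rightarrow> (nat \<Rightarrow>\<^sub>0 nat) \<Rightarrow> 'r" where
  "meval a m = (\<Prod>i\<in>Poly_Mapping.keys m. a i ^ Poly_Mapping.lookup m i)"

lemma meval_superset:
  assumes "finite V" "Poly_Mapping.keys m \<subseteq> V"
  shows "meval a m = (\<Prod>i\<in>V. a i ^ Poly_Mapping.lookup m i)"
  unfolding meval_def
proof (rule prod.mono_neutral_left[OF assms])
  show "\<forall>i\<in>V - Poly_Mapping.keys m. a i ^ Poly_Mapping.lookup m i = 1" by (auto simp: in_keys_iff)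
qed

lemma meval_add: "meval a (m + m') = meval a m * meval a m'"
proof -
  let ?V = "Poly_Mapping.keys m \<union> Poly_Mapping.keys m'"
  have "meval a (m + m') = (\<Prod>i\<in>?V. a i ^ Poly_Mapping.lookup (m + m') i)"
    by (rule meval_superset) (auto simp: keys_add_nat)
  also have "\<dots> = (\<Prod>i\<in>?V. a i ^ Poly_Mapping.lookup m i) * (\<Prod>i\<in>?V. a i ^ Poly_Mapping.lookup m' i)"
    by (simp add: lookup_add power_add prod.distrib)
  also have "\<dots> = meval a m * meval a m'" by (simp add: meval_superset[of ?V])
  finally show ?thesis .
qed

lemma meval_0 [simp]: "meval a 0 = 1" by (simp add: meval_def)
lemma meval_single: "meval a (Poly_Mapping.single i k) = a i ^ k"
  by (cases "k = 0") (simp_all add: meval_def)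

lemma subst_poly_meval: "subst_poly \<iota> a f = (\<Sum>m\<in>Poly_Mapping.keys f. \<iota> (Poly_Mapping.lookup f m) * meval a m)"
  by (simp add: subst_poly_def meval_def)

lemma subst_poly_superset:
  assumes "finite W" "Poly_Mapping.keys f \<subseteq> W" "\<iota> 0 = 0"
  shows "subst_poly \<iota> a f = (\<Sum>m\<in>W. \<iota> (Poly_Mapping.lookup f m) * meval a m)"
  unfolding subst_poly_meval
proof (rule sum.mono_neutral_left[OF assms(1,2)])
  show "\<forall>m\<in>W - Poly_Mapping.keys f. \<iota> (Poly_Mapping.lookup f m) * meval a m = 0"
    using assms(3) by (auto simp: in_keys_iff)
qed

lemma subst_poly_single: "\<iota> 0 = 0 \<Longrightarrow> subst_poly \<iota> a (Poly_Mapping.single m c) = \<iota> c * meval a m"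
  using subst_poly_superset[of "{m}" "Poly_Mapping.single m c" \<iota> a] by simp

lemma subst_poly_add:
  fixes f g :: "'a::comm_ring_1 mpoly"
  assumes \<iota>: "rhom UNIV \<iota>"
  shows "subst_poly \<iota> a (f + g) = subst_poly \<iota> a f + subst_poly \<iota> a g"
proof -
  note 0 = rhom_0[OF \<iota> sring_UNIV]
  let ?W = "Poly_Mapping.keys f \<union> Poly_Mapping.keys g"
  have "subst_poly \<iota> a (f + g) = (\<Sum>m\<in>?W. \<iota> (Poly_Mapping.lookup (f + g) m) * meval a m)"
    using 0 Poly_Mapping.keys_add[of f g] by (intro subst_poly_superset) auto
  also have "\<dots> = (\<Sum>m\<in>?W. \<iota> (Poly_Mapping.lookup f m) * meval a m) + (\<Sum>m\<in>?W. \<iota> (Poly_Mapping.lookup g m) * meval a m)"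
    by (simp add: lookup_add rhom_add[OF \<iota>] distrib_right sum.distrib)
  also have "\<dots> = subst_poly \<iota> a f + subst_poly \<iota> a g"
    using 0 by (simp add: subst_poly_superset[of ?W])
  finally show ?thesis .
qed

lemma subst_poly_zero: "subst_poly \<iota> a 0 = 0" by (simp add: subst_poly_def)

lemma subst_poly_sum:
  fixes f :: "'i \<Rightarrow> 'a::comm_ring_1 mpoly"
  assumes "rhom UNIV \<iota>" shows "subst_poly \<iota> a (\<Sum>i\<in>I. f i) = (\<Sum>i\<in>I. subst_poly \<iota> a (f i))"
  by (induction I rule: infinite_finite_induct) (auto simp: subst_poly_zero subst_poly_add[OF assms])

lemma subst_poly_mult:
  fixes f g :: "'a::comm_ring_1 mpoly"
  assumes \<iota>: "rhom UNIV \<iota>"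
  shows "subst_poly \<iota> a (f * g) = subst_poly \<iota> a f * subst_poly \<iota> a g"
proof -
  note 0 = rhom_0[OF \<iota> sring_UNIV]
  let ?s = "\<lambda>f m. Poly_Mapping.single m (Poly_Mapping.lookup f m)"
  have "f * g = (\<Sum>m\<in>Poly_Mapping.keys f. \<Sum>m'\<in>Poly_Mapping.keys g. ?s f m * ?s g m')"
    by (subst arg_cong2[OF poly_mapping_sum_single[of f] poly_mapping_sum_single[of g], of "(*)"]) (rule sum_product)
  then have "subst_poly \<iota> a (f * g) =
    (\<Sum>m\<in>Poly_Mapping.keys f. \<Sum>m'\<in>Poly_Mapping.keys g. subst_poly \<iota> a (?s f m * ?s g m'))"
    by (simp add: subst_poly_sum[OF \<iota>])
  also have "\<dots> = (\<Sum>m\<in>Poly_Mapping.keys f. \<Sum>m'\<in>Poly_Mapping.keys g.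
    (\<iota> (Poly_Mapping.lookup f m) * meval a m) * (\<iota> (Poly_Mapping.lookup g m') * meval a m'))"
    by (simp add: mult_single subst_poly_single 0 rhom_mult[OF \<iota>] meval_add algebra_simps)
  also have "\<dots> = subst_poly \<iota> a f * subst_poly \<iota> a g"
    by (simp add: subst_poly_meval sum_product)
  finally show ?thesis .
qed

lemma subst_poly_const: "\<iota> 0 = 0 \<Longrightarrow> subst_poly \<iota> a (const c) = \<iota> c"
  by (simp add: const_def subst_poly_single)

lemma subst_poly_var: "\<iota> 0 = 0 \<Longrightarrow> \<iota> 1 = 1 \<Longrightarrow> subst_poly \<iota> a (var i) = a i"
  by (simp add: var_def subst_poly_single meval_single)

lemma rhom_subst_poly:
  assumes "rhom UNIV \<iota>" shows "rhom A (subst_poly \<iota> a :: 'a::comm_ring_1 mpoly \<Rightarrow> _)"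
  using subst_poly_add[OF assms] subst_poly_mult[OF assms] subst_poly_const[of \<iota> a 1]
    rhom_0[OF assms sring_UNIV] rhom_1[OF assms]
  by (simp add: rhom_def const_1)

lemma subst_poly_in:
  fixes f :: "'a::comm_ring_1 mpoly"
  assumes "sring B" "\<And>c. \<iota> c \<in> B" "\<And>i. i \<in> V \<Longrightarrow> a i \<in> B" "f \<in> mpv V"
  shows "subst_poly \<iota> a f \<in> B"
  unfolding subst_poly_meval meval_def
  by (intro sring_sum[OF assms(1)] sring_mult[OF assms(1)] sring_prod[OF assms(1)] sring_power[OF assms(1)] assms(2,3))
    (use assms(4) in \<open>auto simp: mpv_def\<close>)

lemma rhom_comp_subst_poly:
  fixes f :: "'a::comm_ring_1 mpoly"
  assumes \<psi>: "rhom B \<psi>" and B: "sring B" and \<iota>: "\<And>c. \<iota> c \<in> B" and a: "\<And>i. i \<in> V \<Longrightarrow> a i \<in> B" and f: "f \<in> mpv V"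
  shows "\<psi> (subst_poly \<iota> a f) = subst_poly (\<lambda>c. \<psi> (\<iota> c)) (\<lambda>i. \<psi> (a i)) f"
proof -
  have V: "i \<in> V" if "m \<in> Poly_Mapping.keys f" "i \<in> Poly_Mapping.keys m" for m i using f that by (auto simp: mpv_def)
  have pB: "(\<Prod>i\<in>Poly_Mapping.keys m. a i ^ Poly_Mapping.lookup m i) \<in> B" if "m \<in> Poly_Mapping.keys f" for m
    by (intro sring_prod[OF B] sring_power[OF B] a V[OF that])
  have p: "\<psi> (\<Prod>i\<in>Poly_Mapping.keys m. a i ^ Poly_Mapping.lookup m i) =
    (\<Prod>i\<in>Poly_Mapping.keys m. \<psi> (a i) ^ Poly_Mapping.lookup m i)" if m: "m \<in> Poly_Mapping.keys f" for m
  proof -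
    have "\<psi> (\<Prod>i\<in>Poly_Mapping.keys m. a i ^ Poly_Mapping.lookup m i) = (\<Prod>i\<in>Poly_Mapping.keys m. \<psi> (a i ^ Poly_Mapping.lookup m i))"
      by (rule rhom_prod[OF \<psi> B]) (intro sring_power[OF B] a V[OF m])
    then show ?thesis using rhom_power[OF \<psi> B a[OF V[OF m]]] by simp
  qed
  have "\<psi> (subst_poly \<iota> a f) = (\<Sum>m\<in>Poly_Mapping.keys f. \<psi> (\<iota> (Poly_Mapping.lookup f m) *
    (\<Prod>i\<in>Poly_Mapping.keys m. a i ^ Poly_Mapping.lookup m i)))"
    unfolding subst_poly_def by (rule rhom_sum[OF \<psi> B]) (intro sring_mult[OF B] \<iota> pB)
  also have "\<dots> = subst_poly (\<lambda>c. \<psi> (\<iota> c)) (\<lambda>i. \<psi> (a i)) f"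
    unfolding subst_poly_def by (intro sum.cong refl) (simp add: rhom_mult[OF \<psi> \<iota> pB] p)
  finally show ?thesis .
qed

lemma subst_poly_var_id: "subst_poly const var f = (f :: 'a::comm_ring_1 mpoly)"
  unfolding subst_poly_def single_eq_monomial[symmetric] using poly_mapping_sum_single[of f] by simp

lemma CHAR_mpoly: "CHAR('a::comm_ring_1 mpoly) = CHAR('a)"
proof (rule CHAR_eqI)
  show "of_nat CHAR('a) = (0 :: 'a mpoly)"
    by (metis of_nat_CHAR single_of_nat single_zero)
  fix x assume "of_nat x = (0 :: 'a mpoly)"
  then have "Poly_Mapping.single (0 :: nat \<Rightarrow>\<^sub>0 nat) (of_nat x :: 'a) = 0" by simp
  then have "of_nat x = (0 :: 'a)" by (metis lookup_single_eq lookup_zero)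
  then show "CHAR('a) dvd x" by (simp add: of_nat_eq_0_iff_char_dvd)
qed

section \<open>Grading\<close>

lemma lookup_hom_component: "Poly_Mapping.lookup (hom_component d f) m = (if monom_deg m = d then Poly_Mapping.lookup f m else 0)"
  unfolding hom_component_def by (auto simp: lookup_sum lookup_single when_def in_keys_iff)

lemma hom_component_add: "hom_component d (f + g) = hom_component d f + hom_component d g"
  by (rule poly_mapping_eqI) (simp add: lookup_hom_component lookup_add)

lemma hom_component_zero: "hom_component d 0 = 0"
  by (rule poly_mapping_eqI) (simp add: lookup_hom_component)

lemma hom_component_sum: "hom_component d (\<Sum>i\<in>I. f i) = (\<Sum>i\<in>I. hom_component d (f i))"
  by (induction I rule: infinite_finite_induct) (auto simp: hom_component_zero hom_component_add)

lemma homogeneous_hom_component: "homogeneous d (hom_component d f)"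
  by (auto simp: homogeneous_def in_keys_iff lookup_hom_component split: if_splits)

lemma homogeneous_lookup: "homogeneous d f \<Longrightarrow> monom_deg m \<noteq> d \<Longrightarrow> Poly_Mapping.lookup f m = 0"
  by (auto simp: homogeneous_def in_keys_iff)

lemma hom_component_homogeneous: "homogeneous d f \<Longrightarrow> hom_component e f = (if e = d then f else 0)"
  by (rule poly_mapping_eqI) (auto simp: lookup_hom_component homogeneous_lookup)

lemma monom_deg_superset: "finite V \<Longrightarrow> Poly_Mapping.keys m \<subseteq> V \<Longrightarrow> monom_deg m = (\<Sum>i\<in>V. Poly_Mapping.lookup m i)"
  unfolding monom_deg_def by (rule sum.mono_neutral_left) (auto simp: in_keys_iff)

lemma monom_deg_add: "monom_deg (m + m') = monom_deg m + monom_deg m'"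
proof -
  let ?V = "Poly_Mapping.keys m \<union> Poly_Mapping.keys m'"
  have "monom_deg (m + m') = (\<Sum>i\<in>?V. Poly_Mapping.lookup (m + m') i)"
    by (rule monom_deg_superset) (auto simp: keys_add_nat)
  also have "\<dots> = (\<Sum>i\<in>?V. Poly_Mapping.lookup m i) + (\<Sum>i\<in>?V. Poly_Mapping.lookup m' i)"
    by (simp add: lookup_add sum.distrib)
  also have "\<dots> = monom_deg m + monom_deg m'" by (simp add: monom_deg_superset[of ?V])
  finally show ?thesis .
qed

lemma monom_deg_0: "monom_deg 0 = 0" by (simp add: monom_deg_def)
lemma monom_deg_eq_0_iff: "monom_deg m = 0 \<longleftrightarrow> m = 0"
proof
  assume "monom_deg m = 0"
  then have "\<forall>i\<in>Poly_Mapping.keys m. Poly_Mapping.lookup m i = 0" by (simp add: monom_deg_def)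
  then have "Poly_Mapping.lookup m i = 0" for i by (metis in_keys_iff)
  then show "m = 0" by (metis poly_mapping_eqI lookup_zero)
qed (simp add: monom_deg_0)

lemma homogeneous_0: "homogeneous d 0" by (simp add: homogeneous_def)

lemma homogeneous_add: "homogeneous d f \<Longrightarrow> homogeneous d g \<Longrightarrow> homogeneous d (f + g)"
  unfolding homogeneous_def using Poly_Mapping.keys_add[of f g] by blast

lemma homogeneous_mult:
  "homogeneous d f \<Longrightarrow> homogeneous e g \<Longrightarrow> homogeneous (d + e) (f * g)" for f g :: "'a::comm_ring_1 mpoly"
  unfolding homogeneous_def using keys_mult[of f g] monom_deg_add by fastforce

lemma sum_hom_component: "(\<Sum>d\<in>monom_deg ` Poly_Mapping.keys f. hom_component d f) = f"
  by (rule poly_mapping_eqI) (auto simp: lookup_sum lookup_hom_component in_keys_iff sum.delta)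

lemma hom_component_mult_homogeneous:
  fixes f g :: "'a::comm_ring_1 mpoly"
  assumes f: "homogeneous e f"
  shows "hom_component d (f * g) = (if e \<le> d then f * hom_component (d - e) g else 0)"
proof -
  let ?D = "monom_deg ` Poly_Mapping.keys g"
  have "f * g = (\<Sum>k\<in>?D. f * hom_component k g)" unfolding sum_distrib_left[symmetric] sum_hom_component ..
  then have "hom_component d (f * g) = (\<Sum>k\<in>?D. hom_component d (f * hom_component k g))" by (simp add: hom_component_sum)
  also have "\<dots> = (\<Sum>k\<in>?D. if e + k = d then f * hom_component k g else 0)"
    by (intro sum.cong refl, subst hom_component_homogeneous[OF homogeneous_mult[OF f homogeneous_hom_component]])
      (simp only: eq_commute[of d])
  also have "\<dots> = (if e \<le> d then f * hom_component (d - e) g else 0)"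
  proof (cases "e \<le> d")
    case True
    have "(\<Sum>k\<in>?D. if e + k = d then f * hom_component k g else 0) = (\<Sum>k\<in>?D. if k = d - e then f * hom_component k g else 0)"
      using True by (intro sum.cong refl) auto
    also have "\<dots> = f * hom_component (d - e) g"
    proof (cases "d - e \<in> ?D")
      case False
      have "hom_component (d - e) g = 0"
      proof (rule poly_mapping_eqI)
        fix m
        have "m \<notin> Poly_Mapping.keys g" if "monom_deg m = d - e" using False that by (metis imageI)
        then show "Poly_Mapping.lookup (hom_component (d - e) g) m = Poly_Mapping.lookup 0 m"
          by (auto simp: lookup_hom_component in_keys_iff)
      qed
      then show ?thesis using False by simp
    qed simp
    finally show ?thesis using True by simp
  qed (auto intro: sum.neutral)
  finally show ?thesis .
qed

lemma homogeneous_const: "homogeneous 0 (const c)" by (simp add: homogeneous_def const_def monom_deg_0)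
lemma homogeneous_0_imp_const: assumes "homogeneous 0 f" shows "f = const (Poly_Mapping.lookup f 0)"
  by (rule poly_mapping_eqI)
    (use assms in \<open>auto simp: const_def lookup_single when_def homogeneous_lookup monom_deg_eq_0_iff\<close>)

text \<open>The constant coefficient is the value at the origin.\<close>

lemma lookup_0_mult: "Poly_Mapping.lookup (f * g) 0 = Poly_Mapping.lookup f 0 * Poly_Mapping.lookup g 0"
  for f g :: "'a::comm_ring_1 mpoly"
proof -
  have l: "Poly_Mapping.lookup h 0 = subst_poly id (\<lambda>_. 0) h" for h :: "'a mpoly"
  proof -
    have "meval (\<lambda>_. 0::'a) m = (if m = 0 then 1 else 0)" for m
    proof (cases "m = 0")
      case False
      then obtain i where "i \<in> Poly_Mapping.keys m" by (metis in_keys_iff lookup_zero poly_mapping_eqI)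
      then have "(\<Prod>i\<in>Poly_Mapping.keys m. (0::'a) ^ Poly_Mapping.lookup m i) = 0"
        by (intro prod_zero bexI[of _ i]) (auto simp: in_keys_iff zero_power)
      then show ?thesis using False by (simp add: meval_def)
    qed simp
    then have "subst_poly id (\<lambda>_. 0) h = (\<Sum>m\<in>Poly_Mapping.keys h. if m = 0 then Poly_Mapping.lookup h 0 else 0)"
      unfolding subst_poly_meval by (intro sum.cong refl) auto
    then show ?thesis by (simp add: in_keys_iff)
  qed
  show ?thesis unfolding l by (rule subst_poly_mult) (simp add: rhom_def)
qed

section \<open>Characters of p-groups\<close>

context group begin

text \<open>The inverse turns right multiplication into a left action.\<close>

lemma rcoset_action:
  assumes H: "subgroup H G"
  shows "group_action (G\<lparr>carrier := H\<rparr>) (rcosets H) (\<lambda>h. \<lambda>C\<in>rcosets H. C #> inv h)"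
proof -
  let ?E = "rcosets H" and ?\<phi> = "\<lambda>h. \<lambda>C\<in>rcosets H. C #> inv h"
  have HG: "H \<subseteq> carrier G" by (rule subgroup.subset[OF H])
  have closed: "C #> g \<in> ?E" if C: "C \<in> ?E" and g: "g \<in> carrier G" for C g
  proof -
    obtain x where "x \<in> carrier G" "C = H #> x" using C by (auto simp: RCOSETS_def)
    then have "C #> g = H #> (x \<otimes> g)" using coset_mult_assoc HG g by simp
    then show ?thesis using \<open>x \<in> carrier G\<close> g by (auto simp: RCOSETS_def)
  qed
  have CG: "C \<subseteq> carrier G" if "C \<in> ?E" for C
    using that HG r_coset_subset_G by (auto simp: RCOSETS_def)
  have bij: "?\<phi> h \<in> Bij ?E" if h: "h \<in> H" for h
  proof -
    have hG: "h \<in> carrier G" using h HG by blast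
    have "bij_betw (?\<phi> h) ?E ?E"
      by (rule bij_betw_byWitness[where f' = "\<lambda>C. C #> h"])
        (use hG closed CG in \<open>auto simp: coset_mult_assoc coset_mult_one\<close>)
    then show ?thesis by (simp add: Bij_def)
  qed
  have comp: "?\<phi> (g \<otimes> h) = compose ?E (?\<phi> g) (?\<phi> h)" if gh: "g \<in> H" "h \<in> H" for g h
  proof -
    have G: "g \<in> carrier G" "h \<in> carrier G" using gh HG by auto
    show ?thesis
      by (rule ext) (use G closed CG in \<open>auto simp: compose_def coset_mult_assoc inv_mult_group\<close>)
  qed
  show ?thesis
    unfolding group_action_def group_hom_def group_hom_axioms_def
    using subgroup.subgroup_is_group[OF H is_group] group_BijGroup[of ?E] bij comp
    by (auto simp: hom_def BijGroup_def)
qed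

text \<open>Let \<open>H\<close> act on its right cosets by right multiplication. Their number is a
  multiple of \<open>p\<close> and \<open>H\<close> itself is a fixed point, so there is another
  fixed coset \<open>H g\<close>; being fixed means \<open>g h g\<inverse> \<in> H\<close>.\<close>

lemma p_subgroup_normalizer_grows:
  assumes fin: "finite (carrier G)" and p: "normalization_semidom_class.prime p" and ord: "Coset.order G = p ^ k"
    and H: "subgroup H G" and ne: "H \<noteq> carrier G"
  shows "\<exists>g\<in>carrier G - H. \<forall>h\<in>H. g \<otimes> h \<otimes> inv g \<in> H"
proof (rule ccontr)
  assume no: "\<not> ?thesis"
  define E where "E = rcosets H"
  define \<phi> where "\<phi> = (\<lambda>h. \<lambda>C\<in>E. C #> inv h)"
  let ?GH = "G\<lparr>carrier := H\<rparr>"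
  have HG: "H \<subseteq> carrier G" by (rule subgroup.subset[OF H])
  have \<phi>: "\<phi> h C = C #> inv h" if "C \<in> E" for h C using that by (simp add: \<phi>_def)
  interpret a: group_action ?GH E \<phi> unfolding E_def \<phi>_def by (rule rcoset_action[OF H])
  have lag: "card E * card H = p ^ k" using lagrange[OF H] ord by (simp add: E_def)
  have finE: "finite E" unfolding E_def using fin by (metis finite_UnionD rcosets_part_G H)
  have HE: "H \<in> E" using coset_join2[OF one_closed H] one_closed subgroup.one_closed[OF H]
    unfolding E_def RCOSETS_def by blast
  have "card E dvd p ^ k" using lag by (metis dvd_triv_left)
  moreover have "card E \<noteq> 1"
  proof
    assume "card E = 1"
    then have "card H = card (carrier G)" using lag ord by (simp add: Coset.order_def)
    then show False using ne card_subset_eq[OF fin HG] by simp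
  qed
  ultimately have pE: "p dvd card E"
    by (metis divides_primepow_nat p dvd_power power_0 not_gr_zero)
  have orbH: "orbit ?GH \<phi> H = {H}"
  proof -
    have "\<phi> h H = H" if h: "h \<in> H" for h
      using \<phi>[OF HE] coset_join2[OF _ H subgroup.m_inv_closed[OF H h]] HG h by auto
    moreover have "\<one> \<in> H" by (rule subgroup.one_closed[OF H])
    ultimately show ?thesis by (auto simp: orbit_def intro: exI[of _ \<one>])
  qed
  \<comment> \<open>Orbit sizes divide \<open>p ^ k\<close>; size \<open>1\<close> would produce a
    \<open>g\<close> of the excluded kind.\<close>
  have orb_dvd: "p dvd card (orbit ?GH \<phi> C)" if C: "C \<in> E" "C \<noteq> H" for C
  proof -
    have "card (orbit ?GH \<phi> C) * card (stabilizer ?GH \<phi> C) = card H"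
      using a.orbit_stabilizer_theorem[OF C(1)] by (simp add: Coset.order_def)
    then have "card (orbit ?GH \<phi> C) dvd p ^ k" using lag by (metis dvd_triv_left dvd_mult)
    moreover have "card (orbit ?GH \<phi> C) \<noteq> 1"
    proof
      assume "card (orbit ?GH \<phi> C) = 1"
      then obtain D where D: "orbit ?GH \<phi> C = {D}" by (meson card_1_singletonE)
      have fix_: "C #> inv h = C" if h: "h \<in> H" for h
      proof -
        have "\<phi> h C \<in> orbit ?GH \<phi> C" using h by (auto simp: orbit_def)
        moreover have "C \<in> orbit ?GH \<phi> C" by (rule a.orbit_refl[OF C(1)])
        ultimately have "\<phi> h C = C" using D by auto
        then show ?thesis using \<phi>[OF C(1)] by simp
      qed
      obtain g where g: "g \<in> carrier G" "C = H #> g" using C(1) by (auto simp: E_def RCOSETS_def)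
      have "g \<otimes> h \<otimes> inv g \<in> H" if h: "h \<in> H" for h
      proof -
        have hG: "h \<in> carrier G" using h HG by blast
        have "C #> h = C" using fix_[OF subgroup.m_inv_closed[OF H h]] hG by simp
        moreover have "g \<in> C" using rcos_self[OF g(1) H] g(2) by simp
        then have "g \<otimes> h \<in> C #> h" by (auto simp: r_coset_def)
        ultimately have "g \<otimes> h \<in> H #> g" using g by simp
        then obtain h' where "h' \<in> H" "g \<otimes> h = h' \<otimes> g" by (auto simp: r_coset_def)
        then show ?thesis using g HG by (auto simp: m_assoc)
      qed
      moreover have "g \<notin> H" using C(2) g coset_join2[OF _ H] by auto
      ultimately show False using no g by blast
    qed
    ultimately show ?thesis by (metis divides_primepow_nat p dvd_power power_0 not_gr_zero)
  qed
  have finO: "finite (orbits ?GH E \<phi>)" using finE by (simp add: orbits_def setcompr_eq_image)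
  have HO: "{H} \<in> orbits ?GH E \<phi>" using orbH HE by (auto simp: orbits_def)
  have "card E = (\<Sum>Q\<in>orbits ?GH E \<phi>. card Q)"
    using a.disjoint_sum[OF finE, of "\<lambda>_. 1 :: nat"] by simp
  also have "\<dots> = 1 + (\<Sum>Q\<in>orbits ?GH E \<phi> - {{H}}. card Q)"
    using sum.remove[OF finO HO, of card] by simp
  also have "\<dots> = 1 + p * (\<Sum>Q\<in>orbits ?GH E \<phi> - {{H}}. card Q div p)"
  proof -
    have "card Q = p * (card Q div p)" if Q: "Q \<in> orbits ?GH E \<phi> - {{H}}" for Q
    proof -
      obtain C where C: "C \<in> E" "Q = orbit ?GH \<phi> C" using Q by (auto simp: orbits_def)
      then have "C \<noteq> H" using orbH Q by auto
      then show ?thesis using orb_dvd[OF C(1)] C(2) by simp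
    qed
    then show ?thesis unfolding sum_distrib_left by (intro arg_cong[of _ _ "\<lambda>x. 1 + x"] sum.cong refl) auto
  qed
  finally have "p dvd 1" using pE by (metis dvd_add_left_iff dvd_triv_left)
  then show False using p by simp
qed

text \<open>
  For \<open>H\<close> maximal among the proper subgroups containing \<open>N\<close> and \<open>t\<close> normalizing \<open>H\<close>, every element of
  \<open>G\<close> has the form \<open>t\<^sup>i h\<close>, and \<open>i\<close> is determined modulo \<open>p\<close>.
\<close>

lemma p_group_character:
  assumes fin: "finite (carrier G)" and p: "normalization_semidom_class.prime p" and ord: "Coset.order G = p ^ k"
    and N: "subgroup N G" and ne: "N \<noteq> carrier G"
  obtains \<chi> t where "\<And>\<sigma>. \<sigma> \<in> carrier G \<Longrightarrow> \<chi> \<sigma> < p"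
    "\<And>\<sigma> \<tau>. \<sigma> \<in> carrier G \<Longrightarrow> \<tau> \<in> carrier G \<Longrightarrow> \<chi> (\<sigma> \<otimes> \<tau>) = (\<chi> \<sigma> + \<chi> \<tau>) mod p"
    "t \<in> carrier G" "\<chi> t = (1::nat)" "\<And>\<sigma>. \<sigma> \<in> N \<Longrightarrow> \<chi> \<sigma> = 0"
proof -
  define F where "F = {H. subgroup H G \<and> N \<subseteq> H \<and> H \<noteq> carrier G}"
  have F: "H \<in> F \<longleftrightarrow> subgroup H G \<and> N \<subseteq> H \<and> H \<noteq> carrier G" for H by (simp add: F_def)
  have "finite F" by (rule finite_subset[of _ "Pow (carrier G)"]) (use fin subgroup.subset F in auto)
  moreover have "N \<in> F" using N ne F by simp
  ultimately have "\<exists>H\<in>F. \<forall>K\<in>F. H \<subseteq> K \<longrightarrow> H = K" by (intro finite_has_maximal) auto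
  then obtain H where HF: "H \<in> F" and max0: "\<And>K. K \<in> F \<Longrightarrow> H \<subseteq> K \<Longrightarrow> H = K" by blast
  from HF have H: "subgroup H G" and NH: "N \<subseteq> H" and Hne: "H \<noteq> carrier G" using F by auto
  have max: "K = carrier G" if "subgroup K G" "H \<subset> K" for K using max0[of K] that NH F[of K] by blast
  have HG: "H \<subseteq> carrier G" by (rule subgroup.subset[OF H])
  have "\<exists>t\<in>carrier G - H. \<forall>h\<in>H. t \<otimes> h \<otimes> inv t \<in> H"
    by (rule p_subgroup_normalizer_grows[OF fin p ord H Hne])
  then obtain t where "t \<in> carrier G - H" "\<forall>h\<in>H. t \<otimes> h \<otimes> inv t \<in> H" by (rule bexE)
  then have t: "t \<in> carrier G" "t \<notin> H" "\<And>h. h \<in> H \<Longrightarrow> t \<otimes> h \<otimes> inv t \<in> H" by simp_all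
  have conj: "t [^] i \<otimes> h \<otimes> inv (t [^] i) \<in> H" if "h \<in> H" for i :: nat and h
  proof (induction i)
    case 0 then show ?case using that HG by auto
  next
    case (Suc i)
    have "t \<otimes> (t [^] i \<otimes> h \<otimes> inv (t [^] i)) \<otimes> inv t \<in> H" using t(3) Suc by blast
    moreover have "t [^] Suc i = t \<otimes> t [^] i" using t(1) nat_pow_Suc2 by blast
    ultimately show ?case using t(1) that HG by (auto simp: inv_mult_group m_assoc subset_iff)
  qed
  have tord: "t [^] (p ^ k) = \<one>" using pow_order_eq_1[OF t(1)] ord by simp
  \<comment> \<open>Inverses of powers of \<open>t\<close> are again natural powers, so
    \<open>conj\<close> also gives conjugation by inverses.\<close>
  have tinv: "inv (t [^] i) = t [^] (i * (p ^ k - 1))" for i :: nat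
  proof (rule inv_equality)
    obtain m where "p ^ k = Suc m" using prime_gt_0_nat[OF p] by (metis gr0_implies_Suc zero_less_power)
    then have "i * (p ^ k - 1) + i = p ^ k * i" by simp
    then have "t [^] (i * (p ^ k - 1)) \<otimes> t [^] i = t [^] (p ^ k * i)"
      using t(1) by (simp only: nat_pow_mult)
    also have "\<dots> = \<one>" using tord t(1) by (simp flip: nat_pow_pow)
    finally show "t [^] (i * (p ^ k - 1)) \<otimes> t [^] i = \<one>" .
  qed (use t(1) in auto)
  have conj': "inv (t [^] i) \<otimes> h \<otimes> t [^] i \<in> H" if h: "h \<in> H" for i :: nat and h
  proof -
    let ?j = "i * (p ^ k - 1)"
    have "inv (t [^] i) = t [^] ?j" by (rule tinv)
    then show ?thesis using conj[OF h, of ?j] t(1) by (metis inv_inv nat_pow_closed)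
  qed
  \<comment> \<open>A subgroup strictly larger than \<open>H\<close>, hence the whole group by
    maximality.\<close>
  define K where "K = (\<Union>i::nat. (\<lambda>h. t [^] i \<otimes> h) ` H)"
  have KI: "t [^] i \<otimes> h \<in> K" if "h \<in> H" for i :: nat and h using that by (auto simp: K_def)
  have KE: thesis if "a \<in> K" "\<And>i h. a = t [^] (i::nat) \<otimes> h \<Longrightarrow> h \<in> H \<Longrightarrow> thesis" for a thesis
    using that unfolding K_def by blast
  have prod: "\<exists>h''\<in>H. (t [^] i \<otimes> h) \<otimes> (t [^] j \<otimes> h') = t [^] (i + j) \<otimes> h''"
    if h: "h \<in> H" "h' \<in> H" for i j :: nat and h h'
  proof (rule bexI)
    have G: "h \<in> carrier G" "h' \<in> carrier G" "t [^] i \<in> carrier G" "t [^] j \<in> carrier G" using h HG t(1) by auto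
    have "t [^] j \<otimes> (inv (t [^] j) \<otimes> h \<otimes> t [^] j) = h \<otimes> t [^] j" using G by (simp add: m_assoc[symmetric])
    then have "(t [^] i \<otimes> h) \<otimes> (t [^] j \<otimes> h') = t [^] i \<otimes> (t [^] j \<otimes> (inv (t [^] j) \<otimes> h \<otimes> t [^] j)) \<otimes> h'"
      using G by (simp add: m_assoc)
    also have "\<dots> = (t [^] i \<otimes> t [^] j) \<otimes> ((inv (t [^] j) \<otimes> h \<otimes> t [^] j) \<otimes> h')"
      using G by (simp add: m_assoc)
    finally show "(t [^] i \<otimes> h) \<otimes> (t [^] j \<otimes> h') = t [^] (i + j) \<otimes> ((inv (t [^] j) \<otimes> h \<otimes> t [^] j) \<otimes> h')"
      using t(1) by (simp add: nat_pow_mult)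
    show "(inv (t [^] j) \<otimes> h \<otimes> t [^] j) \<otimes> h' \<in> H" using conj'[OF h(1)] h(2) subgroup.m_closed[OF H] by blast
  qed
  have "subgroup K G"
  proof (rule subgroupI)
    show "K \<subseteq> carrier G" using t(1) HG by (auto simp: K_def)
    show "K \<noteq> {}" using KI subgroup.one_closed[OF H] by blast
    show "a \<otimes> b \<in> K" if ab: "a \<in> K" "b \<in> K" for a b
    proof -
      obtain i h where a: "a = t [^] (i::nat) \<otimes> h" "h \<in> H" using ab(1) by (rule KE)
      obtain j h' where b: "b = t [^] (j::nat) \<otimes> h'" "h' \<in> H" using ab(2) by (rule KE)
      obtain h'' where "h'' \<in> H" "a \<otimes> b = t [^] (i + j) \<otimes> h''"
        using prod[OF a(2) b(2)] unfolding a(1) b(1) by (rule bexE)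
      then show ?thesis using KI by simp
    qed
    show "inv a \<in> K" if aK: "a \<in> K" for a
    proof -
      obtain i h where a: "a = t [^] (i::nat) \<otimes> h" "h \<in> H" using aK by (rule KE)
      let ?j = "i * (p ^ k - 1)"
      have G: "h \<in> carrier G" "t [^] i \<in> carrier G" "t [^] ?j \<in> carrier G" using a HG t(1) by auto
      have "inv (t [^] i) = t [^] ?j" by (rule tinv)
      then have "inv a = (t [^] (0::nat) \<otimes> inv h) \<otimes> (t [^] ?j \<otimes> \<one>)"
        using a G by (simp add: inv_mult_group)
      moreover obtain h'' where "h'' \<in> H" "(t [^] (0::nat) \<otimes> inv h) \<otimes> (t [^] ?j \<otimes> \<one>) = t [^] (0 + ?j) \<otimes> h''"
        using prod[OF subgroup.m_inv_closed[OF H a(2)] subgroup.one_closed[OF H]] by (rule bexE)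
      ultimately show ?thesis using KI by simp
    qed
  qed
  moreover have "H \<subset> K"
  proof -
    have "h \<in> K" if "h \<in> H" for h using KI[OF that, of 0] that HG by auto
    moreover have "t \<in> K" using KI[OF subgroup.one_closed[OF H], of 1] t(1) by simp
    ultimately show ?thesis using t(2) by blast
  qed
  ultimately have KG: "K = carrier G" by (rule max)
  \<comment> \<open>Otherwise Bezout writes \<open>t\<close> as a power of \<open>t [^] n\<close>,
    because \<open>t [^] (p ^ k) = \<one>\<close>.\<close>
  have tH: "p dvd n" if n: "t [^] (n::nat) \<in> H" for n
  proof (rule ccontr)
    assume "\<not> p dvd n"
    then have "coprime (p ^ k) n" using prime_imp_coprime[OF p] by simp
    moreover have "n \<noteq> 0" using \<open>\<not> p dvd n\<close> by (metis dvd_0_right)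
    ultimately obtain x y where xy: "n * x = p ^ k * y + 1"
      using bezout_nat[of n "p ^ k"] by (auto simp: coprime_iff_gcd_eq_1 gcd.commute)
    have "(t [^] n) [^] x = t"
    proof -
      have "(t [^] n) [^] x = t [^] (p ^ k * y + 1)" using t(1) xy by (simp add: nat_pow_pow)
      also have "\<dots> = (t [^] (p ^ k)) [^] y \<otimes> t" using t(1) by (simp add: nat_pow_pow)
      finally show ?thesis using tord t(1) by simp
    qed
    moreover have "(t [^] n) [^] x \<in> H" by (induction x) (use n subgroup.one_closed[OF H] subgroup.m_closed[OF H] in auto)
    ultimately show False using t(2) by simp
  qed
  have uniq0: "i mod p = j mod p" if "t [^] i \<otimes> h = t [^] j \<otimes> h'" "h \<in> H" "h' \<in> H" "j \<le> i" for i j :: nat and h h'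
  proof -
    have G: "h \<in> carrier G" "h' \<in> carrier G" using that(2,3) HG by auto
    have "t [^] j \<otimes> (t [^] (i - j) \<otimes> h) = t [^] j \<otimes> h'"
      using that(1,4) G t(1) by (simp add: m_assoc[symmetric] nat_pow_mult)
    then have "t [^] (i - j) \<otimes> h = h'" using G t(1) by simp
    then have "t [^] (i - j) = h' \<otimes> inv h" using G t(1) by (metis inv_solve_right nat_pow_closed)
    then have "p dvd i - j" using tH that(2,3) subgroup.m_closed[OF H] subgroup.m_inv_closed[OF H] by auto
    then show ?thesis using that(4) by (simp add: mod_eq_dvd_iff_nat)
  qed
  have uniq: "i mod p = j mod p" if "t [^] i \<otimes> h = t [^] j \<otimes> h'" "h \<in> H" "h' \<in> H" for i j :: nat and h h'
    using uniq0[OF that] uniq0[OF that(1)[symmetric] that(3,2)] by (cases "j \<le> i") auto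
  \<comment> \<open>The exponent is an arbitrary choice; by \<open>uniq\<close> its class modulo
    \<open>p\<close> is not.\<close>
  define \<chi> where "\<chi> \<sigma> = (SOME i. \<exists>h\<in>H. \<sigma> = t [^] i \<otimes> h) mod p" for \<sigma>
  have \<chi>: "\<chi> (t [^] i \<otimes> h) = i mod p" if h: "h \<in> H" for i :: nat and h
  proof -
    define R where "R i' \<longleftrightarrow> (\<exists>h'\<in>H. t [^] i \<otimes> h = t [^] i' \<otimes> h')" for i' :: nat
    have "R i" using h by (auto simp: R_def)
    then have "R (SOME i'. R i')" by (rule someI)
    then obtain h' where "h' \<in> H" "t [^] i \<otimes> h = t [^] (SOME i'. R i') \<otimes> h'" unfolding R_def by (rule bexE)
    then show ?thesis using uniq[of i h "SOME i'. R i'" h'] h by (simp add: \<chi>_def R_def)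
  qed
  show thesis
  proof
    show "\<chi> \<sigma> < p" for \<sigma> using prime_gt_0_nat[OF p] by (simp add: \<chi>_def)
    show "\<chi> (\<sigma> \<otimes> \<tau>) = (\<chi> \<sigma> + \<chi> \<tau>) mod p" if \<sigma>\<tau>: "\<sigma> \<in> carrier G" "\<tau> \<in> carrier G" for \<sigma> \<tau>
    proof -
      obtain i h where i: "\<sigma> = t [^] (i::nat) \<otimes> h" "h \<in> H" using \<sigma>\<tau>(1)[folded KG] by (rule KE)
      obtain j h' where j: "\<tau> = t [^] (j::nat) \<otimes> h'" "h' \<in> H" using \<sigma>\<tau>(2)[folded KG] by (rule KE)
      obtain h'' where "h'' \<in> H" "\<sigma> \<otimes> \<tau> = t [^] (i + j) \<otimes> h''"
        using prod[OF i(2) j(2)] unfolding i(1) j(1) by (rule bexE)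
      then show ?thesis using \<chi> i j by (simp add: mod_add_eq)
    qed
    show "t \<in> carrier G" by (rule t(1))
    show "\<chi> t = 1" using \<chi>[OF subgroup.one_closed[OF H], of 1] t(1) prime_gt_1_nat[OF p] by simp
    show "\<chi> \<sigma> = 0" if "\<sigma> \<in> N" for \<sigma> proof -
      have "\<sigma> \<in> H" "\<sigma> \<in> carrier G" using that NH HG by auto
      then show ?thesis using \<chi>[of \<sigma> 0] by simp
    qed
  qed
qed

end

section \<open>Finite groups acting on rings\<close>

lemma rhom_map_poly:
  assumes "rhom A \<phi>" "sring A" shows "rhom (cpoly A) (map_poly \<phi>)"
  using map_poly_rhom_add[OF assms] map_poly_rhom_mult[OF assms] rhom_0[OF assms] rhom_1[OF assms(1)]
  by (simp add: rhom_def map_poly_1)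

lemma map_poly_cpoly:
  assumes "\<And>x. x \<in> A \<Longrightarrow> \<phi> x \<in> B" "\<phi> 0 = 0" "p \<in> cpoly A" shows "map_poly \<phi> p \<in> cpoly B"
  using assms by (simp add: cpoly_def coeff_map_poly)

text \<open>Gauss's argument with the first coefficients outside \<open>Q\<close> of the two
  factors.\<close>

lemma pidl_cpoly:
  fixes S :: "'a::comm_ring_1 set"
  assumes S: "sring S" and Q: "pidl S Q"
  shows "pidl (cpoly S) (cpoly Q)"
proof -
  note smQ = pidl_smod[OF Q]
  have QS: "Q \<subseteq> S" using Q by (simp add: pidl_def idl_def)
  have "x * y \<notin> cpoly Q" if x: "x \<in> cpoly S" "x \<notin> cpoly Q" and y: "y \<in> cpoly S" "y \<notin> cpoly Q" for x y
  proof -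
    obtain i where i: "coeff x i \<notin> Q" and imin: "\<And>k. k < i \<Longrightarrow> coeff x k \<in> Q"
      using x(2) exists_least_iff[of "\<lambda>i. coeff x i \<notin> Q"] by (auto simp: cpoly_def)
    obtain j where j: "coeff y j \<notin> Q" and jmin: "\<And>k. k < j \<Longrightarrow> coeff y k \<in> Q"
      using y(2) exists_least_iff[of "\<lambda>i. coeff y i \<notin> Q"] by (auto simp: cpoly_def)
    define R where "R = (\<Sum>k\<in>{..i + j} - {i}. coeff x k * coeff y (i + j - k))"
    have "coeff (x * y) (i + j) = coeff x i * coeff y j + R"
      unfolding coeff_mult R_def by (subst sum.remove[of _ i]) auto
    moreover have "R \<in> Q" unfolding R_def
    proof (rule smod_sum[OF smQ])
      fix k assume k: "k \<in> {..i + j} - {i}"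
      show "coeff x k * coeff y (i + j - k) \<in> Q"
      proof (cases "k < i")
        case True
        then show ?thesis using smod_scale[OF smQ cpolyD[OF y(1)] imin] by (simp add: mult.commute)
      next
        case False
        then have "i + j - k < j" using k by auto
        then show ?thesis using smod_scale[OF smQ cpolyD[OF x(1)] jmin] by simp
      qed
    qed
    moreover have "coeff x i * coeff y j \<notin> Q" using pidl_mult[OF Q] x y i j by (simp add: cpoly_def)
    ultimately have "coeff (x * y) (i + j) \<notin> Q"
      using smod_diff[OF smQ S, of "coeff x i * coeff y j + R" R] by auto
    then show ?thesis by (auto simp: cpoly_def)
  qed
  moreover have "1 \<notin> cpoly Q" using pidl_1[OF Q] cpolyD[of 1 Q 0] by auto
  moreover have "idl (cpoly S) (cpoly Q)" using smod_cpoly[OF S smQ] QS by (auto simp: idl_def cpoly_def)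
  ultimately show ?thesis by (auto simp: pidl_def)
qed

text \<open>Dedekind-Artin independence of homomorphisms, modulo a prime \<open>Q\<close> instead of
  over a field.\<close>

lemma artin_independence:
  assumes B: "sring B" and S: "sring S" and Q: "pidl S Q" and "finite I"
    and hom: "\<And>i. i \<in> I \<Longrightarrow> rhom B (\<phi> i)" and im: "\<And>i b. i \<in> I \<Longrightarrow> b \<in> B \<Longrightarrow> \<phi> i b \<in> S"
    and dist: "\<And>i j. i \<in> I \<Longrightarrow> j \<in> I \<Longrightarrow> i \<noteq> j \<Longrightarrow> \<exists>b\<in>B. \<phi> i b - \<phi> j b \<notin> Q"
    and c: "\<And>i. i \<in> I \<Longrightarrow> c i \<in> S" and rel: "\<And>b. b \<in> B \<Longrightarrow> (\<Sum>i\<in>I. c i * \<phi> i b) \<in> Q"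
  shows "\<forall>i\<in>I. c i \<in> Q"
  using assms(4-)
proof (induction I arbitrary: c rule: finite_induct)
  case empty
  then show ?case by simp
next
  case (insert j I)
  note smQ = pidl_smod[OF Q]
  note hom = insert.prems(1) and im = insert.prems(2) and dist = insert.prems(3) and c = insert.prems(4) and rel = insert.prems(5)
  have cQ: "c i \<in> Q" if i: "i \<in> I" for i
  proof -
    have "i \<noteq> j" using i insert.hyps by auto
    then obtain t where t: "t \<in> B" "\<phi> i t - \<phi> j t \<notin> Q" using dist[of i j] i by auto
    \<comment> \<open>The relation at \<open>t * b\<close> minus \<open>\<phi> j t\<close> times the
      relation at \<open>b\<close>: the term of \<open>j\<close> drops out and the others acquire
      the factors \<open>\<phi> k t - \<phi> j t\<close>.\<close>
    define c' where "c' k = c k * (\<phi> k t - \<phi> j t)" for k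
    have "\<forall>k\<in>I. c' k \<in> Q"
    proof (rule insert.IH)
      show "c' k \<in> S" if "k \<in> I" for k unfolding c'_def
        by (intro sring_mult[OF S] sring_diff[OF S] c im) (use that t in auto)
      show "(\<Sum>k\<in>I. c' k * \<phi> k b) \<in> Q" if b: "b \<in> B" for b
      proof -
        have h: "\<phi> k (t * b) = \<phi> k t * \<phi> k b" if "k \<in> insert j I" for k
          by (rule rhom_mult[OF hom[OF that] t(1) b])
        have "(\<Sum>k\<in>insert j I. c k * \<phi> k (t * b)) - \<phi> j t * (\<Sum>k\<in>insert j I. c k * \<phi> k b)
          = (\<Sum>k\<in>insert j I. c' k * \<phi> k b)"
          unfolding sum_distrib_left sum_subtractf[symmetric]
          by (intro sum.cong refl, simp only: h c'_def, simp add: algebra_simps)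
        also have "\<dots> = (\<Sum>k\<in>I. c' k * \<phi> k b)" using insert.hyps by (simp add: c'_def)
        finally have eq: "(\<Sum>k\<in>insert j I. c k * \<phi> k (t * b)) - \<phi> j t * (\<Sum>k\<in>insert j I. c k * \<phi> k b)
          = (\<Sum>k\<in>I. c' k * \<phi> k b)" .
        show ?thesis unfolding eq[symmetric]
          by (rule smod_diff[OF smQ S rel[OF sring_mult[OF B t(1) b]] smod_scale[OF smQ im rel[OF b]]])
            (use t(1) in auto)
      qed
      show "rhom B (\<phi> k)" if "k \<in> I" for k using hom that by simp
      show "\<phi> k b \<in> S" if "k \<in> I" "b \<in> B" for k b using im that by simp
      show "\<exists>b\<in>B. \<phi> k b - \<phi> l b \<notin> Q" if "k \<in> I" "l \<in> I" "k \<noteq> l" for k l using dist that by simp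
    qed
    then have "c i * (\<phi> i t - \<phi> j t) \<in> Q" using i by (simp add: c'_def)
    then show ?thesis using pidl_mult[OF Q c _ _ t(2)] i im t(1) sring_diff[OF S] by blast
  qed
  have "(\<Sum>k\<in>insert j I. c k * \<phi> k 1) = (\<Sum>k\<in>insert j I. c k)"
    by (intro sum.cong refl) (simp add: rhom_1[OF hom])
  also have "\<dots> = c j + (\<Sum>k\<in>I. c k)" using insert.hyps by simp
  finally have "(\<Sum>k\<in>insert j I. c k * \<phi> k 1) = c j + (\<Sum>k\<in>I. c k)" .
  then have "c j + (\<Sum>k\<in>I. c k) \<in> Q" using rel[OF sring_1[OF B]] by simp
  then have "c j \<in> Q" using smod_diff[OF smQ S _ smod_sum[OF smQ cQ]] by fastforce
  then show ?case using cQ by simp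
qed

locale ring_action = group G for G :: "('g, 'm) monoid_scheme" (structure) +
  fixes act :: "'g \<Rightarrow> 'r::comm_ring_1 \<Rightarrow> 'r" and S :: "'r set"
  assumes fin: "finite (carrier G)" and S: "sring S"
    and act_in: "\<sigma> \<in> carrier G \<Longrightarrow> s \<in> S \<Longrightarrow> act \<sigma> s \<in> S"
    and act_hom: "\<sigma> \<in> carrier G \<Longrightarrow> rhom S (act \<sigma>)"
    and act_mult: "\<sigma> \<in> carrier G \<Longrightarrow> \<tau> \<in> carrier G \<Longrightarrow> s \<in> S \<Longrightarrow> act (\<sigma> \<otimes> \<tau>) s = act \<sigma> (act \<tau> s)"
    and act_one: "s \<in> S \<Longrightarrow> act \<one> s = s"
begin

definition invs :: "'g set \<Rightarrow> 'r set" where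
  "invs H = {s \<in> S. \<forall>h\<in>H. act h s = s}"

lemma act_0: "\<sigma> \<in> carrier G \<Longrightarrow> act \<sigma> 0 = 0"
  using rhom_0[OF act_hom S] .

lemma sring_invs: assumes "H \<subseteq> carrier G" shows "sring (invs H)"
proof -
  have "x - y \<in> invs H" if "x \<in> invs H" "y \<in> invs H" for x y
    using that assms rhom_diff[OF act_hom S] S by (auto simp: invs_def sring_diff subset_iff)
  moreover have "x * y \<in> invs H" if "x \<in> invs H" "y \<in> invs H" for x y
    using that assms rhom_mult[OF act_hom] S by (auto simp: invs_def sring_mult subset_iff)
  moreover have "1 \<in> invs H" using assms rhom_1[OF act_hom] S by (auto simp: invs_def sring_1 subset_iff)
  ultimately show ?thesis by (auto simp: sring_def)
qed

text \<open>
  The polynomial \<open>\<Prod>h. (Y - h \<theta>)\<close> with \<open>\<theta> \<in> S[Z]\<close> separating the finitely many candidates has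
  invariant coefficients.
\<close>

lemma homs_agreeing_on_invariants:
  assumes H: "subgroup H G" and Q: "pidl S Q"
    and \<psi>: "rhom S \<psi>" "\<And>s. s \<in> S \<Longrightarrow> \<psi> s \<in> S" and \<psi>': "rhom S \<psi>'" "\<And>s. s \<in> S \<Longrightarrow> \<psi>' s \<in> S"
    and agree: "\<And>s. s \<in> invs H \<Longrightarrow> \<psi> s - \<psi>' s \<in> Q"
  shows "\<exists>h\<in>H. \<forall>t\<in>S. \<psi> t - \<psi>' (act h t) \<in> Q"
proof (rule ccontr)
  assume no: "\<not> ?thesis"
  have HG: "H \<subseteq> carrier G" using subgroup.subset[OF H] .
  then have finH: "finite H" using fin finite_subset by blast
  have "\<exists>t. t \<in> S \<and> (h \<in> H \<longrightarrow> \<psi> t - \<psi>' (act h t) \<notin> Q)" for h using no sring_1[OF S] by blast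
  then obtain t where t: "\<And>h. t h \<in> S" "\<And>h. h \<in> H \<Longrightarrow> \<psi> (t h) - \<psi>' (act h (t h)) \<notin> Q" by metis
  obtain f :: "'g \<Rightarrow> nat" where f: "inj_on f H" using finite_imp_inj_to_nat_seg[OF finH] by blast
  \<comment> \<open>Each \<open>h\<close> fails at a witness \<open>t h\<close>; the distinct
    exponents \<open>f h\<close> record all witnesses in one polynomial, whose coefficient at
    \<open>f h\<close> detects the failure of \<open>h\<close>.\<close>
  define \<theta> where "\<theta> = (\<Sum>h\<in>H. monom (t h) (f h))"
  note C = sring_cpoly[OF S] and CC = sring_cpoly[OF sring_cpoly[OF S]]
  have \<theta>: "\<theta> \<in> cpoly S" unfolding \<theta>_def
    by (rule sring_sum[OF C]) (use t sring_0[OF S] in \<open>auto simp: cpoly_def\<close>)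
  have \<theta>f: "coeff \<theta> (f h) = t h" if h: "h \<in> H" for h
  proof -
    have "coeff \<theta> (f h) = (\<Sum>h'\<in>H. if h' = h then t h' else 0)"
      unfolding \<theta>_def coeff_sum by (intro sum.cong) (use f h in \<open>auto simp: inj_on_def\<close>)
    then show ?thesis using h finH by simp
  qed
  let ?\<Psi> = "map_poly \<psi>" and ?\<Psi>' = "map_poly \<psi>'" and ?a = "\<lambda>h. map_poly (act h)"
  note \<psi>0 = rhom_0[OF \<psi>(1) S] and \<psi>0' = rhom_0[OF \<psi>'(1) S]
  have a0: "act h 0 = 0" if "h \<in> H" for h using act_0 HG that by blast
  note hom\<Psi> = rhom_map_poly[OF \<psi>(1) S] and hom\<Psi>' = rhom_map_poly[OF \<psi>'(1) S]
  have homa: "rhom (cpoly S) (?a h)" if "h \<in> H" for h using rhom_map_poly[OF act_hom S] HG that by blast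
  have a\<theta>: "?a h \<theta> \<in> cpoly S" if "h \<in> H" for h
    by (rule map_poly_cpoly[of S "act h" S, OF _ a0[OF that] \<theta>]) (use act_in HG that in blast)
  define P where "P = (\<Prod>h\<in>H. [:- ?a h \<theta>, 1:])"
  have fac: "[:- ?a h \<theta>, 1:] \<in> cpoly (cpoly S)" if "h \<in> H" for h
    using sring_uminus[OF C a\<theta>[OF that]] sring_1[OF C] sring_0[OF C]
    by (auto simp: cpoly_def[of "cpoly S"] coeff_pCons split: nat.split)
  have P: "P \<in> cpoly (cpoly S)" unfolding P_def by (rule sring_prod[OF CC]) (use fac in auto)
  have inv: "coeff P k \<in> cpoly (invs H)" for k
  proof (rule cpolyI)
    fix i
    have "act h' (coeff (coeff P k) i) = coeff (coeff P k) i" if h': "h' \<in> H" for h'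
    proof -
      have homa2: "rhom (cpoly (cpoly S)) (map_poly (?a h'))" by (rule rhom_map_poly[OF homa[OF h'] C])
      have "map_poly (?a h') P = (\<Prod>h\<in>H. map_poly (?a h') [:- ?a h \<theta>, 1:])"
        unfolding P_def by (rule rhom_prod[OF homa2 CC]) (use fac in auto)
      also have "\<dots> = (\<Prod>h\<in>H. [:- ?a (h' \<otimes> h) \<theta>, 1:])"
      proof (rule prod.cong[OF refl])
        fix h assume h: "h \<in> H"
        have "?a h' (?a h \<theta>) = ?a (h' \<otimes> h) \<theta>"
          using h h' HG a0[OF h] a0[OF h'] act_0[of "h' \<otimes> h"] cpolyD[OF \<theta>]
          by (intro poly_eqI) (simp add: coeff_map_poly act_mult subset_iff)
        moreover have "?a h' (- ?a h \<theta>) = - ?a h' (?a h \<theta>)" by (rule rhom_uminus[OF homa[OF h'] C a\<theta>[OF h]])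
        moreover have "?a h' 1 = 1" by (rule rhom_1[OF homa[OF h']])
        moreover have "?a h' 0 = 0" by simp
        ultimately show "map_poly (?a h') [:- ?a h \<theta>, 1:] = [:- ?a (h' \<otimes> h) \<theta>, 1:]"
          by (simp add: map_poly_pCons)
      qed
      also have "\<dots> = P" unfolding P_def
      proof (rule prod.reindex_bij_betw)
        show "bij_betw ((\<otimes>) h') H H"
        proof (rule bij_betw_byWitness[where f' = "(\<otimes>) (inv h')"])
          show "\<forall>a\<in>H. inv h' \<otimes> (h' \<otimes> a) = a" "\<forall>a\<in>H. h' \<otimes> (inv h' \<otimes> a) = a"
            using h' HG by (auto simp: subset_iff m_assoc[symmetric])
          show "(\<otimes>) h' ` H \<subseteq> H" "(\<otimes>) (inv h') ` H \<subseteq> H"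
            using h' H by (auto intro: subgroup.m_closed subgroup.m_inv_closed)
        qed
      qed
      finally have "coeff (coeff (map_poly (?a h') P) k) i = coeff (coeff P k) i" by simp
      then show ?thesis using a0[OF h'] by (simp add: coeff_map_poly)
    qed
    then show "coeff (coeff P k) i \<in> invs H" using cpolyD[OF cpolyD[OF P]] by (auto simp: invs_def)
  qed
  have \<Psi>\<theta>: "?\<Psi> \<theta> \<in> cpoly S" by (rule map_poly_cpoly[of S \<psi> S, OF \<psi>(2) \<psi>0 \<theta>])
  note cQ = pidl_cpoly[OF S Q]
  note smcQ = pidl_smod[OF cQ]
  \<comment> \<open>The factor of \<open>\<one>\<close> vanishes at \<open>\<theta>\<close>.
    Applying \<open>\<psi>\<close>, and then replacing \<open>\<psi>\<close> by
    \<open>\<psi>'\<close> on the invariant coefficients, puts the product of all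
    \<open>\<psi> \<theta> - \<psi>' (h \<theta>)\<close> into the prime \<open>cpoly Q\<close>,
    although no factor lies in it.\<close>
  have "poly P \<theta> = 0"
  proof -
    have "\<one> \<in> H" using subgroup.one_closed[OF H] .
    moreover have "?a \<one> \<theta> = \<theta>"
      using act_one cpolyD[OF \<theta>] act_0[OF one_closed] by (intro poly_eqI) (simp add: coeff_map_poly)
    ultimately have "\<exists>h\<in>H. poly [:- ?a h \<theta>, 1:] \<theta> = 0" by (intro bexI[of _ \<one>]) auto
    then show ?thesis unfolding P_def poly_prod using finH prod_zero by metis
  qed
  have "poly (map_poly ?\<Psi> P) (?\<Psi> \<theta>) = ?\<Psi> (poly P \<theta>)"
  proof -
    have "?\<Psi> (poly P \<theta>) = (\<Sum>k\<le>degree P. ?\<Psi> (coeff P k * \<theta> ^ k))"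
      unfolding poly_altdef
      by (rule rhom_sum[OF hom\<Psi> C]) (use cpolyD[OF P] \<theta> in \<open>auto intro!: sring_mult[OF C] sring_power[OF C]\<close>)
    also have "\<dots> = (\<Sum>k\<le>degree P. ?\<Psi> (coeff P k) * ?\<Psi> \<theta> ^ k)"
      using cpolyD[OF P] \<theta> sring_power[OF C \<theta>]
      by (intro sum.cong) (simp_all add: rhom_mult[OF hom\<Psi>] rhom_power[OF hom\<Psi> C])
    also have "\<dots> = (\<Sum>k\<le>degree P. coeff (map_poly ?\<Psi> P) k * ?\<Psi> \<theta> ^ k)"
      by (simp add: coeff_map_poly)
    also have "\<dots> = poly (map_poly ?\<Psi> P) (?\<Psi> \<theta>)"
      unfolding poly_altdef
      by (rule sum.mono_neutral_right) (auto simp: coeff_eq_0 map_poly_degree_leq)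
    finally show ?thesis ..
  qed
  then have z: "poly (map_poly ?\<Psi> P) (?\<Psi> \<theta>) = 0" using \<open>poly P \<theta> = 0\<close> by simp
  have "map_poly ?\<Psi> P - map_poly ?\<Psi>' P \<in> cpoly (cpoly Q)"
    using agree[OF cpolyD[OF inv]] by (auto simp: cpoly_def coeff_map_poly \<psi>0 \<psi>0')
  then have "poly (map_poly ?\<Psi> P - map_poly ?\<Psi>' P) (?\<Psi> \<theta>) \<in> cpoly Q"
    by (rule poly_cpoly_in[OF C smcQ _ \<Psi>\<theta>])
  then have "poly (map_poly ?\<Psi>' P) (?\<Psi> \<theta>) \<in> cpoly Q"
    using z smod_uminus[OF smcQ C] by fastforce
  moreover have "map_poly ?\<Psi>' P = (\<Prod>h\<in>H. [:- ?\<Psi>' (?a h \<theta>), 1:])"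
  proof -
    have "map_poly ?\<Psi>' P = (\<Prod>h\<in>H. map_poly ?\<Psi>' [:- ?a h \<theta>, 1:])"
      unfolding P_def by (rule rhom_prod[OF rhom_map_poly[OF hom\<Psi>' C] CC]) (use fac in auto)
    also have "\<dots> = (\<Prod>h\<in>H. [:- ?\<Psi>' (?a h \<theta>), 1:])"
      by (intro prod.cong) (simp_all add: map_poly_pCons rhom_uminus[OF hom\<Psi>' C a\<theta>] rhom_1[OF hom\<Psi>'])
    finally show ?thesis .
  qed
  ultimately have "(\<Prod>h\<in>H. ?\<Psi> \<theta> - ?\<Psi>' (?a h \<theta>)) \<in> cpoly Q" by (simp add: poly_prod)
  moreover have "(\<Prod>h\<in>H. ?\<Psi> \<theta> - ?\<Psi>' (?a h \<theta>)) \<in> cpoly S - cpoly Q"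
  proof (rule pidl_prod[OF cQ C finH])
    fix h assume h: "h \<in> H"
    have "?\<Psi>' (?a h \<theta>) \<in> cpoly S" by (rule map_poly_cpoly[of S \<psi>' S, OF \<psi>'(2) \<psi>0' a\<theta>[OF h]])
    then have "?\<Psi> \<theta> - ?\<Psi>' (?a h \<theta>) \<in> cpoly S" using sring_diff[OF C \<Psi>\<theta>] by blast
    moreover have "coeff (?\<Psi> \<theta> - ?\<Psi>' (?a h \<theta>)) (f h) \<notin> Q"
      using t(2)[OF h] by (simp add: coeff_map_poly \<psi>0 \<psi>0' a0[OF h] \<theta>f[OF h])
    ultimately show "?\<Psi> \<theta> - ?\<Psi>' (?a h \<theta>) \<in> cpoly S - cpoly Q" by (auto simp: cpoly_def[of Q])
  qed
  ultimately show False by blast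
qed

end

section \<open>The relative trace of a character with values in the prime field\<close>

locale ring_action_character = ring_action G act S for G :: "('g, 'm) monoid_scheme" (structure)
    and act :: "'g \<Rightarrow> 'r::comm_ring_1 \<Rightarrow> 'r" and S +
  fixes p :: nat and \<chi> :: "'g \<Rightarrow> nat" and t :: 'g
  assumes p: "normalization_semidom_class.prime p" "p = CHAR('r)"
    and \<chi>_less: "\<sigma> \<in> carrier G \<Longrightarrow> \<chi> \<sigma> < p"
    and \<chi>_mult: "\<sigma> \<in> carrier G \<Longrightarrow> \<tau> \<in> carrier G \<Longrightarrow> \<chi> (\<sigma> \<otimes> \<tau>) = (\<chi> \<sigma> + \<chi> \<tau>) mod p"
    and t: "t \<in> carrier G" "\<chi> t = 1"
begin

definition Ker :: "'g set" where "Ker = {\<sigma> \<in> carrier G. \<chi> \<sigma> = 0}"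

lemma p_pos: "0 < p" using prime_gt_0_nat[OF p(1)] .

lemma \<chi>_one: "\<chi> \<one> = 0"
proof -
  have "\<chi> \<one> = (\<chi> \<one> + \<chi> \<one>) mod p" using \<chi>_mult[of \<one> \<one>] by simp
  moreover have "\<chi> \<one> < p" using \<chi>_less by simp
  ultimately show ?thesis by (cases "\<chi> \<one> + \<chi> \<one> < p") (auto simp: le_mod_geq)
qed

lemma \<chi>_pow: "i < p \<Longrightarrow> \<chi> (t [^] i) = i"
  by (induction i) (auto simp: \<chi>_one nat_pow_Suc \<chi>_mult t)

lemma \<chi>_inv: "\<sigma> \<in> carrier G \<Longrightarrow> (\<chi> (inv \<sigma>) + \<chi> \<sigma>) mod p = 0"
  using \<chi>_mult[of "inv \<sigma>" \<sigma>] by (simp add: \<chi>_one)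

lemma subgroup_Ker: "subgroup Ker G"
proof
  show "inv x \<in> Ker" if "x \<in> Ker" for x
    using that \<chi>_inv[of x] \<chi>_less[of "inv x"] by (auto simp: Ker_def)
qed (auto simp: Ker_def \<chi>_mult \<chi>_one)

lemma act_eq_of_\<chi>_eq:
  assumes "s \<in> invs Ker" "\<sigma> \<in> carrier G" "\<tau> \<in> carrier G" "\<chi> \<sigma> = \<chi> \<tau>"
  shows "act \<sigma> s = act \<tau> s"
proof -
  have s: "s \<in> S" using assms(1) by (simp add: invs_def)
  have "\<chi> (inv \<tau> \<otimes> \<sigma>) = 0" using assms \<chi>_mult[of "inv \<tau>" \<sigma>] \<chi>_inv[of \<tau>] by simp
  then have "inv \<tau> \<otimes> \<sigma> \<in> Ker" using assms by (simp add: Ker_def)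
  then have "act \<tau> (act (inv \<tau> \<otimes> \<sigma>) s) = act \<tau> s" using assms(1) by (simp add: invs_def)
  moreover have "act \<tau> (act (inv \<tau> \<otimes> \<sigma>) s) = act \<sigma> s"
    using assms s by (simp flip: act_mult add: m_assoc[symmetric])
  ultimately show ?thesis by simp
qed

lemma act_act_pow:
  assumes s: "s \<in> invs Ker" and \<sigma>: "\<sigma> \<in> carrier G" and i: "i < p"
  shows "act \<sigma> (act (t [^] i) s) = act (t [^] ((\<chi> \<sigma> + i) mod p)) s"
proof -
  have "s \<in> S" using s by (simp add: invs_def)
  then have "act \<sigma> (act (t [^] i) s) = act (\<sigma> \<otimes> t [^] i) s" using \<sigma> t by (simp add: act_mult)
  also have "\<dots> = act (t [^] ((\<chi> \<sigma> + i) mod p)) s"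
    by (rule act_eq_of_\<chi>_eq[OF s]) (use \<sigma> t i p_pos in \<open>simp_all add: \<chi>_mult \<chi>_pow\<close>)
  finally show ?thesis .
qed

lemma sum_mod_reindex: "(\<Sum>i<p. f ((c + i) mod p)) = (\<Sum>i<p. f i)" for f :: "nat \<Rightarrow> 'r"
proof (rule sum.reindex_bij_betw)
  have inj: "inj_on (\<lambda>i. (c + i) mod p) {..<p}"
  proof (rule inj_onI)
    fix i j assume ij: "i \<in> {..<p}" "j \<in> {..<p}" "(c + i) mod p = (c + j) mod p"
    then have "[c + i = c + j] (mod p)" by (simp add: cong_def)
    then have "[i = j] (mod p)" by (simp add: cong_add_lcancel_nat)
    then show "i = j" using ij by (simp add: cong_def)
  qed
  moreover have "(\<lambda>i. (c + i) mod p) ` {..<p} \<subseteq> {..<p}" using p_pos by auto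
  ultimately show "bij_betw (\<lambda>i. (c + i) mod p) {..<p} {..<p}"
    using endo_inj_surj[of "{..<p}"] by (auto simp: bij_betw_def)
qed

lemma of_nat_mod_p: "of_nat (m mod p) = (of_nat m :: 'r)"
  by (simp add: p(2) of_nat_eq_iff_cong_CHAR cong_def)

text \<open>The powers of \<open>t\<close> represent the cosets of \<open>Ker\<close>, so on
  \<open>Ker\<close>-invariants this is the relative trace.\<close>

definition Tr :: "'r \<Rightarrow> 'r" where "Tr s = (\<Sum>i<p. act (t [^] i) s)"

lemma pow_closed: "t [^] (i::nat) \<in> carrier G" using t by simp

lemma Tr_invariant: assumes s: "s \<in> invs Ker" shows "Tr s \<in> invs (carrier G)"
proof -
  have sS: "s \<in> S" using s by (simp add: invs_def)
  have "act \<sigma> (Tr s) = Tr s" if \<sigma>: "\<sigma> \<in> carrier G" for \<sigma>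
  proof -
    have "act \<sigma> (Tr s) = (\<Sum>i<p. act \<sigma> (act (t [^] i) s))"
      unfolding Tr_def by (rule rhom_sum[OF act_hom[OF \<sigma>] S]) (use act_in[OF pow_closed sS] in auto)
    also have "\<dots> = (\<Sum>i<p. act (t [^] ((\<chi> \<sigma> + i) mod p)) s)"
      by (intro sum.cong) (auto simp: act_act_pow[OF s \<sigma>])
    also have "\<dots> = Tr s" unfolding Tr_def by (rule sum_mod_reindex)
    finally show ?thesis .
  qed
  moreover have "Tr s \<in> S" unfolding Tr_def by (rule sring_sum[OF S]) (use act_in[OF pow_closed sS] in auto)
  ultimately show ?thesis by (simp add: invs_def)
qed

text \<open>Weight the conjugates of \<open>s\<close> by their index. As \<open>\<sigma>\<close>
  shifts the index by \<open>\<chi> \<sigma>\<close>, the weights change by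
  \<open>\<chi> \<sigma>\<close>, which leaves \<open>\<chi> \<sigma>\<close> times the trace;
  wrapping around modulo \<open>p\<close> is harmless in characteristic \<open>p\<close>.\<close>

lemma trace_is_coboundary:
  assumes s: "s \<in> invs Ker"
  shows "\<exists>b\<in>S. \<forall>\<sigma>\<in>carrier G. act \<sigma> b - b = Tr s * of_nat (\<chi> \<sigma>)"
proof -
  have sS: "s \<in> S" using s by (simp add: invs_def)
  let ?T = "\<lambda>i. act (t [^] i) s"
  have TS: "?T i \<in> S" for i :: nat using act_in[OF pow_closed sS] .
  define b where "b = - (\<Sum>i<p. of_nat i * ?T i)"
  have sumS: "(\<Sum>i<p. of_nat i * ?T i) \<in> S"
    by (intro sring_sum[OF S] sring_mult[OF S] sring_of_nat[OF S] TS)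
  then have bS: "b \<in> S" unfolding b_def by (rule sring_uminus[OF S])
  have act_nat: "act \<sigma> (of_nat k) = of_nat k" if "\<sigma> \<in> carrier G" for \<sigma> k
    using rhom_0[OF act_hom[OF that] S] rhom_1[OF act_hom[OF that]]
    by (induction k) (simp_all add: rhom_add[OF act_hom[OF that] sring_1[OF S] sring_of_nat[OF S]])
  have "act \<sigma> b - b = Tr s * of_nat (\<chi> \<sigma>)" if \<sigma>: "\<sigma> \<in> carrier G" for \<sigma>
  proof -
    note h = act_hom[OF \<sigma>]
    have "act \<sigma> b = - (\<Sum>i<p. act \<sigma> (of_nat i * ?T i))"
      unfolding b_def rhom_uminus[OF h S sumS]
      by (subst rhom_sum[OF h S]) (auto intro!: sring_mult[OF S] sring_of_nat[OF S] TS)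
    also have "(\<Sum>i<p. act \<sigma> (of_nat i * ?T i)) =
      (\<Sum>i<p. (of_nat ((\<chi> \<sigma> + i) mod p) - of_nat (\<chi> \<sigma>)) * ?T ((\<chi> \<sigma> + i) mod p))"
      by (intro sum.cong refl)
        (simp add: rhom_mult[OF h sring_of_nat[OF S] TS] act_nat[OF \<sigma>] act_act_pow[OF s \<sigma>] of_nat_mod_p)
    also have "\<dots> = (\<Sum>i<p. (of_nat i - of_nat (\<chi> \<sigma>)) * ?T i)"
      by (rule sum_mod_reindex[of "\<lambda>i. (of_nat i - of_nat (\<chi> \<sigma>)) * ?T i"])
    also have "\<dots> = (\<Sum>i<p. of_nat i * ?T i) - of_nat (\<chi> \<sigma>) * Tr s"
      unfolding Tr_def by (simp add: sum_distrib_left sum_subtractf left_diff_distrib)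
    finally show ?thesis by (simp add: b_def algebra_simps)
  qed
  then show ?thesis using bS by blast
qed

text \<open>By \<open>trace_is_coboundary\<close> it is enough that some power of \<open>a\<close>
  is a trace. If the extended trace ideal contained no power of \<open>a\<close>, a prime
  \<open>Q\<close> over it would avoid \<open>a\<close>. Traces vanish modulo \<open>Q\<close>, so
  by independence two powers of \<open>t\<close> agree on \<open>Ker\<close>-invariants; hence some
  \<open>\<sigma>\<close> with \<open>\<chi> \<sigma> \<noteq> 0\<close> acts trivially modulo
  \<open>Q\<close>, and \<open>a \<in> Q\<close>.\<close>

lemma power_annihilates_character:
  assumes fg: "S = gs M g (invs (carrier G))" and a: "a \<in> invs (carrier G)"
    and aI: "\<And>\<sigma> Q. \<sigma> \<in> carrier G \<Longrightarrow> \<chi> \<sigma> \<noteq> 0 \<Longrightarrow> idl S Q \<Longrightarrow> (\<And>s. s \<in> S \<Longrightarrow> act \<sigma> s - s \<in> Q) \<Longrightarrow> a \<in> Q"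
  shows "\<exists>m. \<exists>b\<in>S. \<forall>\<sigma>\<in>carrier G. act \<sigma> b - b = a ^ m * of_nat (\<chi> \<sigma>)"
proof -
  let ?A = "invs (carrier G)" and ?B = "invs Ker"
  have A: "sring ?A" by (rule sring_invs) simp
  have B: "sring ?B" by (rule sring_invs) (auto simp: Ker_def)
  have AB: "?A \<subseteq> ?B" by (auto simp: invs_def Ker_def)
  have AS: "?A \<subseteq> S" and BS: "?B \<subseteq> S" by (auto simp: invs_def)
  define J where "J = Tr ` ?B"
  have smJ: "smod ?A J"
  proof -
    have "Tr 0 = 0" by (simp add: Tr_def act_0 t)
    then have "0 \<in> J" unfolding J_def using sring_0[OF B] by (metis imageI)
    moreover have "Tr x + Tr y \<in> J" if "x \<in> ?B" "y \<in> ?B" for x y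
    proof -
      have "Tr (x + y) = Tr x + Tr y" unfolding Tr_def sum.distrib[symmetric]
        by (intro sum.cong refl rhom_add[OF act_hom[OF pow_closed]]) (use that BS in auto)
      then show ?thesis unfolding J_def using sring_add[OF B that] by (metis imageI)
    qed
    moreover have "c * Tr x \<in> J" if "c \<in> ?A" "x \<in> ?B" for c x
    proof -
      have "act (t [^] i) (c * x) = c * act (t [^] i) x" for i :: nat
        using rhom_mult[OF act_hom[OF pow_closed], of c x i] that AS BS pow_closed by (auto simp: invs_def)
      then have "Tr (c * x) = c * Tr x" unfolding Tr_def sum_distrib_left by simp
      moreover have "c * x \<in> ?B" using that AB sring_mult[OF B] by blast
      ultimately show ?thesis unfolding J_def by (metis imageI)
    qed
    ultimately show ?thesis by (auto simp: smod_def J_def)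
  qed
  have J: "idl ?A J" using smJ Tr_invariant by (auto simp: idl_def J_def)
  let ?JS = "gs M g J"
  have "idl S ?JS"
  proof -
    have "?JS \<subseteq> S" using idl_subset[OF J] fg unfolding gs_def by blast
    moreover have "smod S ?JS"
      using smod_gs[OF smJ] gs_mult[OF A smJ fg S] by (auto simp: smod_def)
    ultimately show ?thesis by (simp add: idl_def)
  qed
  have "\<exists>k. a ^ k \<in> ?JS"
  proof (rule ccontr)
    assume "\<not> ?thesis"
    then obtain Q where Q: "pidl S Q" "?JS \<subseteq> Q" "a \<notin> Q"
      using prime_ideal_avoiding[OF S \<open>idl S ?JS\<close>, of a] a AS by blast
    have TrQ: "Tr s \<in> Q" if "s \<in> ?B" for s
      using gs_ideal_mult[OF A smJ fg S, of "Tr s" 1] sring_1[OF S] Q(2) that by (auto simp: J_def)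
    have "\<exists>i j. i < p \<and> j < p \<and> i \<noteq> j \<and> (\<forall>b\<in>?B. act (t [^] i) b - act (t [^] j) b \<in> Q)"
    proof (rule ccontr)
      assume no: "\<not> ?thesis"
      have "\<forall>i\<in>{..<p}. (1::'r) \<in> Q"
      proof (rule artin_independence[OF B S Q(1), of "{..<p}" "\<lambda>i. act (t [^] i)" "\<lambda>_. 1"])
        show "rhom ?B (act (t [^] i))" for i :: nat
          using act_hom[OF pow_closed, of i] BS by (auto simp: rhom_def subset_iff)
        show "act (t [^] i) b \<in> S" if "b \<in> ?B" for i :: nat and b
          using act_in[OF pow_closed] BS that by blast
        show "\<exists>b\<in>?B. act (t [^] i) b - act (t [^] j) b \<notin> Q" if "i \<in> {..<p}" "j \<in> {..<p}" "i \<noteq> j" for i j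
          using no that by blast
        show "(\<Sum>i<p. 1 * act (t [^] i) b) \<in> Q" if "b \<in> ?B" for b
          using TrQ[OF that] by (simp add: Tr_def)
      qed (use sring_1[OF S] in auto)
      then show False using p_pos pidl_1[OF Q(1)] by auto
    qed
    then obtain i j where ij: "i < p" "j < p" "i \<noteq> j" "\<And>b. b \<in> ?B \<Longrightarrow> act (t [^] i) b - act (t [^] j) b \<in> Q"
      by blast
    obtain h where h: "h \<in> Ker" "\<And>s. s \<in> S \<Longrightarrow> act (t [^] i) s - act (t [^] j) (act h s) \<in> Q"
      using homs_agreeing_on_invariants[OF subgroup_Ker Q(1) act_hom[OF pow_closed] act_in[OF pow_closed]
        act_hom[OF pow_closed] act_in[OF pow_closed] ij(4)] by blast
    \<comment> \<open>Agreement on \<open>Ker\<close>-invariants extends to \<open>S\<close> after a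
      twist by \<open>h \<in> Ker\<close>; \<open>\<sigma>\<close> then compares the two
      sides.\<close>
    define \<rho> where "\<rho> = t [^] j \<otimes> h"
    define \<sigma> where "\<sigma> = t [^] i \<otimes> inv \<rho>"
    have hG: "h \<in> carrier G" using h by (simp add: Ker_def)
    have \<rho>: "\<rho> \<in> carrier G" "\<chi> \<rho> = j"
      using h hG pow_closed ij by (simp_all add: \<rho>_def \<chi>_mult \<chi>_pow Ker_def)
    have \<sigma>: "\<sigma> \<in> carrier G" using \<rho> pow_closed by (simp add: \<sigma>_def)
    have "\<sigma> \<otimes> \<rho> = t [^] i" using \<rho> pow_closed by (simp add: \<sigma>_def m_assoc)
    then have "i = (\<chi> \<sigma> + j) mod p" using \<chi>_mult[OF \<sigma> \<rho>(1)] \<rho>(2) \<chi>_pow[OF ij(1)] by simp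
    then have "\<chi> \<sigma> \<noteq> 0" using ij(2,3) by (cases "\<chi> \<sigma> = 0") simp_all
    moreover have "act \<sigma> s - s \<in> Q" if s: "s \<in> S" for s
    proof -
      let ?u = "act (inv \<rho>) s"
      have u: "?u \<in> S" using act_in \<rho> s by simp
      have "act (t [^] i) ?u = act \<sigma> s" using \<rho> s pow_closed by (simp add: \<sigma>_def act_mult)
      moreover have "act (t [^] j) (act h ?u) = act \<rho> ?u" using u hG pow_closed by (simp add: \<rho>_def act_mult)
      moreover have "act \<rho> ?u = s" using \<rho> s by (simp flip: act_mult add: act_one)
      ultimately show ?thesis using h(2)[OF u] by simp
    qed
    ultimately show False using aI[OF \<sigma>] pidl_idl[OF Q(1)] Q(3) by blast
  qed
  then obtain k where "a ^ k \<in> ?JS" by blast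
  \<comment> \<open>Lying over brings the power back from the extended ideal into
    \<open>J\<close>.\<close>
  then have "(a ^ k) ^ M \<in> J" using integral_ideal_power[OF A J fg S] sring_power[OF A a] by blast
  then obtain s where "s \<in> ?B" "a ^ (k * M) = Tr s" by (auto simp: J_def power_mult)
  then show ?thesis using trace_is_coboundary by metis
qed

end

section \<open>Homogeneous regular sequences\<close>

text \<open>Subspaces are treated as modules over the subring of constants.\<close>

lemma subspace_complement:
  fixes V :: "'k::field mpoly set"
  assumes V: "smod (range const) V" and I: "smod (range const) I" "I \<subseteq> V"
  obtains W where "smod (range const) W" "W \<subseteq> V" "W \<inter> I \<subseteq> {0}" "\<And>v. v \<in> V \<Longrightarrow> \<exists>w\<in>W. v - w \<in> I"
proof -
  let ?K = "range const :: 'k mpoly set"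
  have K: "sring ?K"
    by (auto simp: sring_def simp flip: const_1 const_mult) (metis const_def rangeI single_diff)
  define Q where "Q N \<longleftrightarrow> N \<subseteq> V \<and> N \<inter> I \<subseteq> {0}" for N
  have Q0: "Q {0}" using smod_0[OF V] by (auto simp: Q_def)
  have QU: "Q (\<Union>\<C>)" if "\<And>M. M \<in> \<C> \<Longrightarrow> Q M" for \<C> using that unfolding Q_def by blast
  have sm0: "smod ?K {0}" by (simp add: smod_def)
  obtain W where W: "smod ?K W" "{0} \<subseteq> W" "Q W" and max: "\<And>N. smod ?K N \<Longrightarrow> W \<subseteq> N \<Longrightarrow> Q N \<Longrightarrow> N = W"
    using smod_Zorn[OF sm0, of Q] Q0 QU by metis
  have WV: "W \<subseteq> V" and WI: "W \<inter> I \<subseteq> {0}" using W(3) by (auto simp: Q_def)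
  have "\<exists>w\<in>W. v - w \<in> I" if v: "v \<in> V" for v
  proof (cases "v \<in> W")
    case True then show ?thesis using smod_0[OF I(1)] by (intro bexI[of _ v]) auto
  next
    case False
    define N where "N = {b * v + q | b q. b \<in> ?K \<and> q \<in> W}"
    note ins = smod_insert[OF K W(1), of v, folded N_def]
    have "\<not> Q N" using max[OF ins(1,2)] ins(3) False by blast
    moreover have "N \<subseteq> V" using v WV unfolding N_def by (auto intro!: smod_add[OF V] smod_scale[OF V])
    ultimately obtain z where z: "z \<in> N" "z \<in> I" "z \<noteq> 0" by (auto simp: Q_def)
    obtain b w where b: "z = const b * v + w" "w \<in> W" using z(1) by (auto simp: N_def)
    have b0: "b \<noteq> 0"
    proof
      assume "b = 0"
      then have "z = w" using b by (simp add: const_0)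
      then show False using WI z b by blast
    qed
    let ?c = "const (inverse b)"
    have "?c * z = (?c * const b) * v + ?c * w" using b by (simp add: algebra_simps)
    also have "?c * const b = 1" using b0 by (simp add: const_1 flip: const_mult)
    finally have "v - (- (?c * w)) = ?c * z" by simp
    moreover have "?c * z \<in> I" using smod_scale[OF I(1) _ z(2)] by blast
    moreover have "- (?c * w) \<in> W" using smod_uminus[OF W(1) K smod_scale[OF W(1) _ b(2)]] by blast
    ultimately show ?thesis by metis
  qed
  then show thesis using that W(1) WV WI by blast
qed

lemma gs_mono: "M \<le> N \<Longrightarrow> 0 \<in> I \<Longrightarrow> gs M g I \<subseteq> gs N g I"
proof
  fix z assume MN: "M \<le> N" and 0: "0 \<in> I" and z: "z \<in> gs M g I"
  obtain c where c: "\<And>j. c j \<in> I" "z = (\<Sum>j<M. c j * g j)" using z by (rule gsE) blast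
  have "z = (\<Sum>j<M. (if j < M then c j else 0) * g j)" using c(2) by simp
  also have "\<dots> = (\<Sum>j<N. (if j < M then c j else 0) * g j)"
    using MN by (intro sum.mono_neutral_left) auto
  also have "\<dots> \<in> gs N g I" by (rule gsI) (use c 0 in auto)
  finally show "z \<in> gs N g I" .
qed

section \<open>Expansion of a graded algebra along a homogeneous regular sequence\<close>

abbreviation mono_var :: "nat \<Rightarrow> nat \<Rightarrow>\<^sub>0 nat" where "mono_var i \<equiv> Poly_Mapping.single i 1"

locale hom_regular_sequence =
  fixes A :: "'k::field mpoly set" and f :: "nat \<Rightarrow> 'k mpoly" and l :: nat
  assumes A: "sring A" and constA: "\<And>c. const c \<in> A" and grA: "\<And>u d. u \<in> A \<Longrightarrow> hom_component d u \<in> A"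
    and fA: "\<And>i. i < l \<Longrightarrow> f i \<in> A" and hom: "\<And>i. i < l \<Longrightarrow> \<exists>d. homogeneous d (f i)"
    and f0: "\<And>i. i < l \<Longrightarrow> Poly_Mapping.lookup (f i) 0 = 0"
    and reg: "\<And>i a. i < l \<Longrightarrow> a \<in> A \<Longrightarrow> a * f i \<in> gs i f A \<Longrightarrow> a \<in> gs i f A"
begin

text \<open>The outer variables stand for the \<open>f i\<close>; the inner polynomials are the
  coefficients.\<close>

definition \<Phi> :: "'k mpoly mpoly \<Rightarrow> 'k mpoly" where "\<Phi> = subst_poly id f"

lemma rhom_id: "rhom UNIV (id :: 'k mpoly \<Rightarrow> 'k mpoly)" by (simp add: rhom_def)
lemmas \<Phi>_add = subst_poly_add[OF rhom_id, of f, folded \<Phi>_def]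
  and \<Phi>_mult = subst_poly_mult[OF rhom_id, of f, folded \<Phi>_def]
  and \<Phi>_sum = subst_poly_sum[OF rhom_id, of f, folded \<Phi>_def]
  and \<Phi>_zero = subst_poly_zero[of id f, folded \<Phi>_def]
lemma \<Phi>_const: "\<Phi> (const c) = c" by (simp add: \<Phi>_def subst_poly_const)
lemma \<Phi>_var: "\<Phi> (var i) = f i" by (simp add: \<Phi>_def subst_poly_var)
lemma \<Phi>_single: "\<Phi> (Poly_Mapping.single m c) = c * meval f m" by (simp add: \<Phi>_def subst_poly_single)
lemma \<Phi>_meval: "\<Phi> U = (\<Sum>m\<in>Poly_Mapping.keys U. Poly_Mapping.lookup U m * meval f m)"
  by (simp add: \<Phi>_def subst_poly_meval)

lemma smodA: "smod A (gs i f A)" by (rule smod_gs[OF sring_smod[OF A]])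

lemma meval_A: "Poly_Mapping.keys m \<subseteq> {..<l} \<Longrightarrow> meval f m \<in> A"
  unfolding meval_def by (intro sring_prod[OF A] sring_power[OF A] fA) auto

lemma meval_gs:
  assumes m: "Poly_Mapping.keys m \<subseteq> {..<l}" and i: "i \<in> Poly_Mapping.keys m" "i < k"
  shows "meval f m \<in> gs k f A"
proof -
  have "m = mono_var i + (m - mono_var i)"
    using i(1) by (intro poly_mapping_eqI) (auto simp: lookup_add lookup_minus lookup_single when_def in_keys_iff)
  then have "meval f m = f i * meval f (m - mono_var i)" by (metis meval_add meval_single power_one_right)
  moreover have "Poly_Mapping.keys (m - mono_var i) \<subseteq> Poly_Mapping.keys m"
    by (auto simp: in_keys_iff lookup_minus)
  then have "Poly_Mapping.keys (m - mono_var i) \<subseteq> {..<l}" using m by (rule order_trans)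
  then have "meval f (m - mono_var i) \<in> A" by (rule meval_A)
  then have "meval f (m - mono_var i) * f i \<in> gs k f A" by (rule smod_scale[OF smodA]) (rule gs_gen[OF A i(2)])
  ultimately show ?thesis by (simp add: mult.commute)
qed

text \<open>Natural subtraction makes \<open>d - e\<close> meaningless for \<open>d < e\<close>; the
  clause \<open>c j = 0\<close> covers that case.\<close>

lemma gs_graded:
  assumes "u \<in> gs l f A"
  shows "\<exists>c. (\<forall>j. c j \<in> A) \<and> (\<forall>j<l. \<exists>e. homogeneous e (f j) \<and> homogeneous (d - e) (c j) \<and> (d < e \<longrightarrow> c j = 0)) \<and>
    hom_component d u = (\<Sum>j<l. f j * c j)"
proof -
  obtain c where c: "\<And>j. c j \<in> A" "u = (\<Sum>j<l. c j * f j)" using assms by (rule gsE) blast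
  obtain e where e: "\<And>j. j < l \<Longrightarrow> homogeneous (e j) (f j)" using hom by metis
  define c' where "c' j = (if e j \<le> d then hom_component (d - e j) (c j) else 0)" for j
  have "hom_component d u = (\<Sum>j<l. hom_component d (f j * c j))" by (simp add: c(2) hom_component_sum mult.commute)
  also have "\<dots> = (\<Sum>j<l. f j * c' j)"
    by (intro sum.cong refl) (simp add: hom_component_mult_homogeneous[OF e] c'_def)
  finally have "hom_component d u = (\<Sum>j<l. f j * c' j)" .
  moreover have "c' j \<in> A" for j using grA c(1) sring_0[OF A] by (simp add: c'_def)
  moreover have "homogeneous (d - e j) (c' j)" for j by (simp add: c'_def homogeneous_hom_component homogeneous_0)
  moreover have "d < e j \<longrightarrow> c' j = 0" for j by (simp add: c'_def)
  ultimately show ?thesis using e by blast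
qed

text \<open>A complement is chosen in each degree separately, so that expansions can be found by
  induction on the degree.\<close>

lemma exists_graded_complement:
  obtains W where "smod (range const) W" "W \<subseteq> A" "W \<inter> gs l f A \<subseteq> {0}"
    "\<And>d u. u \<in> A \<Longrightarrow> homogeneous d u \<Longrightarrow> \<exists>w\<in>W. homogeneous d w \<and> u - w \<in> gs l f A"
proof -
  define V where "V d = {u \<in> A. homogeneous d u}" for d
  define I where "I d = V d \<inter> gs l f A" for d
  have homc: "homogeneous d (const c * u)" if "homogeneous d u" for d c and u :: "'k mpoly"
    using homogeneous_mult[OF homogeneous_const that, of c] by simp
  have V: "smod (range const) (V d)" for d
    using sring_0[OF A] sring_add[OF A] sring_mult[OF A constA]
    by (auto simp: smod_def V_def homogeneous_0 homogeneous_add homc)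
  have I: "smod (range const) (I d)" for d
    using V[of d] smodA[of l] constA unfolding smod_def I_def by blast
  have "\<exists>W. smod (range const) W \<and> W \<subseteq> V d \<and> W \<inter> I d \<subseteq> {0} \<and> (\<forall>v\<in>V d. \<exists>w\<in>W. v - w \<in> I d)" for d
    using subspace_complement[OF V[of d] I[of d]] unfolding I_def by (metis inf_le1)
  then obtain Wd where Wd: "\<And>d. smod (range const) (Wd d)" "\<And>d. Wd d \<subseteq> V d" "\<And>d. Wd d \<inter> I d \<subseteq> {0}"
    "\<And>d v. v \<in> V d \<Longrightarrow> \<exists>w\<in>Wd d. v - w \<in> I d" by metis
  define W where "W = {w \<in> A. \<forall>d. hom_component d w \<in> Wd d}"
  have hc: "hom_component d (const c * w) = const c * hom_component d w" for d c and w :: "'k mpoly"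
    using hom_component_mult_homogeneous[OF homogeneous_const, of d c w] by simp
  have "smod (range const) W"
    unfolding smod_def W_def
    using sring_0[OF A] sring_add[OF A] sring_mult[OF A constA] smod_0[OF Wd(1)] smod_add[OF Wd(1)] smod_scale[OF Wd(1)]
    by (auto simp: hom_component_zero hom_component_add hc)
  moreover have "W \<subseteq> A" by (auto simp: W_def)
  moreover have "w = 0" if w: "w \<in> W" "w \<in> gs l f A" for w
  proof -
    have "hom_component d w = 0" for d
    proof -
      obtain c where c: "\<And>j. c j \<in> A" "hom_component d w = (\<Sum>j<l. f j * c j)" using gs_graded[OF w(2)] by blast
      have "hom_component d w = (\<Sum>j<l. c j * f j)" using c(2) by (simp add: mult.commute)
      then have "hom_component d w \<in> gs l f A" using gsI[of c A f l, OF c(1)] by simp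
      moreover have "hom_component d w \<in> Wd d" using w(1) by (simp add: W_def)
      ultimately show ?thesis using Wd(2,3)[of d] by (auto simp: I_def)
    qed
    then show ?thesis using sum_hom_component[of w] by simp
  qed
  moreover have "\<exists>w\<in>W. homogeneous d w \<and> u - w \<in> gs l f A" if u: "u \<in> A" "homogeneous d u" for d u
  proof -
    obtain w where w: "w \<in> Wd d" "u - w \<in> I d" using Wd(4)[of u d] u by (auto simp: V_def)
    have wV: "w \<in> A" "homogeneous d w" using w Wd(2) by (auto simp: V_def)
    have "hom_component e w \<in> Wd e" for e
      using w(1) smod_0[OF Wd(1)] by (simp add: hom_component_homogeneous[OF wV(2)])
    then show ?thesis using w wV by (auto simp: W_def I_def)
  qed
  ultimately show thesis using that[of W] by blast
qed

definition W :: "'k mpoly set" where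
  "W = (SOME W. smod (range const) W \<and> W \<subseteq> A \<and> W \<inter> gs l f A \<subseteq> {0} \<and>
    (\<forall>d u. u \<in> A \<longrightarrow> homogeneous d u \<longrightarrow> (\<exists>w\<in>W. homogeneous d w \<and> u - w \<in> gs l f A)))"

lemma W: "smod (range const) W" "W \<subseteq> A" "W \<inter> gs l f A \<subseteq> {0}"
    "\<And>d u. u \<in> A \<Longrightarrow> homogeneous d u \<Longrightarrow> \<exists>w\<in>W. homogeneous d w \<and> u - w \<in> gs l f A"
proof -
  have "\<exists>W. smod (range const) W \<and> W \<subseteq> A \<and> W \<inter> gs l f A \<subseteq> {0} \<and>
    (\<forall>d u. u \<in> A \<longrightarrow> homogeneous d u \<longrightarrow> (\<exists>w\<in>W. homogeneous d w \<and> u - w \<in> gs l f A))"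
    using exists_graded_complement by metis
  from someI_ex[OF this]
  show "smod (range const) W" "W \<subseteq> A" "W \<inter> gs l f A \<subseteq> {0}"
    "\<And>d u. u \<in> A \<Longrightarrow> homogeneous d u \<Longrightarrow> \<exists>w\<in>W. homogeneous d w \<and> u - w \<in> gs l f A"
    unfolding W_def[symmetric] by blast+
qed

text \<open>The normal forms: \<open>\<Phi>\<close> maps \<open>CW {..<l}\<close> bijectively onto
  \<open>A\<close>, which makes \<open>A\<close> free over the polynomial ring in the
  \<open>f i\<close> with any basis of \<open>W\<close> as a basis.\<close>

definition CW :: "nat set \<Rightarrow> 'k mpoly mpoly set" where
  "CW V = {U \<in> mpv V. \<forall>m. Poly_Mapping.lookup U m \<in> W}"

lemma W0: "0 \<in> W" using smod_0[OF W(1)] .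

lemma CW_0: "0 \<in> CW V" using W0 by (simp add: CW_def sring_0[OF sring_mpv])

lemma CW_add: "U \<in> CW V \<Longrightarrow> U' \<in> CW V \<Longrightarrow> U + U' \<in> CW V"
  using smod_add[OF W(1)] by (simp add: CW_def lookup_add sring_add[OF sring_mpv])

lemma CW_sum: "(\<And>i. i \<in> I \<Longrightarrow> F i \<in> CW V) \<Longrightarrow> sum F I \<in> CW V"
  by (induction I rule: infinite_finite_induct) (auto simp: CW_0 CW_add)

lemma CW_single: "Poly_Mapping.keys m \<subseteq> V \<Longrightarrow> w \<in> W \<Longrightarrow> Poly_Mapping.single m w \<in> CW V"
  using W0 by (auto simp: CW_def mpv_def lookup_single when_def)

lemma CW_lookup: "U \<in> CW V \<Longrightarrow> Poly_Mapping.lookup U m \<in> W" by (simp add: CW_def)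

lemma CW_keys: "U \<in> CW V \<Longrightarrow> m \<in> Poly_Mapping.keys U \<Longrightarrow> Poly_Mapping.keys m \<subseteq> V" by (auto simp: CW_def mpv_def)

lemma CW_scale: assumes "U \<in> CW V" shows "const (const c) * U \<in> CW V"
proof -
  have "const (const c) * U = (\<Sum>m\<in>Poly_Mapping.keys U. Poly_Mapping.single m (const c * Poly_Mapping.lookup U m))"
    by (subst (1) poly_mapping_sum_single[of U]) (simp add: sum_distrib_left const_def mult_single)
  moreover have "\<dots> \<in> CW V"
    by (intro CW_sum CW_single CW_keys[OF assms] smod_scale[OF W(1)] CW_lookup[OF assms]) auto
  ultimately show ?thesis by simp
qed

lemma CW_var: assumes U: "U \<in> CW V" and i: "i \<in> V" shows "var i * U \<in> CW V"
proof -
  have "var i * U = (\<Sum>m\<in>Poly_Mapping.keys U. Poly_Mapping.single (mono_var i + m) (Poly_Mapping.lookup U m))"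
    by (subst (1) poly_mapping_sum_single[of U]) (simp add: sum_distrib_left var_def mult_single)
  moreover have "\<dots> \<in> CW V"
    by (intro CW_sum CW_single CW_lookup[OF U]) (use CW_keys[OF U] i in \<open>auto simp: keys_add_nat\<close>)
  ultimately show ?thesis by simp
qed

lemma \<Phi>_A: assumes "U \<in> CW {..<l}" shows "\<Phi> U \<in> A"
  unfolding \<Phi>_meval
  by (intro sring_sum[OF A] sring_mult[OF A] meval_A CW_keys[OF assms]) (use CW_lookup[OF assms] W(2) in auto)

lemma CW_mono: "V \<subseteq> V' \<Longrightarrow> CW V \<subseteq> CW V'" using mpv_mono by (auto simp: CW_def)

text \<open>Write \<open>u = w + (\<Sum>j<l. f j * c j)\<close> with \<open>w \<in> W\<close>. A
  nonzero \<open>f j\<close> has positive degree because its constant coefficient vanishes, so the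
  relevant \<open>c j\<close> have smaller degree.\<close>

lemma expansion_exists_homogeneous: "u \<in> A \<Longrightarrow> homogeneous d u \<Longrightarrow> \<exists>U\<in>CW {..<l}. \<Phi> U = u"
proof (induction d arbitrary: u rule: less_induct)
  case (less d)
  obtain w where w: "w \<in> W" "homogeneous d w" "u - w \<in> gs l f A" using W(4)[OF less.prems] by blast
  obtain c where c: "\<And>j. c j \<in> A"
    "\<And>j. j < l \<Longrightarrow> \<exists>e. homogeneous e (f j) \<and> homogeneous (d - e) (c j) \<and> (d < e \<longrightarrow> c j = 0)"
    "hom_component d (u - w) = (\<Sum>j<l. f j * c j)" using gs_graded[OF w(3), of d] by blast
  have "hom_component d (u - w) = u - w"
  proof (rule poly_mapping_eqI)
    fix m
    show "Poly_Mapping.lookup (hom_component d (u - w)) m = Poly_Mapping.lookup (u - w) m"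
      using homogeneous_lookup[OF less.prems(2), of m] homogeneous_lookup[OF w(2), of m]
      by (cases "monom_deg m = d") (auto simp: lookup_hom_component lookup_minus)
  qed
  then have u: "u = w + (\<Sum>j<l. f j * c j)" using c(3) by (metis add.commute diff_add_cancel)
  have "\<exists>U. U \<in> CW {..<l} \<and> f j * \<Phi> U = f j * c j" if j: "j < l" for j
  proof -
    obtain e where e: "homogeneous e (f j)" "homogeneous (d - e) (c j)" "d < e \<longrightarrow> c j = 0" using c(2)[OF j] by blast
    consider "d < e" | "e = 0" | "0 < e" "e \<le> d" by linarith
    then show ?thesis
    proof cases
      case 1
      then show ?thesis using e(3) CW_0 by (intro exI[of _ 0]) (simp add: \<Phi>_zero)
    next
      case 2
      then have "f j = 0" using homogeneous_0_imp_const[of "f j"] e(1) f0[OF j] by (simp add: const_0)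
      then show ?thesis using CW_0 by auto
    next
      case 3
      then obtain U where "U \<in> CW {..<l}" "\<Phi> U = c j" using less.IH[of "d - e" "c j"] c(1) e(2) by auto
      then show ?thesis by auto
    qed
  qed
  then obtain U where U: "\<And>j. j < l \<Longrightarrow> U j \<in> CW {..<l} \<and> f j * \<Phi> (U j) = f j * c j" by metis
  define T where "T = const w + (\<Sum>j<l. var j * U j)"
  have "const w \<in> CW {..<l}" unfolding const_def by (rule CW_single) (use w in auto)
  then have "T \<in> CW {..<l}" unfolding T_def by (intro CW_add CW_sum CW_var) (use U in auto)
  moreover have "\<Phi> T = u" unfolding T_def u \<Phi>_add \<Phi>_sum \<Phi>_mult \<Phi>_const \<Phi>_var
    by (intro arg_cong[of _ _ "\<lambda>x. w + x"] sum.cong refl) (use U in auto)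
  ultimately show ?case by blast
qed

lemma expansion_exists: assumes "u \<in> A" shows "\<exists>U\<in>CW {..<l}. \<Phi> U = u"
proof -
  have "\<exists>U. U \<in> CW {..<l} \<and> \<Phi> U = hom_component d u" for d
    using expansion_exists_homogeneous[OF grA[OF assms] homogeneous_hom_component] by blast
  then obtain U where U: "\<And>d. U d \<in> CW {..<l}" "\<And>d. \<Phi> (U d) = hom_component d u" by metis
  have "\<Phi> (\<Sum>d\<in>monom_deg ` Poly_Mapping.keys u. U d) = u" unfolding \<Phi>_sum U(2) by (rule sum_hom_component)
  then show ?thesis using CW_sum[of _ U] U(1) by blast
qed

definition pm_restrict :: "((nat \<Rightarrow>\<^sub>0 nat) \<Rightarrow> bool) \<Rightarrow> 'k mpoly mpoly \<Rightarrow> 'k mpoly mpoly" where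
  "pm_restrict Q U = (\<Sum>m\<in>{m\<in>Poly_Mapping.keys U. Q m}. Poly_Mapping.single m (Poly_Mapping.lookup U m))"

lemma lookup_pm_restrict: "Poly_Mapping.lookup (pm_restrict Q U) m = (if Q m then Poly_Mapping.lookup U m else 0)"
  unfolding pm_restrict_def by (auto simp: lookup_sum lookup_single when_def in_keys_iff)

lemma pm_restrict_split: "U = pm_restrict Q U + pm_restrict (\<lambda>m. \<not> Q m) U"
  by (rule poly_mapping_eqI) (simp add: lookup_add lookup_pm_restrict)

lemma keys_pm_restrict: "Poly_Mapping.keys (pm_restrict Q U) = {m \<in> Poly_Mapping.keys U. Q m}"
  by (auto simp: in_keys_iff lookup_pm_restrict split: if_splits)

lemma CW_pm_restrict: assumes "U \<in> CW V" shows "pm_restrict Q U \<in> CW V"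
  using assms W0 by (auto simp: CW_def mpv_def keys_pm_restrict lookup_pm_restrict)

text \<open>
  Descending induction on \<open>i\<close>: modulo the first \<open>i\<close> elements of the sequence the expansion of \<open>0\<close> has no
  monomials in the remaining ones.
\<close>

lemma expansion_support:
  "i \<le> l \<Longrightarrow> U \<in> CW {..<l} \<Longrightarrow> \<Phi> U \<in> gs i f A \<Longrightarrow> m \<in> Poly_Mapping.keys U \<Longrightarrow> Poly_Mapping.keys m \<inter> {..<i} \<noteq> {}"
proof (induction "l - i" arbitrary: i U m)
  case 0
  then have il: "i = l" by simp
  show ?case
  proof
    assume e: "Poly_Mapping.keys m \<inter> {..<i} = {}"
    then have "Poly_Mapping.keys m = {}" using CW_keys[OF 0(3,5)] il by blast
    then have m0: "m = 0" by (metis in_keys_iff empty_iff lookup_zero poly_mapping_eqI)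
    let ?Z = "pm_restrict (\<lambda>m. m \<noteq> 0) U"
    have split: "U = ?Z + Poly_Mapping.single 0 (Poly_Mapping.lookup U 0)"
      by (rule poly_mapping_eqI) (simp add: lookup_add lookup_pm_restrict lookup_single when_def)
    have "\<Phi> ?Z \<in> gs l f A" unfolding \<Phi>_meval
    proof (rule smod_sum[OF smodA])
      fix m' assume m': "m' \<in> Poly_Mapping.keys ?Z"
      then have mU: "m' \<in> Poly_Mapping.keys U" "m' \<noteq> 0" by (auto simp: keys_pm_restrict)
      then obtain k where k: "k \<in> Poly_Mapping.keys m'" by (metis in_keys_iff lookup_zero poly_mapping_eqI)
      have "meval f m' \<in> gs l f A"
        using meval_gs[OF CW_keys[OF 0(3) mU(1)] k] CW_keys[OF 0(3) mU(1)] k by auto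
      then show "Poly_Mapping.lookup ?Z m' * meval f m' \<in> gs l f A"
        using smod_scale[OF smodA] CW_lookup[OF CW_pm_restrict[OF 0(3)]] W(2) by fastforce
    qed
    moreover have "\<Phi> U = \<Phi> ?Z + Poly_Mapping.lookup U 0"
      by (subst split, simp only: \<Phi>_add \<Phi>_single meval_0 mult_1_right)
    ultimately have "Poly_Mapping.lookup U 0 \<in> gs l f A"
      using smod_diff[OF smodA A 0(4)[unfolded il], of "\<Phi> ?Z"] by simp
    then have "Poly_Mapping.lookup U 0 = 0" using W(3) CW_lookup[OF 0(3)] by blast
    then show False using 0(5) m0 by (simp add: in_keys_iff)
  qed
next
  case (Suc n)
  then have il: "i < l" by simp
  let ?c = "\<lambda>m. Poly_Mapping.keys m \<inter> {..<i} = {}"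
  \<comment> \<open>If no monomial involves a variable below \<open>i\<close>, the outer induction
    shows that all are divisible by \<open>var i\<close>. Regularity of \<open>f i\<close> allows to
    cancel it, and the bound \<open>N\<close> on its exponent makes this stop.\<close>
  have van: "V = 0" if "V \<in> CW {..<l}" "\<forall>m\<in>Poly_Mapping.keys V. ?c m \<and> Poly_Mapping.lookup m i < N" "\<Phi> V \<in> gs i f A" for V N
    using that
  proof (induction N arbitrary: V)
    case 0
    then have "Poly_Mapping.keys V = {}" by auto
    then show ?case by (metis in_keys_iff empty_iff lookup_zero poly_mapping_eqI)
  next
    case (Suc N)
    have "\<Phi> V \<in> gs (Suc i) f A" using gs_mono[of i "Suc i" A f] sring_0[OF A] Suc(4) by auto
    then have "Poly_Mapping.keys m \<inter> {..<Suc i} \<noteq> {}" if "m \<in> Poly_Mapping.keys V" for m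
      using Suc.hyps(1)[of "Suc i" V m] \<open>Suc n = l - i\<close> il Suc.prems(1) that by simp
    then have im: "i \<in> Poly_Mapping.keys m" if "m \<in> Poly_Mapping.keys V" for m
      using Suc.prems(2) that by (fastforce simp: less_Suc_eq)
    define V' where "V' = (\<Sum>m\<in>Poly_Mapping.keys V. Poly_Mapping.single (m - mono_var i) (Poly_Mapping.lookup V m))"
    have sh: "mono_var i + (m - mono_var i) = m" if "m \<in> Poly_Mapping.keys V" for m
      using im[OF that] by (intro poly_mapping_eqI) (auto simp: lookup_add lookup_minus lookup_single when_def in_keys_iff)
    have VV': "V = var i * V'"
    proof -
      have "var i * V' = (\<Sum>m\<in>Poly_Mapping.keys V. Poly_Mapping.single m (Poly_Mapping.lookup V m))"
        unfolding V'_def sum_distrib_left by (intro sum.cong refl) (simp only: var_def mult_single sh mult_1_left)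
      then show ?thesis using poly_mapping_sum_single[of V] by simp
    qed
    have subk: "Poly_Mapping.keys (m - mono_var i) \<subseteq> Poly_Mapping.keys m" for m
      by (auto simp: in_keys_iff lookup_minus)
    have V'CW: "V' \<in> CW {..<l}" unfolding V'_def
      by (intro CW_sum CW_single CW_lookup[OF Suc.prems(1)]) (use subk CW_keys[OF Suc.prems(1)] in blast)
    have "\<forall>m\<in>Poly_Mapping.keys V'. ?c m \<and> Poly_Mapping.lookup m i < N"
    proof
      fix m' assume "m' \<in> Poly_Mapping.keys V'"
      then obtain m where m: "m \<in> Poly_Mapping.keys V" "m' = m - mono_var i"
        unfolding V'_def using keys_sum[of _ "Poly_Mapping.keys V"] by (fastforce split: if_splits)
      then have "?c m'" using Suc.prems(2) subk by blast
      moreover have "Poly_Mapping.lookup m' i < N"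
      proof -
        have "Poly_Mapping.lookup m i < Suc N" using Suc.prems(2) m(1) by blast
        moreover have "Poly_Mapping.lookup m i > 0" using im[OF m(1)] by (simp add: in_keys_iff)
        ultimately show ?thesis by (simp add: m(2) lookup_minus)
      qed
      ultimately show "?c m' \<and> Poly_Mapping.lookup m' i < N" by blast
    qed
    moreover have "\<Phi> V' \<in> gs i f A"
      using reg[OF il \<Phi>_A[OF V'CW]] Suc.prems(3) unfolding VV' by (simp add: \<Phi>_mult \<Phi>_var mult.commute)
    ultimately have "V' = 0" using Suc.IH[OF V'CW] by blast
    then show ?case using VV' by simp
  qed
  show ?case
  proof
    assume e: "?c m"
    let ?V = "pm_restrict ?c U" and ?Z = "pm_restrict (\<lambda>m. \<not> ?c m) U"
    have "\<Phi> ?Z \<in> gs i f A" unfolding \<Phi>_meval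
    proof (rule smod_sum[OF smodA])
      fix m' assume m': "m' \<in> Poly_Mapping.keys ?Z"
      then have mU: "m' \<in> Poly_Mapping.keys U" "\<not> ?c m'" by (auto simp: keys_pm_restrict)
      then obtain k where "k \<in> Poly_Mapping.keys m'" "k < i" by auto
      then have "meval f m' \<in> gs i f A" using meval_gs[OF CW_keys[OF Suc.prems(2) mU(1)]] by blast
      then show "Poly_Mapping.lookup ?Z m' * meval f m' \<in> gs i f A"
        using smod_scale[OF smodA] CW_lookup[OF CW_pm_restrict[OF Suc.prems(2)]] W(2) by fastforce
    qed
    moreover have "\<Phi> U = \<Phi> ?V + \<Phi> ?Z"
      by (subst pm_restrict_split[of U ?c]) (rule \<Phi>_add)
    ultimately have "\<Phi> ?V \<in> gs i f A" using smod_diff[OF smodA A Suc.prems(3), of "\<Phi> ?Z"] by simp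
    moreover obtain N where "\<forall>m\<in>Poly_Mapping.keys ?V. Poly_Mapping.lookup m i < N"
      using finite_nat_set_iff_bounded[of "(\<lambda>m. Poly_Mapping.lookup m i) ` Poly_Mapping.keys ?V"] by auto
    ultimately have "?V = 0" using van[OF CW_pm_restrict[OF Suc.prems(2)], of ?c N] by (auto simp: keys_pm_restrict)
    then show False using Suc.prems(4) e by (metis (mono_tags, lifting) keys_pm_restrict keys_zero empty_iff mem_Collect_eq)
  qed
qed

text \<open>The case \<open>i = 0\<close> of \<open>expansion_support\<close>: no monomial has a
  variable in the empty set.\<close>

lemma expansion_unique: assumes "U \<in> CW {..<l}" "\<Phi> U = 0" shows "U = 0"
proof (rule ccontr)
  assume "U \<noteq> 0"
  then obtain m where "m \<in> Poly_Mapping.keys U" by (metis in_keys_iff lookup_zero poly_mapping_eqI)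
  then show False using expansion_support[of 0 U m] assms smod_0[OF smodA] by auto
qed

section \<open>The algebra as a module over polynomial rings in the sequence\<close>

definition D :: "nat set \<Rightarrow> 'k mpoly set" where "D V = subst_poly const f ` mpv V"

text \<open>A module over \<open>D V\<close>. For \<open>V = {..<l} - {j}\<close> it is the
  coefficient module over which the elements of \<open>A\<close> become polynomials in
  \<open>f j\<close>, uniquely.\<close>

definition WM :: "nat set \<Rightarrow> 'k mpoly set" where "WM V = \<Phi> ` CW V"

lemma rhom_sf: "rhom B (subst_poly const f)" by (rule rhom_subst_poly[OF rhom_const])

lemma sring_D: "sring (D V)"
  unfolding D_def sring_def
proof (intro conjI ballI)
  let ?s = "subst_poly const f"
  note M = sring_mpv[of V]
  show "1 \<in> ?s ` mpv V" using rhom_1[OF rhom_sf] sring_1[OF M] by (metis imageI)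
  fix x y assume "x \<in> ?s ` mpv V" "y \<in> ?s ` mpv V"
  then obtain r r' where r: "r \<in> mpv V" "x = ?s r" "r' \<in> mpv V" "y = ?s r'" by blast
  have "x - y = ?s (r - r')" "x * y = ?s (r * r')"
    using r rhom_diff[OF rhom_sf M] rhom_mult[OF rhom_sf] by simp_all
  then show "x - y \<in> ?s ` mpv V" "x * y \<in> ?s ` mpv V"
    using sring_diff[OF M r(1,3)] sring_mult[OF M r(1,3)] by blast+
qed

lemma D_A: "V \<subseteq> {..<l} \<Longrightarrow> D V \<subseteq> A"
proof -
  assume V: "V \<subseteq> {..<l}"
  have "subst_poly const f r \<in> A" if r: "r \<in> mpv V" for r
    by (rule subst_poly_in[OF A constA _ r]) (use fA V in auto)
  then show ?thesis by (auto simp: D_def)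
qed

lemma D_mono: "V \<subseteq> V' \<Longrightarrow> D V \<subseteq> D V'" unfolding D_def using mpv_mono by blast

lemma f_in_D: "i \<in> V \<Longrightarrow> f i \<in> D V"
  unfolding D_def using var_in_mpv[of i V] subst_poly_var[of const f i]
  by (metis const_0 const_1 imageI)

lemma WM_A: "V \<subseteq> {..<l} \<Longrightarrow> WM V \<subseteq> A" unfolding WM_def using \<Phi>_A CW_mono by blast

lemma smod_WM: "smod (D V) (WM V)"
proof -
  let ?s = "subst_poly const f"
  have add: "x + y \<in> WM V" if "x \<in> WM V" "y \<in> WM V" for x y
    using that CW_add unfolding WM_def by (auto simp flip: \<Phi>_add)
  have z: "0 \<in> WM V" unfolding WM_def using CW_0 \<Phi>_zero by (metis imageI)
  have c: "const c * x \<in> WM V" if x: "x \<in> WM V" for c x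
  proof -
    obtain U where "U \<in> CW V" "x = \<Phi> U" using x by (auto simp: WM_def)
    then have "const c * x = \<Phi> (const (const c) * U)" "const (const c) * U \<in> CW V"
      using CW_scale by (simp_all add: \<Phi>_mult \<Phi>_const)
    then show ?thesis by (simp add: WM_def)
  qed
  have v: "f i * x \<in> WM V" if x: "x \<in> WM V" and i: "i \<in> V" for i x
  proof -
    obtain U where "U \<in> CW V" "x = \<Phi> U" using x by (auto simp: WM_def)
    then have "f i * x = \<Phi> (var i * U)" "var i * U \<in> CW V"
      using CW_var i by (simp_all add: \<Phi>_mult \<Phi>_var)
    then show ?thesis by (simp add: WM_def)
  qed
  have minus: "- x \<in> WM V" if "x \<in> WM V" for x
    using c[OF that, of "-1"] by (simp add: const_def single_uminus)
  define B where "B = {r. \<forall>x\<in>WM V. ?s r * x \<in> WM V}"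
  have "sring B"
  proof -
    have "?s (r - r') * x \<in> WM V" if "r \<in> B" "r' \<in> B" "x \<in> WM V" for r r' x
      using that add[of "?s r * x" "- (?s r' * x)"] minus[of "?s r' * x"]
      by (simp add: B_def rhom_diff[OF rhom_sf sring_UNIV] left_diff_distrib)
    moreover have "?s (r * r') * x \<in> WM V" if "r \<in> B" "r' \<in> B" "x \<in> WM V" for r r' x
      using that by (simp add: B_def rhom_mult[OF rhom_sf[of UNIV]] mult.assoc)
    moreover have "?s 1 * x \<in> WM V" if "x \<in> WM V" for x
      using that by (simp add: rhom_1[OF rhom_sf])
    ultimately show ?thesis by (auto simp: sring_def B_def)
  qed
  then have "mpv V \<subseteq> B"
    by (rule mpv_induct) (use c v in \<open>auto simp: B_def subst_poly_const subst_poly_var const_0 const_1\<close>)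
  then show ?thesis using add z by (auto simp: smod_def D_def B_def)
qed

lemma module_expansion_exists:
  assumes u: "u \<in> A" and j: "j < l"
  shows "\<exists>q\<in>cpoly (WM ({..<l} - {j})). u = poly q (f j)"
proof -
  let ?V = "{..<l} - {j}"
  obtain U where U: "U \<in> CW {..<l}" "u = \<Phi> U" using expansion_exists[OF u] by blast
  have sm: "smod (cpoly (D ?V)) (cpoly (WM ?V))" by (rule smod_cpoly[OF sring_D smod_WM])
  have "\<exists>q. q \<in> cpoly (WM ?V) \<and> (m \<in> Poly_Mapping.keys U \<longrightarrow> Poly_Mapping.lookup U m * meval f m = poly q (f j))" for m
  proof (cases "m \<in> Poly_Mapping.keys U")
    case True
    let ?k = "Poly_Mapping.lookup m j" and ?m = "m - Poly_Mapping.single j (Poly_Mapping.lookup m j)"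
    have m: "m = ?m + Poly_Mapping.single j ?k"
      by (rule poly_mapping_eqI) (auto simp: lookup_add lookup_minus lookup_single when_def)
    have "x \<in> Poly_Mapping.keys m \<and> x \<noteq> j" if "x \<in> Poly_Mapping.keys ?m" for x
      using that by (auto simp: in_keys_iff lookup_minus lookup_single when_def split: if_splits)
    then have "Poly_Mapping.keys ?m \<subseteq> ?V" using CW_keys[OF U(1) True] by blast
    then have "\<Phi> (Poly_Mapping.single ?m (Poly_Mapping.lookup U m)) \<in> WM ?V"
      unfolding WM_def by (intro imageI CW_single CW_lookup[OF U(1)])
    moreover have "Poly_Mapping.lookup U m * meval f m = \<Phi> (Poly_Mapping.single ?m (Poly_Mapping.lookup U m)) * f j ^ ?k"
      by (subst (2) m) (simp only: meval_add meval_single \<Phi>_single mult.assoc)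
    ultimately show ?thesis using smod_0[OF smod_WM]
      by (intro exI[of _ "monom (\<Phi> (Poly_Mapping.single ?m (Poly_Mapping.lookup U m))) ?k"]) (auto simp: cpoly_def poly_monom)
  qed (use smod_0[OF sm] in blast)
  then obtain q where q: "\<And>m. q m \<in> cpoly (WM ?V)"
    "\<And>m. m \<in> Poly_Mapping.keys U \<Longrightarrow> Poly_Mapping.lookup U m * meval f m = poly (q m) (f j)" by metis
  have "u = poly (\<Sum>m\<in>Poly_Mapping.keys U. q m) (f j)"
    unfolding U(2) \<Phi>_meval poly_sum by (intro sum.cong refl q)
  then show ?thesis using smod_sum[OF sm, of "Poly_Mapping.keys U" q] q(1) by blast
qed

text \<open>The coefficients of \<open>q\<close> are free of \<open>var j\<close>, so their
  expansions, shifted by different powers of \<open>var j\<close>, have no monomial in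
  common.\<close>

lemma module_expansion_unique:
  assumes q: "q \<in> cpoly (WM ({..<l} - {j}))" and 0: "poly q (f j) = 0" and j: "j < l"
  shows "q = 0"
proof -
  let ?V = "{..<l} - {j}"
  have "\<exists>U. U \<in> CW ?V \<and> \<Phi> U = coeff q k" for k using cpolyD[OF q, of k] by (auto simp: WM_def)
  then obtain U where U: "\<And>k. U k \<in> CW ?V" "\<And>k. \<Phi> (U k) = coeff q k" by metis
  have Vl: "CW ?V \<subseteq> CW {..<l}" by (rule CW_mono) auto
  define T where "T = (\<Sum>k\<le>degree q. var j ^ k * U k)"
  have pw: "var j ^ k * Z \<in> CW {..<l}" if "Z \<in> CW {..<l}" for k Z
    using that by (induction k) (use j in \<open>auto simp: mult.assoc intro!: CW_var\<close>)
  have "T \<in> CW {..<l}" unfolding T_def by (intro CW_sum pw) (use U Vl in auto)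
  moreover have "\<Phi> T = 0"
  proof -
    have "\<Phi> (var j ^ k) = f j ^ k" for k
      using rhom_power[OF rhom_subst_poly[OF rhom_id, of UNIV f] sring_UNIV] by (simp add: \<Phi>_def[symmetric] \<Phi>_var)
    then have "\<Phi> T = poly q (f j)" by (simp add: T_def \<Phi>_sum \<Phi>_mult U poly_altdef mult.commute)
    then show ?thesis using 0 by simp
  qed
  ultimately have T0: "T = 0" by (rule expansion_unique)
  have "U k = 0" if k: "k \<le> degree q" for k
  proof (rule poly_mapping_eqI)
    fix m
    show "Poly_Mapping.lookup (U k) m = Poly_Mapping.lookup 0 m"
    proof (cases "m \<in> Poly_Mapping.keys (U k)")
      case True
      then have "j \<notin> Poly_Mapping.keys m" using CW_keys[OF U(1)] by blast
      then have jm: "Poly_Mapping.lookup m j = 0" by (simp add: in_keys_iff)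
      have pz: "var j ^ k' * U k' = (\<Sum>m'\<in>Poly_Mapping.keys (U k').
        Poly_Mapping.single (Poly_Mapping.single j k' + m') (Poly_Mapping.lookup (U k') m'))" for k'
        by (subst (1) poly_mapping_sum_single[of "U k'"]) (simp add: sum_distrib_left var_power mult_single)
      have eq: "Poly_Mapping.single j k' + m' = Poly_Mapping.single j k + m \<longleftrightarrow> k' = k \<and> m' = m"
        if "m' \<in> Poly_Mapping.keys (U k')" for k' m'
      proof
        assume e: "Poly_Mapping.single j k' + m' = Poly_Mapping.single j k + m"
        have "j \<notin> Poly_Mapping.keys m'" using CW_keys[OF U(1) that] by blast
        then have "Poly_Mapping.lookup m' j = 0" by (simp add: in_keys_iff)
        then have "k' = k" using arg_cong[OF e, of "\<lambda>x. Poly_Mapping.lookup x j"] jm by (simp add: lookup_add)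
        then show "k' = k \<and> m' = m" using e by simp
      qed simp
      have "Poly_Mapping.lookup (var j ^ k' * U k') (Poly_Mapping.single j k + m) =
        (if k' = k then Poly_Mapping.lookup (U k) m else 0)" for k'
      proof -
        have "Poly_Mapping.lookup (var j ^ k' * U k') (Poly_Mapping.single j k + m) =
          (\<Sum>m'\<in>Poly_Mapping.keys (U k'). if k' = k \<and> m' = m then Poly_Mapping.lookup (U k') m' else 0)"
          unfolding pz lookup_sum by (intro sum.cong refl) (simp add: lookup_single when_def eq)
        then show ?thesis using True by (cases "k' = k") auto
      qed
      then have "Poly_Mapping.lookup T (Poly_Mapping.single j k + m) = Poly_Mapping.lookup (U k) m"
        using k by (simp add: T_def lookup_sum)
      then show ?thesis using T0 by simp
    qed (simp add: in_keys_iff)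
  qed
  then have "coeff q k = 0" if "k \<le> degree q" for k using U(2)[of k] that by (simp add: \<Phi>_zero)
  then show ?thesis by (metis leading_coeff_0_iff order_refl)
qed

lemma degree_mult_vanish:
  fixes p q :: "'k mpoly poly"
  assumes "\<forall>i\<ge>degree p. coeff (p * q) i = 0" "p \<noteq> 0" shows "q = 0"
proof (rule ccontr)
  assume "q \<noteq> 0"
  then have "degree p \<le> degree (p * q)" "p * q \<noteq> 0" using assms(2) by (simp_all add: degree_mult_eq)
  then show False using assms(1) by (metis leading_coeff_0_iff)
qed

text \<open>Lift the equation to polynomials in \<open>f j\<close> over \<open>WM\<close>: the
  remainder of \<open>u\<close> modulo \<open>p\<close>, times \<open>a\<close>, is a multiple of
  \<open>p\<close> of lower degree and so vanishes. Thus \<open>a\<close> is a nonzerodivisor modulo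
  \<open>p(f j)\<close> once the leading coefficient of \<open>p\<close> is inverted.\<close>

lemma torsion_one_element:
  assumes j: "j < l" and p: "p \<in> cpoly (D ({..<l} - {j}))" "p \<noteq> 0" and a: "a \<in> D ({..<l} - {j})" "a \<noteq> 0"
    and uv: "u \<in> A" "x \<in> A" "a * u = poly p (f j) * x"
  shows "\<exists>k. \<exists>v\<in>A. lead_coeff p ^ k * u = poly p (f j) * v"
proof -
  let ?V = "{..<l} - {j}"
  let ?D = "D ?V" and ?M = "WM ?V"
  note sD = sring_D[of ?V] and sM = smod_WM[of ?V]
  note sC = sring_cpoly[OF sD] and sCM = smod_cpoly[OF sD sM]
  have cA: "[:a:] \<in> cpoly ?D" using const_cpoly[OF sD a(1)] .
  obtain U where U: "U \<in> cpoly ?M" "u = poly U (f j)" using module_expansion_exists[OF uv(1) j] by blast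
  obtain Y where Y: "Y \<in> cpoly ?M" "x = poly Y (f j)" using module_expansion_exists[OF uv(2) j] by blast
  have "[:a:] * U - p * Y = 0"
  proof (rule module_expansion_unique[OF _ _ j])
    show "[:a:] * U - p * Y \<in> cpoly ?M"
      by (rule smod_diff[OF sCM sC smod_scale[OF sCM cA U(1)] smod_scale[OF sCM p(1) Y(1)]])
    show "poly ([:a:] * U - p * Y) (f j) = 0" using U(2) Y(2) uv(3) by simp
  qed
  then have eq: "[:a:] * U = p * Y" by simp
  obtain k Q r where Q: "Q \<in> cpoly ?M" "smult (lead_coeff p ^ k) U = p * Q + r" "\<forall>i\<ge>degree p. coeff r i = 0"
    using pseudo_division[OF sD sM p(1) U(1)] by blast
  have "[:a:] * r = p * ([:lead_coeff p ^ k:] * Y - [:a:] * Q)"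
  proof -
    have "[:a:] * r = [:a:] * ([:lead_coeff p ^ k:] * U) - [:a:] * (p * Q)" using Q(2) by (simp add: smult_diff_right[symmetric])
    also have "\<dots> = [:lead_coeff p ^ k:] * ([:a:] * U) - [:a:] * (p * Q)" by (simp only: mult.left_commute)
    also have "\<dots> = p * ([:lead_coeff p ^ k:] * Y - [:a:] * Q)" unfolding eq right_diff_distrib by (simp only: mult.left_commute)
    finally show ?thesis .
  qed
  moreover have "\<forall>i\<ge>degree p. coeff ([:a:] * r) i = 0" using Q(3) by simp
  ultimately have "[:a:] * r = 0" using degree_mult_vanish[OF _ p(2)] by (metis mult_zero_right)
  then have "r = 0" using a(2) by simp
  then have "poly (smult (lead_coeff p ^ k) U) (f j) = poly (p * Q) (f j)" using Q(2) by simp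
  then have "lead_coeff p ^ k * u = poly p (f j) * poly Q (f j)" by (simp add: U(2))
  moreover have "poly Q (f j) \<in> A"
    unfolding poly_altdef
    by (intro sring_sum[OF A] sring_mult[OF A] sring_power[OF A fA[OF j]])
      (use cpolyD[OF Q(1)] WM_A[of ?V] in auto)
  ultimately show ?thesis by blast
qed

text \<open>Up to leading coefficients, \<open>p1(f j1)\<close>, \<open>p2(f j2)\<close>,
  \<open>a\<close> act as a regular sequence. Expanding in \<open>f j2\<close> turns
  \<open>p1(f j1)\<close> into a scalar, and comparing remainders modulo \<open>p2\<close> reduces
  each coefficient to \<open>torsion_one_element\<close>.\<close>

lemma torsion_two_elements:
  assumes j: "j1 < l" "j2 < l" "j1 \<noteq> j2"
    and p1: "p1 \<in> cpoly (D ({..<l} - {j1, j2}))" "p1 \<noteq> 0" and p2: "p2 \<in> cpoly (D ({..<l} - {j1, j2}))" "p2 \<noteq> 0"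
    and a: "a \<in> D ({..<l} - {j1, j2})" "a \<noteq> 0"
    and uv: "u \<in> A" "x \<in> A" "y \<in> A" "a * u = poly p1 (f j1) * x + poly p2 (f j2) * y"
  shows "\<exists>k m. \<exists>v\<in>A. \<exists>w\<in>A. lead_coeff p1 ^ k * lead_coeff p2 ^ m * u = poly p1 (f j1) * v + poly p2 (f j2) * w"
proof -
  let ?V = "{..<l} - {j2}"
  let ?D = "D ?V" and ?M = "WM ?V"
  note sD = sring_D[of ?V] and sM = smod_WM[of ?V]
  note sC = sring_cpoly[OF sD] and sCM = smod_cpoly[OF sD sM]
  have "D ({..<l} - {j1, j2}) \<subseteq> ?D" by (rule D_mono) auto
  moreover have "D ({..<l} - {j1, j2}) \<subseteq> D ({..<l} - {j1})" by (rule D_mono) auto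
  ultimately have D12: "D ({..<l} - {j1, j2}) \<subseteq> ?D" "D ({..<l} - {j1, j2}) \<subseteq> D ({..<l} - {j1})" by blast+
  define a1 where "a1 = poly p1 (f j1)"
  have a1: "a1 \<in> ?D" unfolding a1_def poly_altdef
    by (intro sring_sum[OF sD] sring_mult[OF sD] sring_power[OF sD] f_in_D)
      (use cpolyD[OF p1(1)] D12 j in auto)
  have p2D: "p2 \<in> cpoly ?D" using p2 D12 by (auto simp: cpoly_def)
  have aD: "a \<in> ?D" using a D12 by auto
  let ?c1 = "lead_coeff p1" and ?c2 = "lead_coeff p2"
  have c1A: "?c1 \<in> A" using cpolyD[OF p1(1)] D_A[of "{..<l} - {j1, j2}"] by auto
  have c2A: "?c2 \<in> A" using cpolyD[OF p2(1)] D_A[of "{..<l} - {j1, j2}"] by auto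
  have MA: "?M \<subseteq> A" by (rule WM_A) auto
  have polyA: "poly Q (f j2) \<in> A" if "Q \<in> cpoly ?M" for Q
    unfolding poly_altdef
    by (intro sring_sum[OF A] sring_mult[OF A] sring_power[OF A fA[OF j(2)]]) (use cpolyD[OF that] MA in auto)
  obtain U where U: "U \<in> cpoly ?M" "u = poly U (f j2)" using module_expansion_exists[OF uv(1) j(2)] by blast
  obtain Z where Z: "Z \<in> cpoly ?M" "x = poly Z (f j2)" using module_expansion_exists[OF uv(2) j(2)] by blast
  obtain Y where Y: "Y \<in> cpoly ?M" "y = poly Y (f j2)" using module_expansion_exists[OF uv(3) j(2)] by blast
  have "[:a:] * U - ([:a1:] * Z + p2 * Y) = 0"
  proof (rule module_expansion_unique[OF _ _ j(2)])
    show "[:a:] * U - ([:a1:] * Z + p2 * Y) \<in> cpoly ?M"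
      by (rule smod_diff[OF sCM sC smod_scale[OF sCM const_cpoly[OF sD aD] U(1)]
        smod_add[OF sCM smod_scale[OF sCM const_cpoly[OF sD a1] Z(1)] smod_scale[OF sCM p2D Y(1)]]])
    show "poly ([:a:] * U - ([:a1:] * Z + p2 * Y)) (f j2) = 0"
      using U(2) Y(2) Z(2) uv(4) by (simp add: a1_def)
  qed
  then have eq: "[:a:] * U = [:a1:] * Z + p2 * Y" by simp
  obtain s Q r where Q: "Q \<in> cpoly ?M" "r \<in> cpoly ?M" "smult (?c2 ^ s) U = p2 * Q + r" "\<forall>i\<ge>degree p2. coeff r i = 0"
    using pseudo_division[OF sD sM p2D U(1)] by blast
  obtain t Q' r' where Q': "Q' \<in> cpoly ?M" "r' \<in> cpoly ?M" "smult (?c2 ^ t) Z = p2 * Q' + r'" "\<forall>i\<ge>degree p2. coeff r' i = 0"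
    using pseudo_division[OF sD sM p2D Z(1)] by blast
  \<comment> \<open>A multiple of \<open>p2\<close> of lower degree, hence zero. The crossed powers
    of \<open>?c2\<close> balance the different exponents of the two divisions.\<close>
  define R where "R = [:a:] * ([:?c2 ^ t:] * r) - [:a1:] * ([:?c2 ^ s:] * r')"
  have r_eq: "r = [:?c2 ^ s:] * U - p2 * Q" using Q(3) by simp
  have r'_eq: "r' = [:?c2 ^ t:] * Z - p2 * Q'" using Q'(3) by simp
  have "R = p2 * ([:?c2 ^ s:] * [:?c2 ^ t:] * Y - [:a:] * [:?c2 ^ t:] * Q + [:a1:] * [:?c2 ^ s:] * Q')"
  proof -
    have "C * (T * (S * U - p2 * Q)) - E * (S * (T * Z - p2 * Q')) =
      S * T * (C * U - E * Z) - p2 * (C * T * Q) + p2 * (E * S * Q')" for C T S E :: "'k mpoly poly"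
      by (simp add: algebra_simps)
    then have "R = [:?c2 ^ s:] * [:?c2 ^ t:] * ([:a:] * U - [:a1:] * Z) - p2 * ([:a:] * [:?c2 ^ t:] * Q) + p2 * ([:a1:] * [:?c2 ^ s:] * Q')"
      unfolding R_def r_eq r'_eq by (simp only:)
    moreover have "[:a:] * U - [:a1:] * Z = p2 * Y" using eq by simp
    moreover have "S * (p2 * Y) - p2 * C + p2 * E = p2 * (S * Y - C + E)" for S C E :: "'k mpoly poly"
      by (simp add: algebra_simps)
    ultimately show ?thesis by (simp only:)
  qed
  moreover have "\<forall>i\<ge>degree p2. coeff R i = 0" using Q(4) Q'(4) by (simp add: R_def)
  ultimately have "R = 0" using degree_mult_vanish[OF _ p2(2)] by (metis mult_zero_right)
  then have co: "a * (?c2 ^ t * coeff r i) = a1 * (?c2 ^ s * coeff r' i)" for i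
  proof -
    have "coeff R i = a * (?c2 ^ t * coeff r i) - a1 * (?c2 ^ s * coeff r' i)"
    proof -
      have "coeff ([:x:] * z) i = x * coeff z i" for x and z :: "'k mpoly poly" by simp
      then show ?thesis by (simp only: R_def coeff_diff)
    qed
    then show ?thesis using \<open>R = 0\<close> by simp
  qed
  have p1D: "p1 \<in> cpoly (D ({..<l} - {j1}))" using p1 D12 by (auto simp: cpoly_def)
  have "\<exists>k. \<exists>v\<in>A. ?c1 ^ k * (?c2 ^ t * coeff r i) = a1 * v" for i
    unfolding a1_def
    by (rule torsion_one_element[OF j(1) p1D p1(2) _ a(2) _ _ co[of i, unfolded a1_def]])
      (use a D12 cpolyD[OF Q(2)] cpolyD[OF Q'(2)] MA c2A in \<open>auto intro!: sring_mult[OF A] sring_power[OF A]\<close>)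
  then obtain k v where kv: "\<And>i. v i \<in> A" "\<And>i. ?c1 ^ k i * (?c2 ^ t * coeff r i) = a1 * v i" by metis
  define K where "K = (\<Sum>i\<le>degree r. k i)"
  define v' where "v' i = ?c1 ^ (K - k i) * v i" for i
  have v': "?c1 ^ K * (?c2 ^ t * coeff r i) = a1 * v' i" if "i \<le> degree r" for i
  proof -
    have "k i \<le> K" unfolding K_def using that by (intro member_le_sum) auto
    then have "?c1 ^ K = ?c1 ^ (K - k i) * ?c1 ^ k i" by (simp flip: power_add)
    then have "?c1 ^ K * (?c2 ^ t * coeff r i) = ?c1 ^ (K - k i) * (?c1 ^ k i * (?c2 ^ t * coeff r i))" by (simp add: mult.assoc)
    then show ?thesis unfolding kv(2) v'_def by (simp add: mult.left_commute)
  qed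
  have v'A: "v' i \<in> A" for i unfolding v'_def using kv(1) c1A by (intro sring_mult[OF A] sring_power[OF A])
  have "?c2 ^ s * u = poly p2 (f j2) * poly Q (f j2) + poly r (f j2)"
    using arg_cong[OF Q(3), of "\<lambda>q. poly q (f j2)"] U(2) by simp
  then have "?c1 ^ K * ?c2 ^ t * (?c2 ^ s * u) =
    ?c1 ^ K * ?c2 ^ t * (poly p2 (f j2) * poly Q (f j2) + poly r (f j2))" by simp
  also have "\<dots> = poly p2 (f j2) * (?c1 ^ K * ?c2 ^ t * poly Q (f j2)) + ?c1 ^ K * ?c2 ^ t * poly r (f j2)"
    by (simp add: algebra_simps)
  also have "?c1 ^ K * ?c2 ^ t * poly r (f j2) = (\<Sum>i\<le>degree r. (?c1 ^ K * (?c2 ^ t * coeff r i)) * f j2 ^ i)"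
    unfolding poly_altdef sum_distrib_left by (simp add: mult.assoc)
  also have "\<dots> = (\<Sum>i\<le>degree r. (a1 * v' i) * f j2 ^ i)" by (intro sum.cong refl) (simp add: v')
  also have "\<dots> = a1 * (\<Sum>i\<le>degree r. v' i * f j2 ^ i)" by (simp add: sum_distrib_left mult.assoc)
  finally have e: "?c1 ^ K * ?c2 ^ t * (?c2 ^ s * u) = poly p2 (f j2) * (?c1 ^ K * ?c2 ^ t * poly Q (f j2)) +
    a1 * (\<Sum>i\<le>degree r. v' i * f j2 ^ i)" .
  have "?c1 ^ K * ?c2 ^ (t + s) * u = ?c1 ^ K * ?c2 ^ t * (?c2 ^ s * u)" by (simp only: power_add mult.assoc)
  then have "?c1 ^ K * ?c2 ^ (t + s) * u = a1 * (\<Sum>i\<le>degree r. v' i * f j2 ^ i) +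
    poly p2 (f j2) * (?c1 ^ K * ?c2 ^ t * poly Q (f j2))"
    unfolding e by (simp only: add.commute)
  moreover have "(\<Sum>i\<le>degree r. v' i * f j2 ^ i) \<in> A"
    by (intro sring_sum[OF A] sring_mult[OF A] v'A sring_power[OF A fA[OF j(2)]])
  moreover have "?c1 ^ K * ?c2 ^ t * poly Q (f j2) \<in> A"
    by (intro sring_mult[OF A] sring_power[OF A] c1A c2A polyA Q)
  ultimately show ?thesis unfolding a1_def by blast
qed

end

section \<open>Algebraic dependence and complete integral closedness\<close>

definition pm :: "nat set \<Rightarrow> (nat \<Rightarrow> nat) \<Rightarrow> nat \<Rightarrow>\<^sub>0 nat" where
  "pm V \<phi> = (\<Sum>i\<in>V. Poly_Mapping.single i (\<phi> i))"

lemma lookup_pm: "finite V \<Longrightarrow> Poly_Mapping.lookup (pm V \<phi>) i = (if i \<in> V then \<phi> i else 0)"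
  by (simp add: pm_def lookup_sum lookup_single when_def)

lemma keys_pm:
  assumes "finite V" shows "Poly_Mapping.keys (pm V \<phi>) \<subseteq> V"
proof
  fix x assume "x \<in> Poly_Mapping.keys (pm V \<phi>)"
  then have "Poly_Mapping.lookup (pm V \<phi>) x \<noteq> 0" by (simp add: in_keys_iff)
  then show "x \<in> V" using lookup_pm[OF assms, of \<phi> x] by (cases "x \<in> V") simp_all
qed

lemma pm_lookup:
  assumes "finite V" "Poly_Mapping.keys m \<subseteq> V"
  shows "pm V (restrict (Poly_Mapping.lookup m) V) = m"
proof (rule poly_mapping_eqI)
  fix i
  show "Poly_Mapping.lookup (pm V (restrict (Poly_Mapping.lookup m) V)) i = Poly_Mapping.lookup m i"
  proof (cases "i \<in> V")
    case False
    then have "i \<notin> Poly_Mapping.keys m" using assms(2) by blast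
    then show ?thesis using False assms(1) by (simp add: lookup_pm not_in_keys_iff_lookup_eq_zero)
  qed (use assms(1) in \<open>simp add: lookup_pm\<close>)
qed

lemma inj_on_pm: "finite V \<Longrightarrow> inj_on (pm V) (PiE V B)"
proof (rule inj_onI)
  fix \<phi> \<psi> assume V: "finite V" and "\<phi> \<in> PiE V B" "\<psi> \<in> PiE V B" "pm V \<phi> = pm V \<psi>"
  moreover have "\<phi> i = \<psi> i" if "i \<in> V" for i
    using lookup_pm[OF V, of \<phi> i] lookup_pm[OF V, of \<psi> i] that \<open>pm V \<phi> = pm V \<psi>\<close> by simp
  ultimately show "\<phi> = \<psi>" by (intro PiE_ext)
qed

lemma meval_pm: "finite V \<Longrightarrow> meval G (pm V \<phi>) = (\<Prod>i\<in>V. G i ^ \<phi> i)"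
  by (subst meval_superset[OF _ keys_pm]) (auto simp: lookup_pm intro!: prod.cong)

definition bounded_exp :: "nat \<Rightarrow> nat \<Rightarrow> 'a::zero mpoly set" where
  "bounded_exp r M = {f \<in> mpv {..<r}. \<forall>m\<in>Poly_Mapping.keys f. \<forall>i. Poly_Mapping.lookup m i \<le> M}"

lemma bounded_exp_mult:
  fixes f g :: "'a::comm_ring_1 mpoly"
  assumes "f \<in> bounded_exp r M" "g \<in> bounded_exp r N" shows "f * g \<in> bounded_exp r (M + N)"
proof -
  have "Poly_Mapping.lookup m i \<le> M + N" if m: "m \<in> Poly_Mapping.keys (f * g)" for m i
  proof -
    obtain a b where "a \<in> Poly_Mapping.keys f" "b \<in> Poly_Mapping.keys g" "m = a + b"
      using keys_mult[of f g] m by blast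
    then show ?thesis using assms by (simp add: bounded_exp_def lookup_add add_mono)
  qed
  then show ?thesis using assms by (simp add: bounded_exp_def sring_mult[OF sring_mpv])
qed

lemma bounded_exp_1: "1 \<in> (bounded_exp r 0 :: 'a::comm_ring_1 mpoly set)"
  by (simp add: bounded_exp_def sring_1[OF sring_mpv])

lemma bounded_exp_mono: "M \<le> N \<Longrightarrow> bounded_exp r M \<subseteq> bounded_exp r N"
  by (auto simp: bounded_exp_def intro: order_trans)

lemma bounded_exp_power: "f \<in> bounded_exp r M \<Longrightarrow> f ^ k \<in> bounded_exp r (k * M)" for f :: "'a::comm_ring_1 mpoly"
  by (induction k) (auto simp: bounded_exp_1 bounded_exp_mult)

lemma bounded_exp_prod:
  fixes f :: "'i \<Rightarrow> 'a::comm_ring_1 mpoly"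
  assumes "finite I" "\<And>i. i \<in> I \<Longrightarrow> f i \<in> bounded_exp r (M i)"
  shows "prod f I \<in> bounded_exp r (sum M I)"
  using assms by (induction I rule: finite_induct) (auto simp: bounded_exp_1 bounded_exp_mult)

lemma bounded_exp_exists:
  fixes f :: "'a::comm_ring_1 mpoly"
  assumes "f \<in> mpv {..<r}" shows "\<exists>M. f \<in> bounded_exp r M"
proof -
  define M where "M = (\<Sum>m\<in>Poly_Mapping.keys f. monom_deg m)"
  have "Poly_Mapping.lookup m i \<le> M" if m: "m \<in> Poly_Mapping.keys f" for m i
  proof -
    have "Poly_Mapping.lookup m i \<le> monom_deg m"
      unfolding monom_deg_def by (cases "i \<in> Poly_Mapping.keys m") (auto intro!: member_le_sum simp: in_keys_iff)
    also have "\<dots> \<le> M" unfolding M_def using m by (intro member_le_sum) auto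
    finally show ?thesis .
  qed
  then show ?thesis using assms by (auto simp: bounded_exp_def)
qed

interpretation mpoly_vs: vector_space "\<lambda>(c::'k::field) f. const c * (f :: 'k mpoly)"
  by unfold_locales (simp_all add: const_add const_mult const_1 algebra_simps)

lemma bounded_exp_span:
  fixes f :: "'k::field mpoly"
  assumes f: "f \<in> bounded_exp r M"
  shows "f \<in> mpoly_vs.span ((\<lambda>\<psi>. Poly_Mapping.single (pm {..<r} \<psi>) 1) ` (PiE {..<r} (\<lambda>_. {..M})))"
proof -
  let ?T = "(\<lambda>\<psi>. Poly_Mapping.single (pm {..<r} \<psi>) (1::'k)) ` (PiE {..<r} (\<lambda>_. {..M}))"
  have "(\<Sum>m\<in>Poly_Mapping.keys f. const (Poly_Mapping.lookup f m) * Poly_Mapping.single m 1) \<in> mpoly_vs.span ?T"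
  proof (intro mpoly_vs.span_sum mpoly_vs.span_scale mpoly_vs.span_base)
    fix m assume m: "m \<in> Poly_Mapping.keys f"
    let ?\<psi> = "restrict (Poly_Mapping.lookup m) {..<r}"
    have "pm {..<r} ?\<psi> = m" using f m by (intro pm_lookup) (auto simp: bounded_exp_def mpv_def)
    moreover have "?\<psi> \<in> PiE {..<r} (\<lambda>_. {..M})" using f m by (auto simp: bounded_exp_def)
    ultimately show "Poly_Mapping.single m 1 \<in> ?T" by (metis imageI)
  qed
  moreover have "(\<Sum>m\<in>Poly_Mapping.keys f. const (Poly_Mapping.lookup f m) * Poly_Mapping.single m 1) = f"
  proof -
    have "(\<Sum>m\<in>Poly_Mapping.keys f. const (Poly_Mapping.lookup f m) * Poly_Mapping.single m 1) =
      (\<Sum>m\<in>Poly_Mapping.keys f. Poly_Mapping.single m (Poly_Mapping.lookup f m))"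
      by (intro sum.cong refl) (simp add: const_def mult_single)
    then show ?thesis by (simp only: poly_mapping_sum_single[of f, symmetric])
  qed
  ultimately show ?thesis by (simp only:)
qed

text \<open>Counting monomials: the products \<open>\<Prod> G\<^sub>i\<^bsup>\<phi> i\<^esup>\<close> with \<open>\<phi> i < N\<close> outnumber the monomials they are made of.\<close>

lemma algebraically_dependent:
  fixes G :: "nat \<Rightarrow> 'k::field mpoly"
  assumes V: "finite V" and card: "r < card V" and G: "\<And>i. i \<in> V \<Longrightarrow> G i \<in> mpv {..<r}"
  shows "\<exists>R\<in>mpv V. R \<noteq> 0 \<and> subst_poly const G R = 0"
proof -
  have "\<exists>M. \<forall>i\<in>V. G i \<in> bounded_exp r M"
  proof -
    have "\<forall>i\<in>V. \<exists>M. G i \<in> bounded_exp r M" using bounded_exp_exists G by blast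
    then obtain M where M: "\<And>i. i \<in> V \<Longrightarrow> G i \<in> bounded_exp r (M i)" by metis
    have "G i \<in> bounded_exp r (sum M V)" if "i \<in> V" for i
      using M[OF that] bounded_exp_mono[of "M i" "sum M V" r] member_le_sum[of i V M] V that by auto
    then show ?thesis by blast
  qed
  then obtain \<delta> where \<delta>: "\<And>i. i \<in> V \<Longrightarrow> G i \<in> bounded_exp r \<delta>" by blast
  define v where "v = card V"
  \<comment> \<open>The products have exponents at most \<open>M\<close>, so they lie in the span of
    at most \<open>(M + 1) ^ r \<le> (v * \<delta> + 1) ^ r * N ^ r\<close> monomials. The choice of
    \<open>N\<close> makes this smaller than \<open>N * N ^ r \<le> N ^ v\<close>, the number of
    exponent vectors.\<close>
  define N where "N = (v * \<delta> + 1) ^ r + 1"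
  define M where "M = v * N * \<delta>"
  let ?E = "PiE V (\<lambda>_. {..<N})"
  let ?T = "(\<lambda>\<psi>. Poly_Mapping.single (pm {..<r} \<psi>) (1::'k)) ` (PiE {..<r} (\<lambda>_. {..M}))"
  define h where "h \<phi> = meval G (pm V \<phi>)" for \<phi>
  have finE: "finite ?E" using V by (intro finite_PiE) auto
  have finT: "finite ?T" by (intro finite_imageI finite_PiE) auto
  have "card ?T \<le> (M + 1) ^ r"
    by (rule order_trans[OF card_image_le]) (auto simp: card_PiE intro: finite_PiE)
  also have "\<dots> \<le> (N * (v * \<delta> + 1)) ^ r"
    by (intro power_mono) (auto simp: M_def N_def algebra_simps)
  also have "\<dots> = (v * \<delta> + 1) ^ r * N ^ r" by (subst power_mult_distrib) (rule mult.commute)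
  also have "\<dots> < N * N ^ r" by (simp add: N_def)
  also have "N * N ^ r \<le> N ^ v"
    using card power_increasing[of "Suc r" v N] by (simp add: v_def N_def)
  also have "N ^ v = card ?E" using V by (simp add: card_PiE v_def)
  finally have lt: "card ?T < card ?E" .
  have hspan: "h \<phi> \<in> mpoly_vs.span ?T" if \<phi>: "\<phi> \<in> ?E" for \<phi>
  proof (rule bounded_exp_span)
    have "h \<phi> \<in> bounded_exp r (\<Sum>i\<in>V. \<phi> i * \<delta>)"
      unfolding h_def meval_pm[OF V] by (rule bounded_exp_prod[OF V]) (intro bounded_exp_power \<delta>)
    moreover have "(\<Sum>i\<in>V. \<phi> i * \<delta>) \<le> (\<Sum>i\<in>V. N * \<delta>)"
      by (intro sum_mono mult_right_mono) (use \<phi> in \<open>auto simp: PiE_def Pi_def less_imp_le\<close>)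
    ultimately show "h \<phi> \<in> bounded_exp r M" using bounded_exp_mono[of "\<Sum>i\<in>V. \<phi> i * \<delta>" M r] by (auto simp: M_def v_def mult.assoc)
  qed
  show ?thesis
  proof (cases "inj_on h ?E")
    \<comment> \<open>Two different products coincide, and the difference of their monomials is a
      relation.\<close>
    case False
    then obtain \<phi> \<psi> where *: "\<phi> \<in> ?E" "\<psi> \<in> ?E" "\<phi> \<noteq> \<psi>" "h \<phi> = h \<psi>" by (auto simp: inj_on_def)
    let ?R = "Poly_Mapping.single (pm V \<phi>) 1 - Poly_Mapping.single (pm V \<psi>) (1::'k)"
    have "pm V \<phi> \<noteq> pm V \<psi>" using inj_on_eq_iff[OF inj_on_pm[OF V] *(1,2)] *(3) by simp
    then have "Poly_Mapping.lookup ?R (pm V \<phi>) = 1" by (simp add: lookup_minus lookup_single)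
    then have "?R \<noteq> 0" by auto
    moreover have "?R \<in> mpv V"
      by (intro sring_diff[OF sring_mpv]) (use keys_pm[OF V] in \<open>auto simp: mpv_def\<close>)
    moreover have "subst_poly const G ?R = h \<phi> - h \<psi>"
      by (simp add: rhom_diff[OF rhom_subst_poly[OF rhom_const, of UNIV G] sring_UNIV]
        subst_poly_single const_0 const_1 h_def)
    ultimately show ?thesis using * by (intro bexI[of _ ?R]) auto
  next
    case True
    then have "card ?T < card (h ` ?E)" using lt by (simp add: card_image)
    moreover have "h ` ?E \<subseteq> mpoly_vs.span ?T" using hspan by blast
    ultimately have dep: "mpoly_vs.dependent (h ` ?E)"
      using mpoly_vs.independent_span_bound[OF finT, of "h ` ?E"] by linarith
    have "finite (h ` ?E)" using finE by (rule finite_imageI)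
    from dep[unfolded mpoly_vs.dependent_finite[OF this]]
    obtain u where u: "\<exists>z\<in>h ` ?E. u z \<noteq> 0" "(\<Sum>z\<in>h ` ?E. const (u z) * z) = 0" by (elim exE conjE)
    define R where "R = (\<Sum>\<phi>\<in>?E. Poly_Mapping.single (pm V \<phi>) (u (h \<phi>)))"
    obtain \<phi> where \<phi>: "\<phi> \<in> ?E" "u (h \<phi>) \<noteq> 0" using u(1) by blast
    have "Poly_Mapping.lookup R (pm V \<phi>) = (\<Sum>\<psi>\<in>?E. if \<psi> = \<phi> then u (h \<psi>) else 0)"
      unfolding R_def lookup_sum
      by (intro sum.cong refl) (use inj_on_pm[OF V] \<phi>(1) in \<open>auto simp: lookup_single when_def dest: inj_onD\<close>)
    also have "\<dots> = u (h \<phi>)" using finE \<phi>(1) by simp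
    finally have "R \<noteq> 0" using \<phi>(2) by auto
    moreover have "R \<in> mpv V" unfolding R_def
      by (intro sring_sum[OF sring_mpv]) (use keys_pm[OF V] in \<open>auto simp: mpv_def\<close>)
    moreover have "subst_poly const G R = (\<Sum>\<phi>\<in>?E. const (u (h \<phi>)) * h \<phi>)"
      unfolding R_def by (simp add: subst_poly_sum[OF rhom_const] subst_poly_single const_0 h_def)
    then have "subst_poly const G R = 0" using u(2) by (simp add: sum.reindex[OF True])
    ultimately show ?thesis by blast
  qed
qed

section \<open>Leading monomials and complete integral closedness\<close>

definition lm :: "'a::zero mpoly \<Rightarrow> nat \<Rightarrow>\<^sub>0 nat" where
  "lm f = Max (Poly_Mapping.keys f)"

lemma keys_nonempty: "f \<noteq> 0 \<Longrightarrow> Poly_Mapping.keys f \<noteq> {}"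
  by (metis in_keys_iff lookup_zero poly_mapping_eqI empty_iff)

lemma lm_in_keys: "f \<noteq> 0 \<Longrightarrow> lm f \<in> Poly_Mapping.keys f"
  unfolding lm_def using keys_nonempty by (intro Max_in) auto

lemma le_lm: "m \<in> Poly_Mapping.keys f \<Longrightarrow> m \<le> lm f"
  unfolding lm_def by (intro Max_ge) auto

lemma lookup_mult_lm:
  fixes f g :: "'a::comm_ring_1 mpoly"
  shows "Poly_Mapping.lookup (f * g) (lm f + lm g) = Poly_Mapping.lookup f (lm f) * Poly_Mapping.lookup g (lm g)"
proof (cases "f = 0 \<or> g = 0")
  case False
  let ?L = "lm f + lm g" and ?s = "\<lambda>f m. Poly_Mapping.single m (Poly_Mapping.lookup f m)"
  have eq: "a + b = ?L \<longleftrightarrow> a = lm f \<and> b = lm g" if "a \<in> Poly_Mapping.keys f" "b \<in> Poly_Mapping.keys g" for a b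
  proof
    assume e: "a + b = ?L"
    have "a \<le> lm f" "b \<le> lm g" using that le_lm by auto
    have "\<not> a < lm f"
    proof
      assume "a < lm f"
      then have "a + b < ?L" using \<open>b \<le> lm g\<close> by (rule add_less_le_mono)
      then show False using e by simp
    qed
    moreover have "\<not> b < lm g"
    proof
      assume "b < lm g"
      with \<open>a \<le> lm f\<close> have "a + b < ?L" by (rule add_le_less_mono)
      then show False using e by simp
    qed
    ultimately show "a = lm f \<and> b = lm g"
      using \<open>a \<le> lm f\<close> \<open>b \<le> lm g\<close> le_less[of a "lm f"] le_less[of b "lm g"] by blast
  qed auto
  have "f * g = (\<Sum>a\<in>Poly_Mapping.keys f. \<Sum>b\<in>Poly_Mapping.keys g. ?s f a * ?s g b)"
    by (subst arg_cong2[OF poly_mapping_sum_single[of f] poly_mapping_sum_single[of g], of "(*)"]) (rule sum_product)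
  then have "Poly_Mapping.lookup (f * g) ?L =
    (\<Sum>a\<in>Poly_Mapping.keys f. \<Sum>b\<in>Poly_Mapping.keys g. Poly_Mapping.lookup (?s f a * ?s g b) ?L)"
    by (simp add: lookup_sum)
  also have "\<dots> = (\<Sum>a\<in>Poly_Mapping.keys f. \<Sum>b\<in>Poly_Mapping.keys g.
    if a = lm f then (if b = lm g then Poly_Mapping.lookup f a * Poly_Mapping.lookup g b else 0) else 0)"
    by (intro sum.cong refl) (auto simp: mult_single lookup_single when_def eq)
  also have "\<dots> = (\<Sum>a\<in>Poly_Mapping.keys f. if a = lm f then (\<Sum>b\<in>Poly_Mapping.keys g.
    if b = lm g then Poly_Mapping.lookup f a * Poly_Mapping.lookup g b else 0) else 0)"
    by (intro sum.cong refl) auto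
  also have "\<dots> = Poly_Mapping.lookup f (lm f) * Poly_Mapping.lookup g (lm g)"
    using lm_in_keys[of f] lm_in_keys[of g] False by simp
  finally show ?thesis .
qed auto

lemma lm_mult:
  fixes f g :: "'a::idom mpoly"
  assumes "f \<noteq> 0" "g \<noteq> 0" shows "lm (f * g) = lm f + lm g"
proof (rule antisym)
  have "f * g \<noteq> 0" using assms by simp
  then obtain a b where "a \<in> Poly_Mapping.keys f" "b \<in> Poly_Mapping.keys g" "lm (f * g) = a + b"
    using lm_in_keys[of "f * g"] keys_mult[of f g] by blast
  then show "lm (f * g) \<le> lm f + lm g" by (simp add: add_mono le_lm)
  have "Poly_Mapping.lookup (f * g) (lm f + lm g) \<noteq> 0"
    unfolding lookup_mult_lm using lm_in_keys[OF assms(1)] lm_in_keys[OF assms(2)] by (simp add: in_keys_iff)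
  then show "lm f + lm g \<le> lm (f * g)" by (intro le_lm) (simp add: in_keys_iff)
qed

lemma lm_power:
  fixes f :: "'a::idom mpoly"
  assumes "f \<noteq> 0" shows "Poly_Mapping.lookup (lm (f ^ k)) i = k * Poly_Mapping.lookup (lm f) i"
proof (induction k)
  case 0
  have "lm (1 :: 'a mpoly) = 0" by (simp add: lm_def)
  then show ?case by simp
next
  case (Suc k)
  then show ?case using assms by (simp add: lm_mult lookup_add)
qed

text \<open>The lexicographic order is not well-founded in infinitely many variables; with
  \<open>n\<close> variables the exponents can be minimised one after the other.\<close>

lemma lex_minimal:
  fixes T :: "(nat \<Rightarrow>\<^sub>0 nat) set"
  assumes ne: "T \<noteq> {}" and keys: "\<And>m. m \<in> T \<Longrightarrow> Poly_Mapping.keys m \<subseteq> {..<n}"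
  shows "\<exists>m\<in>T. \<forall>m'\<in>T. m \<le> m'"
proof -
  let ?l = "Poly_Mapping.lookup"
  have "\<exists>m\<in>T. \<forall>m'\<in>T. (\<forall>i<k. ?l m i = ?l m' i) \<or> (\<exists>j<k. ?l m j < ?l m' j \<and> (\<forall>i<j. ?l m i = ?l m' i))" for k
  proof (induction k)
    case 0 then show ?case using ne by auto
  next
    case (Suc k)
    then obtain m where m: "m \<in> T" "\<And>m'. m' \<in> T \<Longrightarrow> (\<forall>i<k. ?l m i = ?l m' i) \<or> (\<exists>j<k. ?l m j < ?l m' j \<and> (\<forall>i<j. ?l m i = ?l m' i))"
      by blast
    let ?P = "\<lambda>m'. m' \<in> T \<and> (\<forall>i<k. ?l m i = ?l m' i)"
    obtain m2 where m2: "?P m2" and min: "\<And>m'. ?P m' \<Longrightarrow> ?l m2 k \<le> ?l m' k"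
      using ex_has_least_nat[of ?P m "\<lambda>m'. ?l m' k"] m(1) by blast
    have "(\<forall>i<Suc k. ?l m2 i = ?l m' i) \<or> (\<exists>j<Suc k. ?l m2 j < ?l m' j \<and> (\<forall>i<j. ?l m2 i = ?l m' i))" if m': "m' \<in> T" for m'
    proof (cases "\<forall>i<k. ?l m i = ?l m' i")
      case True
      then have le: "?l m2 k \<le> ?l m' k" using min m' by blast
      have eq: "\<forall>i<k. ?l m2 i = ?l m' i" using True m2 by simp
      show ?thesis
      proof (cases "?l m2 k = ?l m' k")
        case True then show ?thesis using eq by (auto simp: less_Suc_eq)
      next
        case False then show ?thesis using eq le by (intro disjI2 exI[of _ k]) auto
      qed
    next
      case False
      then obtain j where "j < k" "?l m j < ?l m' j" "\<forall>i<j. ?l m i = ?l m' i" using m(2)[OF m'] by blast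
      then show ?thesis using m2 by (intro disjI2 exI[of _ j]) auto
    qed
    then show ?case using m2 by blast
  qed
  from this[of n] obtain m where m: "m \<in> T" "\<And>m'. m' \<in> T \<Longrightarrow> (\<forall>i<n. ?l m i = ?l m' i) \<or> (\<exists>j<n. ?l m j < ?l m' j \<and> (\<forall>i<j. ?l m i = ?l m' i))"
    by blast
  have "m \<le> m'" if m': "m' \<in> T" for m'
    using m(2)[OF m']
  proof
    assume e: "\<forall>i<n. ?l m i = ?l m' i"
    have all: "?l m i = ?l m' i" for i
    proof (cases "i < n")
      case False
      then have "i \<notin> Poly_Mapping.keys m" "i \<notin> Poly_Mapping.keys m'" using keys m(1) m' by blast+
      then show ?thesis by (simp add: in_keys_iff)
    qed (use e in simp)
    have "m = m'" by (rule poly_mapping_eqI) (rule all)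
    then show ?thesis by simp
  next
    assume "\<exists>j<n. ?l m j < ?l m' j \<and> (\<forall>i<j. ?l m i = ?l m' i)"
    then have "m < m'" by (auto simp: less_poly_mapping.rep_eq less_fun_def)
    then show ?thesis by simp
  qed
  then show ?thesis using m(1) by blast
qed

text \<open>
  Among all \<open>r - a h\<close> take one with least leading monomial. If it is nonzero, comparing leading monomials
  in \<open>c (r - a h)\<^sup>k \<in> a\<^sup>k S\<close> for large \<open>k\<close> shows that its leading term is divisible by that of \<open>a\<close>.
\<close>

lemma completely_integrally_closed:
  fixes a r c :: "'k::field mpoly"
  assumes S: "a \<in> mpv {..<n}" "r \<in> mpv {..<n}" and nz: "a \<noteq> 0" "c \<noteq> 0"
    and div: "\<And>k. \<exists>h. c * r ^ k = a ^ k * h"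
  shows "\<exists>h\<in>mpv {..<n}. r = a * h"
proof (rule ccontr)
  assume no: "\<not> ?thesis"
  let ?S = "mpv {..<n} :: 'k mpoly set"
  note M = sring_mpv[of "{..<n}"]
  let ?T = "(\<lambda>h. lm (r - a * h)) ` ?S"
  have nz': "r - a * h \<noteq> 0" if "h \<in> ?S" for h using no that by auto
  have RS: "r - a * h \<in> ?S" if "h \<in> ?S" for h using sring_diff[OF M S(2) sring_mult[OF M S(1) that]] .
  have "\<exists>m\<in>?T. \<forall>m'\<in>?T. m \<le> m'"
  proof (rule lex_minimal)
    show "?T \<noteq> {}" using sring_1[OF M] by blast
    show "Poly_Mapping.keys m \<subseteq> {..<n}" if "m \<in> ?T" for m
      using that RS lm_in_keys[OF nz'] by (force simp: mpv_def)
  qed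
  then obtain h0 where h0: "h0 \<in> ?S" and min: "\<And>h. h \<in> ?S \<Longrightarrow> lm (r - a * h0) \<le> lm (r - a * h)" by blast
  define r' where "r' = r - a * h0"
  have r': "r' \<noteq> 0" "r' \<in> ?S" using nz'[OF h0] RS[OF h0] by (simp_all add: r'_def)
  \<comment> \<open>The divisibility passes from \<open>r\<close> to \<open>r - a * h0\<close>,
    since every term of the binomial expansion contains \<open>a ^ k\<close>.\<close>
  have div': "\<exists>h. c * r' ^ k = a ^ k * h" for k
  proof -
    obtain d where d: "\<And>j. c * r ^ j = a ^ j * d j" using div by metis
    have "c * r' ^ k = (\<Sum>j\<le>k. of_nat (k choose j) * (c * r ^ j) * (- (a * h0)) ^ (k - j))"
      unfolding r'_def using binomial_ring[of r "- (a * h0)" k] by (simp add: sum_distrib_left mult_ac)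
    also have "\<dots> = (\<Sum>j\<le>k. a ^ k * (of_nat (k choose j) * d j * (- h0) ^ (k - j)))"
    proof (intro sum.cong refl)
      fix j assume "j \<in> {..k}"
      then have ak: "a ^ k = a ^ j * a ^ (k - j)" by (simp flip: power_add)
      have "(- (a * h0)) ^ (k - j) = a ^ (k - j) * (- h0) ^ (k - j)"
        unfolding power_mult_distrib[symmetric] by simp
      then show "of_nat (k choose j) * (c * r ^ j) * (- (a * h0)) ^ (k - j) =
        a ^ k * (of_nat (k choose j) * d j * (- h0) ^ (k - j))"
        unfolding d ak by (simp add: mult_ac)
    qed
    also have "\<dots> = a ^ k * (\<Sum>j\<le>k. of_nat (k choose j) * d j * (- h0) ^ (k - j))" by (simp add: sum_distrib_left)
    finally show ?thesis by blast
  qed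
  have le: "Poly_Mapping.lookup (lm a) i \<le> Poly_Mapping.lookup (lm r') i" for i
  proof (rule ccontr)
    assume lt: "\<not> ?thesis"
    \<comment> \<open>One more than the exponent in \<open>c\<close>, so that \<open>c\<close>
      cannot make up for \<open>k\<close> deficits of at least \<open>1\<close>.\<close>
    define k where "k = Poly_Mapping.lookup (lm c) i + 1"
    obtain h where h: "c * r' ^ k = a ^ k * h" using div' by blast
    have "c * r' ^ k \<noteq> 0" using nz r' by simp
    then have "h \<noteq> 0" using h by auto
    have "Poly_Mapping.lookup (lm (c * r' ^ k)) i = Poly_Mapping.lookup (lm c) i + k * Poly_Mapping.lookup (lm r') i"
      using nz r' by (simp add: lm_mult lookup_add lm_power)
    moreover have "Poly_Mapping.lookup (lm (a ^ k * h)) i = k * Poly_Mapping.lookup (lm a) i + Poly_Mapping.lookup (lm h) i"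
      using nz \<open>h \<noteq> 0\<close> by (simp add: lm_mult lookup_add lm_power)
    ultimately have "k * Poly_Mapping.lookup (lm a) i \<le> Poly_Mapping.lookup (lm c) i + k * Poly_Mapping.lookup (lm r') i"
      using h by simp
    moreover have "k * (Poly_Mapping.lookup (lm r') i + 1) \<le> k * Poly_Mapping.lookup (lm a) i"
      using lt by (intro mult_left_mono) auto
    ultimately show False by (simp add: k_def)
  qed
  define m where "m = lm r' - lm a"
  have m: "lm a + m = lm r'" using le by (intro poly_mapping_eqI) (simp add: m_def lookup_add lookup_minus)
  \<comment> \<open>The quotient of the leading terms: \<open>a * e\<close> cancels the leading term
    of \<open>r'\<close>, against its minimality.\<close>
  define e where "e = Poly_Mapping.single m (Poly_Mapping.lookup r' (lm r') / Poly_Mapping.lookup a (lm a))"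
  have lca: "Poly_Mapping.lookup a (lm a) \<noteq> 0" "Poly_Mapping.lookup r' (lm r') \<noteq> 0"
    using lm_in_keys nz r' by (auto simp: in_keys_iff)
  have e0: "e \<noteq> 0" using lca by (metis divide_eq_0_iff e_def lookup_single_eq lookup_zero)
  have lme: "lm e = m" using lca by (simp add: lm_def e_def)
  have "Poly_Mapping.keys m \<subseteq> Poly_Mapping.keys (lm r')" by (auto simp: m_def in_keys_iff lookup_minus)
  also have "\<dots> \<subseteq> {..<n}" using r' lm_in_keys[OF r'(1)] by (auto simp: mpv_def)
  finally have eS: "e \<in> ?S" by (auto simp: e_def mpv_def)
  let ?h = "h0 + e"
  have hS: "?h \<in> ?S" by (rule sring_add[OF M h0 eS])
  have eq: "r - a * ?h = r' - a * e" by (simp add: r'_def algebra_simps)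
  have "lm (r - a * ?h) \<noteq> lm r'"
  proof
    assume "lm (r - a * ?h) = lm r'"
    then have "Poly_Mapping.lookup (r' - a * e) (lm r') \<noteq> 0"
      using lm_in_keys[OF nz'[OF hS]] by (simp add: eq in_keys_iff)
    moreover have "Poly_Mapping.lookup (a * e) (lm r') = Poly_Mapping.lookup r' (lm r')"
    proof -
      have "Poly_Mapping.lookup (a * e) (lm r') = Poly_Mapping.lookup a (lm a) * Poly_Mapping.lookup e m"
        using lookup_mult_lm[of a e] by (simp only: lme m)
      moreover have "Poly_Mapping.lookup e m = Poly_Mapping.lookup r' (lm r') / Poly_Mapping.lookup a (lm a)"
        by (simp add: e_def)
      ultimately show ?thesis using lca(1) by simp
    qed
    ultimately show False by (simp add: lookup_minus)
  qed
  moreover have "lm (r - a * ?h) \<le> lm r'"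
  proof -
    have "lm (r - a * ?h) \<in> Poly_Mapping.keys r' \<union> Poly_Mapping.keys (a * e)"
      using lm_in_keys[OF nz'[OF hS]] unfolding eq by (auto simp: in_keys_iff lookup_minus)
    moreover have "lm (a * e) = lm r'" using lm_mult[OF nz(1) e0] lme m by simp
    ultimately show ?thesis using le_lm by (metis Un_iff)
  qed
  ultimately show False using min[OF hS] unfolding r'_def by simp
qed

definition ispan :: "'a::comm_ring_1 set \<Rightarrow> 'a set \<Rightarrow> 'a set" where
  "ispan A T = \<Inter>{N. smod A N \<and> T \<subseteq> N}"

lemma smod_ispan: "smod A (ispan A T)"
  unfolding ispan_def smod_def by blast

lemma ispan_superset: "T \<subseteq> ispan A T"
  unfolding ispan_def by blast

lemma ispan_minimal: "smod A N \<Longrightarrow> T \<subseteq> N \<Longrightarrow> ispan A T \<subseteq> N"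
  unfolding ispan_def by blast

lemma to_ac_eq_0_iff: "to_ac c = 0 \<longleftrightarrow> c = 0"
proof
  assume z: "to_ac c = 0"
  show "c = 0"
  proof (rule ccontr)
    assume "c \<noteq> 0"
    then have "to_ac c * to_ac (inverse c) = 1"
      by (simp flip: to_ac_mult)
    then show False using z by simp
  qed
qed simp

lemma rhom_to_ac: "rhom A (to_ac :: 'k::field \<Rightarrow> _)" by (simp add: rhom_def)

lemma rhom_comp: "rhom A \<phi> \<Longrightarrow> (\<And>x. x \<in> A \<Longrightarrow> \<phi> x \<in> B) \<Longrightarrow> rhom B \<psi> \<Longrightarrow> rhom A (\<lambda>x. \<psi> (\<phi> x))"
  by (simp add: rhom_def)

section \<open>Separating algebras\<close>

locale separating_algebra = ring_action G act S for G :: "('g, 'm) monoid_scheme" (structure)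
    and act :: "'g \<Rightarrow> 'k::field mpoly \<Rightarrow> 'k mpoly" and S +
  fixes n :: nat and A :: "'k mpoly set"
  assumes S_eq: "S = mpv {..<n}" and ch: "normalization_semidom_class.prime CHAR('k)"
    and act_const: "\<sigma> \<in> carrier G \<Longrightarrow> act \<sigma> (const c) = const c"
    and act_lookup_0: "\<sigma> \<in> carrier G \<Longrightarrow> s \<in> S \<Longrightarrow> Poly_Mapping.lookup (act \<sigma> s) 0 = Poly_Mapping.lookup s 0"
    and A: "sring A" and A_inv: "A \<subseteq> invs (carrier G)" and constA: "const c \<in> A"
    and grA: "a \<in> A \<Longrightarrow> hom_component d a \<in> A"
    and sep: "F \<in> invs (carrier G) \<Longrightarrow> u \<in> ext_space n \<Longrightarrow> w \<in> ext_space n \<Longrightarrow>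
      (\<And>h. h \<in> A \<Longrightarrow> subst_poly to_ac u h = subst_poly to_ac w h) \<Longrightarrow> subst_poly to_ac u F = subst_poly to_ac w F"
begin

lemma ch_mpoly: "normalization_semidom_class.prime CHAR('k mpoly)"
  unfolding CHAR_mpoly by (rule ch)

lemma AS: "A \<subseteq> S" using A_inv by (auto simp: invs_def)

text \<open>In \<open>K[x][y]\<close>, with \<open>x\<close> in the coefficients and
  \<open>y\<close> as outer variables, \<open>const f\<close> is \<open>f(x)\<close> and
  \<open>lift f\<close> is \<open>f(y)\<close>.\<close>

definition lift :: "'k mpoly \<Rightarrow> 'k mpoly mpoly" where
  "lift = subst_poly (\<lambda>c. const (const c)) var"

lemma rhom_cc: "rhom B (\<lambda>c::'k. const (const c) :: 'k mpoly mpoly)"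
  by (simp add: rhom_def const_add const_mult const_1)

lemma rhom_lift: "rhom B lift" unfolding lift_def by (rule rhom_subst_poly[OF rhom_cc])

lemma lift_const: "lift (const c) = const (const c)" by (simp add: lift_def subst_poly_const const_0)
lemma lift_var: "lift (var i) = var i" by (simp add: lift_def subst_poly_var const_0 const_1)

text \<open>\<open>K[x, y]\<close> as a tower of single adjunctions, the form required by
  \<open>nullstellensatz_tower\<close>.\<close>

definition S2 :: "'k mpoly mpoly set" where
  "S2 = adjs (range (\<lambda>c. const (const c))) (map (\<lambda>i. const (var i)) [0..<n] @ map var [0..<n])"

lemma sring_cc: "sring (range (\<lambda>c. const (const c)) :: 'k mpoly mpoly set)"
proof -
  let ?B = "range (\<lambda>c. const (const c)) :: 'k mpoly mpoly set"
  have "const (const c) - const (const d) = const (const (c - d))" for c d :: 'k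
    by (simp add: rhom_diff[OF rhom_cc sring_UNIV])
  moreover have "const (const c) * const (const d) = const (const (c * d))" for c d :: 'k
    by (simp add: const_mult)
  moreover have "1 = const (const (1::'k))" by (simp add: const_1)
  ultimately show ?thesis unfolding sring_def by (metis (no_types, lifting) image_iff rangeI)
qed

lemma sring_S2: "sring S2" unfolding S2_def by (rule sring_adjs[OF sring_cc])

lemma const_S2: "f \<in> S \<Longrightarrow> const f \<in> S2"
proof -
  have "sring {f. const f \<in> S2}"
    using sring_1[OF sring_S2] sring_diff[OF sring_S2] sring_mult[OF sring_S2]
    by (auto simp: sring_def const_1 const_mult rhom_diff[OF rhom_const sring_UNIV])
  moreover have "const (const c) \<in> S2" for c
    unfolding S2_def by (rule subsetD[OF adjs_superset[OF sring_cc]]) blast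
  moreover have "const (var i) \<in> S2" if "i < n" for i
    unfolding S2_def by (rule adjs_elem[OF sring_cc]) (use that in auto)
  ultimately have "mpv {..<n} \<subseteq> {f. const f \<in> S2}" by (intro mpv_induct CollectI; simp)
  then show "f \<in> S \<Longrightarrow> const f \<in> S2" by (auto simp: S_eq)
qed

lemma lift_S2: "f \<in> S \<Longrightarrow> lift f \<in> S2"
proof -
  have "sring {f. lift f \<in> S2}"
    using sring_1[OF sring_S2] sring_diff[OF sring_S2] sring_mult[OF sring_S2]
    by (auto simp: sring_def rhom_1[OF rhom_lift] rhom_mult[OF rhom_lift[of UNIV]] rhom_diff[OF rhom_lift sring_UNIV])
  moreover have "lift (const c) \<in> S2" for c
    unfolding lift_const S2_def by (rule subsetD[OF adjs_superset[OF sring_cc]]) blast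
  moreover have "lift (var i) \<in> S2" if "i < n" for i
    unfolding lift_var S2_def by (rule adjs_elem[OF sring_cc]) (use that in auto)
  ultimately have "mpv {..<n} \<subseteq> {f. lift f \<in> S2}" by (intro mpv_induct CollectI; simp)
  then show "f \<in> S \<Longrightarrow> lift f \<in> S2" by (auto simp: S_eq)
qed

lemma S2_lookup: assumes "U \<in> S2" shows "U \<in> mpv {..<n}" "Poly_Mapping.lookup U m \<in> S"
proof -
  let ?T = "{U \<in> mpv {..<n}. \<forall>m. Poly_Mapping.lookup U m \<in> S}"
  have "sring ?T"
  proof -
    have "Poly_Mapping.lookup (U * U') m \<in> S" if "U \<in> ?T" "U' \<in> ?T" for U U' m
    proof -
      let ?s = "\<lambda>f m. Poly_Mapping.single m (Poly_Mapping.lookup f m)"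
      have "U * U' = (\<Sum>a\<in>Poly_Mapping.keys U. \<Sum>b\<in>Poly_Mapping.keys U'. ?s U a * ?s U' b)"
        by (subst arg_cong2[OF poly_mapping_sum_single[of U] poly_mapping_sum_single[of U'], of "(*)"]) (rule sum_product)
      then have "Poly_Mapping.lookup (U * U') m =
        (\<Sum>a\<in>Poly_Mapping.keys U. \<Sum>b\<in>Poly_Mapping.keys U'. Poly_Mapping.lookup (?s U a * ?s U' b) m)"
        by (simp only: lookup_sum)
      also have "\<dots> \<in> S"
        using that sring_0[OF S] by (intro sring_sum[OF S]) (auto simp: mult_single lookup_single when_def sring_mult[OF S])
      finally show ?thesis .
    qed
    moreover have "Poly_Mapping.lookup (1 :: 'k mpoly mpoly) m \<in> S" for m
      using sring_0[OF S] sring_1[OF S] by (simp add: lookup_one when_def)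
    ultimately show ?thesis
      by (auto simp: sring_def lookup_minus sring_diff[OF S] sring_diff[OF sring_mpv] sring_mult[OF sring_mpv] sring_1[OF sring_mpv])
  qed
  moreover have "const f \<in> ?T" if "f \<in> S" for f
    using that sring_0[OF S] by (auto simp: const_in_mpv) (simp add: const_def lookup_single when_def)
  moreover have "var i \<in> ?T" if "i < n" for i
    using that sring_0[OF S] sring_1[OF S] by (auto simp: var_in_mpv) (simp add: var_def lookup_single when_def)
  moreover have "const c \<in> S" "i < n \<Longrightarrow> var i \<in> S" for c i
    by (auto simp: S_eq const_in_mpv var_in_mpv)
  ultimately have "S2 \<subseteq> ?T" unfolding S2_def by (intro adjs_minimal) auto
  then show "U \<in> mpv {..<n}" "Poly_Mapping.lookup U m \<in> S" using assms by blast+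
qed

text \<open>Its zeros over the algebraic closure are the pairs of points that \<open>A\<close> does
  not separate.\<close>

definition J2 :: "'k mpoly mpoly set" where
  "J2 = ispan S2 ((\<lambda>h. const h - lift h) ` A)"

lemma idl_J2: "idl S2 J2"
proof -
  have "const h - lift h \<in> S2" if "h \<in> A" for h
    using that AS const_S2 lift_S2 sring_diff[OF sring_S2] by blast
  then have "J2 \<subseteq> S2" unfolding J2_def by (intro ispan_minimal sring_smod sring_S2 image_subsetI)
  then show ?thesis unfolding idl_def by (simp add: J2_def smod_ispan)
qed

lemma ev_on_mpv:
  assumes \<phi>: "rhom S \<phi>" and c: "\<And>c. \<phi> (const c) = to_ac c" and f: "f \<in> S"
  shows "\<phi> f = subst_poly to_ac (\<lambda>i. if i < n then \<phi> (var i) else 0) f"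
  by (rule rhom_eq_on_mpv[OF \<phi> rhom_subst_poly[OF rhom_to_ac] S _ _ _ f[unfolded S_eq]])
    (simp_all add: S_eq subst_poly_const subst_poly_var c)

text \<open>By the Nullstellensatz it is enough that \<open>F(x) - F(y)\<close> vanishes at the
  zeros of \<open>J2\<close>: pairs not separated by \<open>A\<close>, hence not by any
  invariant.\<close>

lemma power_in_J2:
  assumes F: "F \<in> invs (carrier G)"
  shows "\<exists>k. (const F - lift F) ^ k \<in> J2"
proof (rule ccontr)
  assume no: "\<not> ?thesis"
  have FS: "F \<in> S" using F by (simp add: invs_def)
  let ?z = "const F - lift F"
  have z: "?z \<in> S2" using FS const_S2 lift_S2 sring_diff[OF sring_S2] by blast
  obtain P where P: "pidl S2 P" "J2 \<subseteq> P" "?z \<notin> P"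
    using prime_ideal_avoiding[OF sring_S2 idl_J2 z] no by metis
  let ?A0 = "range (\<lambda>c. const (const c)) :: 'k mpoly mpoly set"
  define \<phi>0 where "\<phi>0 U = to_ac (Poly_Mapping.lookup (Poly_Mapping.lookup U 0) 0)" for U :: "'k mpoly mpoly"
  have \<phi>0: "\<phi>0 (const (const c)) = to_ac c" for c by (simp add: \<phi>0_def const_def)
  have h0: "rhom ?A0 \<phi>0"
  proof -
    have "\<phi>0 1 = 1" using \<phi>0[of 1] by (simp add: const_1)
    moreover have "\<phi>0 (const (const c) + const (const d)) = \<phi>0 (const (const c)) + \<phi>0 (const (const d))" for c d
      using \<phi>0[of "c + d"] by (simp add: \<phi>0 const_add)
    moreover have "\<phi>0 (const (const c) * const (const d)) = \<phi>0 (const (const c)) * \<phi>0 (const (const d))" for c d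
      using \<phi>0[of "c * d"] by (simp add: \<phi>0 const_mult)
    ultimately show ?thesis by (auto simp: rhom_def)
  qed
  have unit: "c = 0" if cP: "const (const c) \<in> P" for c :: 'k
  proof (rule ccontr)
    assume "c \<noteq> 0"
    then have "const (const (inverse c)) * const (const c) = (1 :: 'k mpoly mpoly)"
      by (simp add: const_1 flip: const_mult)
    moreover have "const (const (inverse c)) \<in> S2" using const_S2 const_in_mpv S_eq by blast
    ultimately have "1 \<in> P" using smod_scale[OF pidl_smod[OF P(1)] _ cP] by metis
    then show False using pidl_1[OF P(1)] by blast
  qed
  have "\<exists>u\<in>?A0 - P. \<forall>\<phi>::'k mpoly mpoly \<Rightarrow> 'k alg_closure. rhom ?A0 \<phi> \<and>
    (\<forall>z\<in>?A0 \<inter> P. \<phi> z = 0) \<and> \<phi> u \<noteq> 0 \<longrightarrow>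
    (\<exists>\<phi>'. rhom S2 \<phi>' \<and> (\<forall>z\<in>?A0. \<phi>' z = \<phi> z) \<and> (\<forall>z\<in>P. \<phi>' z = 0) \<and> \<phi>' ?z \<noteq> 0)"
    unfolding S2_def by (rule nullstellensatz_tower[OF sring_cc]) (use P z in \<open>simp_all only: S2_def[symmetric] not_False_eq_True\<close>)
  then obtain u where u: "u \<in> ?A0 - P" and ext: "\<forall>\<phi>::'k mpoly mpoly \<Rightarrow> 'k alg_closure. rhom ?A0 \<phi> \<and>
    (\<forall>z\<in>?A0 \<inter> P. \<phi> z = 0) \<and> \<phi> u \<noteq> 0 \<longrightarrow>
    (\<exists>\<phi>'. rhom S2 \<phi>' \<and> (\<forall>z\<in>?A0. \<phi>' z = \<phi> z) \<and> (\<forall>z\<in>P. \<phi>' z = 0) \<and> \<phi>' ?z \<noteq> 0)"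
    by (rule bexE)
  have u0: "\<phi>0 u \<noteq> 0"
  proof -
    obtain c where "u = const (const c)" using u by blast
    moreover have "c \<noteq> 0"
      using u calculation smod_0[OF pidl_smod[OF P(1)]] by (auto simp: const_0)
    ultimately show ?thesis by (simp add: \<phi>0 to_ac_eq_0_iff)
  qed
  have z0: "\<forall>z\<in>?A0 \<inter> P. \<phi>0 z = 0" using unit by (auto simp: \<phi>0)
  have "\<exists>\<phi>'. rhom S2 \<phi>' \<and> (\<forall>z\<in>?A0. \<phi>' z = \<phi>0 z) \<and> (\<forall>z\<in>P. \<phi>' z = 0) \<and> \<phi>' ?z \<noteq> 0"
    by (rule ext[rule_format]) (intro conjI h0 z0 u0)
  then obtain \<phi> where \<phi>: "rhom S2 \<phi>" "\<And>z. z \<in> ?A0 \<Longrightarrow> \<phi> z = \<phi>0 z" "\<And>z. z \<in> P \<Longrightarrow> \<phi> z = 0" "\<phi> ?z \<noteq> 0"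
    by blast
  \<comment> \<open>The homomorphism is evaluation at the pair of points
    \<open>(u1, u2)\<close>.\<close>
  define u1 where "u1 = (\<lambda>i. if i < n then \<phi> (const (var i)) else 0)"
  define u2 where "u2 = (\<lambda>i. if i < n then \<phi> (lift (var i)) else 0)"
  have e1: "\<phi> (const f) = subst_poly to_ac u1 f" if "f \<in> S" for f
    unfolding u1_def
    by (rule ev_on_mpv[OF rhom_comp[OF rhom_const const_S2 \<phi>(1)] _ that]) (simp_all add: \<phi>(2) \<phi>0)
  have e2: "\<phi> (lift f) = subst_poly to_ac u2 f" if "f \<in> S" for f
    unfolding u2_def
    by (rule ev_on_mpv[OF rhom_comp[OF rhom_lift lift_S2 \<phi>(1)] _ that]) (simp_all add: lift_const \<phi>(2) \<phi>0)
  have d: "\<phi> (const f - lift f) = subst_poly to_ac u1 f - subst_poly to_ac u2 f" if "f \<in> S" for f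
    using rhom_diff[OF \<phi>(1) sring_S2 const_S2[OF that] lift_S2[OF that]] e1[OF that] e2[OF that] by simp
  have "subst_poly to_ac u1 F = subst_poly to_ac u2 F"
  proof (rule sep[OF F])
    show "u1 \<in> ext_space n" "u2 \<in> ext_space n" by (auto simp: ext_space_def u1_def u2_def)
    fix h assume h: "h \<in> A"
    then have "const h - lift h \<in> J2" unfolding J2_def by (intro subsetD[OF ispan_superset] imageI)
    then have "\<phi> (const h - lift h) = 0" using \<phi>(3) P(2) by blast
    then show "subst_poly to_ac u1 h = subst_poly to_ac u2 h" using d[of h] h AS by auto
  qed
  then show False using d[OF FS] \<phi>(4) by simp
qed

text \<open>A \<open>p ^ k\<close>-th power of \<open>F(x) - F(y)\<close> is again such a
  difference, now of a power of \<open>F\<close>.\<close>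

lemma frobenius_power_in_J2:
  assumes F: "F \<in> invs (carrier G)"
  shows "\<exists>k. const (F ^ (CHAR('k) ^ k)) - lift (F ^ (CHAR('k) ^ k)) \<in> J2"
proof -
  have FS: "F \<in> S" using F by (simp add: invs_def)
  have z: "const F - lift F \<in> S2" using FS const_S2 lift_S2 sring_diff[OF sring_S2] by blast
  obtain N where N: "(const F - lift F) ^ N \<in> J2" using power_in_J2[OF F] by blast
  obtain k where k: "N \<le> CHAR('k) ^ k" using exists_power_ge prime_gt_1_nat[OF ch] by blast
  have CH: "CHAR('k mpoly mpoly) = CHAR('k)" by (simp add: CHAR_mpoly)
  have "(const F - lift F) ^ (CHAR('k) ^ k) = const F ^ (CHAR('k) ^ k) - lift F ^ (CHAR('k) ^ k)"
    using frobenius_diff[of "const F" "lift F" k] ch by (simp add: CH)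
  also have "\<dots> = const (F ^ (CHAR('k) ^ k)) - lift (F ^ (CHAR('k) ^ k))"
    by (simp add: rhom_power[OF rhom_const sring_UNIV] rhom_power[OF rhom_lift sring_UNIV])
  finally show ?thesis
    using power_le_dvd_smod[OF idl_smod[OF idl_J2] sring_S2 z N k] by metis
qed

definition AplusS :: "'k mpoly set" where
  "AplusS = ispan S {a \<in> A. Poly_Mapping.lookup a 0 = 0}"

text \<open>The element of \<open>J2\<close> is read as a polynomial in \<open>y\<close> over \<open>S\<close> and evaluated at \<open>y = 0\<close>.\<close>

lemma J2_at_zero:
  assumes FS: "F \<in> S" and F0: "Poly_Mapping.lookup F 0 = 0" and J: "const F - lift F \<in> J2"
  shows "F \<in> AplusS"
proof -
  define \<theta> where "\<theta> = subst_poly id (\<lambda>_. 0 :: 'k mpoly)"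
  have id: "rhom UNIV (id :: 'k mpoly \<Rightarrow> _)" by (simp add: rhom_def)
  note hom\<theta> = rhom_subst_poly[OF id, of _ "\<lambda>_. 0", folded \<theta>_def]
  have \<theta>c: "\<theta> (const f) = f" for f by (simp add: \<theta>_def subst_poly_const)
  have \<theta>l: "\<theta> (lift f) = const (Poly_Mapping.lookup f 0)" for f
  proof (rule rhom_eq_on_mpv[of UNIV "\<lambda>f. \<theta> (lift f)" "\<lambda>f. const (Poly_Mapping.lookup f 0)" UNIV])
    show "rhom UNIV (\<lambda>f. \<theta> (lift f))" by (rule rhom_comp[OF rhom_lift[of UNIV] UNIV_I hom\<theta>])
    show "rhom UNIV (\<lambda>f::'k mpoly. const (Poly_Mapping.lookup f 0))"
      by (simp add: rhom_def const_1 const_add const_mult lookup_add lookup_0_mult)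
    show "\<theta> (lift (const c)) = const (Poly_Mapping.lookup (const c) 0)" for c
      by (simp add: lift_const \<theta>c) (simp add: const_def)
    show "\<theta> (lift (var i)) = const (Poly_Mapping.lookup (var i) 0)" for i
    proof -
      have "Poly_Mapping.single i (1::nat) \<noteq> 0" by (metis lookup_single_eq lookup_zero one_neq_zero)
      then have "Poly_Mapping.lookup (var i) 0 = (0::'k)" by (simp add: var_def lookup_single when_def)
      then show ?thesis by (simp add: lift_var \<theta>_def subst_poly_var const_0)
    qed
  qed (simp_all add: mpv_UNIV sring_UNIV)
  have \<theta>S: "\<theta> U \<in> S" if "U \<in> S2" for U
    unfolding \<theta>_def subst_poly_meval
    using S2_lookup(2)[OF that] sring_0[OF S]
    by (intro sring_sum[OF S] sring_mult[OF S]) (auto simp: meval_def intro!: sring_prod[OF S] sring_power[OF S])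
  let ?N = "{z. \<theta> z \<in> AplusS}"
  have sm: "smod S AplusS" unfolding AplusS_def by (rule smod_ispan)
  have "smod S2 ?N"
    unfolding smod_def using smod_0[OF sm] smod_add[OF sm] smod_scale[OF sm \<theta>S]
    by (auto simp: rhom_add[OF hom\<theta>[of UNIV]] rhom_mult[OF hom\<theta>[of UNIV]] rhom_0[OF hom\<theta> sring_UNIV])
  moreover have "const h - lift h \<in> ?N" if h: "h \<in> A" for h
  proof -
    have "h - const (Poly_Mapping.lookup h 0) \<in> {a \<in> A. Poly_Mapping.lookup a 0 = 0}"
      using h sring_diff[OF A] constA by (auto simp: lookup_minus) (simp add: const_def)
    from subsetD[OF ispan_superset this] show ?thesis unfolding AplusS_def
      by (simp add: rhom_diff[OF hom\<theta> sring_UNIV] \<theta>c \<theta>l)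
  qed
  ultimately have "J2 \<subseteq> ?N" unfolding J2_def by (intro ispan_minimal) auto
  then have "\<theta> (const F - lift F) \<in> AplusS" using J by blast
  then show ?thesis by (simp add: rhom_diff[OF hom\<theta> sring_UNIV] \<theta>c \<theta>l F0 const_0)
qed

text \<open>
  Applying an \<open>A\<close>-linear functional \<open>l\<close> to the coefficients of \<open>U \<in> S[y]\<close> and putting \<open>y = x\<close>
  kills \<open>J2\<close> modulo \<open>P S\<close>.
\<close>

lemma functional_on_J2:
  assumes fg: "S = gs M g A" and P: "pidl A P" and lA: "\<And>z. l z \<in> A"
    and ladd: "\<And>z w. z \<in> S \<Longrightarrow> w \<in> S \<Longrightarrow> l (z + w) - (l z + l w) \<in> P"
    and lscale: "\<And>a z. a \<in> A \<Longrightarrow> z \<in> S \<Longrightarrow> l (a * z) - a * l z \<in> P"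
    and FS: "F \<in> S" and J: "const F - lift F \<in> J2"
  shows "l 1 * F - l F \<in> gs M g P"
proof -
  let ?PS = "gs M g P"
  note smP = pidl_smod[OF P]
  have smPS: "smod S ?PS"
    using smod_gs[OF smP, of M g] gs_mult[OF A smP fg S] by (auto simp: smod_def)
  have PPS: "x * s \<in> ?PS" if "x \<in> P" "s \<in> S" for x s using gs_ideal_mult[OF A smP fg S that] .
  define \<Psi> where "\<Psi> U = (\<Sum>m\<in>Poly_Mapping.keys U. l (Poly_Mapping.lookup U m) * meval var m)" for U :: "'k mpoly mpoly"
  have mS: "meval var m \<in> S" if "Poly_Mapping.keys m \<subseteq> {..<n}" for m
    unfolding meval_def S_eq by (intro sring_prod[OF sring_mpv] sring_power[OF sring_mpv] var_in_mpv) (use that in auto)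
  \<comment> \<open>\<open>l\<close> is additive only modulo \<open>P\<close>, so \<open>l 0\<close>
    need not vanish, and sums over different supports agree only modulo \<open>P S\<close>.\<close>
  have l0: "l 0 \<in> P"
  proof -
    have "- l 0 \<in> P" using ladd[OF sring_0[OF S] sring_0[OF S]] by simp
    then show ?thesis using smod_uminus[OF smP A] by fastforce
  qed
  have keysS2: "Poly_Mapping.keys m \<subseteq> {..<n}" if "U \<in> S2" "m \<in> Poly_Mapping.keys U" for U m
    using S2_lookup(1)[OF that(1)] that(2) by (auto simp: mpv_def)
  have sup: "\<Psi> U - (\<Sum>m\<in>W. l (Poly_Mapping.lookup U m) * meval var m) \<in> ?PS"
    if W: "finite W" "Poly_Mapping.keys U \<subseteq> W" "\<And>m. m \<in> W \<Longrightarrow> Poly_Mapping.keys m \<subseteq> {..<n}" for U W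
  proof -
    have "(\<Sum>m\<in>W. l (Poly_Mapping.lookup U m) * meval var m) =
      (\<Sum>m\<in>W - Poly_Mapping.keys U. l (Poly_Mapping.lookup U m) * meval var m) + \<Psi> U"
      unfolding \<Psi>_def by (rule sum.subset_diff[OF W(2,1)])
    moreover have "(\<Sum>m\<in>W - Poly_Mapping.keys U. l (Poly_Mapping.lookup U m) * meval var m) \<in> ?PS"
      by (intro smod_sum[OF smPS] PPS mS) (use l0 W(3) in \<open>auto simp: in_keys_iff\<close>)
    ultimately show ?thesis using smod_uminus[OF smPS S] by simp
  qed
  have \<Psi>add: "\<Psi> (U + U') - (\<Psi> U + \<Psi> U') \<in> ?PS" if U: "U \<in> S2" "U' \<in> S2" for U U'
  proof -
    let ?W = "Poly_Mapping.keys U \<union> Poly_Mapping.keys U'"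
    let ?s = "\<lambda>U. \<Sum>m\<in>?W. l (Poly_Mapping.lookup U m) * meval var m"
    have kW: "Poly_Mapping.keys m \<subseteq> {..<n}" if "m \<in> ?W" for m using that keysS2 U by blast
    have "?s (U + U') - (?s U + ?s U') =
      (\<Sum>m\<in>?W. (l (Poly_Mapping.lookup U m + Poly_Mapping.lookup U' m) - (l (Poly_Mapping.lookup U m) + l (Poly_Mapping.lookup U' m))) * meval var m)"
      unfolding sum.distrib[symmetric] sum_subtractf[symmetric]
      by (intro sum.cong refl, simp only: lookup_add left_diff_distrib distrib_right)
    also have "\<dots> \<in> ?PS" using kW by (intro smod_sum[OF smPS] PPS ladd S2_lookup(2) U mS) auto
    finally have 1: "?s (U + U') - (?s U + ?s U') \<in> ?PS" .
    have 2: "\<Psi> (U + U') - ?s (U + U') \<in> ?PS" using Poly_Mapping.keys_add[of U U'] kW by (intro sup) auto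
    have 3: "\<Psi> U - ?s U \<in> ?PS" "\<Psi> U' - ?s U' \<in> ?PS" using kW by (intro sup; auto)+
    have e: "\<Psi> (U + U') - (\<Psi> U + \<Psi> U') = (\<Psi> (U + U') - ?s (U + U')) + (?s (U + U') - (?s U + ?s U')) - ((\<Psi> U - ?s U) + (\<Psi> U' - ?s U'))"
      by (simp only: algebra_simps)
    show ?thesis unfolding e
      by (rule smod_diff[OF smPS S smod_add[OF smPS 2 1] smod_add[OF smPS 3]])
  qed
  have \<Psi>diff: "\<Psi> (U - U') - (\<Psi> U - \<Psi> U') \<in> ?PS" if U: "U \<in> S2" "U' \<in> S2" for U U'
  proof -
    have "\<Psi> U - (\<Psi> (U - U') + \<Psi> U') \<in> ?PS"
      using \<Psi>add[OF sring_diff[OF sring_S2 U] U(2)] by simp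
    then have "- (\<Psi> U - (\<Psi> (U - U') + \<Psi> U')) \<in> ?PS" by (rule smod_uminus[OF smPS S])
    then show ?thesis by (simp add: algebra_simps)
  qed
  have \<Psi>const: "\<Psi> (const h * U) - h * \<Psi> U \<in> ?PS" if h: "h \<in> A" and U: "U \<in> S2" for h U
  proof -
    have lk: "Poly_Mapping.lookup (const h * U) m = h * Poly_Mapping.lookup U m" for m
      by (simp add: const_def mult_map_scale_conv_mult[symmetric] Poly_Mapping.map.rep_eq when_def)
    let ?W = "Poly_Mapping.keys U"
    let ?s = "\<Sum>m\<in>?W. l (Poly_Mapping.lookup (const h * U) m) * meval var m"
    have "?s - h * \<Psi> U = (\<Sum>m\<in>?W. (l (h * Poly_Mapping.lookup U m) - h * l (Poly_Mapping.lookup U m)) * meval var m)"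
      unfolding \<Psi>_def sum_distrib_left sum_subtractf[symmetric] lk
      by (intro sum.cong refl, simp only: left_diff_distrib mult.assoc)
    also have "\<dots> \<in> ?PS" using keysS2[OF U] by (intro smod_sum[OF smPS] PPS lscale h S2_lookup(2) U mS)
    finally have 1: "?s - h * \<Psi> U \<in> ?PS" .
    have "\<Psi> (const h * U) - ?s \<in> ?PS"
      using keysS2[OF U] lk by (intro sup) (auto simp: in_keys_iff)
    from smod_add[OF smPS this 1] show ?thesis by simp
  qed
  have \<Psi>var: "\<Psi> (var i * U) = var i * \<Psi> U" for i U
  proof -
    have eq: "var i * U = (\<Sum>m\<in>Poly_Mapping.keys U. Poly_Mapping.single (Poly_Mapping.single i 1 + m) (Poly_Mapping.lookup U m))"
      by (subst (1) poly_mapping_sum_single[of U]) (simp add: sum_distrib_left var_def mult_single)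
    have lk: "Poly_Mapping.lookup (var i * U) (Poly_Mapping.single i 1 + m) = Poly_Mapping.lookup U m" for m
      unfolding eq lookup_sum by (simp add: lookup_single when_def) (simp add: in_keys_iff)
    have keys: "Poly_Mapping.keys (var i * U) = (\<lambda>m. Poly_Mapping.single i 1 + m) ` Poly_Mapping.keys U"
    proof
      show "Poly_Mapping.keys (var i * U) \<subseteq> (\<lambda>m. Poly_Mapping.single i 1 + m) ` Poly_Mapping.keys U"
        using keys_mult[of "var i" U] by (auto simp: var_def)
      show "(\<lambda>m. Poly_Mapping.single i 1 + m) ` Poly_Mapping.keys U \<subseteq> Poly_Mapping.keys (var i * U)"
        using lk by (auto simp: in_keys_iff)
    qed
    have "\<Psi> (var i * U) = (\<Sum>m\<in>Poly_Mapping.keys U. l (Poly_Mapping.lookup U m) * meval var (Poly_Mapping.single i 1 + m))"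
      unfolding \<Psi>_def keys by (subst sum.reindex) (auto simp: inj_on_def lk[simplified])
    also have "\<dots> = var i * \<Psi> U"
      unfolding \<Psi>_def sum_distrib_left by (intro sum.cong refl) (simp add: meval_add meval_single)
    finally show ?thesis .
  qed
  have \<Psi>S: "\<Psi> U \<in> S" if "U \<in> S2" for U unfolding \<Psi>_def
    by (intro sring_sum[OF S] sring_mult[OF S] mS keysS2[OF that]) (use lA AS in auto)
  \<comment> \<open>\<open>\<Psi>\<close> is linear over \<open>A\<close> through the coefficients
    and over \<open>S\<close> through the outer variables. For \<open>h \<in> A\<close> both give
    \<open>h * \<Psi> s\<close> modulo \<open>P S\<close>, which is why
    \<open>const h - lift h\<close> is killed.\<close>
  let ?B = "{h \<in> S. \<forall>U\<in>S2. \<Psi> (lift h * U) - h * \<Psi> U \<in> ?PS}"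
  have "sring ?B"
  proof -
    have "\<Psi> (lift (h - h') * U) - (h - h') * \<Psi> U \<in> ?PS" if h: "h \<in> ?B" "h' \<in> ?B" and U: "U \<in> S2" for h h' U
    proof -
      have 1: "\<Psi> (lift h * U) - h * \<Psi> U \<in> ?PS" "\<Psi> (lift h' * U) - h' * \<Psi> U \<in> ?PS" using h U by auto
      have "lift h * U \<in> S2" "lift h' * U \<in> S2" using h U lift_S2 sring_mult[OF sring_S2] by auto
      from \<Psi>diff[OF this] have 2: "\<Psi> (lift h * U - lift h' * U) - (\<Psi> (lift h * U) - \<Psi> (lift h' * U)) \<in> ?PS" .
      have "lift (h - h') * U = lift h * U - lift h' * U"
        by (simp add: rhom_diff[OF rhom_lift sring_UNIV] left_diff_distrib)
      then have "\<Psi> (lift (h - h') * U) - (h - h') * \<Psi> U =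
        (\<Psi> (lift h * U - lift h' * U) - (\<Psi> (lift h * U) - \<Psi> (lift h' * U))) + ((\<Psi> (lift h * U) - h * \<Psi> U) - (\<Psi> (lift h' * U) - h' * \<Psi> U))"
        by (simp only:) (simp add: algebra_simps)
      then show ?thesis using smod_add[OF smPS 2 smod_diff[OF smPS S 1]] by simp
    qed
    moreover have "\<Psi> (lift (h * h') * U) - (h * h') * \<Psi> U \<in> ?PS" if h: "h \<in> ?B" "h' \<in> ?B" and U: "U \<in> S2" for h h' U
    proof -
      have "lift h' * U \<in> S2" using h U lift_S2 sring_mult[OF sring_S2] by auto
      then have 1: "\<Psi> (lift h * (lift h' * U)) - h * \<Psi> (lift h' * U) \<in> ?PS" using h by blast
      have "\<Psi> (lift h' * U) - h' * \<Psi> U \<in> ?PS" "h \<in> S" using h U by auto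
      then have 2: "h * (\<Psi> (lift h' * U) - h' * \<Psi> U) \<in> ?PS" using smod_scale[OF smPS] by blast
      have "\<Psi> (lift (h * h') * U) - (h * h') * \<Psi> U =
        (\<Psi> (lift h * (lift h' * U)) - h * \<Psi> (lift h' * U)) + h * (\<Psi> (lift h' * U) - h' * \<Psi> U)"
        by (simp add: rhom_mult[OF rhom_lift[of UNIV]] mult.assoc right_diff_distrib)
      then show ?thesis using smod_add[OF smPS 1 2] by simp
    qed
    moreover have "\<Psi> (lift 1 * U) - 1 * \<Psi> U \<in> ?PS" for U using smod_0[OF smPS] by (simp add: rhom_1[OF rhom_lift])
    ultimately show ?thesis using S unfolding sring_def by blast
  qed
  moreover have "const c \<in> ?B" for c
    using \<Psi>const[OF constA] constA AS by (auto simp: lift_const)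
  moreover have "var i \<in> ?B" if "i < n" for i
    using smod_0[OF smPS] that by (auto simp: lift_var \<Psi>var S_eq var_in_mpv)
  ultimately have "mpv {..<n} \<subseteq> ?B" by (intro mpv_induct) auto
  then have \<Psi>lift: "\<Psi> (lift h * U) - h * \<Psi> U \<in> ?PS" if "h \<in> S" "U \<in> S2" for h U using that by (auto simp: S_eq)
  \<comment> \<open>Asking for all multiples makes this an ideal of \<open>S2\<close>, although
    \<open>\<Psi>\<close> is not linear over \<open>S2\<close>.\<close>
  let ?N = "{z \<in> S2. \<forall>s\<in>S2. \<Psi> (s * z) \<in> ?PS}"
  have "smod S2 ?N"
  proof -
    have "\<Psi> (s * (z + z')) \<in> ?PS" if z: "z \<in> ?N" "z' \<in> ?N" and s: "s \<in> S2" for z z' s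
    proof -
      have "\<Psi> (s * z) \<in> ?PS" "\<Psi> (s * z') \<in> ?PS" using z s by auto
      moreover have "\<Psi> (s * z + s * z') - (\<Psi> (s * z) + \<Psi> (s * z')) \<in> ?PS"
        using z s sring_mult[OF sring_S2] by (intro \<Psi>add) auto
      ultimately have "(\<Psi> (s * z + s * z') - (\<Psi> (s * z) + \<Psi> (s * z'))) + (\<Psi> (s * z) + \<Psi> (s * z')) \<in> ?PS"
        by (intro smod_add[OF smPS])
      then show ?thesis by (simp add: distrib_left)
    qed
    moreover have "\<Psi> (s * (t * z)) \<in> ?PS" if "z \<in> ?N" "t \<in> S2" "s \<in> S2" for z t s
      using that sring_mult[OF sring_S2 that(3,2)] by (auto simp flip: mult.assoc)
    moreover have "\<Psi> 0 \<in> ?PS" using smod_0[OF smPS] by (simp add: \<Psi>_def)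
    ultimately show ?thesis using sring_0[OF sring_S2] sring_add[OF sring_S2] sring_mult[OF sring_S2]
      by (auto simp: smod_def)
  qed
  moreover have "const h - lift h \<in> ?N" if h: "h \<in> A" for h
  proof -
    have hS: "h \<in> S" using h AS by blast
    have "\<Psi> (s * (const h - lift h)) \<in> ?PS" if s: "s \<in> S2" for s
    proof -
      have 1: "\<Psi> (const h * s) - h * \<Psi> s \<in> ?PS" by (rule \<Psi>const[OF h s])
      have 2: "\<Psi> (lift h * s) - h * \<Psi> s \<in> ?PS" by (rule \<Psi>lift[OF hS s])
      have 3: "\<Psi> (const h * s - lift h * s) - (\<Psi> (const h * s) - \<Psi> (lift h * s)) \<in> ?PS"
        by (intro \<Psi>diff sring_mult[OF sring_S2] const_S2 lift_S2 hS s)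
      have "s * (const h - lift h) = const h * s - lift h * s" by (simp add: algebra_simps)
      then have "\<Psi> (s * (const h - lift h)) = (\<Psi> (const h * s - lift h * s) - (\<Psi> (const h * s) - \<Psi> (lift h * s))) +
        ((\<Psi> (const h * s) - h * \<Psi> s) - (\<Psi> (lift h * s) - h * \<Psi> s))" by simp
      then show ?thesis using smod_add[OF smPS 3 smod_diff[OF smPS S 1 2]] by simp
    qed
    then show ?thesis using const_S2[OF hS] lift_S2[OF hS] sring_diff[OF sring_S2] by blast
  qed
  ultimately have "J2 \<subseteq> ?N" unfolding J2_def by (intro ispan_minimal) auto
  then have "\<Psi> (1 * (const F - lift F)) \<in> ?PS" using J sring_1[OF sring_S2] by blast
  then have 0: "\<Psi> (const F - lift F) \<in> ?PS" by simp
  have 1: "\<Psi> (const F - lift F) - (\<Psi> (const F) - \<Psi> (lift F)) \<in> ?PS"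
    by (intro \<Psi>diff const_S2 lift_S2 FS)
  have \<Psi>c: "\<Psi> (const f) - l f \<in> ?PS" for f
  proof -
    have "\<Psi> (const f) - (\<Sum>m\<in>{0}. l (Poly_Mapping.lookup (const f) m) * meval var m) \<in> ?PS"
      by (rule sup) (auto simp: const_def)
    then show ?thesis by (simp add: const_def)
  qed
  have 2: "\<Psi> (const F) - l F \<in> ?PS" by (rule \<Psi>c)
  have 3: "\<Psi> (lift F) - F * \<Psi> 1 \<in> ?PS" using \<Psi>lift[OF FS sring_1[OF sring_S2]] by simp
  have 4: "F * (\<Psi> 1 - l 1) \<in> ?PS" using smod_scale[OF smPS FS \<Psi>c[of 1]] by (simp add: const_1)
  have e: "l 1 * F - l F = (\<Psi> (const F) - l F) - (\<Psi> (lift F) - F * \<Psi> 1) - F * (\<Psi> 1 - l 1) +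
    ((\<Psi> (const F - lift F) - (\<Psi> (const F) - \<Psi> (lift F))) - \<Psi> (const F - lift F))"
    by (simp add: algebra_simps)
  show ?thesis unfolding e
    by (rule smod_add[OF smPS smod_diff[OF smPS S smod_diff[OF smPS S 2 3] 4] smod_diff[OF smPS S 1 0]])
qed

end

section \<open>Finiteness of the polynomial ring over a separating algebra\<close>

lemma rhom_lookup_0: "rhom B (\<lambda>f::'a::comm_ring_1 mpoly. Poly_Mapping.lookup f 0)"
  by (simp add: rhom_def lookup_add lookup_0_mult)

context ring_action
begin

lemma bij_left_mult: "\<tau> \<in> carrier G \<Longrightarrow> bij_betw (\<lambda>\<sigma>. \<tau> \<otimes> \<sigma>) (carrier G) (carrier G)"
  by (rule bij_betwI[where g = "\<lambda>\<sigma>. inv \<tau> \<otimes> \<sigma>"]) (auto simp: m_assoc[symmetric])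

definition orbit_poly :: "'r \<Rightarrow> 'r poly" where
  "orbit_poly v = (\<Prod>\<sigma>\<in>carrier G. [:- act \<sigma> v, 1:])"

lemma orbit_poly_factor: "\<sigma> \<in> carrier G \<Longrightarrow> v \<in> S \<Longrightarrow> [:- act \<sigma> v, 1:] \<in> cpoly S"
  using sring_uminus[OF S act_in] sring_1[OF S] sring_0[OF S] by (auto simp: cpoly_def coeff_pCons split: nat.split)

lemma orbit_poly_cpoly: assumes "v \<in> S" shows "orbit_poly v \<in> cpoly (invs (carrier G))"
proof (rule cpolyI)
  fix k
  have in_S: "orbit_poly v \<in> cpoly S"
    unfolding orbit_poly_def by (intro sring_prod sring_cpoly S orbit_poly_factor assms)
  have "act \<tau> (coeff (orbit_poly v) k) = coeff (orbit_poly v) k" if \<tau>: "\<tau> \<in> carrier G" for \<tau>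
  proof -
    have "map_poly (act \<tau>) (orbit_poly v) = (\<Prod>\<sigma>\<in>carrier G. map_poly (act \<tau>) [:- act \<sigma> v, 1:])"
      unfolding orbit_poly_def
      by (rule rhom_prod[OF rhom_map_poly[OF act_hom[OF \<tau>] S] sring_cpoly[OF S] orbit_poly_factor[OF _ assms]])
    also have "\<dots> = (\<Prod>\<sigma>\<in>carrier G. [:- act (\<tau> \<otimes> \<sigma>) v, 1:])"
      using \<tau> assms rhom_uminus[OF act_hom[OF \<tau>] S act_in] rhom_1[OF act_hom[OF \<tau>]] act_0[OF \<tau>]
      by (intro prod.cong refl) (simp add: map_poly_pCons act_mult)
    also have "\<dots> = orbit_poly v"
      unfolding orbit_poly_def by (rule prod.reindex_bij_betw[OF bij_left_mult[OF \<tau>]])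
    finally have "coeff (map_poly (act \<tau>) (orbit_poly v)) k = coeff (orbit_poly v) k" by simp
    then show ?thesis by (simp add: coeff_map_poly act_0[OF \<tau>])
  qed
  then show "coeff (orbit_poly v) k \<in> invs (carrier G)" using cpolyD[OF in_S] by (simp add: invs_def)
qed

lemma poly_orbit_poly: assumes "v \<in> S" shows "poly (orbit_poly v) v = 0"
proof -
  have "(\<Prod>\<sigma>\<in>carrier G. poly [:- act \<sigma> v, 1:] v) = 0"
  proof (rule prod_zero[OF fin])
    show "\<exists>\<sigma>\<in>carrier G. poly [:- act \<sigma> v, 1:] v = 0" by (rule bexI[of _ \<one>]) (simp_all add: act_one assms)
  qed
  then show ?thesis by (simp add: orbit_poly_def poly_prod)
qed

end

context separating_algebra
begin

lemma var_S: "i < n \<Longrightarrow> var i \<in> S"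
  by (simp add: S_eq var_in_mpv)

lemma lookup_act_var: "\<sigma> \<in> carrier G \<Longrightarrow> i < n \<Longrightarrow> Poly_Mapping.lookup (act \<sigma> (var i)) 0 = 0"
proof -
  have "Poly_Mapping.single i (1::nat) \<noteq> 0" by (metis lookup_single_eq lookup_zero one_neq_zero)
  then have "Poly_Mapping.lookup (var i) 0 = (0::'k)" by (simp add: var_def lookup_single when_def)
  then show "\<sigma> \<in> carrier G \<Longrightarrow> i < n \<Longrightarrow> Poly_Mapping.lookup (act \<sigma> (var i)) 0 = 0"
    by (simp add: act_lookup_0 var_S)
qed

lemma idl_AplusS: "idl S AplusS"
proof -
  have "AplusS \<subseteq> S" unfolding AplusS_def using AS by (intro ispan_minimal sring_smod S) auto
  then show ?thesis unfolding idl_def by (simp add: AplusS_def smod_ispan)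
qed

lemma invariant_power_in_AplusS:
  assumes F: "F \<in> invs (carrier G)" and F0: "Poly_Mapping.lookup F 0 = 0"
  shows "\<exists>k. F ^ (CHAR('k) ^ k) \<in> AplusS"
proof -
  obtain k where k: "const (F ^ (CHAR('k) ^ k)) - lift (F ^ (CHAR('k) ^ k)) \<in> J2"
    using frobenius_power_in_J2[OF F] by blast
  have "Poly_Mapping.lookup (F ^ (CHAR('k) ^ k)) 0 = 0"
    using F0 prime_gt_0_nat[OF ch] by (simp add: rhom_power[OF rhom_lookup_0 sring_UNIV] power_0_left)
  moreover have "F ^ (CHAR('k) ^ k) \<in> S" using F sring_power[OF S] by (simp add: invs_def)
  ultimately show ?thesis using J2_at_zero k by blast
qed

text \<open>Test on a prime \<open>Q\<close> over \<open>AplusS\<close>: the lower coefficients of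
  the orbit polynomial of \<open>var i\<close> are invariants without constant term, so they lie in
  \<open>Q\<close>, and the equation of \<open>var i\<close> puts \<open>var i\<close> into
  \<open>Q\<close>.\<close>

lemma var_power_in_AplusS: assumes i: "i < n" shows "\<exists>N. var i ^ N \<in> AplusS"
proof (rule ccontr)
  assume "\<not> ?thesis"
  then have no: "\<And>N. var i ^ N \<notin> AplusS" by blast
  obtain Q where Q: "pidl S Q" "AplusS \<subseteq> Q" "var i \<notin> Q"
    using prime_ideal_avoiding[OF S idl_AplusS var_S[OF i] no] by blast
  let ?P = "orbit_poly (var i)" and ?N = "card (carrier G)"
  have deg: "degree ?P = ?N"
    unfolding orbit_poly_def by (subst degree_prod_eq_sum_degree) auto
  have lead: "coeff ?P ?N = 1"
    using lead_coeff_prod[of "\<lambda>\<sigma>. [:- act \<sigma> (var i), 1:]" "carrier G"] deg by (simp add: orbit_poly_def)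
  let ?e = "\<lambda>f::'k mpoly. Poly_Mapping.lookup f 0"
  \<comment> \<open>At the origin all conjugates of a variable vanish, so the orbit polynomial
    reduces to a power of the indeterminate.\<close>
  have "map_poly ?e ?P = (\<Prod>\<sigma>\<in>carrier G. map_poly ?e [:- act \<sigma> (var i), 1:])"
    unfolding orbit_poly_def
    by (rule rhom_prod[OF rhom_map_poly[OF rhom_lookup_0 S] sring_cpoly[OF S] orbit_poly_factor[OF _ var_S[OF i]]])
  also have "\<dots> = (\<Prod>\<sigma>\<in>carrier G. monom 1 1)"
    by (intro prod.cong refl) (simp add: map_poly_pCons lookup_act_var i lookup_uminus monom_Suc monom_0)
  also have "\<dots> = monom 1 ?N" by (simp add: monom_power)
  finally have map: "map_poly ?e ?P = monom 1 ?N" .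
  have e: "?e (coeff ?P k) = 0" if "k < ?N" for k
    using arg_cong[OF map, of "\<lambda>p. coeff p k"] that by (simp add: coeff_map_poly)
  have "coeff ?P k \<in> Q" if k: "k < ?N" for k
  proof (rule ccontr)
    assume nQ: "coeff ?P k \<notin> Q"
    have inv: "coeff ?P k \<in> invs (carrier G)" by (rule cpolyD[OF orbit_poly_cpoly[OF var_S[OF i]]])
    obtain j where j: "coeff ?P k ^ (CHAR('k) ^ j) \<in> AplusS" using invariant_power_in_AplusS[OF inv e[OF k]] by blast
    have "coeff ?P k \<in> S" using inv by (simp add: invs_def)
    then show False using pidl_power[OF Q(1) S _ nQ, of "CHAR('k) ^ j"] j Q(2) by blast
  qed
  then have low: "(\<Sum>k<?N. coeff ?P k * var i ^ k) \<in> Q"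
    by (intro smod_sum[OF pidl_smod[OF Q(1)]])
      (metis lessThan_iff mult.commute pidl_smod[OF Q(1)] smod_scale sring_power[OF S] var_S[OF i])
  have "poly ?P (var i) = (\<Sum>k<?N. coeff ?P k * var i ^ k) + var i ^ ?N"
    unfolding poly_altdef deg lessThan_Suc_atMost[symmetric] by (simp add: lead)
  then have "var i ^ ?N = - (\<Sum>k<?N. coeff ?P k * var i ^ k)"
    using poly_orbit_poly[OF var_S[OF i]] by (simp add: eq_neg_iff_add_eq_0 add.commute)
  then have "var i ^ ?N \<in> Q" using smod_uminus[OF pidl_smod[OF Q(1)] S low] by simp
  then show False using pidl_power[OF Q(1) S var_S[OF i] Q(3)] by blast
qed

text \<open>Graded Nakayama: monomials spanning \<open>S\<close> modulo \<open>A\<^sub>+S\<close> span \<open>S\<close> over \<open>A\<close>.\<close>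

lemma finite_over_A: "\<exists>M g. S = gs M g A"
proof -
  obtain Nf where Nf: "\<And>i. i < n \<Longrightarrow> var i ^ Nf i \<in> AplusS" using var_power_in_AplusS by metis
  define N where "N = (\<Sum>i<n. Nf i)"
  have N: "var i ^ N \<in> AplusS" if "i < n" for i
    by (rule power_le_dvd_smod[OF idl_smod[OF idl_AplusS] S var_S[OF that] Nf[OF that]])
      (use that in \<open>auto simp: N_def intro!: member_le_sum\<close>)
  \<comment> \<open>Every other monomial in these variables contains some \<open>var i ^ N\<close>
    and lies in \<open>AplusS\<close>.\<close>
  define E where "E = {meval var m :: 'k mpoly | m. Poly_Mapping.keys m \<subseteq> {..<n} \<and> (\<forall>i<n. Poly_Mapping.lookup m i < N)}"
  have finE: "finite E"
  proof -
    have "E \<subseteq> (\<lambda>\<phi>. \<Prod>i<n. var i ^ \<phi> i) ` (PiE {..<n} (\<lambda>_. {..<N}))"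
    proof
      fix z assume "z \<in> E"
      then obtain m where m: "z = meval var m" "Poly_Mapping.keys m \<subseteq> {..<n}" "\<forall>i<n. Poly_Mapping.lookup m i < N"
        by (auto simp: E_def)
      let ?\<phi> = "restrict (Poly_Mapping.lookup m) {..<n}"
      have "z = (\<Prod>i<n. var i ^ ?\<phi> i)" unfolding m(1) meval_superset[OF finite_lessThan m(2)] by (intro prod.cong) auto
      moreover have "?\<phi> \<in> PiE {..<n} (\<lambda>_. {..<N})" using m(3) by auto
      ultimately show "z \<in> (\<lambda>\<phi>. \<Prod>i<n. var i ^ \<phi> i) ` (PiE {..<n} (\<lambda>_. {..<N}))" by (rule image_eqI)
    qed
    then show ?thesis by (rule finite_subset) (intro finite_imageI finite_PiE, auto)
  qed
  let ?Q = "ispan A E"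
  note smQ = smod_ispan[of A E]
  have homd: "\<forall>s\<in>S. hom_component d s \<in> ?Q" for d
  proof (induction d rule: less_induct)
    case (less d)
    \<comment> \<open>An ideal of \<open>S\<close>. It contains every \<open>a \<in> A\<close>
      without constant term: the components of \<open>a\<close> have positive degree, so their
      cofactors have degree below \<open>d\<close> and the induction hypothesis applies. Hence it
      contains \<open>AplusS\<close>.\<close>
    let ?Z = "{z \<in> S. \<forall>s\<in>S. hom_component d (s * z) \<in> ?Q}"
    have "smod S ?Z"
      unfolding smod_def using smod_0[OF smQ] smod_add[OF smQ] sring_closed[OF S]
      by (auto simp: distrib_left hom_component_add hom_component_zero simp flip: mult.assoc)
    moreover have "a \<in> ?Z" if a: "a \<in> A" "Poly_Mapping.lookup a 0 = 0" for a
    proof -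
      have "hom_component d (s * a) \<in> ?Q" if s: "s \<in> S" for s
      proof -
        have "s * a = (\<Sum>e\<in>monom_deg ` Poly_Mapping.keys a. hom_component e a * s)"
          unfolding sum_distrib_right[symmetric] sum_hom_component by (rule mult.commute)
        then have "hom_component d (s * a) =
          (\<Sum>e\<in>monom_deg ` Poly_Mapping.keys a. hom_component d (hom_component e a * s))"
          by (simp add: hom_component_sum)
        also have "\<dots> \<in> ?Q"
        proof (rule smod_sum[OF smQ])
          fix e assume "e \<in> monom_deg ` Poly_Mapping.keys a"
          then have "e > 0" using a(2) by (auto simp: monom_deg_eq_0_iff in_keys_iff intro!: Nat.gr0I)
          then show "hom_component d (hom_component e a * s) \<in> ?Q"
            using less s smod_scale[OF smQ grA[OF a(1)]] smod_0[OF smQ]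
            by (simp add: hom_component_mult_homogeneous[OF homogeneous_hom_component])
        qed
        finally show ?thesis .
      qed
      then show ?thesis using a AS by auto
    qed
    ultimately have Z: "AplusS \<subseteq> ?Z" unfolding AplusS_def by (intro ispan_minimal) auto
    show ?case
    proof
      fix s assume s: "s \<in> S"
      have "hom_component d s = (\<Sum>m\<in>{m \<in> Poly_Mapping.keys s. monom_deg m = d}. const (Poly_Mapping.lookup s m) * meval var m)"
        unfolding hom_component_def meval_def by (intro sum.cong refl single_eq_monomial)
      also have "\<dots> \<in> ?Q"
      proof (intro smod_sum[OF smQ] smod_scale[OF smQ constA])
        fix m assume "m \<in> {m \<in> Poly_Mapping.keys s. monom_deg m = d}"
        then have m: "Poly_Mapping.keys m \<subseteq> {..<n}" "monom_deg m = d" using s by (auto simp: S_eq mpv_def)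
        show "meval var m \<in> ?Q"
        proof (cases "\<forall>i<n. Poly_Mapping.lookup m i < N")
          case True
          then show ?thesis using m ispan_superset[of E A] by (auto simp: E_def)
        next
          case False
          then obtain i where i: "i < n" "N \<le> Poly_Mapping.lookup m i" by (auto simp: not_less)
          define r where "r = m - Poly_Mapping.single i N"
          have r: "m = Poly_Mapping.single i N + r"
            by (rule poly_mapping_eqI) (use i in \<open>auto simp: r_def lookup_add lookup_minus lookup_single when_def\<close>)
          then have kr: "Poly_Mapping.keys r \<subseteq> {..<n}" using m(1) keys_add_nat[of "Poly_Mapping.single i N" r] by auto
          have rS: "meval var r \<in> S"
            unfolding meval_def by (intro sring_prod[OF S] sring_power[OF S] var_S) (use kr in auto)
          have "hom_component d (meval var r * var i ^ N) \<in> ?Q" using Z N[OF i(1)] rS by blast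
          moreover have "meval var r * var i ^ N = (meval var m :: 'k mpoly)"
            by (subst r) (simp add: meval_add meval_single)
          moreover have "homogeneous d (meval var m :: 'k mpoly)"
            using single_eq_monomial[of m "1::'k"] m(2)
            by (simp add: const_1 meval_def homogeneous_def flip: single_eq_monomial)
              (metis in_keys_iff lookup_single_not_eq)
          ultimately show ?thesis by (simp add: hom_component_homogeneous)
        qed
      qed
      finally show "hom_component d s \<in> ?Q" .
    qed
  qed
  have "S \<subseteq> ?Q"
  proof
    fix s assume "s \<in> S"
    then have "(\<Sum>d\<in>monom_deg ` Poly_Mapping.keys s. hom_component d s) \<in> ?Q"
      using homd by (intro smod_sum[OF smQ]) auto
    then show "s \<in> ?Q" by (simp add: sum_hom_component)
  qed
  moreover have "?Q \<subseteq> S"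
  proof (rule ispan_minimal)
    show "smod A S" using sring_smod[OF S] AS by (auto simp: smod_def)
    show "E \<subseteq> S" by (auto simp: E_def meval_def intro!: sring_prod[OF S] sring_power[OF S] var_S)
  qed
  ultimately have SQ: "S = ?Q" by blast
  obtain M :: nat and g where g: "E = g ` {i. i < M}"
    using finite_imp_nat_seg_image_inj_on[OF finE] by blast
  have "?Q \<subseteq> gs M g A"
    by (rule ispan_minimal[OF smod_gs[OF sring_smod[OF A]]]) (use gs_gen[OF A] g in auto)
  moreover have "gs M g A \<subseteq> ?Q"
  proof
    fix z assume "z \<in> gs M g A"
    then obtain c where c: "\<And>j. c j \<in> A" "z = (\<Sum>j<M. c j * g j)" by (rule gsE) blast
    show "z \<in> ?Q" unfolding c(2)
      by (intro smod_sum[OF smQ] smod_scale[OF smQ] c(1) subsetD[OF ispan_superset]) (auto simp: g)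
  qed
  ultimately show ?thesis using SQ by blast
qed

text \<open>A first Frobenius power brings \<open>F(x) - F(y)\<close> into \<open>J2\<close>, which
  yields the hypothesis of \<open>purely_inseparable\<close>; a second one then lands in
  \<open>A\<close>.\<close>

lemma invariant_power_in_A:
  assumes F: "F \<in> invs (carrier G)"
  shows "\<exists>k. F ^ (CHAR('k) ^ k) \<in> A"
proof -
  obtain M g where g: "S = gs M g A" using finite_over_A by blast
  obtain k where k: "const (F ^ (CHAR('k) ^ k)) - lift (F ^ (CHAR('k) ^ k)) \<in> J2"
    using frobenius_power_in_J2[OF F] by blast
  have FS: "F ^ (CHAR('k) ^ k) \<in> S" using F sring_power[OF S] by (simp add: invs_def)
  have "\<exists>j. (F ^ (CHAR('k) ^ k)) ^ (CHAR('k mpoly) ^ j) \<in> A"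
  proof (rule purely_inseparable[OF ch_mpoly A g S AS FS])
    fix P l
    assume "pidl A P" "\<And>z. l z \<in> A" "\<And>z w. z \<in> S \<Longrightarrow> w \<in> S \<Longrightarrow> l (z + w) - (l z + l w) \<in> P"
      "\<And>a z. a \<in> A \<Longrightarrow> z \<in> S \<Longrightarrow> l (a * z) - a * l z \<in> P"
    from functional_on_J2[OF g this FS k]
    show "l 1 * F ^ (CHAR('k) ^ k) - l (F ^ (CHAR('k) ^ k)) \<in> gs M g P" .
  qed
  then obtain j where "(F ^ (CHAR('k) ^ k)) ^ (CHAR('k) ^ j) \<in> A" by (auto simp: CHAR_mpoly)
  then have "F ^ (CHAR('k) ^ (k + j)) \<in> A" by (simp add: power_add power_mult)
  then show ?thesis by blast
qed

lemma finite_over_invariants: "\<exists>M g. S = gs M g (invs (carrier G))"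
proof -
  obtain M g where g: "S = gs M g A" using finite_over_A by blast
  have "gs M g A \<subseteq> gs M g (invs (carrier G))" using A_inv by (auto simp: gs_def)
  moreover have "gs M g (invs (carrier G)) \<subseteq> S"
  proof
    fix z assume "z \<in> gs M g (invs (carrier G))"
    then obtain c where c: "\<And>j. c j \<in> invs (carrier G)" "z = (\<Sum>j<M. c j * g j)" by (rule gsE) blast
    show "z \<in> S" unfolding c(2)
    proof (intro sring_sum[OF S] sring_mult[OF S])
      fix j assume "j \<in> {..<M}"
      then show "g j \<in> S" using gs_gen[OF A] g by blast
      show "c j \<in> S" using c(1)[of j] by (simp add: invs_def)
    qed
  qed
  ultimately show ?thesis using g by blast
qed

text \<open>The primes \<open>(x\<^sub>0, \<dots>, x\<^sub>i\<^sub>-\<^sub>1) \<inter> A\<close> form a strict chain because \<open>S\<close> is integral over \<open>A\<close>.\<close>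

lemma kernel_chain_strict:
  fixes i :: nat
  defines "\<theta> \<equiv> \<lambda>i. subst_poly const (\<lambda>j. if j < i then 0 else var j) :: 'k mpoly \<Rightarrow> 'k mpoly"
  assumes i: "i < n"
  shows "\<exists>a\<in>A. \<theta> i a \<noteq> 0 \<and> \<theta> (Suc i) a = 0"
proof -
  have hom: "rhom UNIV (\<theta> j)" for j unfolding \<theta>_def by (rule rhom_subst_poly[OF rhom_const])
  have v: "\<theta> i (var i) = var i" "\<theta> (Suc i) (var i) = 0"
    by (simp_all add: \<theta>_def subst_poly_var const_0 const_1)
  have comp: "\<theta> (Suc i) (\<theta> i f) = \<theta> (Suc i) f" for f
  proof (rule rhom_eq_on_mpv[of UNIV "\<lambda>f. \<theta> (Suc i) (\<theta> i f)" "\<theta> (Suc i)" UNIV])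
    show "rhom UNIV (\<lambda>f. \<theta> (Suc i) (\<theta> i f))" by (rule rhom_comp[OF hom UNIV_I hom])
    show "\<theta> (Suc i) (\<theta> i (var j)) = \<theta> (Suc i) (var j)" for j
      by (cases "j < i") (simp_all add: \<theta>_def subst_poly_var const_0 const_1 subst_poly_zero)
    show "\<theta> (Suc i) (\<theta> i (const c)) = \<theta> (Suc i) (const c)" for c by (simp add: \<theta>_def subst_poly_const const_0)
  qed (simp_all add: hom mpv_UNIV sring_UNIV)
  \<comment> \<open>A monic equation for \<open>var i\<close> over \<open>A\<close>, required only
    after setting the variables below \<open>i\<close> to \<open>0\<close>. In one of least degree
    \<open>\<theta> i\<close> does not kill the constant coefficient, since otherwise
    \<open>var i\<close> could be divided out, while \<open>\<theta> (Suc i)\<close> kills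
    it.\<close>
  define R where "R N \<longleftrightarrow> (\<exists>c. (\<forall>k. c k \<in> A) \<and> \<theta> i (var i ^ N + (\<Sum>k<N. c k * var i ^ k)) = 0)" for N
  obtain M g where g: "S = gs M g A" using finite_over_A by blast
  have iA: "idl A A" by (simp add: idl_def sring_smod[OF A])
  obtain c where c: "\<forall>k. c k \<in> A" "var i ^ M + (\<Sum>k<M. c k * var i ^ k) = 0"
    using integral_relation[OF A iA g S] var_S[OF i] g by blast
  have "R M" unfolding R_def
    by (rule exI[of _ c]) (simp only: c rhom_0[OF hom sring_UNIV] simp_thms)
  then have L: "R (LEAST N. R N)" by (rule LeastI)
  define N where "N = (LEAST N. R N)"
  obtain c where c: "\<And>k. c k \<in> A" "\<theta> i (var i ^ N + (\<Sum>k<N. c k * var i ^ k)) = 0"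
    using L[folded N_def] by (auto simp: R_def)
  have "N \<noteq> 0"
  proof
    assume "N = 0"
    then show False using c(2) rhom_1[OF hom, of i] by simp
  qed
  then obtain K where K: "N = Suc K" by (cases N) auto
  let ?r = "var i ^ K + (\<Sum>k<K. c (Suc k) * var i ^ k)"
  have split: "var i ^ N + (\<Sum>k<N. c k * var i ^ k) = c 0 + var i * ?r"
    unfolding K sum.lessThan_Suc_shift
    by (simp add: distrib_left sum_distrib_left mult.left_commute add.left_commute)
  have "\<theta> (Suc i) (c 0 + var i * ?r) = 0"
    using c(2) comp[of "var i ^ N + (\<Sum>k<N. c k * var i ^ k)"] rhom_0[OF hom sring_UNIV, of "Suc i"]
    unfolding split by simp
  then have "\<theta> (Suc i) (c 0) = 0" by (simp add: rhom_add[OF hom] rhom_mult[OF hom] v)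
  moreover have "\<theta> i (c 0) \<noteq> 0"
  proof
    assume "\<theta> i (c 0) = 0"
    then have "var i * \<theta> i ?r = 0" using c(2) unfolding split by (simp add: rhom_add[OF hom] rhom_mult[OF hom] v)
    moreover have "(var i :: 'k mpoly) \<noteq> 0"
      unfolding var_def by (metis lookup_single_eq lookup_zero one_neq_zero)
    ultimately have "\<theta> i ?r = 0" by simp
    then have "R K" unfolding R_def using c(1) by (intro exI[of _ "\<lambda>k. c (Suc k)"]) simp
    then show False using not_less_Least[of K R, folded N_def] K by simp
  qed
  ultimately show ?thesis using c(1) by blast
qed

end

section \<open>Krull dimension and depth of the subalgebra\<close>

lemma ideal_alg_ring_iff: assumes "sring A" shows "ideal I (alg_ring A) \<longleftrightarrow> idl A I"
  and cring_alg_ring: "cring (alg_ring A)"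
proof -
  have ops: "carrier (alg_ring A) = A" "monoid.mult (alg_ring A) = (*)" "ring.add (alg_ring A) = (+)"
    "ring.zero (alg_ring A) = 0" "monoid.one (alg_ring A) = 1" for A :: "'a mpoly set"
    by (simp_all add: alg_ring_def ring_of_type_algebra_def)
  show cr: "cring (alg_ring A)"
    by (rule cringI)
      (auto intro!: abelian_groupI comm_monoidI bexI[of _ "- _"]
        simp: ops sring_closed[OF assms] algebra_simps)
  interpret R: cring "alg_ring A" by (rule cr)
  show "ideal I (alg_ring A) \<longleftrightarrow> idl A I"
  proof
    assume I: "ideal I (alg_ring A)"
    have "0 \<in> I" using additive_subgroup.zero_closed[OF ideal.axioms(1)[OF I]] by (simp add: ops)
    moreover have "x + y \<in> I" if "x \<in> I" "y \<in> I" for x y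
      using additive_subgroup.a_closed[OF ideal.axioms(1)[OF I] that] by (simp add: ops)
    moreover have "a * x \<in> I" if "a \<in> A" "x \<in> I" for a x
      using ideal.I_l_closed[OF I that(2), of a] that(1) by (simp add: ops)
    moreover have "I \<subseteq> A" using additive_subgroup.a_subset[OF ideal.axioms(1)[OF I]] by (simp add: ops)
    ultimately show "idl A I" by (simp add: idl_def smod_def)
  next
    assume I: "idl A I"
    note sm = idl_smod[OF I]
    have inv: "a_inv (alg_ring A) x = - x" if "x \<in> A" for x
      by (rule R.minus_equality) (use that sring_uminus[OF assms that] in \<open>simp_all add: ops\<close>)
    have "subgroup I (add_monoid (alg_ring A))"
    proof (rule R.add.subgroupI)
      show "I \<subseteq> carrier (alg_ring A)" "I \<noteq> {}" using idl_subset[OF I] smod_0[OF sm] by (auto simp: ops)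
      show "\<ominus>\<^bsub>alg_ring A\<^esub> x \<in> I" if "x \<in> I" for x
        using inv[of x] smod_uminus[OF sm assms that] idl_subset[OF I] that by auto
      show "x \<oplus>\<^bsub>alg_ring A\<^esub> y \<in> I" if "x \<in> I" "y \<in> I" for x y
        using smod_add[OF sm that] by (simp add: ops)
    qed
    moreover have "x * a \<in> I" "a * x \<in> I" if "a \<in> I" "x \<in> A" for a x
      using smod_scale[OF sm that(2,1)] by (simp_all add: mult.commute)
    ultimately show "ideal I (alg_ring A)"
      by (intro idealI[OF R.ring_axioms]) (simp_all add: ops)
  qed
qed

lemma genideal_alg_ring:
  assumes A: "sring A" and T: "T \<subseteq> A"
  shows "genideal (alg_ring A) T = ispan A T"
proof
  have "idl A (ispan A T)"
    unfolding idl_def using smod_ispan ispan_minimal[OF sring_smod[OF A] T] by (intro conjI)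
  then show "genideal (alg_ring A) T \<subseteq> ispan A T"
    unfolding genideal_def using ideal_alg_ring_iff[OF A] ispan_superset by (intro Inter_lower) auto
  show "ispan A T \<subseteq> genideal (alg_ring A) T"
    unfolding genideal_def using ideal_alg_ring_iff[OF A] idl_smod by (intro Inter_greatest ispan_minimal) auto
qed

lemma ispan_eq_gs:
  assumes A: "sring A" and i: "i \<le> length fs"
  shows "ispan A (set (take i fs)) = gs i (\<lambda>j. fs ! j) A"
proof
  have "set (take i fs) \<subseteq> gs i (\<lambda>j. fs ! j) A"
    using i gs_gen[OF A, of _ i "\<lambda>j. fs ! j"] by (auto simp: in_set_conv_nth)
  then show "ispan A (set (take i fs)) \<subseteq> gs i (\<lambda>j. fs ! j) A"
    by (rule ispan_minimal[OF smod_gs[OF sring_smod[OF A]]])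
  show "gs i (\<lambda>j. fs ! j) A \<subseteq> ispan A (set (take i fs))"
  proof
    fix z assume "z \<in> gs i (\<lambda>j. fs ! j) A"
    then obtain c where c: "\<And>j. c j \<in> A" "z = (\<Sum>j<i. c j * fs ! j)" by (rule gsE) blast
    show "z \<in> ispan A (set (take i fs))" unfolding c(2)
    proof (intro smod_sum[OF smod_ispan] smod_scale[OF smod_ispan] c(1) subsetD[OF ispan_superset])
      fix j assume "j \<in> {..<i}"
      then show "fs ! j \<in> set (take i fs)" using i by (auto simp: in_set_conv_nth intro!: exI[of _ j])
    qed
  qed
qed

context separating_algebra
begin

lemma krull_dim_ge: "enat n \<le> krull_dim (alg_ring A)"
proof -
  let ?\<theta> = "\<lambda>i. subst_poly const (\<lambda>j. if j < i then 0 else var j) :: 'k mpoly \<Rightarrow> 'k mpoly"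
  define P where "P i = {a \<in> A. ?\<theta> i a = 0}" for i
  have hom: "rhom UNIV (?\<theta> i)" for i by (rule rhom_subst_poly[OF rhom_const])
  have prime: "primeideal (P i) (alg_ring A)" for i
  proof (rule primeidealI)
    have ops: "carrier (alg_ring A) = A" "monoid.mult (alg_ring A) = (*)" by (simp_all add: alg_ring_def ring_of_type_algebra_def)
    have "idl A (P i)"
      unfolding idl_def smod_def P_def
      by (auto simp: rhom_add[OF hom] rhom_mult[OF hom] rhom_0[OF hom sring_UNIV] sring_closed[OF A])
    then show "ideal (P i) (alg_ring A)" using ideal_alg_ring_iff[OF A] by blast
    show "cring (alg_ring A)" by (rule cring_alg_ring[OF A])
    have "1 \<in> A - P i" using sring_1[OF A] by (simp add: P_def rhom_1[OF hom])
    then show "carrier (alg_ring A) \<noteq> P i" by (auto simp: ops)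
    show "a \<in> P i \<or> b \<in> P i" if "a \<in> carrier (alg_ring A)" "b \<in> carrier (alg_ring A)" "a \<otimes>\<^bsub>alg_ring A\<^esub> b \<in> P i" for a b
      using that by (auto simp: ops P_def rhom_mult[OF hom])
  qed
  have "P i \<subset> P (Suc i)" if i: "i < n" for i
  proof
    show "P i \<subseteq> P (Suc i)"
    proof
      fix a assume a: "a \<in> P i"
      have "?\<theta> (Suc i) (?\<theta> i f) = ?\<theta> (Suc i) f" for f
      proof (rule rhom_eq_on_mpv[of UNIV "\<lambda>f. ?\<theta> (Suc i) (?\<theta> i f)" "?\<theta> (Suc i)" UNIV])
        show "rhom UNIV (\<lambda>f. ?\<theta> (Suc i) (?\<theta> i f))" by (rule rhom_comp[OF hom UNIV_I hom])
        show "?\<theta> (Suc i) (?\<theta> i (var j)) = ?\<theta> (Suc i) (var j)" for j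
          by (cases "j < i") (simp_all add: subst_poly_var const_0 const_1 subst_poly_zero)
      qed (simp_all add: hom mpv_UNIV sring_UNIV subst_poly_const const_0)
      from this[of a] show "a \<in> P (Suc i)" using a by (simp add: P_def rhom_0[OF hom sring_UNIV])
    qed
    obtain a where "a \<in> A" "?\<theta> i a \<noteq> 0" "?\<theta> (Suc i) a = 0" using kernel_chain_strict[OF i] by blast
    then have "a \<in> P (Suc i)" "a \<notin> P i" unfolding P_def by blast+
    then show "P i \<noteq> P (Suc i)" by blast
  qed
  then show ?thesis unfolding krull_dim_def using prime by (intro Sup_upper) blast
qed

lemma ex_hom_regular_sequence:
  assumes CM: "graded_Cohen_Macaulay A" and n: "n > 0"
  shows "\<exists>f l. n \<le> l \<and> hom_regular_sequence A f l"
proof -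
  let ?L = "{enat (length fs) | fs. set fs \<subseteq> max_hom_ideal A \<and> (\<forall>f\<in>set fs. \<exists>d. homogeneous d f) \<and>
     regular_sequence (alg_ring A) fs}"
  have ge: "enat n \<le> Sup ?L" using krull_dim_ge CM by (simp add: graded_Cohen_Macaulay_def hom_depth_def)
  \<comment> \<open>The depth is a supremum that a priori need not be attained; a sequence longer
    than \<open>n - 1\<close> is enough.\<close>
  have "enat (n - 1) < enat n" using n by simp
  then have "enat (n - 1) < Sup ?L" using ge by (rule less_le_trans)
  then obtain fs where fs: "enat (n - 1) < enat (length fs)" "set fs \<subseteq> max_hom_ideal A"
    "\<forall>f\<in>set fs. \<exists>d. homogeneous d f" "regular_sequence (alg_ring A) fs"
    unfolding less_Sup_iff by blast
  have "hom_regular_sequence A (\<lambda>i. fs ! i) (length fs)"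
  proof
    show "sring A" "\<And>c. const c \<in> A" "\<And>u d. u \<in> A \<Longrightarrow> hom_component d u \<in> A" by (rule A constA grA; assumption?)+
    fix i assume i: "i < length fs"
    then have "fs ! i \<in> max_hom_ideal A" using fs(2) by auto
    then show "fs ! i \<in> A" "Poly_Mapping.lookup (fs ! i) 0 = 0" by (auto simp: max_hom_ideal_def)
    show "\<exists>d. homogeneous d (fs ! i)" using fs(3) i by simp
    fix a assume a: "a \<in> A" "a * fs ! i \<in> gs i ((!) fs) A"
    have "set (take i fs) \<subseteq> A" using fs(2) set_take_subset[of i fs] by (auto simp: max_hom_ideal_def)
    then have e: "genideal (alg_ring A) (set (take i fs)) = gs i ((!) fs) A"
      using genideal_alg_ring[OF A] ispan_eq_gs[OF A, of i fs] i by simp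
    have "carrier (alg_ring A) = A" "monoid.mult (alg_ring A) = (*)" by (simp_all add: alg_ring_def ring_of_type_algebra_def)
    then show "a \<in> gs i ((!) fs) A" using fs(4) i a e unfolding regular_sequence_def by auto
  qed
  moreover have "n \<le> length fs" using fs(1) n by simp
  ultimately show ?thesis by (intro exI conjI)
qed

end

section \<open>The obstruction from a character\<close>

lemma poly_rhom: assumes "rhom UNIV \<phi>" shows "\<phi> (poly p x) = poly (map_poly \<phi> p) (\<phi> x)"
  using rhom_0[OF assms sring_UNIV]
  by (induction p) (simp_all add: map_poly_pCons rhom_add[OF assms] rhom_mult[OF assms])

lemma mpv_insert_poly:
  fixes R :: "'a::comm_ring_1 mpoly"
  assumes "R \<in> mpv (insert j T)"
  shows "\<exists>p\<in>cpoly (mpv T). poly p (var j) = R"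
proof -
  have sT: "sring (mpv T :: 'a mpoly set)" by (rule sring_mpv)
  have "mpv (insert j T) \<subseteq> adj (mpv T) (var j :: 'a mpoly)"
  proof (rule mpv_induct[OF sring_adj[OF sT]])
    show "const c \<in> adj (mpv T) (var j)" for c :: 'a using adj_superset[OF sT] const_in_mpv by blast
    show "var i \<in> adj (mpv T) (var j :: 'a mpoly)" if "i \<in> insert j T" for i
      using that adj_self[OF sT] adj_superset[OF sT, of "var j"] var_in_mpv by blast
  qed
  then show ?thesis using assms unfolding adj_def by blast
qed

lemma (in hom_regular_sequence) poly_f_nonzero:
  assumes j: "j < l" and p: "p \<in> cpoly (D ({..<l} - {j}))" "p \<noteq> 0"
  shows "poly p (f j) \<noteq> 0"
proof
  assume z: "poly p (f j) = 0"
  obtain q where q: "q \<in> cpoly (WM ({..<l} - {j}))" "1 = poly q (f j)"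
    using module_expansion_exists[OF sring_1[OF A] j] by blast
  have "q \<noteq> 0" using q(2) by auto
  then obtain x where x: "x \<in> WM ({..<l} - {j})" "x \<noteq> 0"
    using cpolyD[OF q(1), of "degree q"] by (metis leading_coeff_0_iff)
  have "smult x p \<in> cpoly (WM ({..<l} - {j}))"
  proof (rule cpolyI)
    fix i show "coeff (smult x p) i \<in> WM ({..<l} - {j})"
      using smod_scale[OF smod_WM cpolyD[OF p(1), of i] x(1)] by (simp add: mult.commute)
  qed
  from module_expansion_unique[OF this _ j] show False using z x(2) p(2) by simp
qed

lemma frobenius_of_nat:
  assumes "normalization_semidom_class.prime CHAR('a::comm_ring_1)"
  shows "(of_nat m :: 'a) ^ (CHAR('a) ^ k) = of_nat m"
  by (induction m) (simp_all add: frobenius_add[OF assms] prime_gt_0_nat[OF assms] power_0_left)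

lemma (in ring_action) subst_poly_congruent:
  fixes a b :: "nat \<Rightarrow> 'r"
  assumes J: "idl S J" and c: "\<And>c. \<iota> c \<in> S" and \<iota>: "rhom UNIV \<iota>"
    and a: "\<And>i. i \<in> V \<Longrightarrow> a i \<in> S" and b: "\<And>i. i \<in> V \<Longrightarrow> b i \<in> S" and ab: "\<And>i. i \<in> V \<Longrightarrow> a i - b i \<in> J"
    and F: "F \<in> mpv V"
  shows "subst_poly \<iota> a (F :: 'c::comm_ring_1 mpoly) - subst_poly \<iota> b F \<in> J"
proof -
  let ?a = "subst_poly \<iota> a" and ?b = "subst_poly \<iota> b"
  note ha = rhom_subst_poly[OF \<iota>, of UNIV a] and hb = rhom_subst_poly[OF \<iota>, of UNIV b]
  note sm = idl_smod[OF J]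
  have \<iota>01: "\<iota> 0 = 0" "\<iota> 1 = 1" using rhom_0[OF \<iota> sring_UNIV] rhom_1[OF \<iota>] by auto
  let ?B = "{F. ?a F \<in> S \<and> ?b F \<in> S \<and> ?a F - ?b F \<in> J}"
  have "sring ?B"
  proof -
    have "?a (F - F') - ?b (F - F') \<in> J" if "F \<in> ?B" "F' \<in> ?B" for F F'
    proof -
      have "?a (F - F') - ?b (F - F') = (?a F - ?b F) - (?a F' - ?b F')"
        by (simp add: rhom_diff[OF ha sring_UNIV] rhom_diff[OF hb sring_UNIV])
      then show ?thesis using that smod_diff[OF sm S] by simp
    qed
    moreover have "?a (F * F') - ?b (F * F') \<in> J" if "F \<in> ?B" "F' \<in> ?B" for F F'
    proof -
      have "?a (F * F') - ?b (F * F') = ?a F * (?a F' - ?b F') + ?b F' * (?a F - ?b F)"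
        by (simp add: rhom_mult[OF ha] rhom_mult[OF hb] algebra_simps)
      then show ?thesis using that smod_add[OF sm smod_scale[OF sm] smod_scale[OF sm]] by simp
    qed
    ultimately show ?thesis unfolding sring_def
      using sring_diff[OF S] sring_mult[OF S] sring_1[OF S] smod_0[OF sm]
      by (simp add: rhom_diff[OF ha sring_UNIV] rhom_diff[OF hb sring_UNIV] rhom_mult[OF ha] rhom_mult[OF hb] rhom_1[OF ha] rhom_1[OF hb])
  qed
  then have "mpv V \<subseteq> ?B"
    by (rule mpv_induct) (use a b ab c smod_0[OF sm] in \<open>simp_all add: subst_poly_const subst_poly_var \<iota>01\<close>)
  then show ?thesis using F by blast
qed

text \<open>For a linear action on a polynomial ring this is the ideal of the fixed space of
  \<open>\<sigma>\<close>.\<close>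

definition (in ring_action) fixed_ideal :: "'g \<Rightarrow> 'r set" where
  "fixed_ideal \<sigma> = ispan S ((\<lambda>s. act \<sigma> s - s) ` S)"

lemma (in ring_action) idl_fixed_ideal: assumes "\<sigma> \<in> carrier G" shows "idl S (fixed_ideal \<sigma>)"
proof -
  have "fixed_ideal \<sigma> \<subseteq> S" unfolding fixed_ideal_def
    using assms by (intro ispan_minimal sring_smod S image_subsetI sring_diff[OF S] act_in)
  then show ?thesis unfolding idl_def by (simp add: fixed_ideal_def smod_ispan)
qed

lemma (in ring_action) diff_in_fixed_ideal: "s \<in> S \<Longrightarrow> act \<sigma> s - s \<in> fixed_ideal \<sigma>"
  unfolding fixed_ideal_def by (intro subsetD[OF ispan_superset] imageI)

text \<open>
  The data of a counterexample: a nontrivial character \<open>\<chi>\<close> such that modulo \<open>fixed_ideal \<sigma>\<close>,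
  for \<open>\<sigma>\<close> outside its kernel, all variables are combinations of \<open>n - 3\<close> elements.
\<close>

locale obstruction = separating_algebra G act S n A + C: ring_action_character G act S p \<chi> t +
    R: hom_regular_sequence A f l
  for G :: "('g, 'm) monoid_scheme" (structure) and act :: "'g \<Rightarrow> 'k::field mpoly \<Rightarrow> 'k mpoly" and S n A
    and p \<chi> t f l +
  assumes nl: "3 \<le> n" "n \<le> l" and fg: "\<exists>M g. S = gs M g (invs (carrier G))"
    and power_A: "\<And>F. F \<in> invs (carrier G) \<Longrightarrow> \<exists>k. F ^ (CHAR('k) ^ k) \<in> A"
    and lin: "\<And>\<sigma>. \<sigma> \<in> carrier G \<Longrightarrow> \<chi> \<sigma> \<noteq> 0 \<Longrightarrow> \<exists>r b c. r + 3 \<le> n \<and> (\<forall>k<r. b k \<in> S) \<and>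
      (\<forall>i<n. var i - (\<Sum>k<r. const (c i k) * b k) \<in> fixed_ideal \<sigma>)"
begin

lemma constS: "const c \<in> S" using constA AS by blast

abbreviation bad :: "'g \<Rightarrow> bool" where "bad \<sigma> \<equiv> \<sigma> \<in> carrier G \<and> \<chi> \<sigma> \<noteq> 0"
abbreviation \<phi> :: "'k mpoly \<Rightarrow> 'k mpoly" where "\<phi> \<equiv> subst_poly const f"

lemma p_CHAR: "p = CHAR('k)" "p = CHAR('k mpoly)" using C.p(2) by (simp_all add: CHAR_mpoly)

lemma hom\<phi>: "rhom B \<phi>" by (rule rhom_subst_poly[OF rhom_const])

lemma \<phi>A: "V \<subseteq> {..<l} \<Longrightarrow> F \<in> mpv V \<Longrightarrow> \<phi> F \<in> A"
  using R.D_A[of V] unfolding R.D_def by blast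

section \<open>Algebraic independence modulo the ideals of fixed spaces\<close>

definition indep :: "'g \<Rightarrow> nat set \<Rightarrow> bool" where
  "indep \<sigma> T \<longleftrightarrow> (\<forall>F\<in>mpv T. F \<noteq> 0 \<longrightarrow> \<phi> F \<notin> fixed_ideal \<sigma>)"

text \<open>By \<open>lin\<close>, everything in \<open>S\<close> is modulo
  \<open>fixed_ideal \<sigma>\<close> a polynomial in at most \<open>n - 3\<close> elements, and
  more polynomials than variables are algebraically dependent.\<close>

lemma dependent:
  assumes \<sigma>: "bad \<sigma>" and T: "finite T" "n \<le> card T + 2" and u: "\<And>i. i \<in> T \<Longrightarrow> u i \<in> S"
  shows "\<exists>F\<in>mpv T. F \<noteq> 0 \<and> subst_poly const u F \<in> fixed_ideal \<sigma>"
proof -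
  obtain r b c where r: "r + 3 \<le> n" and b: "\<And>k. k < r \<Longrightarrow> b k \<in> S"
    and c: "\<And>i. i < n \<Longrightarrow> var i - (\<Sum>k<r. const (c i k) * b k) \<in> fixed_ideal \<sigma>"
    using lin[of \<sigma>] \<sigma> by blast
  have J: "idl S (fixed_ideal \<sigma>)" using idl_fixed_ideal \<sigma> by blast
  \<comment> \<open>The \<open>u i\<close> rewritten in \<open>r\<close> new variables that stand
    for the \<open>b k\<close>.\<close>
  define H where "H i = subst_poly const (\<lambda>j. \<Sum>k<r. const (c j k) * var k) (u i)" for i
  have HV: "H i \<in> mpv {..<r}" if "i \<in> T" for i
    unfolding H_def
    by (rule subst_poly_in[OF sring_mpv, of _ _ "{..<n}"])
      (use u[OF that] in \<open>auto simp: S_eq const_in_mpv intro!: sring_sum sring_mult sring_mpv var_in_mpv\<close>)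
  obtain F where F: "F \<in> mpv T" "F \<noteq> 0" "subst_poly const H F = 0"
    using algebraically_dependent[of T r H] T r HV by auto
  let ?b = "subst_poly const b"
  have hb: "rhom B ?b" for B by (rule rhom_subst_poly[OF rhom_const])
  have bS: "?b z \<in> S" if "z \<in> mpv {..<r}" for z
    by (rule subst_poly_in[OF S, of _ "{..<r}"]) (use that b constS in auto)
  have bc: "?b (const x) = const x" for x by (simp add: subst_poly_const const_0)
  have "u i - ?b (H i) \<in> fixed_ideal \<sigma>" if i: "i \<in> T" for i
  proof -
    let ?g = "\<lambda>j. \<Sum>k<r. const (c j k) * b k"
    have "?b (H i) = subst_poly (\<lambda>x. ?b (const x)) (\<lambda>j. ?b (\<Sum>k<r. const (c j k) * var k)) (u i)"
      unfolding H_def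
      by (rule rhom_comp_subst_poly[OF hb sring_UNIV, of _ "{..<n}"]) (use u[OF i] in \<open>auto simp: S_eq\<close>)
    also have "\<dots> = subst_poly const ?g (u i)"
      by (simp add: bc rhom_sum[OF hb sring_UNIV] rhom_mult[OF hb[of UNIV]] subst_poly_var const_0 const_1)
    finally have e: "?b (H i) = subst_poly const ?g (u i)" .
    have "subst_poly const var (u i) - subst_poly const ?g (u i) \<in> fixed_ideal \<sigma>"
      by (rule subst_poly_congruent[OF J constS rhom_const, of "{..<n}"])
        (use c b u[OF i] constS in \<open>auto simp: S_eq[symmetric] intro!: sring_sum[OF S] sring_mult[OF S]\<close>,
         simp add: S_eq var_in_mpv)
    then show ?thesis unfolding e by (simp add: subst_poly_var_id)
  qed
  then have "subst_poly const u F - subst_poly const (\<lambda>i. ?b (H i)) F \<in> fixed_ideal \<sigma>"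
    by (intro subst_poly_congruent[OF J constS rhom_const _ _ _ F(1)] u bS HV)
  moreover have "?b (subst_poly const H F) = subst_poly (\<lambda>x. ?b (const x)) (\<lambda>i. ?b (H i)) F"
    by (rule rhom_comp_subst_poly[OF hb sring_UNIV _ _ F(1)]) auto
  ultimately have "subst_poly const u F \<in> fixed_ideal \<sigma>"
    using F(3) by (simp add: bc rhom_0[OF hb sring_UNIV])
  then show ?thesis using F by blast
qed

lemma const_not_in_fixed_ideal: assumes "\<sigma> \<in> carrier G" "const c \<in> fixed_ideal \<sigma>" shows "c = 0"
proof -
  have "fixed_ideal \<sigma> \<subseteq> {s. Poly_Mapping.lookup s 0 = 0}"
    unfolding fixed_ideal_def
    by (rule ispan_minimal) (auto simp: smod_def lookup_add lookup_0_mult lookup_minus act_lookup_0 assms(1))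
  then show ?thesis using assms(2) by (auto simp: const_def)
qed

lemma indep_empty: assumes "\<sigma> \<in> carrier G" shows "indep \<sigma> {}"
  unfolding indep_def
proof (intro ballI impI)
  fix F :: "'k mpoly" assume F: "F \<in> mpv {}" "F \<noteq> 0"
  have "homogeneous 0 F" using F(1) by (auto simp: homogeneous_def mpv_def monom_deg_def)
  then have e: "F = const (Poly_Mapping.lookup F 0)" by (rule homogeneous_0_imp_const)
  have "\<phi> F = F" by (subst (1 2) e) (simp add: subst_poly_const const_0)
  then show "\<phi> F \<notin> fixed_ideal \<sigma>"
    using const_not_in_fixed_ideal[OF assms, of "Poly_Mapping.lookup F 0"] e F(2) by (auto simp: const_0)
qed

text \<open>The maximum is taken over all bad \<open>\<sigma>\<close> at once: adding an index to
  \<open>T\<close> then destroys independence modulo every one of their ideals, not only that of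
  \<open>\<sigma>0\<close>.\<close>

lemma maximal_independent:
  obtains \<sigma>0 T where "bad \<sigma>0" "T \<subseteq> {..<l}" "indep \<sigma>0 T" "card T + 3 \<le> n"
    "\<And>\<sigma> T'. bad \<sigma> \<Longrightarrow> T' \<subseteq> {..<l} \<Longrightarrow> indep \<sigma> T' \<Longrightarrow> card T' \<le> card T"
proof -
  define M where "M = {k. \<exists>\<sigma> T. bad \<sigma> \<and> T \<subseteq> {..<l} \<and> indep \<sigma> T \<and> card T = k}"
  have "M \<subseteq> {..l}" unfolding M_def using subset_eq_atLeast0_lessThan_card[of _ l]
    by (auto simp: lessThan_atLeast0)
  then have fM: "finite M" by (rule finite_subset) simp
  have "0 \<in> M" unfolding M_def using indep_empty[OF C.t(1)] C.t by (auto intro!: exI[of _ t] exI[of _ "{}"])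
  then have "Max M \<in> M" using fM by (intro Max_in) auto
  then obtain \<sigma>0 T where T: "bad \<sigma>0" "T \<subseteq> {..<l}" "indep \<sigma>0 T" "card T = Max M" by (auto simp: M_def)
  have "card T' \<le> card T" if "bad \<sigma>" "T' \<subseteq> {..<l}" "indep \<sigma> T'" for \<sigma> T'
  proof -
    have "card T' \<in> M" using that by (auto simp: M_def)
    then show ?thesis using Max_ge[OF fM] T(4) by simp
  qed
  moreover have "card T + 3 \<le> n"
  proof (rule ccontr)
    assume "\<not> ?thesis"
    then have "n \<le> card T + 2" by simp
    moreover have "f i \<in> S" if "i \<in> T" for i using R.fA AS T(2) that by blast
    ultimately obtain F where "F \<in> mpv T" "F \<noteq> 0" "\<phi> F \<in> fixed_ideal \<sigma>0"
      using dependent[OF T(1) finite_subset[OF T(2)]] by auto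
    then show False using T(3) by (auto simp: indep_def)
  qed
  ultimately show ?thesis using that T(1-3) by blast
qed

text \<open>By maximality each bad \<open>\<sigma>\<close> has a nonzero polynomial in the
  \<open>f i\<close>, \<open>i \<in> insert j T\<close>, inside its ideal. The product of these lies
  in all the ideals, and a power of it annihilates the class of the character.\<close>

lemma coboundary_denominator:
  assumes T: "T \<subseteq> {..<l}" and j: "j < l" "j \<notin> T"
    and max: "\<And>\<sigma> T'. bad \<sigma> \<Longrightarrow> T' \<subseteq> {..<l} \<Longrightarrow> indep \<sigma> T' \<Longrightarrow> card T' \<le> card T"
  shows "\<exists>F\<in>mpv (insert j T). \<exists>b\<in>S. F \<noteq> 0 \<and> (\<forall>\<sigma>\<in>carrier G. act \<sigma> b - b = \<phi> F * of_nat (\<chi> \<sigma>))"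
proof -
  have jT: "insert j T \<subseteq> {..<l}" using T j by auto
  have "\<not> indep \<sigma> (insert j T)" if "bad \<sigma>" for \<sigma>
    using max[OF that jT] finite_subset[OF T] j(2) by auto
  then have "\<forall>\<sigma>. bad \<sigma> \<longrightarrow> (\<exists>F. F \<in> mpv (insert j T) \<and> F \<noteq> 0 \<and> \<phi> F \<in> fixed_ideal \<sigma>)"
    unfolding indep_def by blast
  then obtain H where H: "\<And>\<sigma>. bad \<sigma> \<Longrightarrow> H \<sigma> \<in> mpv (insert j T) \<and> H \<sigma> \<noteq> 0 \<and> \<phi> (H \<sigma>) \<in> fixed_ideal \<sigma>"
    by metis
  let ?bad = "{\<sigma>. bad \<sigma>}"
  have fb: "finite ?bad" using fin by (rule rev_finite_subset) auto
  define F where "F = prod H ?bad"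
  have FV: "F \<in> mpv (insert j T)" unfolding F_def using H by (intro sring_prod sring_mpv) auto
  have F0: "F \<noteq> 0" unfolding F_def using H fb by auto
  have a: "\<phi> F \<in> A" by (rule \<phi>A[OF jT FV])
  have aJ: "\<phi> F \<in> fixed_ideal \<sigma>" if \<sigma>: "bad \<sigma>" for \<sigma>
  proof -
    have J: "smod S (fixed_ideal \<sigma>)" using idl_smod[OF idl_fixed_ideal] \<sigma> by blast
    have "F = H \<sigma> * prod H (?bad - {\<sigma>})" unfolding F_def using fb \<sigma> by (intro prod.remove) auto
    then have e: "\<phi> F = \<phi> (prod H (?bad - {\<sigma>})) * \<phi> (H \<sigma>)" by (simp add: rhom_mult[OF hom\<phi>[of UNIV]])
    have "prod H (?bad - {\<sigma>}) \<in> mpv (insert j T)" using H by (intro sring_prod sring_mpv) auto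
    then have "\<phi> (prod H (?bad - {\<sigma>})) \<in> S" using \<phi>A[OF jT] AS by blast
    then show ?thesis unfolding e using H[OF \<sigma>] by (intro smod_scale[OF J]) auto
  qed
  obtain M g where g: "S = gs M g (invs (carrier G))" using fg by blast
  have "\<exists>m. \<exists>b\<in>S. \<forall>\<sigma>\<in>carrier G. act \<sigma> b - b = \<phi> F ^ m * of_nat (\<chi> \<sigma>)"
  proof (rule C.power_annihilates_character[OF g])
    show "\<phi> F \<in> invs (carrier G)" using a A_inv by blast
    fix \<sigma> Q assume \<sigma>: "\<sigma> \<in> carrier G" "\<chi> \<sigma> \<noteq> 0" "idl S Q" "\<And>s. s \<in> S \<Longrightarrow> act \<sigma> s - s \<in> Q"
    have "fixed_ideal \<sigma> \<subseteq> Q" unfolding fixed_ideal_def using \<sigma>(4) by (intro ispan_minimal idl_smod[OF \<sigma>(3)]) auto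
    then show "\<phi> F \<in> Q" using aJ \<sigma> by blast
  qed
  then obtain m b where b: "b \<in> S" "\<forall>\<sigma>\<in>carrier G. act \<sigma> b - b = \<phi> F ^ m * of_nat (\<chi> \<sigma>)" by blast
  have "\<phi> (F ^ m) = \<phi> F ^ m" by (rule rhom_power[OF hom\<phi> sring_UNIV UNIV_I])
  then show ?thesis using b FV F0 sring_power[OF sring_mpv FV, of m] by (intro bexI[of _ "F ^ m"] bexI[of _ b]) auto
qed

lemma invariant_sub:
  assumes a: "a \<in> A" "a' \<in> A" and b: "b \<in> S" "b' \<in> S"
    and co: "\<And>\<sigma>. \<sigma> \<in> carrier G \<Longrightarrow> act \<sigma> b = b + a * of_nat (\<chi> \<sigma>)"
      "\<And>\<sigma>. \<sigma> \<in> carrier G \<Longrightarrow> act \<sigma> b' = b' + a' * of_nat (\<chi> \<sigma>)"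
  shows "a * b' - a' * b \<in> invs (carrier G)"
proof -
  have aS: "a \<in> S" "a' \<in> S" using a AS by auto
  have "act \<sigma> (a * b' - a' * b) = a * b' - a' * b" if \<sigma>: "\<sigma> \<in> carrier G" for \<sigma>
  proof -
    have "act \<sigma> a = a" "act \<sigma> a' = a'" using a A_inv \<sigma> by (auto simp: invs_def)
    then have "act \<sigma> (a * b' - a' * b) = a * (b' + a' * of_nat (\<chi> \<sigma>)) - a' * (b + a * of_nat (\<chi> \<sigma>))"
      using aS b by (simp add: rhom_diff[OF act_hom[OF \<sigma>] S] rhom_mult[OF act_hom[OF \<sigma>]] sring_mult[OF S] co[OF \<sigma>])
    then show ?thesis by (simp add: algebra_simps)
  qed
  then show ?thesis using aS b by (simp add: invs_def sring_diff[OF S] sring_mult[OF S])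
qed

lemma power_A_le: assumes "F ^ (CHAR('k) ^ k) \<in> A" "k \<le> K" shows "F ^ (CHAR('k) ^ K) \<in> A"
proof -
  have "CHAR('k) ^ K = CHAR('k) ^ k * CHAR('k) ^ (K - k)" using assms(2) by (simp flip: power_add)
  then show ?thesis using sring_power[OF A assms(1)] by (simp add: power_mult)
qed

text \<open>The homogenised Artin-Schreier polynomial: both terms change by
  \<open>a ^ p * \<chi> \<sigma>\<close>, since \<open>\<chi> \<sigma>\<close> equals its
  \<open>p\<close>-th power in characteristic \<open>p\<close>.\<close>

lemma artin_schreier_invariant:
  assumes a: "a \<in> A" and Y: "Y \<in> S" and co: "\<And>\<sigma>. \<sigma> \<in> carrier G \<Longrightarrow> act \<sigma> Y = Y + a * of_nat (\<chi> \<sigma>)"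
  shows "Y ^ p - a ^ (p - 1) * Y \<in> invs (carrier G)"
proof -
  have aS: "a \<in> S" using a AS by auto
  have "act \<sigma> (Y ^ p - a ^ (p - 1) * Y) = Y ^ p - a ^ (p - 1) * Y" if \<sigma>: "\<sigma> \<in> carrier G" for \<sigma>
  proof -
    have ia: "act \<sigma> a = a" using a A_inv \<sigma> by (auto simp: invs_def)
    have "act \<sigma> (Y ^ p - a ^ (p - 1) * Y) = act \<sigma> Y ^ p - a ^ (p - 1) * act \<sigma> Y"
      using aS Y by (simp add: rhom_diff[OF act_hom[OF \<sigma>] S] rhom_mult[OF act_hom[OF \<sigma>]] rhom_power[OF act_hom[OF \<sigma>] S]
          sring_mult[OF S] sring_power[OF S] ia)
    also have "\<dots> = (Y ^ p + a ^ p * of_nat (\<chi> \<sigma>)) - a ^ (p - 1) * (Y + a * of_nat (\<chi> \<sigma>))"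
      using frobenius_add[OF ch_mpoly, of Y "a * of_nat (\<chi> \<sigma>)" 1] frobenius_of_nat[OF ch_mpoly, of "\<chi> \<sigma>" 1]
      by (simp add: co[OF \<sigma>] p_CHAR(2)[symmetric] power_mult_distrib)
    also have "a ^ p = a ^ (p - 1) * a" using C.p_pos by (metis One_nat_def Suc_pred power_Suc2)
    finally show ?thesis by (simp add: algebra_simps)
  qed
  then show ?thesis using aS Y by (simp add: invs_def sring_diff[OF S] sring_mult[OF S] sring_power[OF S])
qed

text \<open>If \<open>y = r / a\<close> satisfies a monic equation \<open>y\<^sup>N = s y\<^sup>q + s'\<close> with \<open>q < N\<close> then \<open>y\<close> is a polynomial.\<close>

lemma integral_quotient:
  assumes a: "a \<in> S" "a \<noteq> 0" and r: "r \<in> S" and q: "q < N"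
    and eq: "r ^ N = a ^ (N - q) * s * r ^ q + a ^ N * s'"
  shows "\<exists>h\<in>S. r = a * h"
proof -
  \<comment> \<open>The equation reduces powers of \<open>r\<close> from \<open>N\<close> on, so
    \<open>a ^ N\<close> is a common denominator for all powers of \<open>r / a\<close>.\<close>
  have "\<exists>h. a ^ N * r ^ k = a ^ k * h" for k
  proof (induction k rule: less_induct)
    case (less k)
    show ?case
    proof (cases "k < N")
      case True
      then have "a ^ N = a ^ k * a ^ (N - k)" by (simp flip: power_add)
      then show ?thesis by (metis mult.assoc)
    next
      case False
      obtain h where h: "a ^ N * r ^ (k - N + q) = a ^ (k - N + q) * h" using less q False by (metis add_diff_inverse_nat add_less_cancel_left add.commute)
      obtain h' where h': "a ^ N * r ^ (k - N) = a ^ (k - N) * h'" using less q False by (metis diff_less less_nat_zero_code linorder_neqE_nat not_less zero_less_diff gr_implies_not0 le_less_trans zero_le)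
      have "a ^ N * r ^ k = a ^ N * r ^ (k - N) * r ^ N" using False by (simp add: mult.assoc flip: power_add)
      also have "\<dots> = a ^ (N - q) * s * (a ^ N * r ^ (k - N + q)) + a ^ N * s' * (a ^ N * r ^ (k - N))"
        unfolding eq by (simp add: algebra_simps power_add)
      also have "\<dots> = a ^ (N - q) * a ^ (k - N + q) * (s * h) + a ^ N * a ^ (k - N) * (s' * h')"
        unfolding h h' by (simp add: algebra_simps)
      also have "a ^ (N - q) * a ^ (k - N + q) = a ^ k" using q False by (simp flip: power_add)
      also have "a ^ N * a ^ (k - N) = a ^ k" using False by (simp flip: power_add)
      finally have "a ^ N * r ^ k = a ^ k * (s * h + s' * h')" by (simp add: distrib_left)
      then show ?thesis by blast
    qed
  qed
  then show ?thesis
    using completely_integrally_closed[of a n r "a ^ N"] a r by (simp add: S_eq)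
qed

theorem contradiction: False
proof -
  obtain \<sigma>0 T where T: "bad \<sigma>0" "T \<subseteq> {..<l}" "indep \<sigma>0 T" "card T + 3 \<le> n"
    "\<And>\<sigma> T'. bad \<sigma> \<Longrightarrow> T' \<subseteq> {..<l} \<Longrightarrow> indep \<sigma> T' \<Longrightarrow> card T' \<le> card T"
    using maximal_independent by metis
  have finT: "finite T" using T(2) finite_subset by blast
  \<comment> \<open>One index outside \<open>T\<close> for each of the three elements of the Koszul
    relation.\<close>
  have "3 \<le> card ({..<l} - T)" using T(4) nl card_Diff_subset[OF finT T(2)] by simp
  then obtain Z where Z: "Z \<subseteq> {..<l} - T" "card Z = 3" using obtain_subset_with_card_n by metis
  then obtain j1 j2 j3 where Zj: "Z = {j1, j2, j3}" "j1 \<noteq> j2" "j1 \<noteq> j3" "j2 \<noteq> j3" by (metis card_3_iff)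
  have jT: "j < l" "j \<notin> T" if "j \<in> Z" for j using that Z by auto
  have "\<forall>j\<in>Z. \<exists>F b. F \<in> mpv (insert j T) \<and> b \<in> S \<and> F \<noteq> 0 \<and> (\<forall>\<sigma>\<in>carrier G. act \<sigma> b - b = \<phi> F * of_nat (\<chi> \<sigma>))"
  proof
    fix j assume j: "j \<in> Z"
    have "\<exists>F\<in>mpv (insert j T). \<exists>b\<in>S. F \<noteq> 0 \<and> (\<forall>\<sigma>\<in>carrier G. act \<sigma> b - b = \<phi> F * of_nat (\<chi> \<sigma>))"
      by (rule coboundary_denominator[OF T(2) jT[OF j]]) (erule (2) T(5))
    then show "\<exists>F b. F \<in> mpv (insert j T) \<and> b \<in> S \<and> F \<noteq> 0 \<and> (\<forall>\<sigma>\<in>carrier G. act \<sigma> b - b = \<phi> F * of_nat (\<chi> \<sigma>))"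
    proof (elim bexE conjE)
      fix F b assume "F \<in> mpv (insert j T)" "b \<in> S" "F \<noteq> 0" "\<forall>\<sigma>\<in>carrier G. act \<sigma> b - b = \<phi> F * of_nat (\<chi> \<sigma>)"
      then show ?thesis by (intro exI conjI)
    qed
  qed
  then obtain F b where Fb: "\<And>j. j \<in> Z \<Longrightarrow> F j \<in> mpv (insert j T) \<and> b j \<in> S \<and> F j \<noteq> 0 \<and>
      (\<forall>\<sigma>\<in>carrier G. act \<sigma> (b j) - b j = \<phi> (F j) * of_nat (\<chi> \<sigma>))" by metis
  have ins: "insert j T \<subseteq> {..<l}" if "j \<in> Z" for j using jT[OF that] T(2) by auto
  have cob: "act \<sigma> (b j) = b j + \<phi> (F j) * of_nat (\<chi> \<sigma>)" if "j \<in> Z" "\<sigma> \<in> carrier G" for j \<sigma>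
    using Fb[OF that(1)] that(2) by (metis add_diff_cancel_left' add_diff_eq)
  have inv: "\<phi> (F i) * b j - \<phi> (F j) * b i \<in> invs (carrier G)" if "i \<in> Z" "j \<in> Z" for i j
    by (rule invariant_sub) (use that Fb cob \<phi>A[OF ins] in auto)
  have "\<forall>i\<in>Z. \<forall>j\<in>Z. \<exists>k. (\<phi> (F i) * b j - \<phi> (F j) * b i) ^ (CHAR('k) ^ k) \<in> A" using power_A inv by blast
  then obtain kk where kk: "\<And>i j. i \<in> Z \<Longrightarrow> j \<in> Z \<Longrightarrow> (\<phi> (F i) * b j - \<phi> (F j) * b i) ^ (CHAR('k) ^ kk i j) \<in> A" by metis
  have finZ: "finite Z" using Zj(1) by simp
  define K where "K = (\<Sum>i\<in>Z. \<Sum>j\<in>Z. kk i j)"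
  have kkK: "kk i j \<le> K" if "i \<in> Z" "j \<in> Z" for i j
  proof -
    have "kk i j \<le> (\<Sum>j\<in>Z. kk i j)" using finZ that by (intro member_le_sum) auto
    also have "\<dots> \<le> K" unfolding K_def using finZ that by (intro member_le_sum[of i Z "\<lambda>i. \<Sum>j\<in>Z. kk i j"]) auto
    finally show ?thesis .
  qed
  \<comment> \<open>One Frobenius power for all pairs. It fixes
    \<open>of_nat (\<chi> \<sigma>)\<close>, so the \<open>B j\<close> below satisfy the same
    equation with \<open>a j\<close> in place of \<open>\<phi> (F j)\<close>.\<close>
  define q0 where "q0 = CHAR('k) ^ K"
  have q0: "q0 = CHAR('k mpoly) ^ K" by (simp add: q0_def CHAR_mpoly)
  define a where "a j = \<phi> (F j ^ q0)" for j
  define B where "B j = b j ^ q0" for j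
  have a_pow: "a j = \<phi> (F j) ^ q0" for j unfolding a_def by (rule rhom_power[OF hom\<phi> sring_UNIV UNIV_I])
  have FqV: "F j ^ q0 \<in> mpv (insert j T)" if "j \<in> Z" for j using Fb[OF that] by (intro sring_power sring_mpv) auto
  have aA: "a j \<in> A" if "j \<in> Z" for j unfolding a_def by (rule \<phi>A[OF ins[OF that] FqV[OF that]])
  have BS: "B j \<in> S" if "j \<in> Z" for j unfolding B_def using Fb[OF that] by (intro sring_power[OF S]) auto
  have coB: "act \<sigma> (B j) = B j + a j * of_nat (\<chi> \<sigma>)" if "j \<in> Z" "\<sigma> \<in> carrier G" for j \<sigma>
  proof -
    have "act \<sigma> (B j) = act \<sigma> (b j) ^ q0" unfolding B_def
      using Fb[OF that(1)] by (intro rhom_power[OF act_hom[OF that(2)] S]) auto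
    also have "\<dots> = B j + a j * of_nat (\<chi> \<sigma>)"
      unfolding cob[OF that] B_def a_pow q0 frobenius_add[OF ch_mpoly] power_mult_distrib frobenius_of_nat[OF ch_mpoly] ..
    finally show ?thesis .
  qed
  have U: "a i * B j - a j * B i \<in> A" if "i \<in> Z" "j \<in> Z" for i j
  proof -
    have "a i * B j - a j * B i = (\<phi> (F i) * b j - \<phi> (F j) * b i) ^ q0"
      unfolding B_def a_pow q0 frobenius_diff[OF ch_mpoly] power_mult_distrib ..
    then show ?thesis using power_A_le[OF kk[OF that] kkK[OF that]] by (simp add: q0_def)
  qed
  \<comment> \<open>\<open>F j ^ q0\<close> is read as a polynomial in \<open>var j\<close> over the
    variables of \<open>T\<close>. Its leading coefficient stays nonzero under
    \<open>\<phi>\<close>, as \<open>T\<close> is independent modulo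
    \<open>fixed_ideal \<sigma>0\<close>.\<close>
  have "\<forall>j\<in>Z. \<exists>P. P \<in> cpoly (mpv T) \<and> poly P (var j) = F j ^ q0" using mpv_insert_poly[OF FqV] by blast
  then obtain P where P: "\<And>j. j \<in> Z \<Longrightarrow> P j \<in> cpoly (mpv T) \<and> poly (P j) (var j) = F j ^ q0" by metis
  define L where "L j = lead_coeff (P j)" for j
  have L: "L j \<in> mpv T" "L j \<noteq> 0" if "j \<in> Z" for j
  proof -
    show "L j \<in> mpv T" unfolding L_def using cpolyD P[OF that] by blast
    have "F j ^ q0 \<noteq> 0" using Fb[OF that] by simp
    then show "L j \<noteq> 0" unfolding L_def using P[OF that] by auto
  qed
  have J0: "0 \<in> fixed_ideal \<sigma>0" using smod_0[OF idl_smod[OF idl_fixed_ideal]] T(1) by blast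
  have \<phi>0: "\<phi> 0 = 0" by (rule subst_poly_zero)
  have \<phi>L: "\<phi> x \<noteq> 0" if "x \<in> mpv T" "x \<noteq> 0" for x
    using T(3) that J0 unfolding indep_def by metis
  define pp where "pp j = map_poly \<phi> (P j)" for j
  have lead: "lead_coeff (pp j) = \<phi> (L j)" if "j \<in> Z" for j
    unfolding pp_def L_def
    by (rule lead_coeff_map_poly_nz[of \<phi> "P j"]) (rule \<phi>L[OF L[OF that], unfolded L_def], rule \<phi>0)
  have pp0: "pp j \<noteq> 0" if "j \<in> Z" for j using lead[OF that] \<phi>L L[OF that] by auto
  have ppD: "pp j \<in> cpoly (R.D V)" if "j \<in> Z" "T \<subseteq> V" for j V
  proof (rule cpolyI)
    fix k
    have "coeff (P j) k \<in> mpv T" using cpolyD P[OF that(1)] by blast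
    then have "coeff (P j) k \<in> mpv V" using mpv_mono[OF that(2)] by blast
    then show "coeff (pp j) k \<in> R.D V" by (simp add: pp_def coeff_map_poly \<phi>0 R.D_def)
  qed
  have ppa: "poly (pp j) (f j) = a j" if "j \<in> Z" for j
    using poly_rhom[OF hom\<phi>, of "P j" "var j"] P[OF that]
    by (simp add: pp_def a_def subst_poly_var const_0 const_1)
  have a0: "a j \<noteq> 0" if "j \<in> Z" for j
    using R.poly_f_nonzero[OF jT(1)[OF that] ppD[OF that] pp0[OF that]] ppa[OF that] T(2) jT(2)[OF that] by auto
  have aD: "a j \<in> R.D V" if "j \<in> Z" "insert j T \<subseteq> V" for j V
    unfolding a_def R.D_def using FqV[OF that(1)] mpv_mono[OF that(2)] by blast
  have z: "j1 \<in> Z" "j2 \<in> Z" "j3 \<in> Z" using Zj(1) by auto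
  let ?V = "{..<l} - {j1, j2}"
  have TV: "T \<subseteq> ?V" "insert j3 T \<subseteq> ?V" using T(2) jT z Zj by auto
  \<comment> \<open>The Koszul relation, with all its terms in \<open>A\<close>.\<close>
  have syz: "a j3 * (a j1 * B j2 - a j2 * B j1) =
    poly (pp j1) (f j1) * (- (a j2 * B j3 - a j3 * B j2)) + poly (pp j2) (f j2) * (a j1 * B j3 - a j3 * B j1)"
    unfolding ppa[OF z(1)] ppa[OF z(2)] by (simp add: algebra_simps)
  obtain k m v w where vw: "v \<in> A" "w \<in> A"
    "lead_coeff (pp j1) ^ k * lead_coeff (pp j2) ^ m * (a j1 * B j2 - a j2 * B j1) = poly (pp j1) (f j1) * v + poly (pp j2) (f j2) * w"
    using R.torsion_two_elements[OF jT(1)[OF z(1)] jT(1)[OF z(2)] Zj(2) ppD[OF z(1) TV(1)] pp0[OF z(1)] ppD[OF z(2) TV(1)] pp0[OF z(2)]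
        aD[OF z(3) TV(2)] a0[OF z(3)] U[OF z(1,2)] sring_uminus[OF A U[OF z(2,3)]] U[OF z(1,3)] syz] by blast
  define C0 where "C0 = L j1 ^ k * L j2 ^ m"
  have C0: "C0 \<in> mpv T" "C0 \<noteq> 0"
    unfolding C0_def using L[OF z(1)] L[OF z(2)] by (auto intro!: sring_mult sring_power sring_mpv)
  define c where "c = \<phi> C0"
  have c_eq: "c = lead_coeff (pp j1) ^ k * lead_coeff (pp j2) ^ m"
    unfolding c_def C0_def lead[OF z(1)] lead[OF z(2)]
    by (simp add: rhom_mult[OF hom\<phi>[of UNIV]] rhom_power[OF hom\<phi> sring_UNIV])
  have cA: "c \<in> A" unfolding c_def by (rule \<phi>A[OF T(2) C0(1)])
  have rel: "c * (a j1 * B j2 - a j2 * B j1) = a j1 * v + a j2 * w"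
    using vw(3) unfolding c_eq ppa[OF z(1)] ppa[OF z(2)] .
  \<comment> \<open>\<open>v\<close> and \<open>w\<close> correct \<open>B j2\<close> and
    \<open>B j1\<close> so that \<open>x / a j2 = y / a j1\<close>. Each \<open>\<sigma>\<close>
    moves this common fraction by \<open>c * \<chi> \<sigma>\<close>; it remains to show that a
    harmless multiple of it is a polynomial.\<close>
  define x where "x = c * B j2 - v"
  define y where "y = c * B j1 + w"
  have xy: "a j1 * x = a j2 * y" using rel by (simp add: x_def y_def algebra_simps)
  have inS: "c \<in> S" "v \<in> S" "w \<in> S" using cA vw AS by auto
  have xS: "x \<in> S" "y \<in> S" unfolding x_def y_def
    using inS BS z by (auto intro!: sring_diff[OF S] sring_add[OF S] sring_mult[OF S])
  have ac: "act \<sigma> s = s" if "s \<in> A" "\<sigma> \<in> carrier G" for s \<sigma> using that A_inv by (auto simp: invs_def)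
  have cox: "act \<sigma> x = x + c * a j2 * of_nat (\<chi> \<sigma>)" if \<sigma>: "\<sigma> \<in> carrier G" for \<sigma>
    unfolding x_def using inS BS[OF z(2)] coB[OF z(2) \<sigma>] ac[OF cA \<sigma>] ac[OF vw(1) \<sigma>]
    by (simp add: rhom_diff[OF act_hom[OF \<sigma>] S] rhom_mult[OF act_hom[OF \<sigma>]] sring_mult[OF S] distrib_left mult.assoc)
  have coy: "act \<sigma> y = y + c * a j1 * of_nat (\<chi> \<sigma>)" if \<sigma>: "\<sigma> \<in> carrier G" for \<sigma>
    unfolding y_def using inS BS[OF z(1)] coB[OF z(1) \<sigma>] ac[OF cA \<sigma>] ac[OF vw(2) \<sigma>]
    by (simp add: rhom_add[OF act_hom[OF \<sigma>]] rhom_mult[OF act_hom[OF \<sigma>]] sring_mult[OF S] distrib_left mult.assoc)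
  \<comment> \<open>\<open>E1 / a j1 ^ p\<close> and \<open>E2 / a j2 ^ p\<close> are one and the
    same fraction, the Artin-Schreier polynomial of \<open>y / a j1 = x / a j2\<close>.\<close>
  define E1 where "E1 = y ^ p - (c * a j1) ^ (p - 1) * y"
  define E2 where "E2 = x ^ p - (c * a j2) ^ (p - 1) * x"
  have E: "E1 \<in> invs (carrier G)" "E2 \<in> invs (carrier G)" unfolding E1_def E2_def
    by (rule artin_schreier_invariant; use sring_mult[OF A cA aA] z xS cox coy in simp)+
  obtain k1 k2 where k12: "E1 ^ (CHAR('k) ^ k1) \<in> A" "E2 ^ (CHAR('k) ^ k2) \<in> A" using power_A[OF E(1)] power_A[OF E(2)] by blast
  define q where "q = CHAR('k) ^ (k1 + k2)"
  have q_mp: "q = CHAR('k mpoly) ^ (k1 + k2)" by (simp add: q_def CHAR_mpoly)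
  have Eq: "E1 ^ q \<in> A" "E2 ^ q \<in> A" unfolding q_def using k12 power_A_le by auto
  obtain p' where p': "p = Suc p'" using C.p_pos gr0_implies_Suc by blast
  have hom_degree: "g ^ p * (z ^ p - (c * d) ^ (p - 1) * z) = (g * z) ^ p - (c * d * g) ^ (p - 1) * (g * z)" for g z d
    by (simp add: p' power_mult_distrib right_diff_distrib mult_ac)
  have "a j2 ^ p * E1 = (a j2 * y) ^ p - (c * a j1 * a j2) ^ (p - 1) * (a j2 * y)"
    unfolding E1_def by (rule hom_degree)
  also have "\<dots> = (a j1 * x) ^ p - (c * a j2 * a j1) ^ (p - 1) * (a j1 * x)"
    unfolding xy by (simp only: mult.assoc mult.commute[of "a j1" "a j2"])
  also have "\<dots> = a j1 ^ p * E2" unfolding E2_def by (rule hom_degree[symmetric])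
  finally have E12: "a j2 ^ p * E1 = a j1 ^ p * E2" .
  define N where "N = p * q"
  have qpos: "q > 0" unfolding q_def using prime_gt_0_nat[OF ch] by simp
  have qN: "q < N" unfolding N_def using qpos prime_gt_1_nat[OF C.p(1)] by simp
  have "a j2 ^ N * E1 ^ q = (a j2 ^ p * E1) ^ q" by (simp add: N_def power_mult power_mult_distrib)
  also have "\<dots> = poly (pp j1 ^ N) (f j1) * E2 ^ q"
    unfolding E12 by (simp add: N_def power_mult power_mult_distrib poly_power ppa[OF z(1)])
  finally have t1: "a j2 ^ N * E1 ^ q = poly (pp j1 ^ N) (f j1) * E2 ^ q" .
  let ?V1 = "{..<l} - {j1}"
  have TV1: "T \<subseteq> ?V1" "insert j2 T \<subseteq> ?V1" using T(2) jT z Zj by auto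
  \<comment> \<open>The fraction \<open>E1 ^ q / a j1 ^ N = E2 ^ q / a j2 ^ N\<close> has
    denominators involving different \<open>f j\<close>, so up to a leading coefficient it lies in
    \<open>A\<close>.\<close>
  have "\<exists>k. \<exists>v\<in>A. lead_coeff (pp j1 ^ N) ^ k * E1 ^ q = poly (pp j1 ^ N) (f j1) * v"
    by (rule R.torsion_one_element[OF jT(1)[OF z(1)] _ _ _ _ Eq(1) Eq(2) t1])
      (use pp0[OF z(1)] a0[OF z(2)] in
        \<open>auto intro!: sring_power sring_cpoly R.sring_D ppD[OF z(1) TV1(1)] aD[OF z(2) TV1(2)]\<close>)
  then obtain k' V where V: "V \<in> A" "lead_coeff (pp j1 ^ N) ^ k' * E1 ^ q = poly (pp j1 ^ N) (f j1) * V" by blast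
  define C1 where "C1 = L j1 ^ (N * k')"
  have C1: "C1 \<in> mpv T" "C1 \<noteq> 0" unfolding C1_def using L[OF z(1)] by (auto intro!: sring_power sring_mpv)
  define c' where "c' = \<phi> C1"
  have c'_eq: "c' = lead_coeff (pp j1 ^ N) ^ k'"
    unfolding c'_def C1_def lead_coeff_power lead[OF z(1)] by (simp add: rhom_power[OF hom\<phi> sring_UNIV] power_mult)
  have c'A: "c' \<in> A" unfolding c'_def by (rule \<phi>A[OF T(2) C1(1)])
  then have c'S: "c' \<in> S" using AS by blast
  have rel': "c' * E1 ^ q = a j1 ^ N * V" using V(2) unfolding c'_eq by (simp add: poly_power ppa[OF z(1)])
  have aS: "a j1 \<in> S" using aA[OF z(1)] AS by blast
  let ?r = "c' * y"
  have Nq: "N - q = (p - 1) * q" unfolding N_def by (simp add: diff_mult_distrib)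
  \<comment> \<open>Divided by \<open>a j1 ^ N\<close> this is a monic equation for
    \<open>y / a j1\<close>, whose constant term is integral up to the factor
    \<open>c'\<close>.\<close>
  have yN: "y ^ N = (c * a j1) ^ (N - q) * y ^ q + E1 ^ q"
  proof -
    have "E1 ^ q = (y ^ p) ^ q - ((c * a j1) ^ (p - 1) * y) ^ q" unfolding E1_def q_mp by (rule frobenius_diff[OF ch_mpoly])
    also have "\<dots> = y ^ N - (c * a j1) ^ (N - q) * y ^ q"
    proof -
      have "y ^ N = (y ^ p) ^ q" by (simp only: N_def power_mult)
      then show ?thesis by (simp only: Nq power_mult power_mult_distrib)
    qed
    finally show ?thesis by simp
  qed
  have "\<exists>h\<in>S. ?r = a j1 * h"
  proof (rule integral_quotient[OF aS a0[OF z(1)] sring_mult[OF S c'S xS(2)] qN])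
    have cN: "c' ^ N = c' ^ (N - q) * c' ^ q" "c' ^ N = c' ^ (N - 1) * c'"
      using qN by (simp_all flip: power_add power_Suc2)
    have "?r ^ N = c' ^ N * ((c * a j1) ^ (N - q) * y ^ q) + c' ^ N * E1 ^ q"
      unfolding power_mult_distrib[of c'] yN distrib_left ..
    also have "c' ^ N * ((c * a j1) ^ (N - q) * y ^ q) = a j1 ^ (N - q) * (c' ^ (N - q) * c ^ (N - q)) * ?r ^ q"
      unfolding cN(1) power_mult_distrib by (simp only: ac_simps)
    also have "c' ^ N * E1 ^ q = c' ^ (N - 1) * (c' * E1 ^ q)" unfolding cN(2) by (simp only: mult.assoc)
    also have "\<dots> = a j1 ^ N * (c' ^ (N - 1) * V)" unfolding rel' by (simp only: ac_simps)
    finally show "?r ^ N = a j1 ^ (N - q) * (c' ^ (N - q) * c ^ (N - q)) * ?r ^ q + a j1 ^ N * (c' ^ (N - 1) * V)" .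
  qed
  then obtain h where h: "h \<in> S" "c' * y = a j1 * h" by blast
  have \<sigma>0: "\<sigma>0 \<in> carrier G" "\<chi> \<sigma>0 \<noteq> 0" using T(1) by auto
  \<comment> \<open>\<open>h\<close> is \<open>c'\<close> times the common fraction, so
    \<open>\<sigma>0\<close> moves it by \<open>c * c' * \<chi> \<sigma>0\<close>. As
    \<open>c * c'\<close> comes from a nonzero polynomial in the \<open>f i\<close>,
    \<open>i \<in> T\<close>, this contradicts independence.\<close>
  have "a j1 * act \<sigma>0 h = act \<sigma>0 (c' * y)"
    unfolding h(2) using ac[OF aA[OF z(1)] \<sigma>0(1)] by (simp add: rhom_mult[OF act_hom[OF \<sigma>0(1)] aS h(1)])
  also have "\<dots> = c' * (y + c * a j1 * of_nat (\<chi> \<sigma>0))"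
    by (simp add: rhom_mult[OF act_hom[OF \<sigma>0(1)] c'S xS(2)] ac[OF c'A \<sigma>0(1)] coy[OF \<sigma>0(1)])
  also have "\<dots> = a j1 * (h + c * c' * of_nat (\<chi> \<sigma>0))" using h(2) by (simp add: algebra_simps)
  finally have "act \<sigma>0 h - h = c * c' * of_nat (\<chi> \<sigma>0)" using a0[OF z(1)] by simp
  then have J: "c * c' * of_nat (\<chi> \<sigma>0) \<in> fixed_ideal \<sigma>0" using diff_in_fixed_ideal[OF h(1)] by metis
  have "of_nat m = const (of_nat m :: 'k)" for m by (induction m) (simp_all add: const_0 const_add const_1)
  moreover have "of_nat (\<chi> \<sigma>0) \<noteq> (0::'k)"
    using C.\<chi>_less[OF \<sigma>0(1)] \<sigma>0(2) by (simp add: of_nat_eq_0_iff_char_dvd p_CHAR(1)[symmetric] nat_dvd_not_less)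
  ultimately have "const (inverse (of_nat (\<chi> \<sigma>0))) * of_nat (\<chi> \<sigma>0) = (1 :: 'k mpoly)"
    by (simp add: const_1 flip: const_mult)
  then have "const (inverse (of_nat (\<chi> \<sigma>0))) * (c * c' * of_nat (\<chi> \<sigma>0)) = c * c'"
    by (metis mult.left_commute mult.right_neutral)
  then have "c * c' \<in> fixed_ideal \<sigma>0"
    using smod_scale[OF idl_smod[OF idl_fixed_ideal[OF \<sigma>0(1)]] constS J] by metis
  moreover have "c * c' = \<phi> (C0 * C1)" unfolding c_def c'_def by (simp add: rhom_mult[OF hom\<phi>[of UNIV]])
  moreover have "C0 * C1 \<in> mpv T" "C0 * C1 \<noteq> 0" using C0 C1 by (auto intro: sring_mult[OF sring_mpv])
  ultimately show False using T(3) by (auto simp: indep_def)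
qed

end

section \<open>The action on linear forms\<close>

context finite_dim_rep
begin

abbreviation B where "B \<equiv> e ` {..<n}"

lemma rep_one: "\<rho> \<one> v = v" using id_eq_one by (metis UNIV_I restrict_apply')

lemma rep_mult: "\<sigma> \<in> carrier G \<Longrightarrow> \<tau> \<in> carrier G \<Longrightarrow> \<rho> (\<sigma> \<otimes> \<tau>) v = \<rho> \<sigma> (\<rho> \<tau> v)"
  by (rule composition_rule[OF UNIV_I])

lemma group_G: "group G" using group_hom by (simp add: group_hom_def)

lemma rep_add: "\<sigma> \<in> carrier G \<Longrightarrow> \<rho> \<sigma> (v + w) = \<rho> \<sigma> v + \<rho> \<sigma> w"
  and rep_scale: "\<sigma> \<in> carrier G \<Longrightarrow> \<rho> \<sigma> (scale c v) = scale c (\<rho> \<sigma> v)"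
  using linear_action[of \<sigma>] by (simp_all add: Vector_Spaces.linear_iff)

lemma indB: "independent B" and spanB: "span B = UNIV" by (rule independent_Basis, rule span_Basis)

definition form :: "('v \<Rightarrow> 'k) \<Rightarrow> bool" where
  "form \<psi> \<longleftrightarrow> (\<forall>v w. \<psi> (v + w) = \<psi> v + \<psi> w) \<and> (\<forall>c v. \<psi> (scale c v) = c * \<psi> v)"

lemma form_sum: assumes "form \<psi>" shows "\<psi> (sum g I) = (\<Sum>i\<in>I. \<psi> (g i))"
proof -
  have "\<psi> 0 = 0" using assms unfolding form_def by (metis add_cancel_right_right)
  then show ?thesis using assms by (induction I rule: infinite_finite_induct) (simp_all add: form_def)
qed

lemma form_lincomb: assumes "form \<psi>" shows "\<psi> (\<Sum>b\<in>I. scale (c b) (g b)) = (\<Sum>b\<in>I. c b * \<psi> (g b))"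
  unfolding form_sum[OF assms] using assms by (simp add: form_def)

lemma form_representation: "independent Z \<Longrightarrow> span Z = UNIV \<Longrightarrow> form (\<lambda>v. representation Z v x)"
  by (simp add: form_def representation_add representation_scale)

lemma form_coord: "form (coord scale e n i)"
  unfolding coord_def[abs_def] by (rule form_representation[OF indB spanB])

lemma form_rep: "form \<psi> \<Longrightarrow> \<sigma> \<in> carrier G \<Longrightarrow> form (\<lambda>v. \<psi> (\<rho> \<sigma> v))"
  by (simp add: form_def rep_add rep_scale)

lemma coord_basis: assumes "j < n" "i < n" shows "coord scale e n i (e j) = (if i = j then 1 else 0)"
  using assms inj_basis unfolding coord_def by (subst representation_basis[OF indB]) (auto simp: inj_on_def)

lemma coord_sum: "(\<Sum>i<n. scale (coord scale e n i v) (e i)) = v"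
proof -
  have "(\<Sum>i<n. scale (coord scale e n i v) (e i)) = (\<Sum>b\<in>B. scale (representation B v b) b)"
    unfolding coord_def by (simp add: sum.reindex[OF inj_basis])
  also have "\<dots> = v" by (rule sum_representation_eq[OF indB]) (simp_all add: spanB)
  finally show ?thesis .
qed

lemma form_coord_sum: assumes "form \<psi>" shows "(\<Sum>i<n. coord scale e n i v * \<psi> (e i)) = \<psi> v"
proof -
  have "\<psi> (\<Sum>i<n. scale (coord scale e n i v) (e i)) = (\<Sum>i<n. coord scale e n i v * \<psi> (e i))"
    by (rule form_lincomb[OF assms])
  then show ?thesis by (simp add: coord_sum)
qed

section \<open>The action on polynomials and on points\<close>

abbreviation df :: "('v \<Rightarrow> 'k) \<Rightarrow> 'k mpoly" where "df \<equiv> dual_form e n"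
abbreviation act where "act \<equiv> poly_action G \<rho> scale e n"
abbreviation S :: "'k mpoly set" where "S \<equiv> mpv {..<n}"

lemma df_S: "df \<psi> \<in> S"
  unfolding dual_form_def by (auto intro!: sring_sum sring_mult sring_mpv const_in_mpv var_in_mpv)

lemma df_coord: "i < n \<Longrightarrow> df (coord scale e n i) = var i"
  unfolding dual_form_def
  by (subst sum.cong[OF refl, of _ _ "\<lambda>j. if j = i then var i else 0"]) (auto simp: coord_basis const_1 const_0)

lemma df_sum: "df (\<lambda>v. \<Sum>k\<in>I. g k v) = (\<Sum>k\<in>I. df (g k))"
  unfolding dual_form_def rhom_sum[OF rhom_const sring_UNIV UNIV_I] sum_distrib_right by (rule sum.swap)

lemma df_scale: "df (\<lambda>v. c * \<psi> v) = const c * df \<psi>"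
  unfolding dual_form_def by (simp only: sum_distrib_left const_mult mult.assoc)

lemma df_diff: "df (\<lambda>v. \<psi> v - \<psi>' v) = df \<psi> - df \<psi>'"
  unfolding dual_form_def by (simp only: rhom_diff[OF rhom_const sring_UNIV UNIV_I UNIV_I] left_diff_distrib sum_subtractf)

lemma rhom_act: "rhom Z (act \<sigma>)"
  unfolding poly_action_def[abs_def] by (rule rhom_subst_poly[OF rhom_const])

lemma act_const: "act \<sigma> (const c) = const c"
  by (simp add: poly_action_def subst_poly_const const_0)

lemma act_var: "act \<sigma> (var i) = df (\<lambda>v. coord scale e n i (\<rho> (inv \<sigma>) v))"
  by (simp add: poly_action_def subst_poly_var const_0 const_1)

lemma act_df: assumes "form \<psi>" shows "act \<sigma> (df \<psi>) = df (\<lambda>v. \<psi> (\<rho> (inv \<sigma>) v))"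
proof -
  have "act \<sigma> (df \<psi>) = (\<Sum>j<n. const (\<psi> (e j)) * df (\<lambda>v. coord scale e n j (\<rho> (inv \<sigma>) v)))"
    unfolding dual_form_def[of e n \<psi>]
    by (simp add: rhom_sum[OF rhom_act sring_UNIV] rhom_mult[OF rhom_act[of UNIV]] act_const act_var)
  also have "\<dots> = df (\<lambda>v. \<Sum>j<n. \<psi> (e j) * coord scale e n j (\<rho> (inv \<sigma>) v))"
    unfolding df_sum df_scale ..
  also have "\<dots> = df (\<lambda>v. \<psi> (\<rho> (inv \<sigma>) v))"
    by (subst form_coord_sum[OF assms, symmetric]) (simp add: mult.commute)
  finally show ?thesis .
qed

lemma act_S: "f \<in> S \<Longrightarrow> act \<sigma> f \<in> S"
  unfolding poly_action_def by (rule subst_poly_in[OF sring_mpv, of _ _ "{..<n}"]) (auto simp: const_in_mpv df_S)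

lemma act_mult: assumes "\<sigma> \<in> carrier G" "\<tau> \<in> carrier G" "f \<in> S" shows "act (\<sigma> \<otimes> \<tau>) f = act \<sigma> (act \<tau> f)"
proof (rule rhom_eq_on_mpv[of UNIV "act (\<sigma> \<otimes> \<tau>)" "\<lambda>f. act \<sigma> (act \<tau> f)" "{..<n}"])
  interpret G: group G by (rule group_G)
  show "rhom UNIV (\<lambda>f. act \<sigma> (act \<tau> f))" by (rule rhom_comp[OF rhom_act UNIV_I rhom_act])
  show "act (\<sigma> \<otimes> \<tau>) (var i) = act \<sigma> (act \<tau> (var i))" for i
    unfolding act_var using assms
    by (subst act_df) (auto intro!: form_rep form_coord simp: G.inv_mult_group rep_mult)
qed (simp_all add: rhom_act act_const sring_UNIV assms(3))

lemma act_one: assumes "f \<in> S" shows "act \<one> f = f"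
proof (rule rhom_eq_on_mpv[of UNIV "act \<one>" "\<lambda>f. f" "{..<n}"])
  interpret G: group G by (rule group_G)
  show "rhom UNIV (\<lambda>f. f)" by (simp add: rhom_def)
  show "act \<one> (var i) = var i" if "i \<in> {..<n}" for i using that by (simp add: act_var rep_one df_coord)
qed (simp_all add: rhom_act act_const sring_UNIV assms)

lemma act_lookup_0: assumes "f \<in> S" shows "Poly_Mapping.lookup (act \<sigma> f) 0 = Poly_Mapping.lookup f 0"
proof (rule rhom_eq_on_mpv[of UNIV "\<lambda>f. Poly_Mapping.lookup (act \<sigma> f) 0" "\<lambda>f. Poly_Mapping.lookup f 0" "{..<n}"])
  have hom: "rhom Z (\<lambda>f::'k mpoly. Poly_Mapping.lookup f 0)" for Z
    by (simp add: rhom_def lookup_add lookup_0_mult)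
  then show "rhom UNIV (\<lambda>f::'k mpoly. Poly_Mapping.lookup f 0)" .
  show "rhom UNIV (\<lambda>f. Poly_Mapping.lookup (act \<sigma> f) 0)" by (rule rhom_comp[OF rhom_act UNIV_I hom])
  have "Poly_Mapping.single i (1::nat) \<noteq> 0" for i by (metis lookup_single_eq lookup_zero one_neq_zero)
  then have v: "Poly_Mapping.lookup (var i) 0 = (0::'k)" for i by (simp add: var_def lookup_single when_def)
  show "Poly_Mapping.lookup (act \<sigma> (var i)) 0 = Poly_Mapping.lookup (var i) 0" for i
    unfolding act_var dual_form_def by (simp add: lookup_sum lookup_0_mult v)
qed (simp_all add: act_const sring_UNIV assms)

lemma eval_ext_action:
  assumes \<sigma>: "\<sigma> \<in> carrier G" and f: "f \<in> S"
  shows "subst_poly to_ac (ext_action \<rho> scale e n \<sigma> w) f = subst_poly to_ac w (act (inv \<sigma>) f)"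
proof (rule rhom_eq_on_mpv[of UNIV _ "\<lambda>f. subst_poly to_ac w (act (inv \<sigma>) f)" "{..<n}"])
  interpret G: group G by (rule group_G)
  have hom: "rhom Z (subst_poly to_ac u)" for Z and u :: "nat \<Rightarrow> 'k alg_closure" by (rule rhom_subst_poly[OF rhom_to_ac])
  then show "rhom UNIV (subst_poly to_ac (ext_action \<rho> scale e n \<sigma> w))" .
  show "rhom UNIV (\<lambda>f. subst_poly to_ac w (act (inv \<sigma>) f))" by (rule rhom_comp[OF rhom_act UNIV_I hom])
  show "subst_poly to_ac (ext_action \<rho> scale e n \<sigma> w) (var i) = subst_poly to_ac w (act (inv \<sigma>) (var i))" if "i \<in> {..<n}" for i
    using that \<sigma> unfolding act_var dual_form_def
    by (simp add: rhom_sum[OF hom sring_UNIV] rhom_mult[OF hom[of UNIV]] subst_poly_var subst_poly_const ext_action_def)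
qed (simp_all add: act_const subst_poly_const sring_UNIV f)

text \<open>Points not separated by \<open>A\<close> lie in one orbit, and an invariant over
  \<open>K\<close> is constant on orbits over the algebraic closure too.\<close>

lemma separates_invariants:
  assumes sep: "geom_separating G \<rho> scale e n A" and F: "F \<in> invariant_ring G \<rho> scale e n"
    and uw: "u \<in> ext_space n" "w \<in> ext_space n" and A: "\<And>h. h \<in> A \<Longrightarrow> subst_poly to_ac u h = subst_poly to_ac w h"
  shows "subst_poly to_ac u F = subst_poly to_ac w F"
proof -
  interpret G: group G by (rule group_G)
  have "orbit G (ext_action \<rho> scale e n) u = orbit G (ext_action \<rho> scale e n) w"
    using sep uw A unfolding geom_separating_def by metis
  moreover have "ext_action \<rho> scale e n \<one> u = u"
  proof
    fix i
    have "(\<Sum>j<n. to_ac (coord scale e n i (e j)) * u j) = u i" if "i < n"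
      using that by (subst sum.cong[OF refl, of _ _ "\<lambda>j. if j = i then u i else 0"]) (auto simp: coord_basis)
    then show "ext_action \<rho> scale e n \<one> u i = u i"
      using uw(1) by (simp add: ext_action_def rep_one ext_space_def)
  qed
  then have "u \<in> orbit G (ext_action \<rho> scale e n) u" unfolding orbit_def using G.one_closed by (metis (mono_tags, lifting) mem_Collect_eq)
  ultimately obtain \<sigma> where \<sigma>: "\<sigma> \<in> carrier G" "u = ext_action \<rho> scale e n \<sigma> w" unfolding orbit_def by auto
  have "F \<in> S" "act (inv \<sigma>) F = F" using F \<sigma>(1) by (auto simp: invariant_ring_def polys_eq_mpv)
  then show ?thesis using eval_ext_action[OF \<sigma>(1), of F w] \<sigma>(2) by simp
qed

text \<open>A form vanishing on the kernel of \<open>T = \<sigma> - 1\<close> factors through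
  \<open>T\<close>.\<close>

lemma form_vanishing_on_fixed_space:
  assumes \<sigma>: "\<sigma> \<in> carrier G" and \<psi>: "form \<psi>" and van: "\<And>v. v \<in> fixed_space \<rho> \<sigma> \<Longrightarrow> \<psi> v = 0"
  shows "\<exists>\<eta>. form \<eta> \<and> (\<forall>v. \<psi> v = \<eta> (\<rho> \<sigma> v) - \<eta> v)"
proof -
  let ?F = "fixed_space \<rho> \<sigma>"
  define T where "T v = \<rho> \<sigma> v - v" for v
  have Tadd: "T (v + w) = T v + T w" and Tsc: "T (scale c v) = scale c (T v)" for v w c
    by (simp_all add: T_def rep_add[OF \<sigma>] rep_scale[OF \<sigma>] scale_right_diff_distrib)
  have lT: "Vector_Spaces.linear scale scale T" using Tadd Tsc vector_space_axioms by (simp add: Vector_Spaces.linear_iff)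
  then interpret T: Vector_Spaces.linear scale scale T .
  obtain B0 where B0: "B0 \<subseteq> ?F" "independent B0" "?F \<subseteq> span B0" by (rule basis_exists)
  define B1 where "B1 = extend_basis B0"
  have B1: "B0 \<subseteq> B1" "independent B1" "span B1 = UNIV"
    unfolding B1_def using extend_basis_superset[OF B0(2)] independent_extend_basis[OF B0(2)] span_extend_basis[OF B0(2)] by auto
  let ?C = "B1 - B0"
  have indC: "independent ?C" by (rule independent_mono[OF B1(2)]) auto
  have inj: "inj_on T (span ?C)"
  proof (rule inj_onI)
    fix x y assume xy: "x \<in> span ?C" "y \<in> span ?C" "T x = T y"
    let ?d = "x - y"
    have "T ?d = 0" using xy(3) T.diff[of x y] by simp
    then have "?d \<in> span B0" using B0(3) by (auto simp: T_def fixed_space_def)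
    then have 1: "representation B1 ?d = representation B0 ?d" using representation_extend[OF B1(2) _ B1(1)] by blast
    have "?d \<in> span ?C" using xy span_diff by blast
    then have 2: "representation B1 ?d = representation ?C ?d" using representation_extend[OF B1(2), of ?d ?C] by blast
    have "representation B1 ?d b = 0" for b
    proof (rule ccontr)
      assume "representation B1 ?d b \<noteq> 0"
      then show False using 1 2 representation_ne_zero[of B0 ?d b] representation_ne_zero[of ?C ?d b] by (metis DiffD2)
    qed
    moreover have "(\<Sum>b | representation B1 ?d b \<noteq> 0. scale (representation B1 ?d b) b) = ?d"
      by (rule sum_nonzero_representation_eq[OF B1(2)]) (simp add: B1(3))
    ultimately show "x = y" by simp
  qed
  have indT: "independent (T ` ?C)" by (rule T.independent_injective_image[OF indC inj])
  have injC: "inj_on T ?C" using inj by (rule inj_on_subset) (rule span_superset)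
  define B2 where "B2 = extend_basis (T ` ?C)"
  have B2: "T ` ?C \<subseteq> B2" "independent B2" "span B2 = UNIV"
    unfolding B2_def using extend_basis_superset[OF indT] independent_extend_basis[OF indT] span_extend_basis[OF indT] by auto
  have finC: "finite ?C" by (rule finiteI_independent[OF indC])
  \<comment> \<open>The images \<open>T x\<close> are independent and part of the basis
    \<open>B2\<close>. This form takes the value \<open>\<psi> x\<close> on \<open>T x\<close> and
    \<open>0\<close> on the other basis vectors.\<close>
  define \<eta> where "\<eta> v = (\<Sum>x\<in>?C. \<psi> x * representation B2 v (T x))" for v
  have \<eta>: "form \<eta>"
    using form_representation[OF B2(2,3)] unfolding form_def \<eta>_def
    by (simp add: distrib_left sum.distrib sum_distrib_left mult.left_commute)
  have \<eta>T: "\<eta> (T b) = \<psi> b" if b: "b \<in> B1" for b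
  proof (cases "b \<in> B0")
    case True
    then have "T b = 0" "\<psi> b = 0" using B0(1) van by (auto simp: T_def fixed_space_def)
    moreover have "\<eta> 0 = 0" using \<eta> unfolding form_def by (metis add_cancel_right_right)
    ultimately show ?thesis by simp
  next
    case False
    then have bC: "b \<in> ?C" using b by simp
    have "\<eta> (T b) = (\<Sum>x\<in>?C. if x = b then \<psi> b else 0)"
      unfolding \<eta>_def
    proof (rule sum.cong[OF refl])
      fix x assume x: "x \<in> ?C"
      have "T b \<in> B2" using B2(1) bC by blast
      then have "representation B2 (T b) (T x) = (if T x = T b then 1 else 0)"
        by (simp add: representation_basis[OF B2(2)])
      moreover have "T x = T b \<longleftrightarrow> x = b" using injC x bC by (auto simp: inj_on_def)
      ultimately show "\<psi> x * representation B2 (T b) (T x) = (if x = b then \<psi> b else 0)" by simp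
    qed
    also have "\<dots> = \<psi> b" using finC bC by simp
    finally show ?thesis .
  qed
  have "\<psi> v = \<eta> (\<rho> \<sigma> v) - \<eta> v" for v
  proof -
    let ?r = "representation B1 v"
    have v: "(\<Sum>b\<in>B1. scale (?r b) b) = v"
      using finiteI_independent[OF B1(2)] by (intro sum_representation_eq[OF B1(2)]) (simp_all add: B1(3))
    have "form (\<lambda>v. \<eta> (T v))" using \<eta> by (simp add: form_def Tadd Tsc)
    then have "\<eta> (T (\<Sum>b\<in>B1. scale (?r b) b)) = (\<Sum>b\<in>B1. ?r b * \<eta> (T b))" by (rule form_lincomb)
    also have "\<dots> = (\<Sum>b\<in>B1. ?r b * \<psi> b)" by (intro sum.cong refl) (simp add: \<eta>T)
    also have "\<dots> = \<psi> (\<Sum>b\<in>B1. scale (?r b) b)" by (rule form_lincomb[OF \<psi>, symmetric])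
    finally have "\<eta> (T v) = \<psi> v" unfolding v .
    moreover have "\<eta> (\<rho> \<sigma> v) = \<eta> (T v) + \<eta> v"
      using \<eta> unfolding form_def by (metis T_def diff_add_cancel)
    ultimately show ?thesis by simp
  qed
  then show ?thesis using \<eta> by blast
qed

text \<open>With \<open>r\<close> the dimension of the fixed space, let the forms behind the
  \<open>b k\<close> restrict to a dual basis on it. Each variable agrees there with a combination
  of them, and a form vanishing on the fixed space is of the shape
  \<open>\<sigma> s - s\<close>.\<close>

lemma variables_modulo_fixed_ideal:
  assumes \<sigma>: "\<sigma> \<in> carrier G" and nb: "\<not> bireflection scale \<rho> \<sigma>"
  shows "\<exists>r b c. r + 3 \<le> n \<and> (\<forall>k<r. b k \<in> S) \<and>
    (\<forall>i<n. var i - (\<Sum>k<r. const (c i k) * b k) \<in> ispan S ((\<lambda>s. act \<sigma> s - s) ` S))"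
proof -
  interpret G: group G by (rule group_G)
  let ?F = "fixed_space \<rho> \<sigma>"
  obtain B0 where B0: "B0 \<subseteq> ?F" "independent B0" "?F \<subseteq> span B0" "card B0 = dim ?F" by (rule basis_exists)
  have finB0: "finite B0" by (rule finiteI_independent[OF B0(2)])
  define r where "r = card B0"
  have "dim UNIV = n" using card_image[OF inj_basis] by simp
  then have r: "r + 3 \<le> n" using nb B0(4) by (simp add: bireflection_def r_def)
  obtain w where w: "bij_betw w {..<r} B0"
    using ex_bij_betw_nat_finite[OF finB0] by (auto simp: r_def lessThan_atLeast0)
  define B1 where "B1 = extend_basis B0"
  have B1: "B0 \<subseteq> B1" "independent B1" "span B1 = UNIV"
    unfolding B1_def using extend_basis_superset[OF B0(2)] independent_extend_basis[OF B0(2)] span_extend_basis[OF B0(2)] by auto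
  let ?x = "coord scale e n" and ?w = "\<lambda>k v. representation B1 v (w k)"
  have "var i - (\<Sum>k<r. const (?x i (w k)) * df (?w k)) \<in> ispan S ((\<lambda>s. act \<sigma> s - s) ` S)" if i: "i < n" for i
  proof -
    define \<psi> where "\<psi> v = ?x i v - (\<Sum>k<r. ?x i (w k) * ?w k v)" for v
    have \<psi>: "form \<psi>"
      using form_coord[of i] form_representation[OF B1(2,3)] unfolding form_def \<psi>_def
      by (simp add: distrib_left sum.distrib sum_distrib_left right_diff_distrib mult.left_commute)
    have "\<psi> v = 0" if "v \<in> ?F" for v
    proof -
      have vs: "v \<in> span B0" using that B0(3) by blast
      have "(\<Sum>k<r. ?x i (w k) * ?w k v) = (\<Sum>b\<in>B0. representation B1 v b * ?x i b)"
        using sum.reindex_bij_betw[OF w, of "\<lambda>b. representation B1 v b * ?x i b"] by (simp add: mult.commute)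
      also have "\<dots> = ?x i (\<Sum>b\<in>B0. scale (representation B1 v b) b)"
        by (rule form_lincomb[OF form_coord, symmetric])
      also have "(\<Sum>b\<in>B0. scale (representation B1 v b) b) = v"
        unfolding representation_extend[OF B1(2) vs B1(1)]
        by (rule sum_representation_eq[OF B0(2) vs finB0]) simp
      finally show ?thesis by (simp add: \<psi>_def)
    qed
    then obtain \<eta> where \<eta>: "form \<eta>" "\<And>v. \<psi> v = \<eta> (\<rho> \<sigma> v) - \<eta> v"
      using form_vanishing_on_fixed_space[OF \<sigma> \<psi>] by blast
    \<comment> \<open>Forms are moved by the inverse of \<open>\<sigma>\<close>, so precomposing
      \<open>\<eta>\<close> with \<open>\<rho> \<sigma>\<close> and changing the sign gives
      \<open>\<sigma> s - s = \<psi>\<close>.\<close>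
    define s where "s = - df (\<lambda>v. \<eta> (\<rho> \<sigma> v))"
    have sS: "s \<in> S" unfolding s_def by (rule sring_uminus[OF sring_mpv df_S])
    have "\<rho> \<sigma> (\<rho> (inv \<sigma>) v) = v" for v
      using rep_mult[OF \<sigma> G.inv_closed[OF \<sigma>], of v] \<sigma> by (simp add: rep_one)
    then have "act \<sigma> (df (\<lambda>v. \<eta> (\<rho> \<sigma> v))) = df \<eta>"
      by (subst act_df[OF form_rep[OF \<eta>(1) \<sigma>]]) simp
    then have "act \<sigma> s - s = df (\<lambda>v. \<eta> (\<rho> \<sigma> v)) - df \<eta>"
      by (simp add: s_def rhom_uminus[OF rhom_act sring_UNIV])
    also have "\<dots> = df \<psi>" by (simp add: df_diff[symmetric] \<eta>(2)[symmetric])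
    also have "\<dots> = var i - (\<Sum>k<r. const (?x i (w k)) * df (?w k))"
      unfolding \<psi>_def df_diff df_sum df_scale by (simp add: df_coord[OF i])
    finally have e: "act \<sigma> s - s = var i - (\<Sum>k<r. const (?x i (w k)) * df (?w k))" .
    have "act \<sigma> s - s \<in> ispan S ((\<lambda>s. act \<sigma> s - s) ` S)"
      by (intro subsetD[OF ispan_superset] imageI sS)
    then show ?thesis unfolding e .
  qed
  then show ?thesis using r df_S by (intro exI[of _ r] exI[of _ "\<lambda>k. df (?w k)"] exI[of _ "\<lambda>i k. ?x i (w k)"] conjI) auto
qed

end

lemma sring_graded_subalgebra: assumes "graded_subalgebra A" shows "sring A"
proof -
  interpret R: cring "ring_of_type_algebra :: 'a mpoly ring" by (rule cring_from_type_algebra)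
  have sub: "subring A ring_of_type_algebra" using assms by (simp add: graded_subalgebra_def)
  note E = subringE[OF sub]
  have minus: "a_inv ring_of_type_algebra x = - x" for x :: "'a mpoly"
    by (rule R.minus_equality) (simp_all add: ring_of_type_algebra_def)
  have "x - y \<in> A" if "x \<in> A" "y \<in> A" for x y
    using E(7)[OF that(1) E(5)[OF that(2)]] unfolding minus by (simp add: ring_of_type_algebra_def)
  moreover have "x * y \<in> A" if "x \<in> A" "y \<in> A" for x y
    using E(6)[OF that] by (simp add: ring_of_type_algebra_def)
  ultimately show ?thesis using E(3) by (simp add: sring_def ring_of_type_algebra_def)
qed

theorem theorem1p5:
  fixes G :: "('g, 'm) monoid_scheme"
    and \<rho> :: "'g \<Rightarrow> 'v::ab_group_add \<Rightarrow> 'v"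
    and scale :: "'k::field \<Rightarrow> 'v \<Rightarrow> 'v"
    and e :: "nat \<Rightarrow> 'v"
    and n p :: nat
  assumes "CHAR('k) = p" and "p > 0"
    and "group G" and "finite (carrier G)" and "\<exists>k. Coset.order G = p ^ k"
    and "finite_dim_rep G \<rho> scale e n"
    and "\<exists>A. graded_subalgebra A \<and> A \<subseteq> invariant_ring G \<rho> scale e n \<and>
           geom_separating G \<rho> scale e n A \<and> graded_Cohen_Macaulay A"
  shows "generate G {\<sigma> \<in> carrier G. bireflection scale \<rho> \<sigma>} = carrier G"
proof (rule ccontr)
  assume ne: "generate G {\<sigma> \<in> carrier G. bireflection scale \<rho> \<sigma>} \<noteq> carrier G"
  interpret V: finite_dim_rep G \<rho> scale e n by (rule assms(6))
  interpret G: group G by (rule assms(3))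
  obtain A where A: "graded_subalgebra A" "A \<subseteq> invariant_ring G \<rho> scale e n"
    "geom_separating G \<rho> scale e n A" "graded_Cohen_Macaulay A" using assms(7) by blast
  let ?N = "generate G {\<sigma> \<in> carrier G. bireflection scale \<rho> \<sigma>}"
  have ch: "normalization_semidom_class.prime CHAR('k)" using prime_CHAR_semidom[where ?'a = 'k] assms(1,2) by simp
  then have p: "normalization_semidom_class.prime p" using assms(1) by simp
  obtain k where k: "Coset.order G = p ^ k" using assms(5) by blast
  have sub: "subgroup ?N G" by (rule G.generate_is_subgroup) blast
  obtain \<chi> t where \<chi>: "\<And>\<sigma>. \<sigma> \<in> carrier G \<Longrightarrow> \<chi> \<sigma> < p"
    "\<And>\<sigma> \<tau>. \<sigma> \<in> carrier G \<Longrightarrow> \<tau> \<in> carrier G \<Longrightarrow> \<chi> (\<sigma> \<otimes>\<^bsub>G\<^esub> \<tau>) = (\<chi> \<sigma> + \<chi> \<tau>) mod p"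
    "t \<in> carrier G" "\<chi> t = 1" "\<And>\<sigma>. \<sigma> \<in> ?N \<Longrightarrow> \<chi> \<sigma> = 0"
  proof (rule G.p_group_character[OF assms(4) p k sub ne])
    fix \<chi> t
    assume "\<And>\<sigma>. \<sigma> \<in> carrier G \<Longrightarrow> \<chi> \<sigma> < p"
      "\<And>\<sigma> \<tau>. \<sigma> \<in> carrier G \<Longrightarrow> \<tau> \<in> carrier G \<Longrightarrow> \<chi> (\<sigma> \<otimes>\<^bsub>G\<^esub> \<tau>) = (\<chi> \<sigma> + \<chi> \<tau>) mod p"
      "t \<in> carrier G" "\<chi> t = 1" "\<And>\<sigma>. \<sigma> \<in> ?N \<Longrightarrow> \<chi> \<sigma> = 0"
    then show thesis by (rule that)
  qed
  have nb: "\<not> bireflection scale \<rho> \<sigma>" if "\<sigma> \<in> carrier G" "\<chi> \<sigma> \<noteq> 0" for \<sigma>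
  proof
    assume "bireflection scale \<rho> \<sigma>"
    then have "\<sigma> \<in> ?N" using that(1) by (intro generate.incl) simp
    then show False using \<chi>(5) that(2) by simp
  qed
  have "\<not> bireflection scale \<rho> t" using nb \<chi>(3,4) by simp
  \<comment> \<open>From \<open>r + 3 \<le> n\<close> for the single element \<open>t\<close>; this
    also gives \<open>n > 0\<close>, which the choice of a regular sequence requires.\<close>
  from V.variables_modulo_fixed_ideal[OF \<chi>(3) this] have n3: "3 \<le> n" by (elim exE conjE) simp
  interpret RA: ring_action G "poly_action G \<rho> scale e n" "mpv {..<n}"
    by unfold_locales (simp_all add: assms(4) sring_mpv V.act_S V.rhom_act V.act_mult V.act_one)
  have inv: "invariant_ring G \<rho> scale e n = RA.invs (carrier G)"
    by (auto simp: invariant_ring_def RA.invs_def polys_eq_mpv)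
  interpret SA: separating_algebra G "poly_action G \<rho> scale e n" "mpv {..<n}" n A
  proof
    show "normalization_semidom_class.prime CHAR('k)" by (rule ch)
    show "sring A" by (rule sring_graded_subalgebra[OF A(1)])
    show "A \<subseteq> RA.invs (carrier G)" using A(2) inv by simp
    show "const c \<in> A" for c using A(1) by (auto simp: graded_subalgebra_def)
    show "hom_component d a \<in> A" if "a \<in> A" for d a using A(1) that by (simp add: graded_subalgebra_def)
    show "subst_poly to_ac u F = subst_poly to_ac w F"
      if "F \<in> RA.invs (carrier G)" "u \<in> ext_space n" "w \<in> ext_space n"
        "\<And>h. h \<in> A \<Longrightarrow> subst_poly to_ac u h = subst_poly to_ac w h" for F u w
      by (rule V.separates_invariants[OF A(3) that(1)[folded inv] that(2-4)])
  qed (simp_all add: V.act_const V.act_lookup_0)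
  obtain f l where f: "n \<le> l" "hom_regular_sequence A f l" using SA.ex_hom_regular_sequence[OF A(4)] n3 by auto
  have C: "ring_action_character G (poly_action G \<rho> scale e n) (mpv {..<n}) p \<chi> t"
    by (intro ring_action_character.intro RA.ring_action_axioms ring_action_character_axioms.intro)
      (simp_all add: p \<chi> CHAR_mpoly assms(1))
  interpret obstruction G "poly_action G \<rho> scale e n" "mpv {..<n}" n A p \<chi> t f l
  proof (intro obstruction.intro SA.separating_algebra_axioms C f(2) obstruction_axioms.intro n3 f(1)
      SA.finite_over_invariants SA.invariant_power_in_A)
    fix \<sigma> assume "\<sigma> \<in> carrier G" "\<chi> \<sigma> \<noteq> 0"
    then show "\<exists>r b c. r + 3 \<le> n \<and> (\<forall>k<r. b k \<in> mpv {..<n}) \<and>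
      (\<forall>i<n. var i - (\<Sum>k<r. const (c i k) * b k) \<in> RA.fixed_ideal \<sigma>)"
      unfolding RA.fixed_ideal_def by (intro V.variables_modulo_fixed_ideal nb)
  qed
  show False by (rule contradiction)
qed

end
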